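(* Let $\lambda=(\lambda_1\ge\dots\ge\lambda_m)$ be the eigenvalue process of the real Jacobi matrix process of parameters $(p,q)$ (the $\beta$-Jacobi process with $\beta=1$), started at an arbitrary point with $1\ge\lambda_1(0)\ge\dots\ge\lambda_m(0)\ge 0$ (possibly with non-distinct coordinates). (i) If $\min(p,q)>m$, then $$\mathbb{P}_{\lambda(0)}\big(\forall t>0,\ \forall i\ne j,\ \lambda_i(t)\ne\lambda_j(t)\big)=1 .$$ (ii) If $\min(p,q)\ge m+1$, then almost surely the process never hits the boundaries $0$ and $1$ at any time $t>0$ (i.e. $0<\lambda_m(t)$ and $\lambda_1(t)<1$ for all $t>0$), even if it starts on them at time $t=0$.
   Context: The process $\lambda$ is the continuous Markov process with values in $\{1\ge\lambda_1\ge\dots\ge\lambda_m\ge 0\}$ solving, for all $t\ge 0$, $$d\lambda_i(t)=2\sqrt{\lambda_i(1-\lambda_i)}\,d\nu_i(t)+\Big[p-(p+q)\lambda_i+\sum_{j\ne i}\frac{\lambda_i(1-\lambda_j)+\lambda_j(1-\lambda_i)}{\lambda_i-\lambda_j}\Big]dt,\qquad 1\le i\le m,$$ where $\nu_1,\dots,\nu_m$ are independent Brownian motions; the equation is understood in integral form, with absolutely convergent drift integrals. *)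

theory Defs
  imports "HOL-Probability.Probability"
begin

text \<open>
  Processes are indexed by real time and only their values at times \<open>t \<ge> 0\<close> matter.
  A vector in \<open>\<real>\<^sup>m\<close> is a function on \<open>nat\<close> of which only the values on \<open>{1..m}\<close> matter.
\<close>

definition filtered_prob_space :: "'w measure \<Rightarrow> (real \<Rightarrow> 'w measure) \<Rightarrow> bool" where
  "filtered_prob_space M F \<longleftrightarrow>
     prob_space M \<and>
     (\<forall>t\<ge>0. subalgebra M (F t)) \<and>
     (\<forall>s t. 0 \<le> s \<longrightarrow> s \<le> t \<longrightarrow> sets (F s) \<subseteq> sets (F t))"

text \<open>
  \<open>W 1, \<dots>, W m\<close> are independent standard Brownian motions with respect to \<open>F\<close>. Slot \<open>0\<close> of the
  independent family holds the past \<open>F s\<close>, slot \<open>i \<ge> 1\<close> the \<open>i\<close>-th increment; so the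
  \<open>m\<close> increments after \<open>s\<close> are independent of each other and of the past.
\<close>

definition independent_brownian_motions ::
  "'w measure \<Rightarrow> (real \<Rightarrow> 'w measure) \<Rightarrow> nat \<Rightarrow> (nat \<Rightarrow> real \<Rightarrow> 'w \<Rightarrow> real) \<Rightarrow> bool" where
  "independent_brownian_motions M F m W \<longleftrightarrow>
     (\<forall>i\<in>{1..m}.
        (\<forall>t\<ge>0. W i t \<in> borel_measurable (F t)) \<and>
        (AE \<omega> in M. W i 0 \<omega> = 0) \<and>
        (AE \<omega> in M. continuous_on {0..} (\<lambda>t. W i t \<omega>)) \<and>
        (\<forall>s t. 0 \<le> s \<longrightarrow> s < t \<longrightarrow>
           distributed M lborel (\<lambda>\<omega>. W i t \<omega> - W i s \<omega>) (normal_density 0 (sqrt (t - s))))) \<and>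
     (\<forall>s t. 0 \<le> s \<longrightarrow> s < t \<longrightarrow>
        prob_space.indep_sets M
          (\<lambda>i. if i = 0 then sets (F s)
               else {(\<lambda>\<omega>. W i t \<omega> - W i s \<omega>) -` B \<inter> space M | B. B \<in> sets borel})
          {0..m})"

text \<open>
  The Ito integral, by \<open>L\<^sup>2\<close>-approximation. A simple predictable process
  \<open>\<Sum>k<n. \<xi>\<^sub>k 1\<^bsub>(\<tau>\<^sub>k, \<tau>\<^sub>k\<^sub>+\<^sub>1]\<^esub>\<close> is given by the data \<open>(n, \<tau>, \<xi>)\<close>.
\<close>

type_synonym 'w simple_data = "nat \<times> (nat \<Rightarrow> real) \<times> (nat \<Rightarrow> 'w \<Rightarrow> real)"

definition simple_predictable :: "(real \<Rightarrow> 'w measure) \<Rightarrow> 'w simple_data \<Rightarrow> bool" where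
  "simple_predictable F = (\<lambda>(n, \<tau>, \<xi>).
     0 \<le> \<tau> 0 \<and>
     (\<forall>k<n. \<tau> k < \<tau> (Suc k)) \<and>
     (\<forall>k<n. \<xi> k \<in> borel_measurable (F (\<tau> k)) \<and>
        (\<exists>C. \<forall>\<omega>\<in>space (F (\<tau> k)). \<bar>\<xi> k \<omega>\<bar> \<le> C)))"

definition simple_process :: "'w simple_data \<Rightarrow> real \<Rightarrow> 'w \<Rightarrow> real" where
  "simple_process = (\<lambda>(n, \<tau>, \<xi>) s \<omega>. \<Sum>k<n. \<xi> k \<omega> * indicator {\<tau> k<..\<tau> (Suc k)} s)"

definition simple_integral :: "(real \<Rightarrow> 'w \<Rightarrow> real) \<Rightarrow> 'w simple_data \<Rightarrow> real \<Rightarrow> 'w \<Rightarrow> real" where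
  "simple_integral W = (\<lambda>(n, \<tau>, \<xi>) t \<omega>.
     \<Sum>k<n. \<xi> k \<omega> * (W (min (\<tau> (Suc k)) t) \<omega> - W (min (\<tau> k) t) \<omega>))"

text \<open>\<open>J\<close> is (a version of) the random variable \<open>\<integral>\<^sub>0\<^sup>t H\<^sub>s dW\<^sub>s\<close>.\<close>

definition is_ito_integral_at ::
  "'w measure \<Rightarrow> (real \<Rightarrow> 'w measure) \<Rightarrow> (real \<Rightarrow> 'w \<Rightarrow> real) \<Rightarrow> (real \<Rightarrow> 'w \<Rightarrow> real)
     \<Rightarrow> real \<Rightarrow> ('w \<Rightarrow> real) \<Rightarrow> bool" where
  "is_ito_integral_at M F W H t J \<longleftrightarrow>
     J \<in> borel_measurable M \<and>
     (\<lambda>(s, \<omega>). H s \<omega>) \<in> borel_measurable (restrict_space borel {0..t} \<Otimes>\<^sub>M F t) \<and>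
     (\<exists>\<phi> :: nat \<Rightarrow> 'w simple_data.
        (\<forall>k. simple_predictable F (\<phi> k)) \<and>
        (\<lambda>k. \<integral>\<^sup>+\<omega>. (\<integral>\<^sup>+s\<in>{0..t}. ennreal ((H s \<omega> - simple_process (\<phi> k) s \<omega>)\<^sup>2) \<partial>lborel) \<partial>M)
          \<longlonglongrightarrow> 0 \<and>
        (\<lambda>k. \<integral>\<^sup>+\<omega>. ennreal ((J \<omega> - simple_integral W (\<phi> k) t \<omega>)\<^sup>2) \<partial>M) \<longlonglongrightarrow> 0)"

definition is_ito_integral ::
  "'w measure \<Rightarrow> (real \<Rightarrow> 'w measure) \<Rightarrow> (real \<Rightarrow> 'w \<Rightarrow> real) \<Rightarrow> (real \<Rightarrow> 'w \<Rightarrow> real)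
     \<Rightarrow> (real \<Rightarrow> 'w \<Rightarrow> real) \<Rightarrow> bool" where
  "is_ito_integral M F W H I \<longleftrightarrow>
     (AE \<omega> in M. continuous_on {0..} (\<lambda>t. I t \<omega>)) \<and>
     (\<forall>t\<ge>0. is_ito_integral_at M F W H t (I t))"

text \<open>The \<open>\<sigma>\<close>-algebra generated by the variables \<open>X s i\<close> with \<open>s \<in> T\<close> and \<open>1 \<le> i \<le> m\<close>.\<close>

definition generated_algebra ::
  "'w measure \<Rightarrow> nat \<Rightarrow> (real \<Rightarrow> 'w \<Rightarrow> nat \<Rightarrow> real) \<Rightarrow> real set \<Rightarrow> 'w measure" where
  "generated_algebra M m X T =
     sigma (space M) {(\<lambda>\<omega>. X s \<omega> i) -` B \<inter> space M | s i B. s \<in> T \<and> i \<in> {1..m} \<and> B \<in> sets borel}"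

text \<open>Markov property with respect to the natural filtration of \<open>X\<close>.\<close>

definition markov_process ::
  "'w measure \<Rightarrow> nat \<Rightarrow> (real \<Rightarrow> 'w \<Rightarrow> nat \<Rightarrow> real) \<Rightarrow> bool" where
  "markov_process M m X \<longleftrightarrow>
     (\<forall>s t. 0 \<le> s \<longrightarrow> s \<le> t \<longrightarrow> (\<forall>A\<in>sets (generated_algebra M m X {t}).
        AE \<omega> in M. real_cond_exp M (generated_algebra M m X {0..s}) (indicator A) \<omega> =
                   real_cond_exp M (generated_algebra M m X {s}) (indicator A) \<omega>))"

definition ordered_unit_vectors :: "nat \<Rightarrow> (nat \<Rightarrow> real) set" where
  "ordered_unit_vectors m =
     {x. (\<forall>i\<in>{1..m}. 0 \<le> x i \<and> x i \<le> 1) \<and> (\<forall>i\<in>{1..m}. \<forall>j\<in>{1..m}. i \<le> j \<longrightarrow> x j \<le> x i)}"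

definition jacobi_drift :: "nat \<Rightarrow> real \<Rightarrow> real \<Rightarrow> (nat \<Rightarrow> real) \<Rightarrow> nat \<Rightarrow> real" where
  "jacobi_drift m p q x i =
     p - (p + q) * x i +
     (\<Sum>j\<in>{1..m} - {i}. (x i * (1 - x j) + x j * (1 - x i)) / (x i - x j))"

text \<open>
  The sum of the absolute values of the singular drift terms. It is taken in \<open>ennreal\<close>, where
  \<open>a / 0 = \<infinity>\<close> for \<open>a > 0\<close>, so that finiteness of its time integral is absolute convergence of the
  drift integrals and collisions are not hidden by the convention \<open>a / 0 = 0\<close> of the reals.
  (Only at \<open>x i = x j \<in> {0, 1}\<close> does a term have the form \<open>0 / 0\<close>; it then counts as \<open>0\<close>.)
\<close>

definition jacobi_singular_drift :: "nat \<Rightarrow> (nat \<Rightarrow> real) \<Rightarrow> nat \<Rightarrow> ennreal" where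
  "jacobi_singular_drift m x i =
     (\<Sum>j\<in>{1..m} - {i}. ennreal (x i * (1 - x j) + x j * (1 - x i)) / ennreal \<bar>x i - x j\<bar>)"

text \<open>
  \<open>X\<close> is the eigenvalue process of the real Jacobi matrix process of size \<open>m\<close> and parameters
  \<open>(p, q)\<close>, driven by \<open>\<nu>\<close>: a continuous Markov process of ordered vectors solving, on \<open>(M, F)\<close>,
  the stochastic differential equation in integral form.
\<close>

definition jacobi_eigenvalue_process ::
  "'w measure \<Rightarrow> (real \<Rightarrow> 'w measure) \<Rightarrow> nat \<Rightarrow> real \<Rightarrow> real \<Rightarrow> (nat \<Rightarrow> real \<Rightarrow> 'w \<Rightarrow> real)
     \<Rightarrow> (real \<Rightarrow> 'w \<Rightarrow> nat \<Rightarrow> real) \<Rightarrow> bool" where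
  "jacobi_eigenvalue_process M F m p q \<nu> X \<longleftrightarrow>
     filtered_prob_space M F \<and>
     independent_brownian_motions M F m \<nu> \<and>
     (\<forall>t\<ge>0. \<forall>i\<in>{1..m}. (\<lambda>\<omega>. X t \<omega> i) \<in> borel_measurable (F t)) \<and>
     (\<forall>\<omega>\<in>space M. \<forall>t\<ge>0. X t \<omega> \<in> ordered_unit_vectors m) \<and>
     (\<forall>\<omega>\<in>space M. \<forall>i\<in>{1..m}. continuous_on {0..} (\<lambda>t. X t \<omega> i)) \<and>
     markov_process M m X \<and>
     (AE \<omega> in M. \<forall>t\<ge>0. \<forall>i\<in>{1..m}.
        (\<integral>\<^sup>+s\<in>{0..t}. jacobi_singular_drift m (X s \<omega>) i \<partial>lborel) < \<infinity>) \<and>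
     (\<forall>i\<in>{1..m}. \<exists>I.
        is_ito_integral M F (\<nu> i) (\<lambda>s \<omega>. 2 * sqrt (X s \<omega> i * (1 - X s \<omega> i))) I \<and>
        (AE \<omega> in M. \<forall>t\<ge>0.
           X t \<omega> i = X 0 \<omega> i + I t \<omega> + (LINT s:{0..t}|lborel. jacobi_drift m p q (X s \<omega>) i)))"

end

(* Every collision or boundary question is reduced to one about scalar semimartingales Y in [0,1]:
   Y = X i - X j for collisions, Y = X i and Y = 1 - X i for the boundary. With d > 0 the function
   G = - sum ln (Y + d) satisfies L G <= C uniformly in d: the second-order term is dominated by the
   pair's own repulsion, the three-body terms have a sign, and min(p,q) >= m+1 absorbs the rest at the
   boundary. So G - C t is a supermartingale, and Doob's maximal inequality with d -> 0 excludes zeros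
   after any time s at which all Y are positive. Almost every s is such a time: applying Ito's formula
   to d ln (Y + d) with d -> 0 shows that the time spent at the boundary is null, and off the boundary
   collision times are null because the singular drift is integrable. *)

theory Submission
  imports Defs
begin

text \<open>The singular drift is only known to have finite integrals along paths, so an Ito formula
  for bounded coefficients does not apply. Statements about the process are phrased as expectations
  against bounded \<open>F s\<close>-measurable test variables, and the missing integrability is
  earned from the equation itself: weighting coordinate i by -i makes all pair interactions act with
  one sign, so given the past of s the expected drift variation over (s, t] is bounded by a
  constant. This controls quadratic sums along grids and with them the Taylor remainder. The
  thresholds come from two balances. At the lower boundary the symmetrized interactions cost at most
  m - 1, and the second-order term at most 2, times the sum of 1 / (x_i + d); p \<ge> m + 1 pays for
  both. For a pair at distance u the second-order term and the repulsion are both close to 2 w /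
  u^2, where w is the numerator of the interaction: there is no margin, and the sign is saved
  because d > 0 damps the former more. The bound min(p, q) > m makes the drift point inwards at 0
  and 1, which is what frees almost every time from the boundary.\<close>

definition square_integrable :: "'a measure \<Rightarrow> ('a \<Rightarrow> real) \<Rightarrow> bool" where
  "square_integrable N f \<longleftrightarrow> f \<in> borel_measurable N \<and> integrable N (\<lambda>x. (f x)\<^sup>2)"

lemma abs_mult_le_squares: "\<bar>a * b\<bar> \<le> a\<^sup>2 + (b::real)\<^sup>2"
proof -
  have "0 \<le> (\<bar>a\<bar> - \<bar>b\<bar>)\<^sup>2" by simp
  then have "2 * \<bar>a * b\<bar> \<le> a\<^sup>2 + b\<^sup>2"
    by (simp add: power2_eq_square algebra_simps abs_mult)
  then show ?thesis using abs_ge_zero[of "a * b"] by linarith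
qed

lemma square_integrable_mult:
  assumes "square_integrable N f" "square_integrable N g"
  shows "integrable N (\<lambda>x. f x * g x)"
proof (rule Bochner_Integration.integrable_bound)
  show "integrable N (\<lambda>x. (f x)\<^sup>2 + (g x)\<^sup>2)"
    using assms by (auto simp: square_integrable_def)
  show "(\<lambda>x. f x * g x) \<in> borel_measurable N"
    using assms by (auto simp: square_integrable_def)
  show "AE x in N. norm (f x * g x) \<le> norm ((f x)\<^sup>2 + (g x)\<^sup>2)"
    by (intro AE_I2) (simp add: abs_mult_le_squares)
qed

lemma square_integrable_add:
  assumes "square_integrable N f" "square_integrable N g"
  shows "square_integrable N (\<lambda>x. f x + g x)"
proof -
  have "integrable N (\<lambda>x. (f x)\<^sup>2 + (g x)\<^sup>2 + 2 * (f x * g x))"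
    using assms square_integrable_mult[OF assms] by (auto simp: square_integrable_def)
  moreover have "(\<lambda>x. (f x)\<^sup>2 + (g x)\<^sup>2 + 2 * (f x * g x)) = (\<lambda>x. (f x + g x)\<^sup>2)"
    by (auto simp: power2_eq_square algebra_simps)
  ultimately show ?thesis using assms by (auto simp: square_integrable_def)
qed

lemma square_integrable_bounded_mult:
  assumes "square_integrable N f" and Z: "Z \<in> borel_measurable N" "\<And>x. x \<in> space N \<Longrightarrow> \<bar>Z x\<bar> \<le> C"
  shows "square_integrable N (\<lambda>x. Z x * f x)"
proof -
  have [measurable]: "f \<in> borel_measurable N" "Z \<in> borel_measurable N"
    using assms by (auto simp: square_integrable_def)
  have "integrable N (\<lambda>x. (Z x * f x)\<^sup>2)"
  proof (rule Bochner_Integration.integrable_bound)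
    show "integrable N (\<lambda>x. C\<^sup>2 * (f x)\<^sup>2)"
      using assms by (auto simp: square_integrable_def)
    show "AE x in N. norm ((Z x * f x)\<^sup>2) \<le> norm (C\<^sup>2 * (f x)\<^sup>2)"
    proof (rule AE_I2)
      fix x assume "x \<in> space N"
      from Z(2)[OF this] have "(Z x)\<^sup>2 \<le> C\<^sup>2" by (metis abs_ge_zero power2_abs power_mono)
      then show "norm ((Z x * f x)\<^sup>2) \<le> norm (C\<^sup>2 * (f x)\<^sup>2)"
        by (simp add: power_mult_distrib mult_right_mono)
    qed
  qed auto
  then show ?thesis by (simp add: square_integrable_def)
qed

lemma square_integrable_cmult:
  "square_integrable N f \<Longrightarrow> square_integrable N (\<lambda>x. c * f x)"
  by (rule square_integrable_bounded_mult[where C = "\<bar>c\<bar>"]) auto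

lemma square_integrable_diff:
  "square_integrable N f \<Longrightarrow> square_integrable N g \<Longrightarrow> square_integrable N (\<lambda>x. f x - g x)"
  using square_integrable_add[of N f "\<lambda>x. (-1) * g x"] square_integrable_cmult[of N g "-1"] by simp

lemma square_integrable_0 [simp]: "square_integrable N (\<lambda>x. 0)"
  by (simp add: square_integrable_def)

lemma square_integrable_sum:
  "finite K \<Longrightarrow> (\<And>k. k \<in> K \<Longrightarrow> square_integrable N (f k)) \<Longrightarrow>
    square_integrable N (\<lambda>x. \<Sum>k\<in>K. f k x)"
  by (induction K rule: finite_induct) (auto intro: square_integrable_add)

lemma (in finite_measure) square_integrable_bounded:
  assumes "f \<in> borel_measurable M" "\<And>x. x \<in> space M \<Longrightarrow> \<bar>f x\<bar> \<le> C"
  shows "square_integrable M f"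
proof -
  have "square_integrable M (\<lambda>_. 1)" by (simp add: square_integrable_def)
  from square_integrable_bounded_mult[OF this assms] show ?thesis by simp
qed

lemma (in finite_measure) square_integrable_imp_integrable:
  assumes "square_integrable M f" shows "integrable M f"
proof -
  have "square_integrable M (\<lambda>_. 1)" by (simp add: square_integrable_def)
  from square_integrable_mult[OF assms this] show ?thesis by simp
qed

section \<open>Filtrations and bounded test variables\<close>

locale filtered_prob = prob_space M for M :: "'w measure" +
  fixes F :: "real \<Rightarrow> 'w measure"
  assumes subalg: "0 \<le> t \<Longrightarrow> subalgebra M (F t)"
    and filtration_mono: "0 \<le> s \<Longrightarrow> s \<le> t \<Longrightarrow> sets (F s) \<subseteq> sets (F t)"
begin

lemma space_F [simp]: "0 \<le> t \<Longrightarrow> space (F t) = space M"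
  using subalg by (auto simp: subalgebra_def)

lemma adapted_mono:
  assumes "f \<in> measurable (F s) N" "0 \<le> s" "s \<le> t"
  shows "f \<in> measurable (F t) N"
proof -
  have "subalgebra (F t) (F s)"
    using assms filtration_mono by (auto simp: subalgebra_def)
  from measurable_from_subalg[OF this assms(1)] show ?thesis .
qed

lemma adapted_measurable: "f \<in> measurable (F s) N \<Longrightarrow> 0 \<le> s \<Longrightarrow> f \<in> measurable M N"
  using measurable_from_subalg subalg by blast

text \<open>Bounded test variables known at time s. An identity between expectations against all
  multipliers, or an inequality against all nonnegative ones, stands in for a statement about
  conditional expectations given \<open>F s\<close>.\<close>

definition multiplier :: "real \<Rightarrow> ('w \<Rightarrow> real) \<Rightarrow> bool" where
  "multiplier s Z \<longleftrightarrow> Z \<in> borel_measurable (F s) \<and> (\<exists>C. \<forall>\<omega>\<in>space M. \<bar>Z \<omega>\<bar> \<le> C)"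

lemma multiplier_mono: "multiplier s Z \<Longrightarrow> 0 \<le> s \<Longrightarrow> s \<le> t \<Longrightarrow> multiplier t Z"
  unfolding multiplier_def using adapted_mono by blast

lemma multiplier_measurable: "multiplier s Z \<Longrightarrow> 0 \<le> s \<Longrightarrow> Z \<in> borel_measurable M"
  unfolding multiplier_def using adapted_measurable by blast

lemma multiplier_mult: "multiplier s Y \<Longrightarrow> multiplier s Z \<Longrightarrow> multiplier s (\<lambda>\<omega>. Y \<omega> * Z \<omega>)"
proof -
  assume Y: "multiplier s Y" and Z: "multiplier s Z"
  then obtain C D where "\<And>\<omega>. \<omega> \<in> space M \<Longrightarrow> \<bar>Y \<omega>\<bar> \<le> C" "\<And>\<omega>. \<omega> \<in> space M \<Longrightarrow> \<bar>Z \<omega>\<bar> \<le> D"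
    unfolding multiplier_def by blast
  then have "\<bar>Y \<omega> * Z \<omega>\<bar> \<le> C * D" if "\<omega> \<in> space M" for \<omega>
    unfolding abs_mult using that by (intro mult_mono') auto
  then show ?thesis using Y Z unfolding multiplier_def by auto
qed

lemma multiplier_const [simp]: "multiplier s (\<lambda>_. c)"
  unfolding multiplier_def by (intro conjI exI[of _ "\<bar>c\<bar>"]) auto

lemma multiplier_bounded:
  assumes "multiplier s Z"
  obtains C where "\<And>\<omega>. \<omega> \<in> space M \<Longrightarrow> \<bar>Z \<omega>\<bar> \<le> C"
  using assms unfolding multiplier_def by blast

lemma square_integrable_multiplier: "multiplier s Z \<Longrightarrow> 0 \<le> s \<Longrightarrow> square_integrable M Z"
  by (metis multiplier_bounded multiplier_measurable square_integrable_bounded)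

lemma integrable_multiplier: "multiplier s Z \<Longrightarrow> 0 \<le> s \<Longrightarrow> integrable M Z"
  using square_integrable_multiplier square_integrable_imp_integrable by blast

lemma square_integrable_multiplier_mult:
  "multiplier s Z \<Longrightarrow> 0 \<le> s \<Longrightarrow> square_integrable M f \<Longrightarrow> square_integrable M (\<lambda>\<omega>. Z \<omega> * f \<omega>)"
  by (metis multiplier_bounded multiplier_measurable square_integrable_bounded_mult)

lemma integrable_multiplier_mult:
  assumes "multiplier s Z" "0 \<le> s" "integrable M f"
  shows "integrable M (\<lambda>\<omega>. Z \<omega> * f \<omega>)"
proof -
  obtain C where C: "\<And>\<omega>. \<omega> \<in> space M \<Longrightarrow> \<bar>Z \<omega>\<bar> \<le> C" using assms(1) unfolding multiplier_def by blast
  have [measurable]: "Z \<in> borel_measurable M" using assms multiplier_measurable by blast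
  show ?thesis
  proof (rule Bochner_Integration.integrable_bound)
    show "integrable M (\<lambda>\<omega>. C * f \<omega>)" using assms by simp
    show "(\<lambda>\<omega>. Z \<omega> * f \<omega>) \<in> borel_measurable M" using assms by measurable
    show "AE x in M. norm (Z x * f x) \<le> norm (C * f x)"
    proof (rule AE_I2)
      fix x assume "x \<in> space M"
      from C[OF this] have "\<bar>Z x\<bar> \<le> \<bar>C\<bar>" by linarith
      then show "norm (Z x * f x) \<le> norm (C * f x)" by (simp add: abs_mult mult_right_mono)
    qed
  qed
qed

end

section \<open>Moments of Brownian increments against variables of the past\<close>

locale brownian_filtered = filtered_prob M F for M :: "'w measure" and F +
  fixes m :: nat and W :: "nat \<Rightarrow> real \<Rightarrow> 'w \<Rightarrow> real"
  assumes brownian: "independent_brownian_motions M F m W"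
begin

lemma brownian_adapted: "i \<in> {1..m} \<Longrightarrow> 0 \<le> t \<Longrightarrow> W i t \<in> borel_measurable (F t)"
  using brownian unfolding independent_brownian_motions_def by blast

lemma brownian_measurable: "i \<in> {1..m} \<Longrightarrow> 0 \<le> t \<Longrightarrow> W i t \<in> borel_measurable M"
  using brownian_adapted adapted_measurable by blast

lemma increment_moments:
  assumes i: "i \<in> {1..m}" and st: "0 \<le> s" "s \<le> t"
  shows "square_integrable M (\<lambda>\<omega>. W i t \<omega> - W i s \<omega>)"
    and "expectation (\<lambda>\<omega>. W i t \<omega> - W i s \<omega>) = 0"
    and "expectation (\<lambda>\<omega>. (W i t \<omega> - W i s \<omega>)\<^sup>2) = t - s"
proof -
  let ?D = "\<lambda>\<omega>. W i t \<omega> - W i s \<omega>"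
  have [measurable]: "W i t \<in> borel_measurable M" "W i s \<in> borel_measurable M"
    using brownian_measurable i st by auto
  have "square_integrable M ?D \<and> expectation ?D = 0 \<and> expectation (\<lambda>\<omega>. (?D \<omega>)\<^sup>2) = t - s"
  \<comment> \<open>The normal law is given for \<open>s < t\<close> only; at \<open>s = t\<close>
    the increment vanishes identically.\<close>
  proof (cases "s = t")
    case False
    then have s: "0 < sqrt (t - s)" using st by simp
    have D: "distributed M lborel ?D (normal_density 0 (sqrt (t - s)))"
      using brownian i st False unfolding independent_brownian_motions_def by auto
    have e: "expectation ?D = 0" by (rule normal_distributed_expectation[OF s D])
    have "integrable M (\<lambda>\<omega>. (?D \<omega>)\<^sup>2)"
      using integrable_normal_moment[OF s, of 0 2]
        distributed_integrable[OF D, of "\<lambda>x. x\<^sup>2"] by simp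
    moreover have "expectation (\<lambda>\<omega>. (?D \<omega>)\<^sup>2) = t - s"
      using normal_distributed_variance[OF s D] st by (simp add: e)
    ultimately show ?thesis using e by (auto simp: square_integrable_def)
  qed auto
  then show "square_integrable M ?D" "expectation ?D = 0" "expectation (\<lambda>\<omega>. (?D \<omega>)\<^sup>2) = t - s"
    by auto
qed

text \<open>Slot 0 of the given independent family of events carries the whole of
  \<open>F s\<close>, hence any variable known at time s may take that slot beside the m
  increments.\<close>

lemma indep_vars_increments:
  assumes Z: "Z \<in> borel_measurable (F s)" and st: "0 \<le> s" "s < t"
  shows "indep_vars (\<lambda>_. borel) (\<lambda>i. if i = 0 then Z else (\<lambda>\<omega>. W i t \<omega> - W i s \<omega>)) {0..m}"
  unfolding indep_vars_def2
proof (intro conjI ballI)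
  fix i assume "i \<in> {0..m}"
  then show "random_variable borel (if i = 0 then Z else (\<lambda>\<omega>. W i t \<omega> - W i s \<omega>))"
    using adapted_measurable[OF Z] brownian_measurable[of i t] brownian_measurable[of i s] st
    by (cases "i = 0") auto
next
  have "indep_sets (\<lambda>i. if i = 0 then sets (F s)
               else {(\<lambda>\<omega>. W i t \<omega> - W i s \<omega>) -` B \<inter> space M | B. B \<in> sets borel}) {0..m}"
    using brownian st unfolding independent_brownian_motions_def by blast
  then show "indep_sets (\<lambda>i. {(if i = 0 then Z else (\<lambda>\<omega>. W i t \<omega> - W i s \<omega>)) -` A \<inter> space M |A.
                A \<in> sets borel}) {0..m}"
  proof (rule indep_sets_mono_sets)
    fix i assume "i \<in> {0..m}"
    have "Z -` A \<inter> space M \<in> sets (F s)" if "A \<in> sets borel" for A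
      using measurable_sets[OF Z that] st by simp
    then show "{(if i = 0 then Z else (\<lambda>\<omega>. W i t \<omega> - W i s \<omega>)) -` A \<inter> space M |A. A \<in> sets borel}
      \<subseteq> (if i = 0 then sets (F s)
               else {(\<lambda>\<omega>. W i t \<omega> - W i s \<omega>) -` B \<inter> space M | B. B \<in> sets borel})"
      by auto
  qed
qed

text \<open>Independence factorizes the expectation. Z is asked to be integrable and not bounded,
  because it will later be a bounded variable times an earlier Brownian increment.\<close>

lemma increment_orthogonal:
  assumes Z: "Z \<in> borel_measurable (F s)" "integrable M Z" and st: "0 \<le> s" "s \<le> t" and i: "i \<in> {1..m}"
  shows "integrable M (\<lambda>\<omega>. Z \<omega> * (W i t \<omega> - W i s \<omega>))"
    and "expectation (\<lambda>\<omega>. Z \<omega> * (W i t \<omega> - W i s \<omega>)) = 0"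
proof -
  let ?X = "\<lambda>i. if i = 0 then Z else (\<lambda>\<omega>. W i t \<omega> - W i s \<omega>)"
  have "integrable M (\<lambda>\<omega>. Z \<omega> * (W i t \<omega> - W i s \<omega>)) \<and>
    expectation (\<lambda>\<omega>. Z \<omega> * (W i t \<omega> - W i s \<omega>)) = 0"
  proof (cases "s = t")
    case False
    then have "s < t" using st by simp
    have ind: "indep_vars (\<lambda>_. borel) ?X {0, i}"
      by (rule indep_vars_subset[OF indep_vars_increments[OF Z(1) st(1) \<open>s < t\<close>]]) (use i in auto)
    have int: "integrable M (?X j)" if "j \<in> {0, i}" for j
      using that i Z square_integrable_imp_integrable[OF increment_moments(1)[OF i st]] by auto
    have "i \<noteq> 0" using i by auto
    show ?thesis
      using indep_vars_lebesgue_integral[OF _ ind int] indep_vars_integrable[OF _ ind int] \<open>i \<noteq> 0\<close>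
        increment_moments(2)[OF i st] by auto
  qed auto
  then show "integrable M (\<lambda>\<omega>. Z \<omega> * (W i t \<omega> - W i s \<omega>))"
    "expectation (\<lambda>\<omega>. Z \<omega> * (W i t \<omega> - W i s \<omega>)) = 0" by auto
qed

lemma increment_product:
  assumes Z: "Z \<in> borel_measurable (F s)" "integrable M Z" and st: "0 \<le> s" "s \<le> t"
    and ij: "i \<in> {1..m}" "j \<in> {1..m}"
  shows "expectation (\<lambda>\<omega>. Z \<omega> * ((W i t \<omega> - W i s \<omega>) * (W j t \<omega> - W j s \<omega>))) =
      (if i = j then expectation Z * (t - s) else 0)"
proof (cases "s = t")
  case False
  let ?X = "\<lambda>i. if i = 0 then Z else (\<lambda>\<omega>. W i t \<omega> - W i s \<omega>)"
  have "s < t" using st False by simp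
  have nz: "i \<noteq> 0" "j \<noteq> 0" using ij by auto
  show ?thesis
  proof (cases "i = j")
    case False
    have ind: "indep_vars (\<lambda>_. borel) ?X {0, i, j}"
      by (rule indep_vars_subset[OF indep_vars_increments[OF Z(1) st(1) \<open>s < t\<close>]]) (use ij in auto)
    have int: "integrable M (?X k)" if "k \<in> {0, i, j}" for k
      using that ij Z square_integrable_imp_integrable[OF increment_moments(1)[OF _ st]] by auto
    show ?thesis
      using indep_vars_lebesgue_integral[OF _ ind int] False nz
        increment_moments(2)[OF ij(1) st] by auto
  next
    case True
    \<comment> \<open>With \<open>i = j\<close> only two members of the family occur. Squaring slot
      i keeps the independence and turns the product into Z times the square whose mean is the
      variance.\<close>
    have "indep_vars (\<lambda>_. borel) ?X {0, i}"
      by (rule indep_vars_subset[OF indep_vars_increments[OF Z(1) st(1) \<open>s < t\<close>]]) (use ij in auto)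
    from indep_vars_compose2[OF this, of "\<lambda>k. if k = 0 then (\<lambda>x. x) else (\<lambda>x. x\<^sup>2)" "\<lambda>_. borel"]
    have ind: "indep_vars (\<lambda>_. borel) (\<lambda>k \<omega>. (if k = 0 then (\<lambda>x. x) else (\<lambda>x. x\<^sup>2)) (?X k \<omega>)) {0, i}"
      by auto
    have int: "integrable M (\<lambda>\<omega>. (if k = 0 then (\<lambda>x. x) else (\<lambda>x. x\<^sup>2)) (?X k \<omega>))" if "k \<in> {0, i}" for k
      using that ij Z increment_moments(1)[OF ij(1) st] by (auto simp: square_integrable_def)
    have "expectation (\<lambda>\<omega>. Z \<omega> * (W i t \<omega> - W i s \<omega>)\<^sup>2) = expectation Z * (t - s)"
      using indep_vars_lebesgue_integral[OF _ ind int] nz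
        increment_moments(3)[OF ij(1) st] by auto
    then show ?thesis using True by (simp add: power2_eq_square)
  qed
qed auto

end

section \<open>Stochastic integrals of elementary processes\<close>

text \<open>Unlike in \<open>simple_predictable\<close>, the intervals may be empty and need not be
  consecutive: cutting a simple process to a time window produces degenerate intervals.\<close>

definition elem_process ::
  "nat \<Rightarrow> (nat \<Rightarrow> real) \<Rightarrow> (nat \<Rightarrow> real) \<Rightarrow> (nat \<Rightarrow> 'w \<Rightarrow> real) \<Rightarrow> 'w \<times> real \<Rightarrow> real" where
  "elem_process n a b \<xi> = (\<lambda>(\<omega>, s). \<Sum>k<n. \<xi> k \<omega> * indicator {a k<..b k} s)"

context prob_space
begin

sublocale space_time: pair_sigma_finite M lborel
  by standard

lemma
  assumes f: "integrable M f" and A: "A \<in> sets borel" "emeasure lborel A < \<infinity>"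
  shows integrable_product_indicator: "integrable (M \<Otimes>\<^sub>M lborel) (\<lambda>(\<omega>, s::real). f \<omega> * indicator A s :: real)"
    and integral_product_indicator:
      "(\<integral>x. (case x of (\<omega>, s::real) \<Rightarrow> f \<omega> * indicator A s) \<partial>(M \<Otimes>\<^sub>M lborel)) = expectation f * measure lborel A"
proof -
  have [measurable]: "f \<in> borel_measurable M" "A \<in> sets borel" using f A by auto
  show int: "integrable (M \<Otimes>\<^sub>M lborel) (\<lambda>(\<omega>, s::real). f \<omega> * indicator A s :: real)"
  proof (rule space_time.Fubini_integrable)
    show "(\<lambda>(\<omega>, s::real). f \<omega> * indicator A s :: real) \<in> borel_measurable (M \<Otimes>\<^sub>M lborel)"
      by measurable
    have "(\<lambda>x. LINT y|lborel. norm (case (x, y) of (\<omega>, s) \<Rightarrow> f \<omega> * indicator A s))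
        = (\<lambda>x. \<bar>f x\<bar> * measure lborel A)"
      by (auto simp: abs_mult)
    then show "integrable M (\<lambda>x. LINT y|lborel. norm (case (x, y) of (\<omega>, s) \<Rightarrow> f \<omega> * indicator A s))"
      using f by auto
    show "AE x in M. integrable lborel (\<lambda>y. case (x, y) of (\<omega>, s) \<Rightarrow> f \<omega> * indicator A s)"
      using A by auto
  qed
  show "(\<integral>x. (case x of (\<omega>, s::real) \<Rightarrow> f \<omega> * indicator A s) \<partial>(M \<Otimes>\<^sub>M lborel)) = expectation f * measure lborel A"
    using space_time.integral_fst'[OF int] by simp
qed

end

context filtered_prob
begin

definition elementary :: "nat \<Rightarrow> (nat \<Rightarrow> real) \<Rightarrow> (nat \<Rightarrow> real) \<Rightarrow> (nat \<Rightarrow> 'w \<Rightarrow> real) \<Rightarrow> bool" where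
  "elementary n a b \<xi> \<longleftrightarrow> (\<forall>k<n. 0 \<le> a k \<and> a k \<le> b k \<and> multiplier (a k) (\<xi> k))"

lemma square_integrable_elem_process:
  assumes "elementary n a b \<xi>"
  shows "square_integrable (M \<Otimes>\<^sub>M lborel) (elem_process n a b \<xi>)"
proof -
  have "square_integrable (M \<Otimes>\<^sub>M lborel) (\<lambda>x. case x of (\<omega>, s) \<Rightarrow> \<xi> k \<omega> * indicator {a k<..b k} s)"
    if "k < n" for k
  proof -
    have k: "0 \<le> a k" "a k \<le> b k" "multiplier (a k) (\<xi> k)" using assms that by (auto simp: elementary_def)
    then have [measurable]: "\<xi> k \<in> borel_measurable M" using multiplier_measurable by blast
    have "integrable M (\<lambda>\<omega>. (\<xi> k \<omega>)\<^sup>2)"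
      using square_integrable_multiplier k by (auto simp: square_integrable_def)
    moreover have "(\<lambda>x. (case x of (\<omega>, s) \<Rightarrow> \<xi> k \<omega> * indicator {a k<..b k} s)\<^sup>2) =
        (\<lambda>(\<omega>, s). (\<xi> k \<omega>)\<^sup>2 * indicator {a k<..b k} s)"
      by (auto simp: fun_eq_iff power_mult_distrib indicator_def)
    ultimately have "integrable (M \<Otimes>\<^sub>M lborel) (\<lambda>x. (case x of (\<omega>, s) \<Rightarrow> \<xi> k \<omega> * indicator {a k<..b k} s)\<^sup>2)"
      using k integrable_product_indicator[of "\<lambda>\<omega>. (\<xi> k \<omega>)\<^sup>2" "{a k<..b k}"] by simp
    then show ?thesis by (simp add: square_integrable_def)
  qed
  from square_integrable_sum[of "{..<n}", OF _ this]
  show ?thesis by (simp add: elem_process_def split_beta')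
qed

end

context brownian_filtered
begin

definition elem_integral :: "nat \<Rightarrow> nat \<Rightarrow> (nat \<Rightarrow> real) \<Rightarrow> (nat \<Rightarrow> real) \<Rightarrow> (nat \<Rightarrow> 'w \<Rightarrow> real) \<Rightarrow> 'w \<Rightarrow> real" where
  "elem_integral i n a b \<xi> \<omega> = (\<Sum>k<n. \<xi> k \<omega> * (W i (b k) \<omega> - W i (a k) \<omega>))"

lemma square_integrable_elem_integral:
  assumes "elementary n a b \<xi>" "i \<in> {1..m}"
  shows "square_integrable M (elem_integral i n a b \<xi>)"
proof -
  have "square_integrable M (\<lambda>\<omega>. \<Sum>k<n. \<xi> k \<omega> * (W i (b k) \<omega> - W i (a k) \<omega>))"
    using assms by (intro square_integrable_sum)
      (auto simp: elementary_def intro!: square_integrable_multiplier_mult increment_moments(1))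
  then show ?thesis unfolding elem_integral_def .
qed

lemma expectation_elem_integral:
  assumes "elementary n a b \<xi>" "i \<in> {1..m}"
  shows "expectation (elem_integral i n a b \<xi>) = 0"
proof -
  have *: "integrable M (\<lambda>\<omega>. \<xi> k \<omega> * (W i (b k) \<omega> - W i (a k) \<omega>)) \<and>
    expectation (\<lambda>\<omega>. \<xi> k \<omega> * (W i (b k) \<omega> - W i (a k) \<omega>)) = 0" if "k < n" for k
  proof -
    have k: "0 \<le> a k" "a k \<le> b k" "multiplier (a k) (\<xi> k)" using assms that by (auto simp: elementary_def)
    then show ?thesis
      using increment_orthogonal[OF _ integrable_multiplier k(1,2) assms(2), of "\<xi> k"]
      by (auto simp: multiplier_def)
  qed
  have "expectation (\<lambda>\<omega>. \<Sum>k<n. \<xi> k \<omega> * (W i (b k) \<omega> - W i (a k) \<omega>)) =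
    (\<Sum>k<n. expectation (\<lambda>\<omega>. \<xi> k \<omega> * (W i (b k) \<omega> - W i (a k) \<omega>)))"
    using * by (intro Bochner_Integration.integral_sum) auto
  also have "\<dots> = 0" using * by simp
  finally show ?thesis by (simp add: elem_integral_def[abs_def])
qed

text \<open>The earlier increment is known at time c, so it can be absorbed into the test variable;
  the resulting integrable variable is orthogonal to the later increment.\<close>

lemma increment_product_orthogonal:
  assumes Z: "multiplier c Z" and tm: "0 \<le> a" "a \<le> b" "b \<le> c" "c \<le> d" and ij: "i \<in> {1..m}" "j \<in> {1..m}"
  shows "expectation (\<lambda>\<omega>. Z \<omega> * ((W i b \<omega> - W i a \<omega>) * (W j d \<omega> - W j c \<omega>))) = 0"
    and "integrable M (\<lambda>\<omega>. Z \<omega> * ((W i b \<omega> - W i a \<omega>) * (W j d \<omega> - W j c \<omega>)))"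
proof -
  have [measurable]: "W i b \<in> borel_measurable (F c)" "W i a \<in> borel_measurable (F c)" "Z \<in> borel_measurable (F c)"
    using adapted_mono[OF brownian_adapted] tm ij Z by (auto simp: multiplier_def)
  have "integrable M (\<lambda>\<omega>. Z \<omega> * (W i b \<omega> - W i a \<omega>))"
    using square_integrable_imp_integrable[OF square_integrable_multiplier_mult[OF Z _ increment_moments(1)[OF ij(1)]]] tm
    by auto
  from increment_orthogonal[OF _ this _ tm(4) ij(2)] tm
  show "expectation (\<lambda>\<omega>. Z \<omega> * ((W i b \<omega> - W i a \<omega>) * (W j d \<omega> - W j c \<omega>))) = 0"
    "integrable M (\<lambda>\<omega>. Z \<omega> * ((W i b \<omega> - W i a \<omega>) * (W j d \<omega> - W j c \<omega>)))"
    by (auto simp: mult.assoc)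
qed

lemma increment_pair_ordered:
  assumes Z: "multiplier c Z" and tm: "0 \<le> a" "a \<le> b" "a \<le> c" "c \<le> d" and ij: "i \<in> {1..m}" "j \<in> {1..m}"
  shows "expectation (\<lambda>\<omega>. Z \<omega> * ((W i b \<omega> - W i a \<omega>) * (W j d \<omega> - W j c \<omega>))) =
    (if i = j then expectation Z * max 0 (min b d - c) else 0)"
proof (cases "b \<le> c")
  case True
  then show ?thesis using increment_product_orthogonal[OF Z tm(1,2) _ tm(4) ij] by auto
next
  case False
  \<comment> \<open>The two intervals overlap in (c, e].\<close>
  define e where "e = min b d"
  have e: "c \<le> e" "e \<le> b" "e \<le> d" "0 \<le> c" "0 \<le> e" using tm False by (auto simp: e_def)
  note Ze = multiplier_mono[OF Z e(4) e(1)]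
  have b_or_d: "e = b \<or> e = d" by (auto simp: e_def)
  \<comment> \<open>The increments are cut at c and at e. The product of the two pieces beyond e is
    missing because one of them is zero. Only the term over the overlap can survive in expectation:
    every other one ends with an increment that starts when its remaining factors are already
    known.\<close>
  have eq: "(\<lambda>\<omega>. Z \<omega> * ((W i b \<omega> - W i a \<omega>) * (W j d \<omega> - W j c \<omega>))) =
     (\<lambda>\<omega>. Z \<omega> * ((W i c \<omega> - W i a \<omega>) * (W j d \<omega> - W j c \<omega>)) +
      (Z \<omega> * ((W i e \<omega> - W i c \<omega>) * (W j e \<omega> - W j c \<omega>)) +
      (Z \<omega> * ((W i e \<omega> - W i c \<omega>) * (W j d \<omega> - W j e \<omega>)) +
      Z \<omega> * ((W j e \<omega> - W j c \<omega>) * (W i b \<omega> - W i e \<omega>)))))"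
    using b_or_d by (auto simp: algebra_simps)
  note o1 = increment_product_orthogonal[OF Z tm(1,3) order_refl tm(4) ij]
  note o2 = increment_product_orthogonal[OF Ze e(4,1) order_refl e(3) ij]
  note o3 = increment_product_orthogonal[OF Ze e(4,1) order_refl e(2) ij(2,1)]
  have i2: "integrable M (\<lambda>\<omega>. Z \<omega> * ((W i e \<omega> - W i c \<omega>) * (W j e \<omega> - W j c \<omega>)))"
    using increment_moments(1)[OF ij(1) e(4,1)] increment_moments(1)[OF ij(2) e(4,1)]
    by (intro integrable_multiplier_mult[OF Z] square_integrable_mult) (use e in auto)
  have e2: "expectation (\<lambda>\<omega>. Z \<omega> * ((W i e \<omega> - W i c \<omega>) * (W j e \<omega> - W j c \<omega>))) =
      (if i = j then expectation Z * (e - c) else 0)"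
    using increment_product[OF _ integrable_multiplier[OF Z e(4)] e(4,1) ij] Z by (auto simp: multiplier_def)
  have "expectation (\<lambda>\<omega>. Z \<omega> * ((W i b \<omega> - W i a \<omega>) * (W j d \<omega> - W j c \<omega>))) =
      (if i = j then expectation Z * (e - c) else 0)"
    unfolding eq using o1 o2 o3 i2 e2 by (simp add: )
  then show ?thesis using e by (simp add: e_def)
qed

text \<open>The product of the two coefficients is known at the later of the two left endpoints,
  which reduces the claim to intervals ordered by their starts;
  \<open>max 0 (min b d - max a c)\<close> is the length of the overlap.\<close>

lemma increment_pair:
  assumes xi: "multiplier a \<xi>" and eta: "multiplier c \<eta>"
    and tm: "0 \<le> a" "a \<le> b" "0 \<le> c" "c \<le> d" and ij: "i \<in> {1..m}" "j \<in> {1..m}"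
  shows "expectation (\<lambda>\<omega>. (\<xi> \<omega> * (W i b \<omega> - W i a \<omega>)) * (\<eta> \<omega> * (W j d \<omega> - W j c \<omega>))) =
    (if i = j then expectation (\<lambda>\<omega>. \<xi> \<omega> * \<eta> \<omega>) * max 0 (min b d - max a c) else 0)"
proof (cases "a \<le> c")
  case True
  then have "multiplier c (\<lambda>\<omega>. \<xi> \<omega> * \<eta> \<omega>)" by (intro multiplier_mult multiplier_mono[OF xi tm(1)] eta)
  from increment_pair_ordered[OF this tm(1,2) True tm(4) ij] True
  show ?thesis by (simp add: algebra_simps max_absorb2)
next
  case False
  then have "multiplier a (\<lambda>\<omega>. \<xi> \<omega> * \<eta> \<omega>)" by (intro multiplier_mult multiplier_mono[OF eta tm(3)] xi) auto
  from increment_pair_ordered[OF this tm(3,4) _ tm(2) ij(2,1)] False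
  show ?thesis by (auto simp: algebra_simps max_absorb1 min.commute)
qed

text \<open>The isometry in bilinear form, and across two Brownian motions: its vanishing for i
  \<noteq> j is what later leaves no cross terms in the bracket of a combination of
  coordinates.\<close>

lemma elementary_isometry:
  assumes e1: "elementary n a b \<xi>" and e2: "elementary n' c d \<eta>" and ij: "i \<in> {1..m}" "j \<in> {1..m}"
  shows "expectation (\<lambda>\<omega>. elem_integral i n a b \<xi> \<omega> * elem_integral j n' c d \<eta> \<omega>) =
    (if i = j then (\<integral>x. elem_process n a b \<xi> x * elem_process n' c d \<eta> x \<partial>(M \<Otimes>\<^sub>M lborel)) else 0)"
proof -
  have k: "0 \<le> a k" "a k \<le> b k" "multiplier (a k) (\<xi> k)" if "k < n" for k
    using e1 that by (auto simp: elementary_def)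
  have l: "0 \<le> c l" "c l \<le> d l" "multiplier (c l) (\<eta> l)" if "l < n'" for l
    using e2 that by (auto simp: elementary_def)
  let ?I = "\<lambda>k \<omega>. \<xi> k \<omega> * (W i (b k) \<omega> - W i (a k) \<omega>)"
  let ?J = "\<lambda>l \<omega>. \<eta> l \<omega> * (W j (d l) \<omega> - W j (c l) \<omega>)"
  let ?ov = "\<lambda>k l. max 0 (min (b k) (d l) - max (a k) (c l))"
  let ?P = "\<lambda>k l x. case x of (\<omega>, s) \<Rightarrow> (\<xi> k \<omega> * \<eta> l \<omega>) * indicator ({a k<..b k} \<inter> {c l<..d l}) s"
  have int1: "integrable M (\<lambda>\<omega>. ?I k \<omega> * ?J l \<omega>)" if "k < n" "l < n'" for k l
    by (rule square_integrable_mult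
        [OF square_integrable_multiplier_mult[OF k(3,1) increment_moments(1)[OF ij(1) k(1,2)]]
          square_integrable_multiplier_mult[OF l(3,1) increment_moments(1)[OF ij(2) l(1,2)]]])
      (use that in auto)
  have int2: "integrable M (\<lambda>\<omega>. \<xi> k \<omega> * \<eta> l \<omega>)" if "k < n" "l < n'" for k l
    by (rule square_integrable_mult[OF square_integrable_multiplier[OF k(3,1)] square_integrable_multiplier[OF l(3,1)]])
      (use that in auto)
  have ov: "{a k<..b k} \<inter> {c l<..d l} = {max (a k) (c l)<..min (b k) (d l)}" for k l by auto
  have ovm: "emeasure lborel ({a k<..b k} \<inter> {c l<..d l}) < \<infinity>" for k l
    unfolding ov by (cases "max (a k) (c l) \<le> min (b k) (d l)") auto
  have ovm2: "measure lborel ({a k<..b k} \<inter> {c l<..d l}) = ?ov k l" for k l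
    unfolding ov by (cases "max (a k) (c l) \<le> min (b k) (d l)") auto
  have int3: "integrable (M \<Otimes>\<^sub>M lborel) (?P k l)" if "k < n" "l < n'" for k l
    using integrable_product_indicator[OF int2[OF that] _ ovm] by auto
  have "(\<integral>x. elem_process n a b \<xi> x * elem_process n' c d \<eta> x \<partial>(M \<Otimes>\<^sub>M lborel))
      = (\<integral>x. (\<Sum>k<n. \<Sum>l<n'. ?P k l x) \<partial>(M \<Otimes>\<^sub>M lborel))"
  proof (intro Bochner_Integration.integral_cong refl)
    fix x :: "'w \<times> real"
    obtain \<omega> s where x: "x = (\<omega>, s)" by (cases x)
    show "elem_process n a b \<xi> x * elem_process n' c d \<eta> x = (\<Sum>k<n. \<Sum>l<n'. ?P k l x)"
      unfolding x elem_process_def prod.case sum_product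
      by (intro sum.cong refl) (simp only: indicator_inter_arith ac_simps)
  qed
  also have "\<dots> = (\<Sum>k<n. \<Sum>l<n'. (\<integral>x. ?P k l x \<partial>(M \<Otimes>\<^sub>M lborel)))"
    using int3 by (subst Bochner_Integration.integral_sum) (auto intro!: sum.cong Bochner_Integration.integral_sum)
  also have "\<dots> = (\<Sum>k<n. \<Sum>l<n'. expectation (\<lambda>\<omega>. \<xi> k \<omega> * \<eta> l \<omega>) * ?ov k l)"
    using integral_product_indicator[OF int2 _ ovm] ovm2 by (intro sum.cong refl) auto
  finally have rhs: "(\<integral>x. elem_process n a b \<xi> x * elem_process n' c d \<eta> x \<partial>(M \<Otimes>\<^sub>M lborel))
     = (\<Sum>k<n. \<Sum>l<n'. expectation (\<lambda>\<omega>. \<xi> k \<omega> * \<eta> l \<omega>) * ?ov k l)" .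
  have "expectation (\<lambda>\<omega>. elem_integral i n a b \<xi> \<omega> * elem_integral j n' c d \<eta> \<omega>)
     = expectation (\<lambda>\<omega>. \<Sum>k<n. \<Sum>l<n'. ?I k \<omega> * ?J l \<omega>)"
    by (simp add: elem_integral_def sum_product)
  also have "\<dots> = (\<Sum>k<n. \<Sum>l<n'. expectation (\<lambda>\<omega>. ?I k \<omega> * ?J l \<omega>))"
    using int1 by (subst Bochner_Integration.integral_sum) (auto intro!: sum.cong Bochner_Integration.integral_sum)
  also have "\<dots> = (\<Sum>k<n. \<Sum>l<n'. if i = j then expectation (\<lambda>\<omega>. \<xi> k \<omega> * \<eta> l \<omega>) * ?ov k l else 0)"
    using k l ij by (intro sum.cong refl increment_pair) auto
  finally show ?thesis unfolding rhs by simp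
qed

end

section \<open>Mean-square convergence\<close>

definition L2_tendsto :: "'a measure \<Rightarrow> (nat \<Rightarrow> 'a \<Rightarrow> real) \<Rightarrow> ('a \<Rightarrow> real) \<Rightarrow> bool" where
  "L2_tendsto N f g \<longleftrightarrow> (\<forall>k. square_integrable N (f k)) \<and> square_integrable N g \<and>
     (\<lambda>k. \<integral>x. (f k x - g x)\<^sup>2 \<partial>N) \<longlonglongrightarrow> 0"

lemma integrable_square_diff:
  "square_integrable N f \<Longrightarrow> square_integrable N g \<Longrightarrow> integrable N (\<lambda>x. (f x - g x)\<^sup>2)"
  using square_integrable_diff[of N f g] by (simp add: square_integrable_def)

lemma L2_tendsto_const: "square_integrable N g \<Longrightarrow> L2_tendsto N (\<lambda>_. g) g"
  by (simp add: L2_tendsto_def)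

lemma sq_add_le: "(a + b)\<^sup>2 \<le> 2 * a\<^sup>2 + 2 * (b::real)\<^sup>2"
  using zero_le_power2[of "a - b"] by (simp add: power2_eq_square algebra_simps)

lemma L2_tendsto_add:
  assumes "L2_tendsto N f g" "L2_tendsto N f' g'"
  shows "L2_tendsto N (\<lambda>k x. f k x + f' k x) (\<lambda>x. g x + g' x)"
proof -
  have sq: "square_integrable N (f k)" "square_integrable N g" "square_integrable N (f' k)" "square_integrable N g'" for k
    using assms by (auto simp: L2_tendsto_def)
  have "(\<lambda>k. \<integral>x. (f k x + f' k x - (g x + g' x))\<^sup>2 \<partial>N) \<longlonglongrightarrow> 0"
  proof (rule tendsto_sandwich[OF always_eventually always_eventually tendsto_const])
    show "\<forall>k. 0 \<le> (\<integral>x. (f k x + f' k x - (g x + g' x))\<^sup>2 \<partial>N)" by simp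
    show "\<forall>k. (\<integral>x. (f k x + f' k x - (g x + g' x))\<^sup>2 \<partial>N) \<le>
      2 * (\<integral>x. (f k x - g x)\<^sup>2 \<partial>N) + 2 * (\<integral>x. (f' k x - g' x)\<^sup>2 \<partial>N)"
    proof
      fix k
      note i = integrable_square_diff[OF sq(1)[of k] sq(2)] integrable_square_diff[OF sq(3)[of k] sq(4)]
      have "(\<integral>x. (f k x + f' k x - (g x + g' x))\<^sup>2 \<partial>N) \<le> (\<integral>x. 2 * (f k x - g x)\<^sup>2 + 2 * (f' k x - g' x)\<^sup>2 \<partial>N)"
      proof (rule integral_mono)
        show "integrable N (\<lambda>x. (f k x + f' k x - (g x + g' x))\<^sup>2)"
          by (intro integrable_square_diff square_integrable_add sq)
        show "integrable N (\<lambda>x. 2 * (f k x - g x)\<^sup>2 + 2 * (f' k x - g' x)\<^sup>2)" using i by simp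
        show "(f k x + f' k x - (g x + g' x))\<^sup>2 \<le> 2 * (f k x - g x)\<^sup>2 + 2 * (f' k x - g' x)\<^sup>2" for x
          using sq_add_le[of "f k x - g x" "f' k x - g' x"] by (simp add: algebra_simps)
      qed
      then show "(\<integral>x. (f k x + f' k x - (g x + g' x))\<^sup>2 \<partial>N) \<le>
        2 * (\<integral>x. (f k x - g x)\<^sup>2 \<partial>N) + 2 * (\<integral>x. (f' k x - g' x)\<^sup>2 \<partial>N)"
        using i by simp
    qed
    show "(\<lambda>k. 2 * (\<integral>x. (f k x - g x)\<^sup>2 \<partial>N) + 2 * (\<integral>x. (f' k x - g' x)\<^sup>2 \<partial>N)) \<longlonglongrightarrow> 0"
      using assms by (auto simp: L2_tendsto_def intro!: tendsto_eq_intros)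
  qed
  then show ?thesis using sq by (auto simp: L2_tendsto_def intro!: square_integrable_add)
qed

lemma L2_tendsto_bounded_mult:
  assumes fg: "L2_tendsto N f g" and Z: "Z \<in> borel_measurable N" "\<And>x. x \<in> space N \<Longrightarrow> \<bar>Z x\<bar> \<le> C"
  shows "L2_tendsto N (\<lambda>k x. Z x * f k x) (\<lambda>x. Z x * g x)"
proof -
  have sq: "square_integrable N (f k)" "square_integrable N g" for k
    using assms by (auto simp: L2_tendsto_def)
  note sqZ = square_integrable_bounded_mult[OF sq(1) Z] square_integrable_bounded_mult[OF sq(2) Z]
  have "(\<lambda>k. \<integral>x. (Z x * f k x - Z x * g x)\<^sup>2 \<partial>N) \<longlonglongrightarrow> 0"
  proof (rule tendsto_sandwich[OF always_eventually always_eventually tendsto_const])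
    show "\<forall>k. 0 \<le> (\<integral>x. (Z x * f k x - Z x * g x)\<^sup>2 \<partial>N)" by simp
    show "\<forall>k. (\<integral>x. (Z x * f k x - Z x * g x)\<^sup>2 \<partial>N) \<le> C\<^sup>2 * (\<integral>x. (f k x - g x)\<^sup>2 \<partial>N)"
    proof
      fix k
      have "(\<integral>x. (Z x * f k x - Z x * g x)\<^sup>2 \<partial>N) \<le> (\<integral>x. C\<^sup>2 * (f k x - g x)\<^sup>2 \<partial>N)"
      proof (rule integral_mono)
        show "integrable N (\<lambda>x. (Z x * f k x - Z x * g x)\<^sup>2)"
          by (intro integrable_square_diff sqZ)
        show "integrable N (\<lambda>x. C\<^sup>2 * (f k x - g x)\<^sup>2)" using integrable_square_diff[OF sq(1) sq(2)] by simp
        fix x assume "x \<in> space N"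
        from Z(2)[OF this] have "(Z x)\<^sup>2 \<le> C\<^sup>2" by (metis abs_ge_zero power2_abs power_mono)
        then show "(Z x * f k x - Z x * g x)\<^sup>2 \<le> C\<^sup>2 * (f k x - g x)\<^sup>2"
          by (simp add: power_mult_distrib mult_right_mono flip: right_diff_distrib)
      qed
      then show "(\<integral>x. (Z x * f k x - Z x * g x)\<^sup>2 \<partial>N) \<le> C\<^sup>2 * (\<integral>x. (f k x - g x)\<^sup>2 \<partial>N)" by simp
    qed
    show "(\<lambda>k. C\<^sup>2 * (\<integral>x. (f k x - g x)\<^sup>2 \<partial>N)) \<longlonglongrightarrow> 0"
      using assms by (auto simp: L2_tendsto_def intro!: tendsto_eq_intros)
  qed
  then show ?thesis using sqZ by (auto simp: L2_tendsto_def)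
qed

lemma L2_tendsto_diff:
  assumes "L2_tendsto N f g" "L2_tendsto N f' g'"
  shows "L2_tendsto N (\<lambda>k x. f k x - f' k x) (\<lambda>x. g x - g' x)"
  using L2_tendsto_add[OF assms(1) L2_tendsto_bounded_mult[OF assms(2), of "\<lambda>_. -1" 1]] by simp

text \<open>Young's inequality with a small weight on \<open>b\<^sup>2\<close> takes the place of
  the triangle inequality for the norm.\<close>

lemma L2_tendsto_norm:
  assumes "L2_tendsto N f g"
  shows "(\<lambda>k. \<integral>x. (f k x)\<^sup>2 \<partial>N) \<longlonglongrightarrow> (\<integral>x. (g x)\<^sup>2 \<partial>N)"
proof (rule LIMSEQ_I)
  fix e :: real assume e: "0 < e"
  have sq: "square_integrable N (f k)" "square_integrable N g" for k
    using assms by (auto simp: L2_tendsto_def)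
  define G where "G = (\<integral>x. (g x)\<^sup>2 \<partial>N)"
  have G: "0 \<le> G" unfolding G_def by simp
  \<comment> \<open>This weight makes the part proportional to G at most e / 2; G + 1 instead of G
    covers the case G = 0.\<close>
  define \<eta> where "\<eta> = e / (2 * (G + 1))"
  have \<eta>: "0 < \<eta>" using e G by (simp add: \<eta>_def)
  have *: "\<bar>a\<^sup>2 - b\<^sup>2\<bar> \<le> (1 + 1 / \<eta>) * (a - b)\<^sup>2 + \<eta> * b\<^sup>2" for a b :: real
  proof -
    have "a\<^sup>2 - b\<^sup>2 = (a - b)\<^sup>2 + 2 * (a - b) * b" by (simp add: power2_eq_square algebra_simps)
    then have 1: "\<bar>a\<^sup>2 - b\<^sup>2\<bar> \<le> (a - b)\<^sup>2 + \<bar>2 * (a - b) * b\<bar>"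
      by (metis abs_power2 abs_triangle_ineq power2_abs)
    define c where "c = a - b"
    have "0 \<le> (\<bar>c\<bar> - \<eta> * \<bar>b\<bar>)\<^sup>2 / \<eta>" using \<eta> by simp
    also have "\<dots> = c\<^sup>2 / \<eta> + \<eta> * b\<^sup>2 - 2 * \<bar>c\<bar> * \<bar>b\<bar>"
      using \<eta> by (simp add: power2_diff power_mult_distrib field_simps) (simp add: power2_eq_square)
    finally have "0 \<le> (a - b)\<^sup>2 / \<eta> + \<eta> * b\<^sup>2 - \<bar>2 * (a - b) * b\<bar>"
      unfolding c_def abs_mult by simp
    then show ?thesis using 1 by (simp add: algebra_simps)
  qed
  have "(\<lambda>k. (1 + 1 / \<eta>) * (\<integral>x. (f k x - g x)\<^sup>2 \<partial>N)) \<longlonglongrightarrow> 0"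
    using assms by (auto simp: L2_tendsto_def intro!: tendsto_eq_intros)
  from LIMSEQ_D[OF this, of "e / 2"] e obtain n0 where
    n0: "\<And>k. k \<ge> n0 \<Longrightarrow> \<bar>(1 + 1 / \<eta>) * (\<integral>x. (f k x - g x)\<^sup>2 \<partial>N)\<bar> < e / 2" by auto
  show "\<exists>no. \<forall>n\<ge>no. norm ((\<integral>x. (f n x)\<^sup>2 \<partial>N) - (\<integral>x. (g x)\<^sup>2 \<partial>N)) < e"
  proof (intro exI allI impI)
    fix k assume "n0 \<le> k"
    have i: "integrable N (\<lambda>x. (f k x)\<^sup>2)" "integrable N (\<lambda>x. (g x)\<^sup>2)" "integrable N (\<lambda>x. (f k x - g x)\<^sup>2)"
      using sq integrable_square_diff[OF sq(1)[of k] sq(2)] by (auto simp: square_integrable_def)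
    have "norm ((\<integral>x. (f k x)\<^sup>2 \<partial>N) - (\<integral>x. (g x)\<^sup>2 \<partial>N)) = \<bar>\<integral>x. (f k x)\<^sup>2 - (g x)\<^sup>2 \<partial>N\<bar>"
      using i by simp
    also have "\<dots> \<le> (\<integral>x. \<bar>(f k x)\<^sup>2 - (g x)\<^sup>2\<bar> \<partial>N)" by (rule integral_abs_bound)
    also have "\<dots> \<le> (\<integral>x. (1 + 1 / \<eta>) * (f k x - g x)\<^sup>2 + \<eta> * (g x)\<^sup>2 \<partial>N)"
      using i by (intro integral_mono) (auto simp: *)
    also have "\<dots> = (1 + 1 / \<eta>) * (\<integral>x. (f k x - g x)\<^sup>2 \<partial>N) + \<eta> * G"
      using i by (simp add: G_def)
    also have "\<dots> < e / 2 + \<eta> * G" using n0[OF \<open>n0 \<le> k\<close>] by linarith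
    also have "\<eta> * G \<le> e / 2" using e G by (simp add: \<eta>_def field_simps)
    finally show "norm ((\<integral>x. (f k x)\<^sup>2 \<partial>N) - (\<integral>x. (g x)\<^sup>2 \<partial>N)) < e" by simp
  qed
qed

text \<open>Polarization reduces inner products to squared norms.\<close>

lemma L2_tendsto_mult:
  assumes "L2_tendsto N f g" "L2_tendsto N f' g'"
  shows "(\<lambda>k. \<integral>x. f k x * f' k x \<partial>N) \<longlonglongrightarrow> (\<integral>x. g x * g' x \<partial>N)"
proof -
  have eq: "(\<integral>x. u x * v x \<partial>N) = ((\<integral>x. (u x + v x)\<^sup>2 \<partial>N) - (\<integral>x. (u x - v x)\<^sup>2 \<partial>N)) / 4"
    if u: "square_integrable N u" "square_integrable N v" for u v :: "'a \<Rightarrow> real"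
  proof -
    have "(\<integral>x. (u x + v x)\<^sup>2 \<partial>N) - (\<integral>x. (u x - v x)\<^sup>2 \<partial>N) = (\<integral>x. (u x + v x)\<^sup>2 - (u x - v x)\<^sup>2 \<partial>N)"
      using square_integrable_add[OF u] square_integrable_diff[OF u]
      by (simp add: square_integrable_def)
    also have "\<dots> = (\<integral>x. 4 * (u x * v x) \<partial>N)"
      by (intro Bochner_Integration.integral_cong refl) (simp add: power2_eq_square algebra_simps)
    finally show ?thesis by simp
  qed
  have "(\<lambda>k. ((\<integral>x. (f k x + f' k x)\<^sup>2 \<partial>N) - (\<integral>x. (f k x - f' k x)\<^sup>2 \<partial>N)) / 4)
    \<longlonglongrightarrow> ((\<integral>x. (g x + g' x)\<^sup>2 \<partial>N) - (\<integral>x. (g x - g' x)\<^sup>2 \<partial>N)) / 4"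
    by (intro tendsto_intros L2_tendsto_norm L2_tendsto_add L2_tendsto_diff assms) simp
  then show ?thesis using assms by (simp add: eq L2_tendsto_def)
qed

lemma L2_tendsto_trans:
  assumes f: "L2_tendsto N f g" and h: "\<And>k. square_integrable N (h k)"
    and d: "(\<lambda>k. \<integral>x. (h k x - f k x)\<^sup>2 \<partial>N) \<longlonglongrightarrow> 0"
  shows "L2_tendsto N h g"
proof -
  have "L2_tendsto N (\<lambda>k x. h k x - f k x) (\<lambda>_. 0)"
    using f h d by (auto simp: L2_tendsto_def intro!: square_integrable_diff)
  from L2_tendsto_add[OF this f] show ?thesis by simp
qed

text \<open>The definition of the Ito integral measures distances in the extended nonnegative reals
  and does not claim that the limit is square integrable. One approximant at finite distance yields
  that, and from then on the distances are ordinary integrals.\<close>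

lemma L2_tendsto_nn_integral:
  assumes f: "\<And>k. square_integrable N (f k)" and g: "g \<in> borel_measurable N"
    and lim: "(\<lambda>k. \<integral>\<^sup>+x. ennreal ((g x - f k x)\<^sup>2) \<partial>N) \<longlonglongrightarrow> 0"
  shows "L2_tendsto N f g"
proof -
  have [measurable]: "g \<in> borel_measurable N" "f k \<in> borel_measurable N" for k
    using f g by (auto simp: square_integrable_def)
  have "eventually (\<lambda>k. (\<integral>\<^sup>+x. ennreal ((g x - f k x)\<^sup>2) \<partial>N) < 1) sequentially"
    using order_tendstoD(2)[OF lim, of 1] by simp
  then obtain k0 where k0: "(\<integral>\<^sup>+x. ennreal ((g x - f k0 x)\<^sup>2) \<partial>N) < 1"
    using eventually_happens' sequentially_bot by blast
  have "integrable N (\<lambda>x. (g x - f k0 x)\<^sup>2)"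
    by (rule integrableI_nonneg) (use k0 in \<open>auto simp: ennreal_one_less_top intro: less_trans\<close>)
  then have "square_integrable N (\<lambda>x. g x - f k0 x)" by (simp add: square_integrable_def)
  from square_integrable_add[OF this f[of k0]] have sg: "square_integrable N g" by simp
  have "(\<integral>\<^sup>+x. ennreal ((g x - f k x)\<^sup>2) \<partial>N) = ennreal (\<integral>x. (f k x - g x)\<^sup>2 \<partial>N)" for k
    using integrable_square_diff[OF sg f[of k]]
    by (subst nn_integral_eq_integral) (auto simp: power2_commute)
  with lim have "(\<lambda>k. ennreal (\<integral>x. (f k x - g x)\<^sup>2 \<partial>N)) \<longlonglongrightarrow> ennreal 0" by simp
  then have "(\<lambda>k. \<integral>x. (f k x - g x)\<^sup>2 \<partial>N) \<longlonglongrightarrow> 0"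
    by (rule tendsto_ennrealD) auto
  then show ?thesis using f sg by (simp add: L2_tendsto_def)
qed

section \<open>Stochastic integrals over a time window\<close>

definition clamp_time :: "real \<Rightarrow> real \<Rightarrow> real \<Rightarrow> real" where
  "clamp_time s t r = max s (min r t)"

text \<open>For \<open>\<tau> k > t\<close> the clamped interval is degenerate and starts at t, when
  \<xi> k need not be known yet; the coefficient is set to 0 there to stay adapted. Otherwise the
  clamped interval starts no earlier than \<tau> k.\<close>

definition clamp_coeff :: "real \<Rightarrow> ('w \<Rightarrow> real) \<Rightarrow> 'w simple_data \<Rightarrow> nat \<Rightarrow> 'w \<Rightarrow> real" where
  "clamp_coeff t Z = (\<lambda>(n, \<tau>, \<xi>) k \<omega>. if \<tau> k \<le> t then Z \<omega> * \<xi> k \<omega> else 0)"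

lemma simple_process_restrict:
  assumes "s \<le> t"
  shows "elem_process n (\<lambda>k. clamp_time s t (\<tau> k)) (\<lambda>k. clamp_time s t (\<tau> (Suc k)))
    (clamp_coeff t Z (n, \<tau>, \<xi>)) (\<omega>, r) = Z \<omega> * indicator {s<..t} r * simple_process (n, \<tau>, \<xi>) r \<omega>"
proof -
  have "(if \<tau> k \<le> t then Z \<omega> * \<xi> k \<omega> else 0) * indicator {max s (min (\<tau> k) t)<..max s (min (\<tau> (Suc k)) t)} r
    = Z \<omega> * indicator {s<..t} r * (\<xi> k \<omega> * indicator {\<tau> k<..\<tau> (Suc k)} r)" for k
    using assms by (cases "s < r"; cases "r \<le> t"; cases "\<tau> k < r"; cases "r \<le> \<tau> (Suc k)")
      (auto simp: indicator_def)
  then show ?thesis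
    unfolding elem_process_def simple_process_def clamp_coeff_def clamp_time_def prod.case sum_distrib_left
    by (intro sum.cong refl)
qed

context filtered_prob
begin

lemma simple_predictable_elementary:
  assumes \<phi>: "simple_predictable F (n, \<tau>, \<xi>)" and Z: "multiplier s Z" and st: "0 \<le> s" "s \<le> t"
  shows "elementary n (\<lambda>k. clamp_time s t (\<tau> k)) (\<lambda>k. clamp_time s t (\<tau> (Suc k)))
    (clamp_coeff t Z (n, \<tau>, \<xi>))"
  unfolding elementary_def
proof (intro allI impI conjI)
  fix k assume k: "k < n"
  have inc: "\<forall>k<n. \<tau> k < \<tau> (Suc k)" and \<tau>0: "0 \<le> \<tau> 0" using \<phi> by (auto simp: simple_predictable_def)
  have \<tau>pos: "0 \<le> \<tau> k" if "k < n" for k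
    using that
  proof (induction k)
    case (Suc k)
    then have "\<tau> k < \<tau> (Suc k)" using inc by simp
    then show ?case using Suc by linarith
  qed (use \<tau>0 in simp)
  show "0 \<le> clamp_time s t (\<tau> k)" using st by (simp add: clamp_time_def)
  show "clamp_time s t (\<tau> k) \<le> clamp_time s t (\<tau> (Suc k))"
    using inc k by (force simp: clamp_time_def)
  show "multiplier (clamp_time s t (\<tau> k)) (clamp_coeff t Z (n, \<tau>, \<xi>) k)"
  proof (cases "\<tau> k \<le> t")
    case True
    have "\<xi> k \<in> borel_measurable (F (\<tau> k)) \<and> (\<exists>C. \<forall>\<omega>\<in>space (F (\<tau> k)). \<bar>\<xi> k \<omega>\<bar> \<le> C)"
      using \<phi> k by (auto simp: simple_predictable_def)
    then have "multiplier (\<tau> k) (\<xi> k)"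
      using \<tau>pos[OF k] by (simp add: multiplier_def)
    moreover have "\<tau> k \<le> clamp_time s t (\<tau> k)" "s \<le> clamp_time s t (\<tau> k)" using True by (auto simp: clamp_time_def)
    ultimately have "multiplier (clamp_time s t (\<tau> k)) (\<lambda>\<omega>. Z \<omega> * \<xi> k \<omega>)"
      using multiplier_mono \<tau>pos[OF k] st Z by (intro multiplier_mult) blast+
    then show ?thesis using True by (simp add: clamp_coeff_def)
  next
    case False
    then show ?thesis by (simp add: clamp_coeff_def)
  qed
qed

end

context brownian_filtered
begin

lemma simple_integral_restrict:
  assumes "s \<le> t" and \<phi>: "simple_predictable F (n, \<tau>, \<xi>)"
  shows "elem_integral i n (\<lambda>k. clamp_time s t (\<tau> k)) (\<lambda>k. clamp_time s t (\<tau> (Suc k)))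
    (clamp_coeff t Z (n, \<tau>, \<xi>)) \<omega> =
    Z \<omega> * (simple_integral (W i) (n, \<tau>, \<xi>) t \<omega> - simple_integral (W i) (n, \<tau>, \<xi>) s \<omega>)"
proof -
  \<comment> \<open>Clamping amounts to two truncations, up to a term that does not depend on r and
    cancels in increments.\<close>
  have *: "W i (clamp_time s t r) \<omega> = W i (min r t) \<omega> - W i (min r s) \<omega> + W i s \<omega>" for r
    using assms by (auto simp: clamp_time_def max_def min_def)
  have "clamp_coeff t Z (n, \<tau>, \<xi>) k \<omega> * (W i (clamp_time s t (\<tau> (Suc k))) \<omega> - W i (clamp_time s t (\<tau> k)) \<omega>)
    = Z \<omega> * (\<xi> k \<omega> * (W i (min (\<tau> (Suc k)) t) \<omega> - W i (min (\<tau> k) t) \<omega>) -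
        \<xi> k \<omega> * (W i (min (\<tau> (Suc k)) s) \<omega> - W i (min (\<tau> k) s) \<omega>))" if "k < n" for k
  proof -
    have "\<tau> k < \<tau> (Suc k)" using \<phi> that by (auto simp: simple_predictable_def)
    then show ?thesis using \<open>s \<le> t\<close> unfolding * by (auto simp: clamp_coeff_def algebra_simps)
  qed
  then show ?thesis
    unfolding elem_integral_def simple_integral_def
    by (simp add: sum_distrib_left right_diff_distrib sum_subtractf)
qed

text \<open>The data \<phi> stay as they are and the window enters as a factor; passing to a smaller
  window is then multiplication by an indicator and not a change of data.\<close>

definition clamped_process ::
  "real \<Rightarrow> real \<Rightarrow> ('w \<Rightarrow> real) \<Rightarrow> 'w simple_data \<Rightarrow> 'w \<times> real \<Rightarrow> real" where
  "clamped_process s t Z \<phi> = (\<lambda>(\<omega>, r). Z \<omega> * indicator {s<..t} r * simple_process \<phi> r \<omega>)"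

definition clamped_integral ::
  "nat \<Rightarrow> real \<Rightarrow> real \<Rightarrow> ('w \<Rightarrow> real) \<Rightarrow> 'w simple_data \<Rightarrow> 'w \<Rightarrow> real" where
  "clamped_integral i s t Z \<phi> \<omega> =
     Z \<omega> * (simple_integral (W i) \<phi> t \<omega> - simple_integral (W i) \<phi> s \<omega>)"

text \<open>The window version is again elementary, so mean and isometry carry over; which clamped
  data represent it is of no interest afterwards.\<close>

lemma clamped_elementary:
  assumes "simple_predictable F \<phi>" "multiplier s Z" "0 \<le> s" "s \<le> t"
  obtains n a b \<xi> where "elementary n a b \<xi>" "clamped_process s t Z \<phi> = elem_process n a b \<xi>"
    "\<And>i. clamped_integral i s t Z \<phi> = elem_integral i n a b \<xi>"
proof -
  obtain n \<tau> \<xi> where \<phi>: "\<phi> = (n, \<tau>, \<xi>)" by (cases \<phi>)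
  show thesis
  proof (rule that)
    show "elementary n (\<lambda>k. clamp_time s t (\<tau> k)) (\<lambda>k. clamp_time s t (\<tau> (Suc k))) (clamp_coeff t Z \<phi>)"
      using assms simple_predictable_elementary unfolding \<phi> by blast
    show "clamped_process s t Z \<phi> =
      elem_process n (\<lambda>k. clamp_time s t (\<tau> k)) (\<lambda>k. clamp_time s t (\<tau> (Suc k))) (clamp_coeff t Z \<phi>)"
      unfolding \<phi> clamped_process_def by (simp add: fun_eq_iff simple_process_restrict[OF assms(4)])
    show "clamped_integral i s t Z \<phi> =
      elem_integral i n (\<lambda>k. clamp_time s t (\<tau> k)) (\<lambda>k. clamp_time s t (\<tau> (Suc k))) (clamp_coeff t Z \<phi>)" for i
      using simple_integral_restrict[OF assms(4)] assms(1) unfolding \<phi> clamped_integral_def by auto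
  qed
qed

lemma square_integrable_clamped:
  assumes "simple_predictable F \<phi>" "multiplier s Z" "0 \<le> s" "s \<le> t"
  shows "square_integrable (M \<Otimes>\<^sub>M lborel) (clamped_process s t Z \<phi>)"
    and "i \<in> {1..m} \<Longrightarrow> square_integrable M (clamped_integral i s t Z \<phi>)"
    and "i \<in> {1..m} \<Longrightarrow> expectation (clamped_integral i s t Z \<phi>) = 0"
  by (rule clamped_elementary[OF assms],
      simp add: square_integrable_elem_process square_integrable_elem_integral expectation_elem_integral)+

lemma clamped_isometry:
  assumes "simple_predictable F \<phi>" "multiplier s Z" "0 \<le> s" "s \<le> t"
    and "simple_predictable F \<psi>" "multiplier s' Y" "0 \<le> s'" "s' \<le> t'"
    and "i \<in> {1..m}" "j \<in> {1..m}"
  shows "expectation (\<lambda>\<omega>. clamped_integral i s t Z \<phi> \<omega> * clamped_integral j s' t' Y \<psi> \<omega>) =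
    (if i = j then (\<integral>x. clamped_process s t Z \<phi> x * clamped_process s' t' Y \<psi> x \<partial>(M \<Otimes>\<^sub>M lborel)) else 0)"
  by (rule clamped_elementary[OF assms(1-4)], rule clamped_elementary[OF assms(5-8)])
    (simp add: elementary_isometry[OF _ _ assms(9,10)])

text \<open>The square is expanded into three inner products, which avoids merging the two
  partitions into a common refinement.\<close>

lemma clamped_isometry_diff:
  assumes "simple_predictable F \<phi>" "simple_predictable F \<psi>" "multiplier s Z" "0 \<le> s" "s \<le> t" "i \<in> {1..m}"
  shows "expectation (\<lambda>\<omega>. (clamped_integral i s t Z \<phi> \<omega> - clamped_integral i s t Z \<psi> \<omega>)\<^sup>2) =
    (\<integral>x. (clamped_process s t Z \<phi> x - clamped_process s t Z \<psi> x)\<^sup>2 \<partial>(M \<Otimes>\<^sub>M lborel))"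
proof -
  have exp: "(\<integral>x. (f x - g x)\<^sup>2 \<partial>N) = (\<integral>x. f x * f x \<partial>N) - 2 * (\<integral>x. f x * g x \<partial>N) + (\<integral>x. g x * g x \<partial>N)"
    if "square_integrable N f" "square_integrable N g" for N :: "'x measure" and f g
  proof -
    have "(\<integral>x. (f x - g x)\<^sup>2 \<partial>N) = (\<integral>x. f x * f x - 2 * (f x * g x) + g x * g x \<partial>N)"
      by (intro Bochner_Integration.integral_cong refl) (simp add: power2_eq_square algebra_simps)
    then show ?thesis
      using square_integrable_mult[OF that] square_integrable_mult[OF that(1,1)] square_integrable_mult[OF that(2,2)]
      by simp
  qed
  note a = assms(3-5)
  show ?thesis
    unfolding exp[OF square_integrable_clamped(2)[OF assms(1) a assms(6)] square_integrable_clamped(2)[OF assms(2) a assms(6)]]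
      exp[OF square_integrable_clamped(1)[OF assms(1) a] square_integrable_clamped(1)[OF assms(2) a]]
    using clamped_isometry[OF assms(1) a assms(1) a assms(6,6)] clamped_isometry[OF assms(1) a assms(2) a assms(6,6)]
      clamped_isometry[OF assms(2) a assms(2) a assms(6,6)] by simp
qed

lemma clamped_integral_0:
  assumes "simple_predictable F \<phi>" "0 \<le> t"
  shows "clamped_integral i 0 t (\<lambda>_. 1) \<phi> = simple_integral (W i) \<phi> t"
proof
  fix \<omega>
  obtain n \<tau> \<xi> where \<phi>: "\<phi> = (n, \<tau>, \<xi>)" by (cases \<phi>)
  have inc: "\<forall>k<n. \<tau> k < \<tau> (Suc k)" and \<tau>0: "0 \<le> \<tau> 0" using assms by (auto simp: simple_predictable_def \<phi>)
  have \<tau>pos: "0 \<le> \<tau> k" if "k \<le> n" for k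
    using that
  proof (induction k)
    case (Suc k)
    then have "\<tau> k < \<tau> (Suc k)" using inc by simp
    then show ?case using Suc by linarith
  qed (use \<tau>0 in simp)
  have "simple_integral (W i) \<phi> 0 \<omega> = 0"
    unfolding \<phi> simple_integral_def using \<tau>pos by (auto intro!: sum.neutral simp: min_absorb2)
  then show "clamped_integral i 0 t (\<lambda>_. 1) \<phi> \<omega> = simple_integral (W i) \<phi> t \<omega>"
    by (simp add: clamped_integral_def)
qed

end

text \<open>The integrand is cut to nonnegative times before joint measurability is demanded, since
  its values at negative times are arbitrary; the bound C makes it square integrable over every
  finite window.\<close>

locale ito_integral = brownian_filtered M F m W for M :: "'w measure" and F m W +
  fixes i :: nat and H :: "real \<Rightarrow> 'w \<Rightarrow> real" and I :: "real \<Rightarrow> 'w \<Rightarrow> real" and C :: real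
  assumes index: "i \<in> {1..m}"
    and ito: "is_ito_integral M F (W i) H I"
    and bounded: "\<And>r \<omega>. 0 \<le> r \<Longrightarrow> \<omega> \<in> space M \<Longrightarrow> \<bar>H r \<omega>\<bar> \<le> C"
    and integrand_measurable: "(\<lambda>(\<omega>, r). indicator {0..} r * H r \<omega>) \<in> borel_measurable (M \<Otimes>\<^sub>M lborel)"
begin

definition restricted :: "real \<Rightarrow> real \<Rightarrow> ('w \<Rightarrow> real) \<Rightarrow> 'w \<times> real \<Rightarrow> real" where
  "restricted s t Z = (\<lambda>(\<omega>, r). Z \<omega> * indicator {s<..t} r * H r \<omega>)"

lemma square_integrable_restricted:
  assumes Z: "multiplier s Z" and st: "0 \<le> s" "s \<le> t"
  shows "square_integrable (M \<Otimes>\<^sub>M lborel) (restricted s t Z)"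
proof -
  obtain D where D: "\<And>\<omega>. \<omega> \<in> space M \<Longrightarrow> \<bar>Z \<omega>\<bar> \<le> D" using Z multiplier_bounded by blast
  have [measurable]: "Z \<in> borel_measurable M" using Z multiplier_measurable st by blast
  \<comment> \<open>On (s, t] with \<open>0 \<le> s\<close> the cut at negative times is
    invisible.\<close>
  have eq: "restricted s t Z = (\<lambda>x. (Z (fst x) * indicator {s<..t} (snd x)) * (case x of (\<omega>, r) \<Rightarrow> indicator {0..} r * H r \<omega>))"
    unfolding restricted_def using st by (auto simp: fun_eq_iff indicator_def)
  have meas [measurable]: "restricted s t Z \<in> borel_measurable (M \<Otimes>\<^sub>M lborel)"
    unfolding eq using integrand_measurable by measurable
  have int: "integrable (M \<Otimes>\<^sub>M lborel) (\<lambda>x. case x of (\<omega>, r) \<Rightarrow> (D * C)\<^sup>2 * indicator {s<..t} r)"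
    using integrable_product_indicator[of "\<lambda>_. (D * C)\<^sup>2" "{s<..t}"] st by simp
  have "integrable (M \<Otimes>\<^sub>M lborel) (\<lambda>x. (restricted s t Z x)\<^sup>2)"
  proof (rule Bochner_Integration.integrable_bound[OF int])
    show "AE x in M \<Otimes>\<^sub>M lborel. norm ((restricted s t Z x)\<^sup>2) \<le> norm (case x of (\<omega>, r) \<Rightarrow> (D * C)\<^sup>2 * indicator {s<..t} r)"
    proof (rule AE_I2)
      fix x :: "'w \<times> real" assume "x \<in> space (M \<Otimes>\<^sub>M lborel)"
      then obtain \<omega> r where x: "x = (\<omega>, r)" "\<omega> \<in> space M" by (auto simp: space_pair_measure)
      show "norm ((restricted s t Z x)\<^sup>2) \<le> norm (case x of (\<omega>, r) \<Rightarrow> (D * C)\<^sup>2 * indicator {s<..t} r)"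
      proof (cases "r \<in> {s<..t}")
        case True
        then have "\<bar>Z \<omega> * H r \<omega>\<bar> \<le> D * C"
          unfolding abs_mult using D[OF x(2)] bounded[OF _ x(2), of r] st by (intro mult_mono') auto
        then have "(Z \<omega> * H r \<omega>)\<^sup>2 \<le> (D * C)\<^sup>2" by (metis abs_ge_zero power2_abs power_mono)
        then show ?thesis using True x by (simp add: restricted_def)
      qed (simp add: restricted_def x)
    qed
  qed measurable
  then show ?thesis by (simp add: square_integrable_def)
qed

lemma ito_approximation_0:
  assumes t: "0 \<le> t"
  obtains \<phi> where "\<And>k. simple_predictable F (\<phi> k)"
    "L2_tendsto (M \<Otimes>\<^sub>M lborel) (\<lambda>k. clamped_process 0 t (\<lambda>_. 1) (\<phi> k)) (restricted 0 t (\<lambda>_. 1))"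
    "L2_tendsto M (\<lambda>k. clamped_integral i 0 t (\<lambda>_. 1) (\<phi> k)) (I t)"
proof -
  have "is_ito_integral_at M F (W i) H t (I t)" using ito t by (auto simp: is_ito_integral_def)
  then obtain \<phi> where I: "I t \<in> borel_measurable M"
    and \<phi>: "\<And>k. simple_predictable F (\<phi> k)"
    and l1: "(\<lambda>k. \<integral>\<^sup>+\<omega>. (\<integral>\<^sup>+s\<in>{0..t}. ennreal ((H s \<omega> - simple_process (\<phi> k) s \<omega>)\<^sup>2) \<partial>lborel) \<partial>M)
          \<longlonglongrightarrow> 0"
    and l2: "(\<lambda>k. \<integral>\<^sup>+\<omega>. ennreal ((I t \<omega> - simple_integral (W i) (\<phi> k) t \<omega>)\<^sup>2) \<partial>M) \<longlonglongrightarrow> 0"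
    unfolding is_ito_integral_at_def by blast
  note sq = square_integrable_clamped[where Z = "\<lambda>_. 1", OF \<phi> multiplier_const order_refl t]
  note sqr = square_integrable_restricted[OF multiplier_const order_refl t, of 1]
  show thesis
  proof (rule that[of \<phi>])
    show "simple_predictable F (\<phi> k)" for k by (rule \<phi>)
    show "L2_tendsto M (\<lambda>k. clamped_integral i 0 t (\<lambda>_. 1) (\<phi> k)) (I t)"
    proof (rule L2_tendsto_nn_integral)
      show "square_integrable M (clamped_integral i 0 t (\<lambda>_. 1) (\<phi> k))" for k by (rule sq(2)[OF index])
    qed (use I l2 in \<open>simp_all add: clamped_integral_0[OF \<phi> t]\<close>)
    show "L2_tendsto (M \<Otimes>\<^sub>M lborel) (\<lambda>k. clamped_process 0 t (\<lambda>_. 1) (\<phi> k)) (restricted 0 t (\<lambda>_. 1))"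
    proof (rule L2_tendsto_nn_integral)
      show "(\<lambda>k. \<integral>\<^sup>+x. ennreal ((restricted 0 t (\<lambda>_. 1) x - clamped_process 0 t (\<lambda>_. 1) (\<phi> k) x)\<^sup>2) \<partial>(M \<Otimes>\<^sub>M lborel))
        \<longlonglongrightarrow> 0"
      proof (rule tendsto_sandwich[OF always_eventually always_eventually tendsto_const l1]; intro allI)
        fix k
        have [measurable]: "restricted 0 t (\<lambda>_. 1) \<in> borel_measurable (M \<Otimes>\<^sub>M lborel)"
          "clamped_process 0 t (\<lambda>_. 1) (\<phi> k) \<in> borel_measurable (M \<Otimes>\<^sub>M lborel)"
          using sq(1)[of k] sqr by (auto simp: square_integrable_def)
        have "(\<integral>\<^sup>+x. ennreal ((restricted 0 t (\<lambda>_. 1) x - clamped_process 0 t (\<lambda>_. 1) (\<phi> k) x)\<^sup>2) \<partial>(M \<Otimes>\<^sub>M lborel))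
          = (\<integral>\<^sup>+\<omega>. \<integral>\<^sup>+r. ennreal ((restricted 0 t (\<lambda>_. 1) (\<omega>, r) - clamped_process 0 t (\<lambda>_. 1) (\<phi> k) (\<omega>, r))\<^sup>2) \<partial>lborel \<partial>M)"
          by (rule lborel.nn_integral_fst[symmetric]) measurable
        \<comment> \<open>The restricted processes live on (0, t], while the defining distance
          integrates over [0, t].\<close>
        also have "\<dots> \<le> (\<integral>\<^sup>+\<omega>. (\<integral>\<^sup>+s\<in>{0..t}. ennreal ((H s \<omega> - simple_process (\<phi> k) s \<omega>)\<^sup>2) \<partial>lborel) \<partial>M)"
          by (intro nn_integral_mono) (auto simp: restricted_def clamped_process_def indicator_def)
        finally show "(\<integral>\<^sup>+x. ennreal ((restricted 0 t (\<lambda>_. 1) x - clamped_process 0 t (\<lambda>_. 1) (\<phi> k) x)\<^sup>2) \<partial>(M \<Otimes>\<^sub>M lborel))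
          \<le> (\<integral>\<^sup>+\<omega>. (\<integral>\<^sup>+s\<in>{0..t}. ennreal ((H s \<omega> - simple_process (\<phi> k) s \<omega>)\<^sup>2) \<partial>lborel) \<partial>M)" .
      qed simp
    qed (use sq(1) sqr in \<open>auto simp: square_integrable_def\<close>)
  qed
qed

lemma square_integrable_ito: "0 \<le> t \<Longrightarrow> square_integrable M (I t)"
  using ito_approximation_0[of t] by (auto simp: L2_tendsto_def)

text \<open>The definition gives approximations at s and at t that are unrelated to each other.
  Those for t, restricted to (0, s], approximate the integrand there as well as those for s do, and
  by the isometry their integrals have the same limit \<open>I s\<close>. So a single sequence
  serves the increment over (s, t].\<close>

lemma ito_approximation:
  assumes Z: "multiplier s Z" and st: "0 \<le> s" "s \<le> t"
  obtains \<phi> where "\<And>k. simple_predictable F (\<phi> k)"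
    "L2_tendsto (M \<Otimes>\<^sub>M lborel) (\<lambda>k. clamped_process s t Z (\<phi> k)) (restricted s t Z)"
    "L2_tendsto M (\<lambda>k. clamped_integral i s t Z (\<phi> k)) (\<lambda>\<omega>. Z \<omega> * (I t \<omega> - I s \<omega>))"
proof -
  have t: "0 \<le> t" using st by simp
  obtain \<phi> where \<phi>: "\<And>k. simple_predictable F (\<phi> k)"
    and p: "L2_tendsto (M \<Otimes>\<^sub>M lborel) (\<lambda>k. clamped_process 0 t (\<lambda>_. 1) (\<phi> k)) (restricted 0 t (\<lambda>_. 1))"
    and I: "L2_tendsto M (\<lambda>k. clamped_integral i 0 t (\<lambda>_. 1) (\<phi> k)) (I t)"
    using ito_approximation_0[OF t] by blast
  obtain \<psi> where \<psi>: "\<And>k. simple_predictable F (\<psi> k)"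
    and q: "L2_tendsto (M \<Otimes>\<^sub>M lborel) (\<lambda>k. clamped_process 0 s (\<lambda>_. 1) (\<psi> k)) (restricted 0 s (\<lambda>_. 1))"
    and J: "L2_tendsto M (\<lambda>k. clamped_integral i 0 s (\<lambda>_. 1) (\<psi> k)) (I s)"
    using ito_approximation_0[OF st(1)] by blast
  obtain D where D: "\<And>\<omega>. \<omega> \<in> space M \<Longrightarrow> \<bar>Z \<omega>\<bar> \<le> D" using Z multiplier_bounded by blast
  have [measurable]: "Z \<in> borel_measurable M" using Z multiplier_measurable st by blast
  have e1: "(\<lambda>x. indicator {0<..s} (snd x) * clamped_process 0 t (\<lambda>_. 1) (\<phi> k) x) = clamped_process 0 s (\<lambda>_. 1) (\<phi> k)"
    "(\<lambda>x. (Z (fst x) * indicator {s<..t} (snd x)) * clamped_process 0 t (\<lambda>_. 1) (\<phi> k) x) = clamped_process s t Z (\<phi> k)" for k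
    using st by (auto simp: fun_eq_iff clamped_process_def indicator_def)
  have e2: "(\<lambda>x. indicator {0<..s} (snd x) * restricted 0 t (\<lambda>_. 1) x) = restricted 0 s (\<lambda>_. 1)"
    "(\<lambda>x. (Z (fst x) * indicator {s<..t} (snd x)) * restricted 0 t (\<lambda>_. 1) x) = restricted s t Z"
    using st by (auto simp: fun_eq_iff restricted_def indicator_def)
  have "L2_tendsto (M \<Otimes>\<^sub>M lborel) (\<lambda>k x. indicator {0<..s} (snd x) * clamped_process 0 t (\<lambda>_. 1) (\<phi> k) x)
    (\<lambda>x. indicator {0<..s} (snd x) * restricted 0 t (\<lambda>_. 1) x)"
    by (rule L2_tendsto_bounded_mult[OF p, where C = 1]) (auto simp: indicator_def)
  then have p': "L2_tendsto (M \<Otimes>\<^sub>M lborel) (\<lambda>k. clamped_process 0 s (\<lambda>_. 1) (\<phi> k)) (restricted 0 s (\<lambda>_. 1))"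
    unfolding e1 e2 .
  have "L2_tendsto M (\<lambda>k. clamped_integral i 0 s (\<lambda>_. 1) (\<phi> k)) (I s)"
  proof (rule L2_tendsto_trans[OF J])
    show "square_integrable M (clamped_integral i 0 s (\<lambda>_. 1) (\<phi> k))" for k
      by (rule square_integrable_clamped(2)[OF \<phi> multiplier_const order_refl st(1) index])
    have "(\<lambda>k. \<integral>x. (clamped_process 0 s (\<lambda>_. 1) (\<phi> k) x - clamped_process 0 s (\<lambda>_. 1) (\<psi> k) x)\<^sup>2 \<partial>(M \<Otimes>\<^sub>M lborel)) \<longlonglongrightarrow> 0"
      using L2_tendsto_norm[OF L2_tendsto_diff[OF p' q]] by simp
    then show "(\<lambda>k. \<integral>x. (clamped_integral i 0 s (\<lambda>_. 1) (\<phi> k) x - clamped_integral i 0 s (\<lambda>_. 1) (\<psi> k) x)\<^sup>2 \<partial>M) \<longlonglongrightarrow> 0"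
      by (simp add: clamped_isometry_diff[OF \<phi> \<psi> multiplier_const order_refl st(1) index])
  qed
  from L2_tendsto_bounded_mult[OF L2_tendsto_diff[OF I this], of Z D]
  have I': "L2_tendsto M (\<lambda>k. clamped_integral i s t Z (\<phi> k)) (\<lambda>\<omega>. Z \<omega> * (I t \<omega> - I s \<omega>))"
    using D clamped_integral_0[OF \<phi> t] clamped_integral_0[OF \<phi> st(1)] by (simp add: clamped_integral_def[abs_def])
  have "L2_tendsto (M \<Otimes>\<^sub>M lborel) (\<lambda>k x. (Z (fst x) * indicator {s<..t} (snd x)) * clamped_process 0 t (\<lambda>_. 1) (\<phi> k) x)
    (\<lambda>x. (Z (fst x) * indicator {s<..t} (snd x)) * restricted 0 t (\<lambda>_. 1) x)"
  proof (rule L2_tendsto_bounded_mult[OF p, where C = D])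
    fix x :: "'w \<times> real" assume "x \<in> space (M \<Otimes>\<^sub>M lborel)"
    then have "\<bar>Z (fst x)\<bar> \<le> D" using D by (auto simp: space_pair_measure)
    then show "\<bar>Z (fst x) * indicator {s<..t} (snd x)\<bar> \<le> D" by (auto simp: indicator_def)
  qed measurable
  then have "L2_tendsto (M \<Otimes>\<^sub>M lborel) (\<lambda>k. clamped_process s t Z (\<phi> k)) (restricted s t Z)"
    unfolding e1 e2 .
  with \<phi> I' show thesis by (intro that)
qed

lemma ito_martingale:
  assumes Z: "multiplier s Z" and st: "0 \<le> s" "s \<le> t"
  shows "expectation (\<lambda>\<omega>. Z \<omega> * (I t \<omega> - I s \<omega>)) = 0"
proof -
  obtain \<phi> where \<phi>: "\<And>k. simple_predictable F (\<phi> k)"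
    and I: "L2_tendsto M (\<lambda>k. clamped_integral i s t Z (\<phi> k)) (\<lambda>\<omega>. Z \<omega> * (I t \<omega> - I s \<omega>))"
    using ito_approximation[OF assms] by blast
  have "L2_tendsto M (\<lambda>k \<omega>. 1) (\<lambda>\<omega>. 1)" by (rule L2_tendsto_const) (simp add: square_integrable_def)
  from L2_tendsto_mult[OF I this] square_integrable_clamped(3)[OF \<phi> assms index]
  have "(\<lambda>k::nat. 0) \<longlonglongrightarrow> expectation (\<lambda>\<omega>. Z \<omega> * (I t \<omega> - I s \<omega>))" by simp
  then show ?thesis by (simp add: LIMSEQ_const_iff)
qed

end

text \<open>The test variable is attached to one of the two factors, so that the product carries it
  once. For i \<noteq> j the approximants already have inner product 0.\<close>

lemma ito_covariation:
  assumes "ito_integral M F m W i H I C" "ito_integral M F m W j H' I' C'"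
    and Z: "filtered_prob.multiplier M F s Z" and st: "0 \<le> s" "s \<le> t"
  shows "(\<integral>\<omega>. Z \<omega> * ((I t \<omega> - I s \<omega>) * (I' t \<omega> - I' s \<omega>)) \<partial>M) =
    (if i = j then (\<integral>(\<omega>, r). Z \<omega> * (indicator {s<..t} r * (H r \<omega> * H' r \<omega>)) \<partial>(M \<Otimes>\<^sub>M lborel)) else 0)"
proof -
  interpret A: ito_integral M F m W i H I C by fact
  interpret B: ito_integral M F m W j H' I' C' by fact
  obtain \<phi> where \<phi>: "\<And>k. simple_predictable F (\<phi> k)"
    and p: "L2_tendsto (M \<Otimes>\<^sub>M lborel) (\<lambda>k. A.clamped_process s t Z (\<phi> k)) (A.restricted s t Z)"
    and I: "L2_tendsto M (\<lambda>k. A.clamped_integral i s t Z (\<phi> k)) (\<lambda>\<omega>. Z \<omega> * (I t \<omega> - I s \<omega>))"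
    using A.ito_approximation[OF assms(3-5)] by blast
  obtain \<psi> where \<psi>: "\<And>k. simple_predictable F (\<psi> k)"
    and q: "L2_tendsto (M \<Otimes>\<^sub>M lborel) (\<lambda>k. A.clamped_process s t (\<lambda>_. 1) (\<psi> k)) (B.restricted s t (\<lambda>_. 1))"
    and J: "L2_tendsto M (\<lambda>k. A.clamped_integral j s t (\<lambda>_. 1) (\<psi> k)) (\<lambda>\<omega>. 1 * (I' t \<omega> - I' s \<omega>))"
    using B.ito_approximation[OF A.multiplier_const st] by blast
  note L = L2_tendsto_mult[OF I J]
  have iso: "(\<integral>\<omega>. A.clamped_integral i s t Z (\<phi> k) \<omega> * A.clamped_integral j s t (\<lambda>_. 1) (\<psi> k) \<omega> \<partial>M) =
    (if i = j then (\<integral>x. A.clamped_process s t Z (\<phi> k) x * A.clamped_process s t (\<lambda>_. 1) (\<psi> k) x \<partial>(M \<Otimes>\<^sub>M lborel)) else 0)" for k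
    by (rule A.clamped_isometry[OF \<phi> Z st \<psi> A.multiplier_const st A.index B.index])
  have "(\<lambda>k. (if i = j then (\<integral>x. A.clamped_process s t Z (\<phi> k) x * A.clamped_process s t (\<lambda>_. 1) (\<psi> k) x \<partial>(M \<Otimes>\<^sub>M lborel)) else 0))
    \<longlonglongrightarrow> (if i = j then (\<integral>x. A.restricted s t Z x * B.restricted s t (\<lambda>_. 1) x \<partial>(M \<Otimes>\<^sub>M lborel)) else 0)"
    using L2_tendsto_mult[OF p q] by auto
  with L have "(\<integral>\<omega>. (Z \<omega> * (I t \<omega> - I s \<omega>)) * (1 * (I' t \<omega> - I' s \<omega>)) \<partial>M) =
    (if i = j then (\<integral>x. A.restricted s t Z x * B.restricted s t (\<lambda>_. 1) x \<partial>(M \<Otimes>\<^sub>M lborel)) else 0)"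
    unfolding iso by (rule LIMSEQ_unique)
  moreover have "(\<integral>x. A.restricted s t Z x * B.restricted s t (\<lambda>_. 1) x \<partial>(M \<Otimes>\<^sub>M lborel)) =
    (\<integral>(\<omega>, r). Z \<omega> * (indicator {s<..t} r * (H r \<omega> * H' r \<omega>)) \<partial>(M \<Otimes>\<^sub>M lborel))"
    by (intro Bochner_Integration.integral_cong refl)
      (auto simp: A.restricted_def B.restricted_def indicator_def)
  ultimately show ?thesis by (simp add: mult.assoc)
qed

section \<open>Ito's formula for scalar processes\<close>

text \<open>There are n + 1 steps, so that the mesh makes sense for every n.\<close>

definition grid :: "real \<Rightarrow> real \<Rightarrow> nat \<Rightarrow> nat \<Rightarrow> real" where
  "grid s t n k = s + (t - s) * real k / real (Suc n)"

lemma grid_0 [simp]: "grid s t n 0 = s"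
  by (simp add: grid_def)

lemma grid_last [simp]: "grid s t n (Suc n) = t"
  by (simp add: grid_def)

lemma grid_mono: "s \<le> t \<Longrightarrow> k \<le> l \<Longrightarrow> grid s t n k \<le> grid s t n l"
  unfolding grid_def by (intro add_left_mono divide_right_mono mult_left_mono) auto

lemma grid_lower: "s \<le> t \<Longrightarrow> s \<le> grid s t n k"
  using grid_mono[of s t 0 k n] by simp

lemma grid_upper: "s \<le> t \<Longrightarrow> k \<le> Suc n \<Longrightarrow> grid s t n k \<le> t"
  using grid_mono[of s t k "Suc n" n] by simp

lemma grid_step: "grid s t n (Suc k) - grid s t n k = (t - s) / real (Suc n)"
  by (simp add: grid_def add_divide_distrib algebra_simps diff_divide_distrib)

lemma grid_mesh:
  assumes "0 < \<delta>"
  shows "eventually (\<lambda>n. \<forall>k. \<bar>grid s t n (Suc k) - grid s t n k\<bar> < \<delta>) sequentially"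
proof -
  have "(\<lambda>n. \<bar>(t - s) / real (Suc n)\<bar>) \<longlonglongrightarrow> \<bar>0\<bar>"
    by (intro tendsto_rabs LIMSEQ_Suc[of "\<lambda>n. (t - s) / real n"] lim_const_over_n)
  then have "eventually (\<lambda>n. \<bar>(t - s) / real (Suc n)\<bar> < \<delta>) sequentially"
    using assms order_tendstoD(2) by fastforce
  then show ?thesis by (simp add: grid_step)
qed

lemma grid_increments_tendsto:
  fixes y :: "real \<Rightarrow> real"
  assumes y: "continuous_on {s..t} y" and "s \<le> t" "0 < e"
  shows "eventually (\<lambda>n. \<forall>k<Suc n. \<bar>y (grid s t n (Suc k)) - y (grid s t n k)\<bar> < e) sequentially"
proof -
  have "uniformly_continuous_on {s..t} y"
    by (rule compact_uniformly_continuous[OF y]) simp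
  then obtain \<delta> where \<delta>: "0 < \<delta>" "\<And>a b. a \<in> {s..t} \<Longrightarrow> b \<in> {s..t} \<Longrightarrow> dist b a < \<delta> \<Longrightarrow> dist (y b) (y a) < e"
    unfolding uniformly_continuous_on_def using \<open>0 < e\<close> by metis
  from grid_mesh[OF \<delta>(1), of s t] show ?thesis
  proof eventually_elim
    case (elim n)
    show ?case
    proof (intro allI impI)
      fix k assume k: "k < Suc n"
      have "grid s t n k \<in> {s..t}" "grid s t n (Suc k) \<in> {s..t}"
        using k grid_lower[OF \<open>s \<le> t\<close>] grid_upper[OF \<open>s \<le> t\<close>] by simp_all
      from \<delta>(2)[OF this] elim show "\<bar>y (grid s t n (Suc k)) - y (grid s t n k)\<bar> < e"
        by (simp add: dist_real_def)
    qed
  qed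
qed

lemma sum_grid_indicator:
  assumes "s \<le> t"
  shows "(\<Sum>k<Suc n. indicator {grid s t n k<..grid s t n (Suc k)} r) = (indicator {s<..t} r :: real)"
proof -
  have "indicator {a<..b} r = (if r \<le> b then 1 else 0) - (if r \<le> a then 1 else 0 :: real)" if "a \<le> b" for a b
    using that by (auto simp: indicator_def)
  then have "(\<Sum>k<Suc n. indicator {grid s t n k<..grid s t n (Suc k)} r) =
      (\<Sum>k<Suc n. (if r \<le> grid s t n (Suc k) then 1 else 0) - (if r \<le> grid s t n k then 1 else 0 :: real))"
    by (intro sum.cong refl) (use grid_mono[OF assms] in auto)
  also have "\<dots> = (if r \<le> t then 1 else 0) - (if r \<le> s then 1 else 0)"
    by (subst sum_lessThan_telescope) simp
  also have "\<dots> = indicator {s<..t} r" using assms by (auto simp: indicator_def)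
  finally show ?thesis .
qed

text \<open>The function is frozen at left endpoints, which for an adapted coefficient are times
  before the increment starts.\<close>

lemma grid_step_function_tendsto:
  fixes f :: "real \<Rightarrow> real"
  assumes f: "continuous_on {s..t} f" and st: "s \<le> t"
  shows "(\<lambda>n. \<Sum>k<Suc n. f (grid s t n k) * indicator {grid s t n k<..grid s t n (Suc k)} r)
    \<longlonglongrightarrow> f r * indicator {s<..t} r"
proof (rule LIMSEQ_I)
  fix e :: real assume e: "0 < e"
  show "\<exists>n0. \<forall>n\<ge>n0. norm ((\<Sum>k<Suc n. f (grid s t n k) * indicator {grid s t n k<..grid s t n (Suc k)} r)
     - f r * indicator {s<..t} r) < e"
  proof -
    have "uniformly_continuous_on {s..t} f"
      by (rule compact_uniformly_continuous[OF f]) simp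
    then obtain \<delta> where \<delta>: "0 < \<delta>" "\<And>a b. a \<in> {s..t} \<Longrightarrow> b \<in> {s..t} \<Longrightarrow> dist b a < \<delta> \<Longrightarrow> dist (f b) (f a) < e / 2"
      unfolding uniformly_continuous_on_def using \<open>0 < e\<close> half_gt_zero by metis
    from grid_mesh[OF \<delta>(1), of s t] obtain n0 where
      n0: "\<And>n k. n \<ge> n0 \<Longrightarrow> \<bar>grid s t n (Suc k) - grid s t n k\<bar> < \<delta>"
      unfolding eventually_sequentially by blast
    show ?thesis
    proof (intro exI allI impI)
      fix n assume n: "n0 \<le> n"
      let ?I = "\<lambda>k. indicator {grid s t n k<..grid s t n (Suc k)} r :: real"
      have "(\<Sum>k<Suc n. f (grid s t n k) * ?I k) - f r * indicator {s<..t} r =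
         (\<Sum>k<Suc n. (f (grid s t n k) - f r) * ?I k)"
        unfolding sum_grid_indicator[OF st, of n, symmetric]
        by (simp add: sum_distrib_left sum_subtractf left_diff_distrib del: sum.lessThan_Suc)
      also have "norm \<dots> \<le> (\<Sum>k<Suc n. norm ((f (grid s t n k) - f r) * ?I k))" by (rule norm_sum)
      also have "\<dots> \<le> (\<Sum>k<Suc n. e / 2 * ?I k)"
      proof (rule sum_mono)
        fix k assume "k \<in> {..<Suc n}"
        then have k: "Suc k \<le> Suc n" by auto
        show "norm ((f (grid s t n k) - f r) * ?I k) \<le> e / 2 * ?I k"
        proof (cases "r \<in> {grid s t n k<..grid s t n (Suc k)}")
          case True
          then have "dist (f (grid s t n k)) (f r) < e / 2"
            using n0[OF n, of k] grid_lower[OF st, of n k] grid_upper[OF st k]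
            by (intro \<delta>(2)) (auto simp: dist_real_def)
          then show ?thesis using True by (simp add: dist_real_def)
        qed simp
      qed
      also have "\<dots> = e / 2 * indicator {s<..t} r"
        using sum_grid_indicator[OF st, of n r] by (simp only: flip: sum_distrib_left)
      also have "\<dots> < e" using e by (auto simp: indicator_def)
      finally show "norm ((\<Sum>k<Suc n. f (grid s t n k) * ?I k) - f r * indicator {s<..t} r) < e" .
    qed
  qed
qed

lemma grid_step_function_bound:
  fixes f :: "nat \<Rightarrow> real"
  assumes "s \<le> t" and "\<And>k. k < Suc n \<Longrightarrow> \<bar>f k\<bar> \<le> S"
  shows "\<bar>\<Sum>k<Suc n. f k * indicator {grid s t n k<..grid s t n (Suc k)} r\<bar> \<le> S * indicator {s<..t} r"
proof -
  have "\<bar>\<Sum>k<Suc n. f k * indicator {grid s t n k<..grid s t n (Suc k)} r\<bar>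
    \<le> (\<Sum>k<Suc n. \<bar>f k * indicator {grid s t n k<..grid s t n (Suc k)} r\<bar>)" by (rule sum_abs)
  also have "\<dots> \<le> (\<Sum>k<Suc n. S * indicator {grid s t n k<..grid s t n (Suc k)} r)"
    using assms(2) by (intro sum_mono) (auto simp: indicator_def)
  also have "\<dots> = S * indicator {s<..t} r"
    using sum_grid_indicator[OF assms(1), of n r] by (simp only: flip: sum_distrib_left)
  finally show ?thesis .
qed

text \<open>Each term is paired with the sum of the later ones. In this form a bound on future sums
  given the past yields a bound on the second moment.\<close>

lemma sum_square_tails:
  fixes a :: "nat \<Rightarrow> real"
  shows "(\<Sum>k<N. a k)\<^sup>2 = (\<Sum>k<N. a k * (a k + 2 * (\<Sum>l=Suc k..<N. a l)))"
proof (induction N)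
  case (Suc N)
  have "(\<Sum>k<N. a k * (a k + 2 * (\<Sum>l=Suc k..<Suc N. a l))) =
     (\<Sum>k<N. a k * (a k + 2 * (\<Sum>l=Suc k..<N. a l)) + 2 * a N * a k)"
    by (intro sum.cong refl) (auto simp: algebra_simps)
  also have "\<dots> = (\<Sum>k<N. a k)\<^sup>2 + 2 * a N * (\<Sum>k<N. a k)"
    by (simp add: Suc sum.distrib sum_distrib_left)
  finally show ?case by (simp add: power2_eq_square algebra_simps)
qed simp

lemma set_integrable_const: "set_integrable lborel {a..b::real} (\<lambda>_. c :: real)"
  unfolding set_integrable_def
  by (cases "a \<le> b") (auto intro!: integrable_mult_left integrable_real_indicator)

lemma set_integral_Ioc:
  fixes f :: "real \<Rightarrow> real"
  assumes "0 \<le> s" "s \<le> t" "set_integrable lborel {0..t} f"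
  shows "set_integrable lborel {s<..t} f"
    and "(LINT r:{0..t}|lborel. f r) - (LINT r:{0..s}|lborel. f r) = (LINT r:{s<..t}|lborel. f r)"
proof -
  show i: "set_integrable lborel {s<..t} f" by (rule set_integrable_subset[OF assms(3)]) (use assms in auto)
  have i': "set_integrable lborel {0..s} f" by (rule set_integrable_subset[OF assms(3)]) (use assms in auto)
  have "{0..t} = {0..s} \<union> {s<..t}" using assms by auto
  moreover have "{0..s} \<inter> {s<..t} = {}" by auto
  ultimately have "(LINT r:{0..t}|lborel. f r) = (LINT r:{0..s}|lborel. f r) + (LINT r:{s<..t}|lborel. f r)"
    using set_integral_Un[OF _ i' i] by simp
  then show "(LINT r:{0..t}|lborel. f r) - (LINT r:{0..s}|lborel. f r) = (LINT r:{s<..t}|lborel. f r)" by simp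
qed

lemma set_integral_singleton:
  fixes f :: "real \<Rightarrow> real"
  shows "(LINT r:{a}|lborel. f r) = 0"
proof -
  have "AE r in lborel. r \<noteq> a" by (rule AE_lborel_singleton)
  then have "AE r in lborel. indicator {a} r *\<^sub>R f r = 0"
    by eventually_elim auto
  then show ?thesis unfolding set_lebesgue_integral_def by (rule integral_eq_zero_AE)
qed

lemma continuous_on_unit_interval_bounded:
  fixes f :: "real \<Rightarrow> real"
  assumes "continuous_on {0..1} f"
  obtains S where "\<And>y. y \<in> {0..1} \<Longrightarrow> \<bar>f y\<bar> \<le> S"
proof -
  obtain S where "\<And>x. x \<in> f ` {0..1} \<Longrightarrow> norm x \<le> S"
    using compact_imp_bounded[OF compact_continuous_image[OF assms]] unfolding bounded_iff by auto
  then show thesis by (intro that[of S]) fastforce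
qed

text \<open>A semimartingale in [0,1] with martingale part N, whose bracket has density \<gamma>,
  and with drift density \<beta>, possibly unbounded. What replaces boundedness is
  \<open>variation_conditional\<close>: given the past of s, the expected total variation of the
  drift over (s, t] is at most \<open>K t\<close>, uniformly in s and in the past.\<close>

locale scalar_ito = filtered_prob M F for M :: "'w measure" and F +
  fixes Y N :: "real \<Rightarrow> 'w \<Rightarrow> real" and \<beta> \<gamma> :: "real \<Rightarrow> 'w \<Rightarrow> real" and \<Gamma> :: real and K :: "real \<Rightarrow> real"
  assumes Y_adapted: "0 \<le> t \<Longrightarrow> Y t \<in> borel_measurable (F t)"
    and Y_range: "0 \<le> t \<Longrightarrow> \<omega> \<in> space M \<Longrightarrow> Y t \<omega> \<in> {0..1}"
    and Y_continuous: "\<omega> \<in> space M \<Longrightarrow> continuous_on {0..} (\<lambda>t. Y t \<omega>)"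
    and N_continuous: "AE \<omega> in M. continuous_on {0..} (\<lambda>t. N t \<omega>)"
    and N_square_integrable: "0 \<le> t \<Longrightarrow> square_integrable M (N t)"
    and \<beta>_measurable: "(\<lambda>(\<omega>, r). \<beta> r \<omega>) \<in> borel_measurable (M \<Otimes>\<^sub>M lborel)"
    and \<gamma>_measurable: "(\<lambda>(\<omega>, r). \<gamma> r \<omega>) \<in> borel_measurable (M \<Otimes>\<^sub>M lborel)"
    and \<gamma>_bound: "0 \<le> r \<Longrightarrow> \<omega> \<in> space M \<Longrightarrow> \<bar>\<gamma> r \<omega>\<bar> \<le> \<Gamma>"
    and \<beta>_integrable: "AE \<omega> in M. \<forall>t\<ge>0. set_integrable lborel {0..t} (\<lambda>r. \<beta> r \<omega>)"
    and decomposition: "AE \<omega> in M. \<forall>t\<ge>0. Y t \<omega> = Y 0 \<omega> + N t \<omega> + (LINT r:{0..t}|lborel. \<beta> r \<omega>)"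
    and variation_square_integrable: "0 \<le> t \<Longrightarrow> square_integrable M (\<lambda>\<omega>. LINT r:{0..t}|lborel. \<bar>\<beta> r \<omega>\<bar>)"
    and variation_conditional: "0 \<le> s \<Longrightarrow> s \<le> t \<Longrightarrow> multiplier s Z \<Longrightarrow> (\<And>\<omega>. \<omega> \<in> space M \<Longrightarrow> 0 \<le> Z \<omega>) \<Longrightarrow>
        expectation (\<lambda>\<omega>. Z \<omega> * ((LINT r:{0..t}|lborel. \<bar>\<beta> r \<omega>\<bar>) - (LINT r:{0..s}|lborel. \<bar>\<beta> r \<omega>\<bar>)))
          \<le> K t * expectation Z"
    and N_martingale: "0 \<le> s \<Longrightarrow> s \<le> t \<Longrightarrow> multiplier s Z \<Longrightarrow> expectation (\<lambda>\<omega>. Z \<omega> * (N t \<omega> - N s \<omega>)) = 0"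
    and N_variance: "0 \<le> s \<Longrightarrow> s \<le> t \<Longrightarrow> multiplier s Z \<Longrightarrow> expectation (\<lambda>\<omega>. Z \<omega> * (N t \<omega> - N s \<omega>)\<^sup>2) =
        (\<integral>(\<omega>, r). Z \<omega> * (indicator {s<..t} r * \<gamma> r \<omega>) \<partial>(M \<Otimes>\<^sub>M lborel))"
begin

text \<open>Total variation of the drift part of a path; it has the default value 0 when \<beta> is
  not integrable along the path.\<close>

definition V :: "real \<Rightarrow> 'w \<Rightarrow> real" where
  "V t \<omega> = (LINT r:{0..t}|lborel. \<bar>\<beta> r \<omega>\<bar>)"

lemma Y_measurable [measurable]: "0 \<le> t \<Longrightarrow> Y t \<in> borel_measurable M"
  using Y_adapted adapted_measurable by blast

lemma N_measurable [measurable]: "0 \<le> t \<Longrightarrow> N t \<in> borel_measurable M"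
  using N_square_integrable by (auto simp: square_integrable_def)

lemma V_square_integrable: "0 \<le> t \<Longrightarrow> square_integrable M (V t)"
  using variation_square_integrable unfolding V_def by blast

lemma V_measurable [measurable]: "0 \<le> t \<Longrightarrow> V t \<in> borel_measurable M"
  using V_square_integrable by (auto simp: square_integrable_def)

lemma V_integrable: "0 \<le> t \<Longrightarrow> integrable M (V t)"
  using V_square_integrable square_integrable_imp_integrable by blast

lemma Y_increment_bound:
  assumes "0 \<le> a" "0 \<le> b" "\<omega> \<in> space M" shows "\<bar>Y b \<omega> - Y a \<omega>\<bar> \<le> 1"
  using Y_range[OF assms(1,3)] Y_range[OF assms(2,3)] by auto

lemma multiplier_comp_Y:
  assumes "continuous_on {0..1} g" "0 \<le> t"
  shows "multiplier t (\<lambda>\<omega>. g (Y t \<omega>))"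
proof -
  obtain S where S: "\<And>y. y \<in> {0..1} \<Longrightarrow> \<bar>g y\<bar> \<le> S"
    using continuous_on_unit_interval_bounded[OF assms(1)] by blast
  \<comment> \<open>g is continuous on [0,1] only. Cutting it off outside makes it Borel and changes
    nothing on the range of Y.\<close>
  have "(\<lambda>\<omega>. (\<lambda>y. indicator {0..1} y *\<^sub>R g y) (Y t \<omega>)) \<in> borel_measurable (F t)"
    by (rule measurable_compose[OF Y_adapted[OF assms(2)] borel_measurable_continuous_on_indicator[OF _ assms(1)]]) simp
  then have "(\<lambda>\<omega>. g (Y t \<omega>)) \<in> borel_measurable (F t)"
    by (rule measurable_cong[THEN iffD1, rotated]) (use Y_range[OF assms(2)] assms(2) in auto)
  then show ?thesis using S Y_range[OF assms(2)] unfolding multiplier_def by blast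
qed

text \<open>One exceptional null set serves all windows at once, so pathwise estimates may use grids
  of any size.\<close>

lemma path_AE:
  "AE \<omega> in M. continuous_on {0..} (\<lambda>t. N t \<omega>) \<and> (\<forall>a b. 0 \<le> a \<longrightarrow> a \<le> b \<longrightarrow>
     Y b \<omega> - Y a \<omega> = N b \<omega> - N a \<omega> + (LINT r:{a<..b}|lborel. \<beta> r \<omega>) \<and>
     set_integrable lborel {a<..b} (\<lambda>r. \<beta> r \<omega>) \<and>
     \<bar>LINT r:{a<..b}|lborel. \<beta> r \<omega>\<bar> \<le> V b \<omega> - V a \<omega>)"
  using N_continuous \<beta>_integrable decomposition
proof eventually_elim
  case (elim \<omega>)
  show ?case
  proof (intro conjI allI impI elim(1))
    fix a b :: real assume ab: "0 \<le> a" "a \<le> b"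
    have "0 \<le> b" using ab by simp
    have i: "set_integrable lborel {0..b} (\<lambda>r. \<beta> r \<omega>)" using elim(2) \<open>0 \<le> b\<close> by blast
    note I = set_integral_Ioc[OF ab i] and J = set_integral_Ioc(2)[OF ab set_integrable_abs[OF i]]
    show "set_integrable lborel {a<..b} (\<lambda>r. \<beta> r \<omega>)" by (rule I(1))
    have "Y a \<omega> = Y 0 \<omega> + N a \<omega> + (LINT r:{0..a}|lborel. \<beta> r \<omega>)"
      "Y b \<omega> = Y 0 \<omega> + N b \<omega> + (LINT r:{0..b}|lborel. \<beta> r \<omega>)" using elim(3) ab(1) \<open>0 \<le> b\<close> by blast+
    with I(2) show "Y b \<omega> - Y a \<omega> = N b \<omega> - N a \<omega> + (LINT r:{a<..b}|lborel. \<beta> r \<omega>)" by linarith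
    have "\<bar>LINT r:{a<..b}|lborel. \<beta> r \<omega>\<bar> \<le> (LINT r:{a<..b}|lborel. \<bar>\<beta> r \<omega>\<bar>)"
      using set_integral_norm_bound[OF I(1)] by simp
    then show "\<bar>LINT r:{a<..b}|lborel. \<beta> r \<omega>\<bar> \<le> V b \<omega> - V a \<omega>" unfolding V_def J .
  qed
qed

lemma variation_bound:
  assumes "0 \<le> s" "s \<le> t" "multiplier s Z" "\<And>\<omega>. \<omega> \<in> space M \<Longrightarrow> 0 \<le> Z \<omega>"
  shows "expectation (\<lambda>\<omega>. Z \<omega> * (V t \<omega> - V s \<omega>)) \<le> K t * expectation Z"
  using variation_conditional[OF assms] unfolding V_def .

lemma integrable_mult_N:
  assumes "0 \<le> s" "s \<le> t" "multiplier s Z"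
  shows "integrable M (\<lambda>\<omega>. Z \<omega> * (N t \<omega> - N s \<omega>))"
  using square_integrable_imp_integrable[OF square_integrable_diff[OF N_square_integrable N_square_integrable]] assms
  by (intro integrable_multiplier_mult[OF assms(3)]) auto

lemma integrable_mult_Y:
  assumes "0 \<le> s" "s \<le> t" "multiplier s Z"
  shows "integrable M (\<lambda>\<omega>. Z \<omega> * (Y t \<omega> - Y s \<omega>))"
proof -
  have "square_integrable M (\<lambda>\<omega>. Y t \<omega> - Y s \<omega>)"
    using Y_increment_bound[of s t] assms by (intro square_integrable_bounded[where C = 1]) auto
  then show ?thesis using square_integrable_imp_integrable assms by (intro integrable_multiplier_mult[OF assms(3)]) auto
qed

text \<open>The martingale part of the increment averages out against Z Y, and the drift part enters
  with a factor Y in [0,1].\<close>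

lemma increment_lower_bound:
  assumes st: "0 \<le> s" "s \<le> t" and Z: "multiplier s Z" "\<And>\<omega>. \<omega> \<in> space M \<Longrightarrow> 0 \<le> Z \<omega>"
  shows "- expectation (\<lambda>\<omega>. (Z \<omega> * Y s \<omega>) * (Y t \<omega> - Y s \<omega>)) \<le> expectation (\<lambda>\<omega>. Z \<omega> * (V t \<omega> - V s \<omega>))"
proof -
  have ZY: "multiplier s (\<lambda>\<omega>. Z \<omega> * Y s \<omega>)"
    using multiplier_comp_Y[of "\<lambda>y. y" s] st Z(1) by (intro multiplier_mult) (auto intro: continuous_intros)
  have iV: "integrable M (\<lambda>\<omega>. Z \<omega> * (V t \<omega> - V s \<omega>))"
    using st V_integrable by (intro integrable_multiplier_mult[OF Z(1)]) auto
  note iY = integrable_mult_Y[OF st ZY] and iN = integrable_mult_N[OF st ZY]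
  have "expectation (\<lambda>\<omega>. (Z \<omega> * Y s \<omega>) * (N t \<omega> - N s \<omega>) - (Z \<omega> * Y s \<omega>) * (Y t \<omega> - Y s \<omega>))
     \<le> expectation (\<lambda>\<omega>. Z \<omega> * (V t \<omega> - V s \<omega>))"
  proof (rule integral_mono_AE)
    show "AE \<omega> in M. (Z \<omega> * Y s \<omega>) * (N t \<omega> - N s \<omega>) - (Z \<omega> * Y s \<omega>) * (Y t \<omega> - Y s \<omega>) \<le> Z \<omega> * (V t \<omega> - V s \<omega>)"
      using path_AE AE_space
    proof eventually_elim
      case (elim \<omega>)
      define d where "d = (LINT r:{s<..t}|lborel. \<beta> r \<omega>)"
      have d: "Y t \<omega> - Y s \<omega> = N t \<omega> - N s \<omega> + d" "\<bar>d\<bar> \<le> V t \<omega> - V s \<omega>" using elim st by (auto simp: d_def)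
      have y: "0 \<le> Y s \<omega>" "Y s \<omega> \<le> 1" using Y_range[OF st(1) elim(2)] by auto
      have "Y s \<omega> * (- d) \<le> Y s \<omega> * \<bar>d\<bar>" using y by (intro mult_left_mono) auto
      also have "\<dots> \<le> \<bar>d\<bar>" using y by (intro mult_left_le_one_le) auto
      finally have "Y s \<omega> * (- d) \<le> \<bar>d\<bar>" .
      then have "Z \<omega> * (Y s \<omega> * (- d)) \<le> Z \<omega> * (V t \<omega> - V s \<omega>)" using d(2) Z(2)[OF elim(2)] by (intro mult_left_mono) auto
      then show ?case unfolding d(1) by (simp add: algebra_simps)
    qed
  qed (use iY iN iV in auto)
  then show ?thesis using N_martingale[OF st ZY] iY iN by simp
qed

text \<open>A squared increment is an increment of Y^2 minus 2 Y dY. The first telescopes to at most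
  1; in the second the martingale part has mean zero and the drift part is bounded by the variation,
  which gives 1 + 2 K. As j and Z are free, the sum still to come is bounded given the past of any
  grid time.\<close>

lemma quadratic_sum_bound:
  assumes st: "0 \<le> s" "s \<le> t" and j: "j \<le> Suc n" and Z: "multiplier (grid s t n j) Z" "\<And>\<omega>. \<omega> \<in> space M \<Longrightarrow> 0 \<le> Z \<omega>"
  shows "expectation (\<lambda>\<omega>. Z \<omega> * (\<Sum>l=j..<Suc n. (Y (grid s t n (Suc l)) \<omega> - Y (grid s t n l) \<omega>)\<^sup>2))
    \<le> (1 + 2 * K t) * expectation Z"
proof -
  let ?g = "grid s t n"
  have g: "0 \<le> ?g l" "?g l \<le> ?g (Suc l)" for l using grid_lower[OF st(2), of n l] grid_mono[OF st(2), of l "Suc l" n] st by auto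
  have Zl: "multiplier (?g l) Z" if "j \<le> l" for l
    using multiplier_mono[OF Z(1) g(1)] grid_mono[OF st(2) that] by blast
  have ZYl: "multiplier (?g l) (\<lambda>\<omega>. Z \<omega> * Y (?g l) \<omega>)" if "j \<le> l" for l
    using multiplier_comp_Y[of "\<lambda>y. y" "?g l"] g Zl[OF that] by (intro multiplier_mult) (auto intro: continuous_intros)
  have tele: "(\<Sum>l=j..<Suc n. f (Suc l) - f l) = f (Suc n) - f j" for f :: "nat \<Rightarrow> real"
    by (rule sum_Suc_diff'[OF j])
  have iY2: "integrable M (\<lambda>\<omega>. Z \<omega> * ((Y t \<omega>)\<^sup>2 - (Y (?g j) \<omega>)\<^sup>2))"
  proof (rule integrable_multiplier_mult[OF Z(1) g(1)])
    have "integrable M (\<lambda>\<omega>. (Y u \<omega>)\<^sup>2)" if "0 \<le> u" for u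
    proof -
      have "continuous_on {0..1} (\<lambda>y::real. y\<^sup>2)" by (intro continuous_intros)
      from integrable_multiplier[OF multiplier_comp_Y[OF this that] that] show ?thesis .
    qed
    then show "integrable M (\<lambda>\<omega>. (Y t \<omega>)\<^sup>2 - (Y (?g j) \<omega>)\<^sup>2)" using st g by auto
  qed
  have iY: "integrable M (\<lambda>\<omega>. (Z \<omega> * Y (?g l) \<omega>) * (Y (?g (Suc l)) \<omega> - Y (?g l) \<omega>))" if "l \<in> {j..<Suc n}" for l
    using integrable_mult_Y[OF g ZYl] that by auto
  have iV: "integrable M (\<lambda>\<omega>. Z \<omega> * (V (?g (Suc l)) \<omega> - V (?g l) \<omega>))" for l
    using V_integrable g by (intro integrable_multiplier_mult[OF Z(1)]) auto
  have "expectation (\<lambda>\<omega>. Z \<omega> * (\<Sum>l=j..<Suc n. (Y (?g (Suc l)) \<omega> - Y (?g l) \<omega>)\<^sup>2)) =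
     expectation (\<lambda>\<omega>. Z \<omega> * ((Y t \<omega>)\<^sup>2 - (Y (?g j) \<omega>)\<^sup>2) +
        2 * (\<Sum>l=j..<Suc n. - ((Z \<omega> * Y (?g l) \<omega>) * (Y (?g (Suc l)) \<omega> - Y (?g l) \<omega>))))"
  proof (intro Bochner_Integration.integral_cong refl)
    fix \<omega>
    have "(\<Sum>l=j..<Suc n. (Y (?g (Suc l)) \<omega> - Y (?g l) \<omega>)\<^sup>2) =
      (\<Sum>l=j..<Suc n. ((Y (?g (Suc l)) \<omega>)\<^sup>2 - (Y (?g l) \<omega>)\<^sup>2) - 2 * (Y (?g l) \<omega> * (Y (?g (Suc l)) \<omega> - Y (?g l) \<omega>)))"
      by (intro sum.cong refl) (simp add: power2_eq_square algebra_simps)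
    also have "\<dots> = (Y t \<omega>)\<^sup>2 - (Y (?g j) \<omega>)\<^sup>2 - 2 * (\<Sum>l=j..<Suc n. Y (?g l) \<omega> * (Y (?g (Suc l)) \<omega> - Y (?g l) \<omega>))"
      using tele[of "\<lambda>l. (Y (?g l) \<omega>)\<^sup>2"] by (simp only: sum_subtractf sum_distrib_left grid_last)
    finally show "Z \<omega> * (\<Sum>l=j..<Suc n. (Y (?g (Suc l)) \<omega> - Y (?g l) \<omega>)\<^sup>2) =
      Z \<omega> * ((Y t \<omega>)\<^sup>2 - (Y (?g j) \<omega>)\<^sup>2) +
        2 * (\<Sum>l=j..<Suc n. - ((Z \<omega> * Y (?g l) \<omega>) * (Y (?g (Suc l)) \<omega> - Y (?g l) \<omega>)))"
      by (simp only: sum_negf mult.assoc flip: sum_distrib_left) (simp only: algebra_simps)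
  qed
  also have "\<dots> = expectation (\<lambda>\<omega>. Z \<omega> * ((Y t \<omega>)\<^sup>2 - (Y (?g j) \<omega>)\<^sup>2)) +
      2 * (\<Sum>l=j..<Suc n. - expectation (\<lambda>\<omega>. (Z \<omega> * Y (?g l) \<omega>) * (Y (?g (Suc l)) \<omega> - Y (?g l) \<omega>)))"
    using iY2 iY by (subst Bochner_Integration.integral_add) (auto simp: Bochner_Integration.integral_sum simp del: sum.op_ivl_Suc intro!: sum.cong)
  also have "expectation (\<lambda>\<omega>. Z \<omega> * ((Y t \<omega>)\<^sup>2 - (Y (?g j) \<omega>)\<^sup>2)) \<le> expectation Z"
  proof (rule integral_mono[OF iY2 integrable_multiplier[OF Z(1) g(1)]])
    fix \<omega> assume w: "\<omega> \<in> space M"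
    have "(Y t \<omega>)\<^sup>2 \<le> 1" using Y_range[of t \<omega>] w st by (simp add: power_le_one)
    moreover have "0 \<le> (Y (?g j) \<omega>)\<^sup>2" by simp
    ultimately have "(Y t \<omega>)\<^sup>2 - (Y (?g j) \<omega>)\<^sup>2 \<le> 1" by linarith
    then show "Z \<omega> * ((Y t \<omega>)\<^sup>2 - (Y (?g j) \<omega>)\<^sup>2) \<le> Z \<omega>" using Z(2)[OF w] mult_left_mono by fastforce
  qed
  also have "(\<Sum>l=j..<Suc n. - expectation (\<lambda>\<omega>. (Z \<omega> * Y (?g l) \<omega>) * (Y (?g (Suc l)) \<omega> - Y (?g l) \<omega>)))
    \<le> (\<Sum>l=j..<Suc n. expectation (\<lambda>\<omega>. Z \<omega> * (V (?g (Suc l)) \<omega> - V (?g l) \<omega>)))"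
  proof (rule sum_mono)
    fix l assume "l \<in> {j..<Suc n}"
    then have l: "j \<le> l" by auto
    show "- expectation (\<lambda>\<omega>. (Z \<omega> * Y (?g l) \<omega>) * (Y (?g (Suc l)) \<omega> - Y (?g l) \<omega>))
      \<le> expectation (\<lambda>\<omega>. Z \<omega> * (V (?g (Suc l)) \<omega> - V (?g l) \<omega>))"
      by (rule increment_lower_bound[OF g Zl[OF l] Z(2)])
  qed
  also have "\<dots> = expectation (\<lambda>\<omega>. \<Sum>l=j..<Suc n. Z \<omega> * (V (?g (Suc l)) \<omega> - V (?g l) \<omega>))"
    using iV by (intro Bochner_Integration.integral_sum[symmetric])
  also have "(\<lambda>\<omega>. \<Sum>l=j..<Suc n. Z \<omega> * (V (?g (Suc l)) \<omega> - V (?g l) \<omega>)) = (\<lambda>\<omega>. Z \<omega> * (V t \<omega> - V (?g j) \<omega>))"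
    using tele[of "\<lambda>l. V (?g l) \<omega>" for \<omega>] by (simp only: sum_distrib_left[symmetric] grid_last)
  also have "expectation (\<lambda>\<omega>. Z \<omega> * (V t \<omega> - V (?g j) \<omega>)) \<le> K t * expectation Z"
    using variation_bound[OF g(1) _ Z] grid_upper[OF st(2) j] by blast
  finally show ?thesis by (simp add: algebra_simps)
qed

text \<open>Uniform integrability of the quadratic sums, which controls the Taylor remainder although the
  drift is unbounded: by \<open>quadratic_sum_bound\<close> the expected sum over the remaining steps is bounded
  conditionally on the past.\<close>

lemma square_sum_bound:
  assumes st: "0 \<le> s" "s \<le> t"
  shows "expectation (\<lambda>\<omega>. (\<Sum>k<Suc n. (Y (grid s t n (Suc k)) \<omega> - Y (grid s t n k) \<omega>)\<^sup>2)\<^sup>2)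
    \<le> \<bar>3 + 4 * K t\<bar> * (1 + 2 * K t)"
    and "square_integrable M (\<lambda>\<omega>. \<Sum>k<Suc n. (Y (grid s t n (Suc k)) \<omega> - Y (grid s t n k) \<omega>)\<^sup>2)"
proof -
  let ?g = "grid s t n"
  define a where "a = (\<lambda>k \<omega>. (Y (?g (Suc k)) \<omega> - Y (?g k) \<omega>)\<^sup>2)"
  define T where "T = (\<lambda>k \<omega>. \<Sum>l=k..<Suc n. a l \<omega>)"
  have g: "0 \<le> ?g l" "?g l \<le> ?g (Suc l)" for l using grid_lower[OF st(2), of n l] grid_mono[OF st(2), of l "Suc l" n] st by auto
  have a01: "0 \<le> a k \<omega>" "a k \<omega> \<le> 1" if "\<omega> \<in> space M" for k \<omega>
  proof -
    show "0 \<le> a k \<omega>" by (simp add: a_def)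
    show "a k \<omega> \<le> 1"
      using Y_increment_bound[OF g(1) g(1) that, of k "Suc k"] by (simp add: a_def abs_square_le_1)
  qed
  have am: "multiplier (?g (Suc k)) (a k)" for k
  proof -
    have "Y (?g (Suc k)) \<in> borel_measurable (F (?g (Suc k)))" "Y (?g k) \<in> borel_measurable (F (?g (Suc k)))"
      using Y_adapted[OF g(1)] adapted_mono[OF Y_adapted[OF g(1)] g] by auto
    then have "a k \<in> borel_measurable (F (?g (Suc k)))" unfolding a_def by measurable
    then show ?thesis unfolding multiplier_def using a01[of _ k] by (metis abs_of_nonneg)
  qed
  have asq: "square_integrable M (a k)" for k using square_integrable_multiplier[OF am g(1)] .
  then have Tsq: "square_integrable M (T k)" for k unfolding T_def by (intro square_integrable_sum) auto
  show "square_integrable M (\<lambda>\<omega>. \<Sum>k<Suc n. (Y (?g (Suc k)) \<omega> - Y (?g k) \<omega>)\<^sup>2)"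
    using Tsq[of 0] unfolding T_def a_def by (simp add: atLeast0LessThan)
  have i1: "integrable M (\<lambda>\<omega>. a k \<omega> * T l \<omega>)" for k l by (rule square_integrable_mult[OF asq Tsq])
  have i2: "integrable M (\<lambda>\<omega>. a k \<omega> * a k \<omega>)" for k by (rule square_integrable_mult[OF asq asq])
  have i3: "integrable M (a k)" for k using square_integrable_imp_integrable[OF asq] .
  have "expectation (\<lambda>\<omega>. (\<Sum>k<Suc n. a k \<omega>)\<^sup>2) = expectation (\<lambda>\<omega>. \<Sum>k<Suc n. a k \<omega> * a k \<omega> + 2 * (a k \<omega> * T (Suc k) \<omega>))"
    unfolding sum_square_tails T_def by (intro Bochner_Integration.integral_cong refl sum.cong) (simp add: algebra_simps)
  also have "\<dots> = (\<Sum>k<Suc n. expectation (\<lambda>\<omega>. a k \<omega> * a k \<omega>) + 2 * expectation (\<lambda>\<omega>. a k \<omega> * T (Suc k) \<omega>))"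
    using i1 i2 by (subst Bochner_Integration.integral_sum) (auto intro!: sum.cong)
  \<comment> \<open>The constant is 1 + 2 (1 + 2 K t). Increments are at most 1 in size, so
    \<open>a k\<close> squared is at most \<open>a k\<close>; and the tail after step k is bounded
    given the past, with \<open>a k\<close> itself as the test variable.\<close>
  also have "\<dots> \<le> (\<Sum>k<Suc n. (3 + 4 * K t) * expectation (a k))"
  proof (rule sum_mono)
    fix k assume "k \<in> {..<Suc n}"
    then have k: "Suc k \<le> Suc n" by simp
    have "expectation (\<lambda>\<omega>. a k \<omega> * a k \<omega>) \<le> expectation (a k)"
      using i2 i3 a01 by (intro integral_mono) (auto intro: mult_left_le)
    moreover have "expectation (\<lambda>\<omega>. a k \<omega> * T (Suc k) \<omega>) \<le> (1 + 2 * K t) * expectation (a k)"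
      using quadratic_sum_bound[OF st k am a01(1)] unfolding T_def a_def by simp
    ultimately show "expectation (\<lambda>\<omega>. a k \<omega> * a k \<omega>) + 2 * expectation (\<lambda>\<omega>. a k \<omega> * T (Suc k) \<omega>)
      \<le> (3 + 4 * K t) * expectation (a k)"
      by (simp add: algebra_simps)
  qed
  also have "\<dots> = (3 + 4 * K t) * expectation (T 0)"
    using i3 by (simp only: T_def Bochner_Integration.integral_sum sum_distrib_left atLeast0LessThan)
  also have "\<dots> \<le> \<bar>3 + 4 * K t\<bar> * expectation (T 0)"
    using a01 by (intro mult_right_mono Bochner_Integration.integral_nonneg) (auto simp: T_def simp del: sum.op_ivl_Suc intro!: sum_nonneg)
  also have "expectation (T 0) \<le> 1 + 2 * K t"
    using quadratic_sum_bound[OF st le0, where Z = "\<lambda>_. 1" and n = n] unfolding T_def a_def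
    by (simp add: prob_space del: sum.op_ivl_Suc)
  finally show "expectation (\<lambda>\<omega>. (\<Sum>k<Suc n. (Y (?g (Suc k)) \<omega> - Y (?g k) \<omega>)\<^sup>2)\<^sup>2)
    \<le> \<bar>3 + 4 * K t\<bar> * (1 + 2 * K t)" by (simp add: a_def mult_left_mono)
qed

text \<open>The cubic sum is at most the largest increment \<delta> times the quadratic sum S. By
  continuity of paths \<delta> tends to 0 boundedly, and S is bounded in mean square; Young's
  inequality with a free weight \<mu> combines the two.\<close>

lemma cubic_sum_tendsto_0:
  assumes st: "0 \<le> s" "s \<le> t"
  shows "(\<lambda>n. expectation (\<lambda>\<omega>. \<Sum>k<Suc n. \<bar>Y (grid s t n (Suc k)) \<omega> - Y (grid s t n k) \<omega>\<bar> ^ 3)) \<longlonglongrightarrow> 0"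
proof -
  define d where "d = (\<lambda>n k \<omega>. \<bar>Y (grid s t n (Suc k)) \<omega> - Y (grid s t n k) \<omega>\<bar>)"
  define S where "S = (\<lambda>n \<omega>. \<Sum>k<Suc n. (d n k \<omega>)\<^sup>2)"
  define \<delta> where "\<delta> = (\<lambda>n \<omega>. Max ((\<lambda>k. d n k \<omega>) ` {..<Suc n}))"
  define C where "C = \<bar>3 + 4 * K t\<bar> * (1 + 2 * K t)"
  have g: "0 \<le> grid s t n l" for n l using grid_lower[OF st(2), of n l] st by auto
  have [measurable]: "d n k \<in> borel_measurable M" for n k
    unfolding d_def using Y_measurable g by measurable
  have \<delta>m [measurable]: "\<delta> n \<in> borel_measurable M" for n
    unfolding \<delta>_def by measurable
  have d01: "0 \<le> d n k \<omega>" "d n k \<omega> \<le> 1" if "\<omega> \<in> space M" for n k \<omega>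
    using Y_increment_bound[OF g g that] by (auto simp: d_def)
  have d_le: "d n k \<omega> \<le> \<delta> n \<omega>" if "k < Suc n" for n k \<omega>
    unfolding \<delta>_def using that by (intro Max_ge) auto
  have \<delta>01: "0 \<le> \<delta> n \<omega>" "\<delta> n \<omega> \<le> 1" if "\<omega> \<in> space M" for n \<omega>
  proof -
    show "0 \<le> \<delta> n \<omega>" using d01(1)[OF that, of n 0] d_le[of 0 n \<omega>] by simp
    show "\<delta> n \<omega> \<le> 1" unfolding \<delta>_def using d01[OF that] by (intro Max.boundedI) (auto simp: lessThan_empty_iff)
  qed
  have \<delta>lim: "(\<lambda>n. expectation (\<lambda>\<omega>. (\<delta> n \<omega>)\<^sup>2)) \<longlonglongrightarrow> expectation (\<lambda>\<omega>. 0)"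
  proof (rule integral_dominated_convergence[where w = "\<lambda>_. 1"])
    show "AE \<omega> in M. (\<lambda>n. (\<delta> n \<omega>)\<^sup>2) \<longlonglongrightarrow> 0"
    proof (rule AE_I2)
      fix \<omega> assume w: "\<omega> \<in> space M"
      have "\<delta> n \<omega> \<ge> 0" for n using \<delta>01[OF w] by auto
      have "(\<lambda>n. \<delta> n \<omega>) \<longlonglongrightarrow> 0"
      proof (rule LIMSEQ_I)
        fix e :: real assume e: "0 < e"
        have "continuous_on {s..t} (\<lambda>r. Y r \<omega>)"
          using Y_continuous[OF w] st by (rule_tac continuous_on_subset) auto
        from grid_increments_tendsto[OF this st(2) e] obtain n0 where
          n0: "\<And>n k. n0 \<le> n \<Longrightarrow> k < Suc n \<Longrightarrow> d n k \<omega> < e"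
          unfolding eventually_sequentially d_def by blast
        have "norm (\<delta> n \<omega> - 0) < e" if "n0 \<le> n" for n
        proof -
          have "\<delta> n \<omega> < e" unfolding \<delta>_def using n0[OF that] by (subst Max_less_iff) (auto simp: lessThan_empty_iff)
          then show ?thesis using \<delta>01[OF w, of n] by simp
        qed
        then show "\<exists>no. \<forall>n\<ge>no. norm (\<delta> n \<omega> - 0) < e" by blast
      qed
      from tendsto_power[OF this, of 2] show "(\<lambda>n. (\<delta> n \<omega>)\<^sup>2) \<longlonglongrightarrow> 0" by simp
    qed
    show "AE \<omega> in M. norm ((\<delta> n \<omega>)\<^sup>2) \<le> 1" for n
      using \<delta>01 by (intro AE_I2) (simp add: abs_square_le_1)
  qed auto
  have Ssq: "square_integrable M (S n)" and SC: "expectation (\<lambda>\<omega>. (S n \<omega>)\<^sup>2) \<le> C" for n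
    using square_sum_bound[OF st, of n] unfolding S_def d_def C_def by simp_all
  have C0: "0 \<le> C" using SC[of 0] by (rule order_trans[rotated]) simp
  have bound: "expectation (\<lambda>\<omega>. \<Sum>k<Suc n. d n k \<omega> ^ 3) \<le> (\<mu> * C + expectation (\<lambda>\<omega>. (\<delta> n \<omega>)\<^sup>2) / \<mu>) / 2"
    if mu: "0 < \<mu>" for \<mu> n
  proof -
    have i\<delta>: "integrable M (\<lambda>\<omega>. (\<delta> n \<omega>)\<^sup>2)"
      by (rule integrable_const_bound[where B = 1]) (use \<delta>01 in \<open>auto simp: abs_square_le_1\<close>)
    have iS: "integrable M (\<lambda>\<omega>. (S n \<omega>)\<^sup>2)" using Ssq by (auto simp: square_integrable_def)
    have "expectation (\<lambda>\<omega>. \<Sum>k<Suc n. d n k \<omega> ^ 3) \<le> expectation (\<lambda>\<omega>. (\<mu> * (S n \<omega>)\<^sup>2 + (\<delta> n \<omega>)\<^sup>2 / \<mu>) / 2)"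
    proof (rule integral_mono)
      show "integrable M (\<lambda>\<omega>. \<Sum>k<Suc n. d n k \<omega> ^ 3)"
      proof (intro Bochner_Integration.integrable_sum integrable_const_bound[where B = 1])
        show "AE \<omega> in M. norm (d n k \<omega> ^ 3) \<le> 1" for k
          using d01 by (intro AE_I2) (simp add: power_le_one)
      qed measurable
      show "integrable M (\<lambda>\<omega>. (\<mu> * (S n \<omega>)\<^sup>2 + (\<delta> n \<omega>)\<^sup>2 / \<mu>) / 2)" using i\<delta> iS by auto
      fix \<omega> assume w: "\<omega> \<in> space M"
      have "(\<Sum>k<Suc n. d n k \<omega> ^ 3) \<le> (\<Sum>k<Suc n. \<delta> n \<omega> * (d n k \<omega>)\<^sup>2)"
      proof (rule sum_mono)
        fix k assume "k \<in> {..<Suc n}"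
        then have "d n k \<omega> * (d n k \<omega>)\<^sup>2 \<le> \<delta> n \<omega> * (d n k \<omega>)\<^sup>2" by (intro mult_right_mono d_le) auto
        then show "d n k \<omega> ^ 3 \<le> \<delta> n \<omega> * (d n k \<omega>)\<^sup>2" by (simp add: power3_eq_cube power2_eq_square mult.assoc)
      qed
      also have "\<dots> = \<delta> n \<omega> * S n \<omega>" by (simp only: S_def sum_distrib_left)
      also have "\<dots> \<le> (\<mu> * (S n \<omega>)\<^sup>2 + (\<delta> n \<omega>)\<^sup>2 / \<mu>) / 2"
      proof -
        have "0 \<le> (\<mu> * S n \<omega> - \<delta> n \<omega>)\<^sup>2 / \<mu>" using mu by simp
        also have "\<dots> = \<mu> * (S n \<omega>)\<^sup>2 + (\<delta> n \<omega>)\<^sup>2 / \<mu> - 2 * (\<delta> n \<omega> * S n \<omega>)"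
          using mu by (simp add: power2_diff power_mult_distrib field_simps) (simp add: power2_eq_square)
        finally show ?thesis by simp
      qed
      finally show "(\<Sum>k<Suc n. d n k \<omega> ^ 3) \<le> (\<mu> * (S n \<omega>)\<^sup>2 + (\<delta> n \<omega>)\<^sup>2 / \<mu>) / 2" .
    qed
    also have "\<dots> = (\<mu> * expectation (\<lambda>\<omega>. (S n \<omega>)\<^sup>2) + expectation (\<lambda>\<omega>. (\<delta> n \<omega>)\<^sup>2) / \<mu>) / 2"
      using i\<delta> iS by simp
    also have "\<dots> \<le> (\<mu> * C + expectation (\<lambda>\<omega>. (\<delta> n \<omega>)\<^sup>2) / \<mu>) / 2"
      using SC mu by simp
    finally show ?thesis .
  qed
  have "(\<lambda>n. expectation (\<lambda>\<omega>. \<Sum>k<Suc n. d n k \<omega> ^ 3)) \<longlonglongrightarrow> 0"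
  proof (rule LIMSEQ_I)
    fix e :: real assume e: "0 < e"
    \<comment> \<open>Fixes the part coming from S below e; for this fixed weight the part coming
      from \<delta> vanishes in the limit.\<close>
    define \<mu> where "\<mu> = e / (C + 1)"
    have mu: "0 < \<mu>" using e C0 by (simp add: \<mu>_def)
    have "\<mu> * C < e" using e C0 by (simp add: \<mu>_def field_simps)
    have "(\<lambda>n. expectation (\<lambda>\<omega>. (\<delta> n \<omega>)\<^sup>2) / \<mu>) \<longlonglongrightarrow> 0 / \<mu>"
      using \<delta>lim mu by (intro tendsto_divide tendsto_const) auto
    then have "eventually (\<lambda>n. expectation (\<lambda>\<omega>. (\<delta> n \<omega>)\<^sup>2) / \<mu> < e) sequentially"
      using e by (intro order_tendstoD(2)) auto
    then obtain n0 where n0: "\<And>n. n0 \<le> n \<Longrightarrow> expectation (\<lambda>\<omega>. (\<delta> n \<omega>)\<^sup>2) / \<mu> < e"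
      unfolding eventually_sequentially by blast
    have "norm (expectation (\<lambda>\<omega>. \<Sum>k<Suc n. d n k \<omega> ^ 3) - 0) < e" if "n0 \<le> n" for n
    proof -
      have "0 \<le> expectation (\<lambda>\<omega>. \<Sum>k<Suc n. d n k \<omega> ^ 3)"
        using d01 by (intro Bochner_Integration.integral_nonneg sum_nonneg) auto
      then show ?thesis using bound[OF mu, of n] n0[OF that] \<open>\<mu> * C < e\<close> by simp
    qed
    then show "\<exists>no. \<forall>n\<ge>no. norm (expectation (\<lambda>\<omega>. \<Sum>k<Suc n. d n k \<omega> ^ 3) - 0) < e" by blast
  qed
  then show ?thesis unfolding d_def .
qed

text \<open>Fubini asks for an integrable bound on the time integral of |\<beta>|, and
  \<open>V t\<close> is one.\<close>

lemma drift_integrable: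
  assumes st: "0 \<le> s" "s \<le> t"
  shows "integrable (M \<Otimes>\<^sub>M lborel) (\<lambda>(\<omega>, r). indicator {s<..t} r * \<beta> r \<omega>)"
proof (rule space_time.Fubini_integrable)
  note \<beta>_measurable[measurable]
  show "(\<lambda>(\<omega>, r). indicator {s<..t} r * \<beta> r \<omega>) \<in> borel_measurable (M \<Otimes>\<^sub>M lborel)" by measurable
  have t: "0 \<le> t" using st by simp
  show "AE \<omega> in M. integrable lborel (\<lambda>r. case (\<omega>, r) of (\<omega>, r) \<Rightarrow> indicator {s<..t} r * \<beta> r \<omega>)"
    using path_AE
  proof eventually_elim
    case (elim \<omega>)
    then have "set_integrable lborel {s<..t} (\<lambda>r. \<beta> r \<omega>)" using st by blast
    then show ?case by (simp add: set_integrable_def)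
  qed
  show "integrable M (\<lambda>\<omega>. LINT r|lborel. norm (case (\<omega>, r) of (\<omega>, r) \<Rightarrow> indicator {s<..t} r * \<beta> r \<omega>))"
  proof (rule Bochner_Integration.integrable_bound[OF V_integrable[OF t]])
    show "(\<lambda>\<omega>. LINT r|lborel. norm (case (\<omega>, r) of (\<omega>, r) \<Rightarrow> indicator {s<..t} r * \<beta> r \<omega>)) \<in> borel_measurable M"
      by measurable
    show "AE \<omega> in M. norm (LINT r|lborel. norm (case (\<omega>, r) of (\<omega>, r) \<Rightarrow> indicator {s<..t} r * \<beta> r \<omega>)) \<le> norm (V t \<omega>)"
      using \<beta>_integrable
    proof eventually_elim
      case (elim \<omega>)
      have i: "set_integrable lborel {0..t} (\<lambda>r. \<bar>\<beta> r \<omega>\<bar>)" using elim t set_integrable_abs by blast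
      have i': "set_integrable lborel {s<..t} (\<lambda>r. \<bar>\<beta> r \<omega>\<bar>)" by (rule set_integrable_subset[OF i]) (use st in auto)
      have "(LINT r:{s<..t}|lborel. \<bar>\<beta> r \<omega>\<bar>) \<le> V t \<omega>"
        unfolding V_def set_lebesgue_integral_def using i i' st
        by (intro integral_mono) (auto simp: set_integrable_def indicator_def)
      moreover have "0 \<le> (LINT r:{s<..t}|lborel. \<bar>\<beta> r \<omega>\<bar>)"
        unfolding set_lebesgue_integral_def by (intro Bochner_Integration.integral_nonneg) auto
      moreover have "(LINT r|lborel. norm (case (\<omega>, r) of (\<omega>, r) \<Rightarrow> indicator {s<..t} r * \<beta> r \<omega>)) =
        (LINT r:{s<..t}|lborel. \<bar>\<beta> r \<omega>\<bar>)"
        unfolding set_lebesgue_integral_def by (intro Bochner_Integration.integral_cong) (auto simp: abs_mult)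
      ultimately show ?case by simp
    qed
  qed
qed

lemma bracket_integrable:
  assumes st: "0 \<le> s" "s \<le> t"
  shows "integrable (M \<Otimes>\<^sub>M lborel) (\<lambda>(\<omega>, r). indicator {s<..t} r * \<gamma> r \<omega>)"
proof (rule Bochner_Integration.integrable_bound)
  note \<gamma>_measurable[measurable]
  show "integrable (M \<Otimes>\<^sub>M lborel) (\<lambda>(\<omega>, r). \<Gamma> * indicator {s<..t} r)"
    using integrable_product_indicator[of "\<lambda>_. \<Gamma>" "{s<..t}"] st by simp
  show "(\<lambda>(\<omega>, r). indicator {s<..t} r * \<gamma> r \<omega>) \<in> borel_measurable (M \<Otimes>\<^sub>M lborel)" by measurable
  show "AE x in M \<Otimes>\<^sub>M lborel. norm (case x of (\<omega>, r) \<Rightarrow> indicator {s<..t} r * \<gamma> r \<omega>)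
     \<le> norm (case x of (\<omega>, r) \<Rightarrow> \<Gamma> * indicator {s<..t} r)"
  proof (rule AE_I2)
    fix x :: "'w \<times> real" assume "x \<in> space (M \<Otimes>\<^sub>M lborel)"
    then obtain \<omega> r where "x = (\<omega>, r)" "\<omega> \<in> space M" by (auto simp: space_pair_measure)
    then show "norm (case x of (\<omega>, r) \<Rightarrow> indicator {s<..t} r * \<gamma> r \<omega>) \<le> norm (case x of (\<omega>, r) \<Rightarrow> \<Gamma> * indicator {s<..t} r)"
      using \<gamma>_bound[of r \<omega>] st by (auto simp: indicator_def)
  qed
qed

text \<open>The martingale increment averages out against Z; what remains is the drift integral,
  written over space-time by Fubini.\<close>

lemma drift_expectation:
  assumes st: "0 \<le> s" "s \<le> t" and Z: "multiplier s Z"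
  shows "expectation (\<lambda>\<omega>. Z \<omega> * (Y t \<omega> - Y s \<omega>)) = (\<integral>(\<omega>, r). Z \<omega> * (indicator {s<..t} r * \<beta> r \<omega>) \<partial>(M \<Otimes>\<^sub>M lborel))"
proof -
  obtain C where C: "\<And>\<omega>. \<omega> \<in> space M \<Longrightarrow> \<bar>Z \<omega>\<bar> \<le> C" using multiplier_bounded[OF Z] by blast
  have [measurable]: "Z \<in> borel_measurable M" using multiplier_measurable Z st by blast
  note \<beta>_measurable[measurable]
  have int: "integrable (M \<Otimes>\<^sub>M lborel) (\<lambda>(\<omega>, r). Z \<omega> * (indicator {s<..t} r * \<beta> r \<omega>))"
  proof (rule Bochner_Integration.integrable_bound)
    show "integrable (M \<Otimes>\<^sub>M lborel) (\<lambda>x. C * (case x of (\<omega>, r) \<Rightarrow> indicator {s<..t} r * \<beta> r \<omega>))"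
      using drift_integrable[OF st] by simp
    show "(\<lambda>(\<omega>, r). Z \<omega> * (indicator {s<..t} r * \<beta> r \<omega>)) \<in> borel_measurable (M \<Otimes>\<^sub>M lborel)" by measurable
    show "AE x in M \<Otimes>\<^sub>M lborel. norm (case x of (\<omega>, r) \<Rightarrow> Z \<omega> * (indicator {s<..t} r * \<beta> r \<omega>))
      \<le> norm (C * (case x of (\<omega>, r) \<Rightarrow> indicator {s<..t} r * \<beta> r \<omega>))"
    proof (rule AE_I2)
      fix x :: "'w \<times> real" assume "x \<in> space (M \<Otimes>\<^sub>M lborel)"
      then obtain \<omega> r where x: "x = (\<omega>, r)" "\<omega> \<in> space M" by (auto simp: space_pair_measure)
      have "\<bar>Z \<omega>\<bar> \<le> \<bar>C\<bar>" using C[OF x(2)] by linarith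
      then show "norm (case x of (\<omega>, r) \<Rightarrow> Z \<omega> * (indicator {s<..t} r * \<beta> r \<omega>))
        \<le> norm (C * (case x of (\<omega>, r) \<Rightarrow> indicator {s<..t} r * \<beta> r \<omega>))"
        unfolding x by (simp add: abs_mult mult_right_mono)
    qed
  qed
  have "(\<integral>(\<omega>, r). Z \<omega> * (indicator {s<..t} r * \<beta> r \<omega>) \<partial>(M \<Otimes>\<^sub>M lborel)) =
     expectation (\<lambda>\<omega>. Z \<omega> * (LINT r:{s<..t}|lborel. \<beta> r \<omega>))"
    using space_time.integral_fst'[OF int] by (simp add: set_lebesgue_integral_def)
  also have "\<dots> = expectation (\<lambda>\<omega>. Z \<omega> * (Y t \<omega> - Y s \<omega>) - Z \<omega> * (N t \<omega> - N s \<omega>))"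
  proof (rule integral_cong_AE)
    show "(\<lambda>\<omega>. Z \<omega> * (LINT r:{s<..t}|lborel. \<beta> r \<omega>)) \<in> borel_measurable M"
      unfolding set_lebesgue_integral_def by measurable
    show "(\<lambda>\<omega>. Z \<omega> * (Y t \<omega> - Y s \<omega>) - Z \<omega> * (N t \<omega> - N s \<omega>)) \<in> borel_measurable M"
      using integrable_mult_N[OF st Z] integrable_mult_Y[OF st Z] by auto
    show "AE \<omega> in M. Z \<omega> * (LINT r:{s<..t}|lborel. \<beta> r \<omega>) = Z \<omega> * (Y t \<omega> - Y s \<omega>) - Z \<omega> * (N t \<omega> - N s \<omega>)"
      using path_AE
    proof eventually_elim
      case (elim \<omega>)
      then have "Y t \<omega> - Y s \<omega> = N t \<omega> - N s \<omega> + (LINT r:{s<..t}|lborel. \<beta> r \<omega>)" using st by blast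
      then have "(LINT r:{s<..t}|lborel. \<beta> r \<omega>) = (Y t \<omega> - Y s \<omega>) - (N t \<omega> - N s \<omega>)" by simp
      then show ?case by (simp only: right_diff_distrib)
    qed
  qed
  also have "\<dots> = expectation (\<lambda>\<omega>. Z \<omega> * (Y t \<omega> - Y s \<omega>))"
    using integrable_mult_N[OF st Z] integrable_mult_Y[OF st Z] N_martingale[OF st Z] by simp
  finally show ?thesis by simp
qed

text \<open>Limit of sums whose coefficient is frozen at the left endpoint of each step, against an
  integrable space-time density b; drift and bracket are both instances. Dominated convergence on
  the product space, with the bound C S |b| on the window.\<close>

lemma
  assumes f: "continuous_on {0..1} f" and st: "0 \<le> s" "s \<le> t" and Z: "multiplier s Z"
    and b: "(\<lambda>(\<omega>, r). b r \<omega>) \<in> borel_measurable (M \<Otimes>\<^sub>M lborel)"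
    and bi: "integrable (M \<Otimes>\<^sub>M lborel) (\<lambda>(\<omega>, r). indicator {s<..t} r * b r \<omega>)"
  shows grid_integral_tendsto:
      "(\<lambda>n. \<Sum>k<Suc n. (\<integral>(\<omega>, r). (Z \<omega> * f (Y (grid s t n k) \<omega>)) *
          (indicator {grid s t n k<..grid s t n (Suc k)} r * b r \<omega>) \<partial>(M \<Otimes>\<^sub>M lborel)))
        \<longlonglongrightarrow> (\<integral>(\<omega>, r). Z \<omega> * (indicator {s<..t} r * (f (Y r \<omega>) * b r \<omega>)) \<partial>(M \<Otimes>\<^sub>M lborel))"
    and integrable_comp_Y_mult:
      "integrable (M \<Otimes>\<^sub>M lborel) (\<lambda>(\<omega>, r). Z \<omega> * (indicator {s<..t} r * (f (Y r \<omega>) * b r \<omega>)))"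
proof -
  obtain C where C: "\<And>\<omega>. \<omega> \<in> space M \<Longrightarrow> \<bar>Z \<omega>\<bar> \<le> C" using multiplier_bounded[OF Z] by blast
  have [measurable]: "Z \<in> borel_measurable M" using multiplier_measurable Z st by blast
  note b[measurable]
  obtain S where S: "\<And>y. y \<in> {0..1} \<Longrightarrow> \<bar>f y\<bar> \<le> S"
    using continuous_on_unit_interval_bounded[OF f] by blast
  have g: "0 \<le> grid s t n l" for n l using grid_lower[OF st(2), of n l] st by auto
  have fm [measurable]: "(\<lambda>\<omega>. f (Y (grid s t n k) \<omega>)) \<in> borel_measurable M" for n k
    using multiplier_measurable[OF multiplier_comp_Y[OF f g] g] .
  let ?I = "\<lambda>n k r. indicator {grid s t n k<..grid s t n (Suc k)} r :: real"
  define w where "w = (\<lambda>(\<omega>, r). C * S * \<bar>indicator {s<..t} r * b r \<omega>\<bar>)"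
  have wi: "integrable (M \<Otimes>\<^sub>M lborel) w"
  proof -
    have "integrable (M \<Otimes>\<^sub>M lborel) (\<lambda>x. C * S * \<bar>case x of (\<omega>, r) \<Rightarrow> indicator {s<..t} r * b r \<omega>\<bar>)"
      using bi by simp
    then show ?thesis unfolding w_def by (simp add: split_beta')
  qed
  define h where "h = (\<lambda>n (\<omega>, r). (Z \<omega> * b r \<omega>) * (\<Sum>k<Suc n. f (Y (grid s t n k) \<omega>) * ?I n k r))"
  define h' where "h' = (\<lambda>(\<omega>, r). Z \<omega> * (indicator {s<..t} r * (f (Y r \<omega>) * b r \<omega>)))"
  have hm [measurable]: "h n \<in> borel_measurable (M \<Otimes>\<^sub>M lborel)" for n
    unfolding h_def by measurable
  have CZ: "\<bar>Z \<omega> * b r \<omega>\<bar> * (S * indicator {s<..t} r) \<le> w (\<omega>, r)" if "\<omega> \<in> space M" for \<omega> r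
  proof -
    have "0 \<le> S" using S[of 0] by simp
    then have "\<bar>Z \<omega>\<bar> * (\<bar>b r \<omega>\<bar> * (S * indicator {s<..t} r)) \<le> C * (\<bar>b r \<omega>\<bar> * (S * indicator {s<..t} r))"
      using C[OF that] by (intro mult_right_mono) auto
    then show ?thesis unfolding w_def by (simp add: abs_mult mult_ac)
  qed
  have lim: "(\<lambda>n. h n x) \<longlonglongrightarrow> h' x" if x: "x \<in> space (M \<Otimes>\<^sub>M lborel)" for x
  proof -
    obtain \<omega> r where xr: "x = (\<omega>, r)" "\<omega> \<in> space M" using x by (auto simp: space_pair_measure)
    have "continuous_on {s..t} (\<lambda>r. f (Y r \<omega>))"
    proof (rule continuous_on_compose2[OF f])
      show "continuous_on {s..t} (\<lambda>r. Y r \<omega>)"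
        using Y_continuous[OF xr(2)] by (rule continuous_on_subset) (use st in auto)
      show "(\<lambda>r. Y r \<omega>) ` {s..t} \<subseteq> {0..1}" using Y_range[OF _ xr(2)] st by force
    qed
    from tendsto_mult[OF tendsto_const grid_step_function_tendsto[OF this st(2)], of "Z \<omega> * b r \<omega>" r]
    show ?thesis unfolding xr h_def h'_def by (simp add: mult_ac)
  qed
  \<comment> \<open>Joint measurability of the limit in path and time is inherited from the step
    approximations, which involve only countably many times.\<close>
  have h'm [measurable]: "h' \<in> borel_measurable (M \<Otimes>\<^sub>M lborel)"
    by (rule borel_measurable_LIMSEQ_real[OF lim hm])
  have hb: "norm (h n x) \<le> w x" if x: "x \<in> space (M \<Otimes>\<^sub>M lborel)" for x n
  proof -
    obtain \<omega> r where xr: "x = (\<omega>, r)" "\<omega> \<in> space M" using x by (auto simp: space_pair_measure)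
    have "\<bar>\<Sum>k<Suc n. f (Y (grid s t n k) \<omega>) * ?I n k r\<bar> \<le> S * indicator {s<..t} r"
      using S Y_range[OF g xr(2)] by (intro grid_step_function_bound[OF st(2)]) auto
    then have "\<bar>Z \<omega> * b r \<omega>\<bar> * \<bar>\<Sum>k<Suc n. f (Y (grid s t n k) \<omega>) * ?I n k r\<bar>
       \<le> \<bar>Z \<omega> * b r \<omega>\<bar> * (S * indicator {s<..t} r)" by (intro mult_left_mono) auto
    with CZ[OF xr(2), of r] show ?thesis unfolding xr h_def by (simp add: abs_mult del: sum.lessThan_Suc)
  qed
  have int_h: "integrable (M \<Otimes>\<^sub>M lborel) h'"
    and conv: "(\<lambda>n. integral\<^sup>L (M \<Otimes>\<^sub>M lborel) (h n)) \<longlonglongrightarrow> integral\<^sup>L (M \<Otimes>\<^sub>M lborel) h'"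
    using integrable_dominated_convergence[OF h'm hm wi AE_I2[OF lim] AE_I2[OF hb]]
      integral_dominated_convergence[OF h'm hm wi AE_I2[OF lim] AE_I2[OF hb]] by auto
  show "integrable (M \<Otimes>\<^sub>M lborel) (\<lambda>(\<omega>, r). Z \<omega> * (indicator {s<..t} r * (f (Y r \<omega>) * b r \<omega>)))"
    using int_h unfolding h'_def .
  have int_k: "integrable (M \<Otimes>\<^sub>M lborel) (\<lambda>(\<omega>, r). (Z \<omega> * f (Y (grid s t n k) \<omega>)) * (?I n k r * b r \<omega>))"
    if k: "k < Suc n" for n k
  proof (rule Bochner_Integration.integrable_bound[OF wi])
    show "(\<lambda>(\<omega>, r). (Z \<omega> * f (Y (grid s t n k) \<omega>)) * (?I n k r * b r \<omega>)) \<in> borel_measurable (M \<Otimes>\<^sub>M lborel)"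
      by measurable
    show "AE x in M \<Otimes>\<^sub>M lborel. norm (case x of (\<omega>, r) \<Rightarrow> (Z \<omega> * f (Y (grid s t n k) \<omega>)) * (?I n k r * b r \<omega>)) \<le> norm (w x)"
    proof (rule AE_I2)
      fix x :: "'w \<times> real" assume "x \<in> space (M \<Otimes>\<^sub>M lborel)"
      then obtain \<omega> r where xr: "x = (\<omega>, r)" "\<omega> \<in> space M" by (auto simp: space_pair_measure)
      have "?I n k r \<le> indicator {s<..t} r"
        using grid_lower[OF st(2), of n k] grid_upper[OF st(2), of "Suc k" n] k by (auto simp: indicator_def)
      moreover have "\<bar>f (Y (grid s t n k) \<omega>)\<bar> \<le> S" using S Y_range[OF g xr(2)] by auto
      ultimately have "\<bar>f (Y (grid s t n k) \<omega>)\<bar> * ?I n k r \<le> S * indicator {s<..t} r"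
        by (intro mult_mono') auto
      then have "\<bar>Z \<omega> * b r \<omega>\<bar> * (\<bar>f (Y (grid s t n k) \<omega>)\<bar> * ?I n k r) \<le> \<bar>Z \<omega> * b r \<omega>\<bar> * (S * indicator {s<..t} r)"
        by (intro mult_left_mono) auto
      with CZ[OF xr(2), of r] abs_ge_self[of "w (\<omega>, r)"] show "norm (case x of (\<omega>, r) \<Rightarrow> (Z \<omega> * f (Y (grid s t n k) \<omega>)) * (?I n k r * b r \<omega>)) \<le> norm (w x)"
        unfolding xr by (simp add: abs_mult mult_ac)
    qed
  qed
  have "(\<Sum>k<Suc n. (\<integral>(\<omega>, r). (Z \<omega> * f (Y (grid s t n k) \<omega>)) * (?I n k r * b r \<omega>) \<partial>(M \<Otimes>\<^sub>M lborel))) =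
     integral\<^sup>L (M \<Otimes>\<^sub>M lborel) (h n)" for n
  proof -
    have "(\<Sum>k<Suc n. (\<integral>(\<omega>, r). (Z \<omega> * f (Y (grid s t n k) \<omega>)) * (?I n k r * b r \<omega>) \<partial>(M \<Otimes>\<^sub>M lborel))) =
      (\<integral>x. (\<Sum>k<Suc n. case x of (\<omega>, r) \<Rightarrow> (Z \<omega> * f (Y (grid s t n k) \<omega>)) * (?I n k r * b r \<omega>)) \<partial>(M \<Otimes>\<^sub>M lborel))"
      by (rule Bochner_Integration.integral_sum[symmetric]) (use int_k in auto)
    also have "\<dots> = integral\<^sup>L (M \<Otimes>\<^sub>M lborel) (h n)"
    proof (intro Bochner_Integration.integral_cong refl)
      fix x :: "'w \<times> real"
      obtain \<omega> r where x: "x = (\<omega>, r)" by (cases x)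
      show "(\<Sum>k<Suc n. case x of (\<omega>, r) \<Rightarrow> (Z \<omega> * f (Y (grid s t n k) \<omega>)) * (?I n k r * b r \<omega>)) = h n x"
        unfolding h_def x prod.case sum_distrib_left by (intro sum.cong refl) (simp only: mult_ac)
    qed
    finally show ?thesis .
  qed
  then show "(\<lambda>n. \<Sum>k<Suc n. (\<integral>(\<omega>, r). (Z \<omega> * f (Y (grid s t n k) \<omega>)) *
          (indicator {grid s t n k<..grid s t n (Suc k)} r * b r \<omega>) \<partial>(M \<Otimes>\<^sub>M lborel)))
        \<longlonglongrightarrow> (\<integral>(\<omega>, r). Z \<omega> * (indicator {s<..t} r * (f (Y r \<omega>) * b r \<omega>)) \<partial>(M \<Otimes>\<^sub>M lborel))"
    using conv unfolding h'_def by simp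
qed

text \<open>Expected squared increments are known for N and not for Y. The difference of squares
  factors as (y + z) (y - z): here y - z is a drift increment, and these sum to at most the total
  variation, while y + z is uniformly small by continuity of both paths.\<close>

lemma square_difference_sum_tendsto_0:
  assumes f: "continuous_on {0..1} f" and st: "0 \<le> s" "s \<le> t" and Z: "multiplier s Z"
  shows "(\<lambda>n. expectation (\<lambda>\<omega>. \<Sum>k<Suc n. Z \<omega> * f (Y (grid s t n k) \<omega>) *
     ((Y (grid s t n (Suc k)) \<omega> - Y (grid s t n k) \<omega>)\<^sup>2 - (N (grid s t n (Suc k)) \<omega> - N (grid s t n k) \<omega>)\<^sup>2))) \<longlonglongrightarrow> 0"
proof -
  obtain C where C: "\<And>\<omega>. \<omega> \<in> space M \<Longrightarrow> \<bar>Z \<omega>\<bar> \<le> C" using multiplier_bounded[OF Z] by blast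
  have [measurable]: "Z \<in> borel_measurable M" using multiplier_measurable Z st by blast
  obtain S where S: "\<And>y. y \<in> {0..1} \<Longrightarrow> \<bar>f y\<bar> \<le> S"
    using continuous_on_unit_interval_bounded[OF f] by blast
  have g: "0 \<le> grid s t n l" for n l using grid_lower[OF st(2), of n l] st by auto
  have t: "0 \<le> t" using st by simp
  have [measurable]: "(\<lambda>\<omega>. f (Y (grid s t n k) \<omega>)) \<in> borel_measurable M"
    "Y (grid s t n k) \<in> borel_measurable M" "N (grid s t n k) \<in> borel_measurable M" for n k
    using multiplier_measurable[OF multiplier_comp_Y[OF f g] g] Y_measurable[OF g] N_measurable[OF g] by auto
  define X where "X = (\<lambda>n \<omega>. \<Sum>k<Suc n. Z \<omega> * f (Y (grid s t n k) \<omega>) *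
     ((Y (grid s t n (Suc k)) \<omega> - Y (grid s t n k) \<omega>)\<^sup>2 - (N (grid s t n (Suc k)) \<omega> - N (grid s t n k) \<omega>)\<^sup>2))"
  have [measurable]: "X n \<in> borel_measurable M" for n unfolding X_def by measurable
  have bound: "AE \<omega> in M. \<forall>n e. (\<forall>k<Suc n. \<bar>Y (grid s t n (Suc k)) \<omega> - Y (grid s t n k) \<omega>\<bar> +
      \<bar>N (grid s t n (Suc k)) \<omega> - N (grid s t n k) \<omega>\<bar> \<le> e) \<longrightarrow> \<bar>X n \<omega>\<bar> \<le> C * S * e * (V t \<omega> - V s \<omega>)"
    using path_AE AE_space
  proof eventually_elim
    case (elim \<omega>)
    show ?case
    proof (intro allI impI)
      fix n e assume e: "\<forall>k<Suc n. \<bar>Y (grid s t n (Suc k)) \<omega> - Y (grid s t n k) \<omega>\<bar> +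
        \<bar>N (grid s t n (Suc k)) \<omega> - N (grid s t n k) \<omega>\<bar> \<le> e"
      have "\<bar>X n \<omega>\<bar> \<le> (\<Sum>k<Suc n. \<bar>Z \<omega> * f (Y (grid s t n k) \<omega>) *
     ((Y (grid s t n (Suc k)) \<omega> - Y (grid s t n k) \<omega>)\<^sup>2 - (N (grid s t n (Suc k)) \<omega> - N (grid s t n k) \<omega>)\<^sup>2)\<bar>)"
        unfolding X_def by (rule sum_abs)
      also have "\<dots> \<le> (\<Sum>k<Suc n. C * S * e * (V (grid s t n (Suc k)) \<omega> - V (grid s t n k) \<omega>))"
      proof (rule sum_mono)
        fix k assume "k \<in> {..<Suc n}"
        then have k: "k < Suc n" by simp
        define y where "y = Y (grid s t n (Suc k)) \<omega> - Y (grid s t n k) \<omega>"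
        define z where "z = N (grid s t n (Suc k)) \<omega> - N (grid s t n k) \<omega>"
        define v where "v = V (grid s t n (Suc k)) \<omega> - V (grid s t n k) \<omega>"
        have gk: "grid s t n k \<le> grid s t n (Suc k)" using grid_mono[OF st(2)] by simp
        from elim(1) g[of n k] gk have v: "\<bar>y - z\<bar> \<le> v" unfolding y_def z_def v_def by fastforce
        have 1: "\<bar>y + z\<bar> \<le> e" using e k unfolding y_def z_def by fastforce
        have 2: "\<bar>y\<^sup>2 - z\<^sup>2\<bar> \<le> e * v"
        proof -
          have "y\<^sup>2 - z\<^sup>2 = (y + z) * (y - z)" by (simp add: power2_eq_square algebra_simps)
          then show ?thesis using mult_mono'[OF 1 v] by (simp add: abs_mult)
        qed
        have 3: "\<bar>Z \<omega> * f (Y (grid s t n k) \<omega>)\<bar> \<le> C * S"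
          unfolding abs_mult using C[OF elim(2)] S[OF Y_range[OF g elim(2)]] by (intro mult_mono') auto
        show "\<bar>Z \<omega> * f (Y (grid s t n k) \<omega>) *
     ((Y (grid s t n (Suc k)) \<omega> - Y (grid s t n k) \<omega>)\<^sup>2 - (N (grid s t n (Suc k)) \<omega> - N (grid s t n k) \<omega>)\<^sup>2)\<bar>
          \<le> C * S * e * (V (grid s t n (Suc k)) \<omega> - V (grid s t n k) \<omega>)"
          using mult_mono'[OF 3 2] unfolding y_def[symmetric] z_def[symmetric] v_def[symmetric]
          by (simp add: abs_mult mult.assoc)
      qed
      also have "\<dots> = C * S * e * (V t \<omega> - V s \<omega>)"
        using sum_lessThan_telescope[of "\<lambda>k. V (grid s t n k) \<omega>" "Suc n"]
        by (simp only: sum_distrib_left[symmetric] grid_last grid_0)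
      finally show "\<bar>X n \<omega>\<bar> \<le> C * S * e * (V t \<omega> - V s \<omega>)" .
    qed
  qed
  \<comment> \<open>Only almost surely: where \<beta> fails to be integrable, \<open>V\<close> falls
    back to 0.\<close>
  have V_mono: "AE \<omega> in M. \<forall>a b. 0 \<le> a \<longrightarrow> a \<le> b \<longrightarrow> V a \<omega> \<le> V b \<omega>"
    using path_AE
  proof eventually_elim
    case (elim \<omega>)
    show ?case
    proof (intro allI impI)
      fix a b :: real assume "0 \<le> a" "a \<le> b"
      then have "\<bar>LINT r:{a<..b}|lborel. \<beta> r \<omega>\<bar> \<le> V b \<omega> - V a \<omega>" using elim by blast
      then show "V a \<omega> \<le> V b \<omega>" using abs_ge_zero[of "LINT r:{a<..b}|lborel. \<beta> r \<omega>"] by linarith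
    qed
  qed
  have V0: "V 0 \<omega> = 0" for \<omega> by (simp add: V_def set_integral_singleton)
  have CS: "0 \<le> C * S"
  proof -
    obtain \<omega> where "\<omega> \<in> space M" using not_empty by blast
    then have "0 \<le> C" using C by force
    moreover have "0 \<le> S" using S[of 0] by force
    ultimately show ?thesis by simp
  qed
  have "(\<lambda>n. expectation (X n)) \<longlonglongrightarrow> expectation (\<lambda>\<omega>. 0)"
  \<comment> \<open>From |y| \<le> 1 and |y - z| \<le> V t one gets |y| + |z| \<le> 2 + V t. A
    further factor V t comes from the sum of the drift increments, which is why V t is needed in
    mean square.\<close>
  proof (rule integral_dominated_convergence[where w = "\<lambda>\<omega>. C * S * (2 * V t \<omega> + V t \<omega> * V t \<omega>)"])
    show "integrable M (\<lambda>\<omega>. C * S * (2 * V t \<omega> + V t \<omega> * V t \<omega>))"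
      using V_integrable[OF t] square_integrable_mult[OF V_square_integrable[OF t] V_square_integrable[OF t]] by auto
    show "AE \<omega> in M. norm (X n \<omega>) \<le> C * S * (2 * V t \<omega> + V t \<omega> * V t \<omega>)" for n
      using bound path_AE V_mono AE_space
    proof eventually_elim
      case (elim \<omega>)
      have Vs: "0 \<le> V s \<omega>" "0 \<le> V t \<omega>" using elim(3) st t V0[of \<omega>] by (metis order_refl)+
      have "\<bar>Y (grid s t n (Suc k)) \<omega> - Y (grid s t n k) \<omega>\<bar> +
        \<bar>N (grid s t n (Suc k)) \<omega> - N (grid s t n k) \<omega>\<bar> \<le> 2 + V t \<omega>" if k: "k < Suc n" for k
      proof -
        have gk: "grid s t n k \<le> grid s t n (Suc k)" "grid s t n (Suc k) \<le> t"
          using grid_mono[OF st(2)] grid_upper[OF st(2)] k by auto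
        have "\<bar>Y (grid s t n (Suc k)) \<omega> - Y (grid s t n k) \<omega> - (N (grid s t n (Suc k)) \<omega> - N (grid s t n k) \<omega>)\<bar>
          \<le> V (grid s t n (Suc k)) \<omega> - V (grid s t n k) \<omega>"
          using elim(2) g[of n k] gk(1) by fastforce
        moreover have "V (grid s t n (Suc k)) \<omega> \<le> V t \<omega>" using elim(3) g gk(2) by blast
        moreover have "0 \<le> V (grid s t n k) \<omega>" using elim(3) g[of n k] V0[of \<omega>] by (metis order_refl)
        moreover have "\<bar>Y (grid s t n (Suc k)) \<omega> - Y (grid s t n k) \<omega>\<bar> \<le> 1"
          by (rule Y_increment_bound[OF g g elim(4)])
        ultimately show ?thesis by linarith
      qed
      then have "\<bar>X n \<omega>\<bar> \<le> C * S * (2 + V t \<omega>) * (V t \<omega> - V s \<omega>)" using elim(1) by blast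
      also have "\<dots> \<le> C * S * (2 + V t \<omega>) * V t \<omega>"
        using Vs by (intro mult_left_mono mult_nonneg_nonneg[OF CS]) auto
      finally show ?case by (simp add: algebra_simps)
    qed
    show "AE \<omega> in M. (\<lambda>n. X n \<omega>) \<longlonglongrightarrow> 0"
      using bound path_AE V_mono AE_space
    proof eventually_elim
      case (elim \<omega>)
      show ?case
      proof (rule LIMSEQ_I)
        fix e :: real assume e: "0 < e"
        define A where "A = C * S * (V t \<omega> - V s \<omega>)"
        have A: "0 \<le> A" using CS elim(3) st by (simp add: A_def)
        define \<eta> where "\<eta> = e / (2 * (A + 1))"
        have \<eta>: "0 < \<eta>" using e A by (simp add: \<eta>_def)
        have sub: "{s..t} \<subseteq> {0..}" using st by auto
        have cY: "continuous_on {s..t} (\<lambda>r. Y r \<omega>)" "continuous_on {s..t} (\<lambda>r. N r \<omega>)"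
          using continuous_on_subset[OF Y_continuous[OF elim(4)] sub] continuous_on_subset[OF _ sub] elim(2) by auto
        have "eventually (\<lambda>n. \<bar>X n \<omega>\<bar> < e) sequentially"
          using grid_increments_tendsto[OF cY(1) st(2) \<eta>] grid_increments_tendsto[OF cY(2) st(2) \<eta>]
        proof eventually_elim
          case (elim n)
          then have "\<forall>k<Suc n. \<bar>Y (grid s t n (Suc k)) \<omega> - Y (grid s t n k) \<omega>\<bar> +
             \<bar>N (grid s t n (Suc k)) \<omega> - N (grid s t n k) \<omega>\<bar> \<le> 2 * \<eta>" by fastforce
          with \<open>\<forall>n e. _ n e \<longrightarrow> \<bar>X n \<omega>\<bar> \<le> _ n e\<close> have "\<bar>X n \<omega>\<bar> \<le> C * S * (2 * \<eta>) * (V t \<omega> - V s \<omega>)" by blast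
          also have "\<dots> = 2 * \<eta> * A" by (simp add: A_def)
          also have "\<dots> < e" using e A by (simp add: \<eta>_def field_simps)
          finally show ?case .
        qed
        then show "\<exists>no. \<forall>n\<ge>no. norm (X n \<omega> - 0) < e" unfolding eventually_sequentially by simp
      qed
    qed
  qed auto
  then show ?thesis by (simp add: X_def)
qed

text \<open>Ito's formula between s and t in expectation, given the past of s. The cubic Taylor
  bound is the link between \<phi>, \<phi>' and \<phi>'', in exactly the form in which the remainder
  is estimated.\<close>

theorem ito_formula:
  fixes \<phi> \<phi>' \<phi>'' :: "real \<Rightarrow> real"
  assumes st: "0 \<le> s" "s \<le> t" and Z: "multiplier s Z"
    and cont: "continuous_on {0..1} \<phi>" "continuous_on {0..1} \<phi>'" "continuous_on {0..1} \<phi>''"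
    and taylor: "\<And>x y. x \<in> {0..1} \<Longrightarrow> y \<in> {0..1} \<Longrightarrow>
      \<bar>\<phi> y - \<phi> x - \<phi>' x * (y - x) - \<phi>'' x / 2 * (y - x)\<^sup>2\<bar> \<le> L * \<bar>y - x\<bar> ^ 3"
  shows "expectation (\<lambda>\<omega>. Z \<omega> * (\<phi> (Y t \<omega>) - \<phi> (Y s \<omega>))) =
    (\<integral>(\<omega>, r). Z \<omega> * (indicator {s<..t} r * (\<phi>' (Y r \<omega>) * \<beta> r \<omega>)) \<partial>(M \<Otimes>\<^sub>M lborel)) +
    (\<integral>(\<omega>, r). Z \<omega> * (indicator {s<..t} r * (\<phi>'' (Y r \<omega>) / 2 * \<gamma> r \<omega>)) \<partial>(M \<Otimes>\<^sub>M lborel))"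
    (is "?E = ?B + ?G")
proof -
  obtain C where C: "\<And>\<omega>. \<omega> \<in> space M \<Longrightarrow> \<bar>Z \<omega>\<bar> \<le> C" using multiplier_bounded[OF Z] by blast
  have Zs [measurable]: "Z \<in> borel_measurable M" using multiplier_measurable Z st by blast
  have g: "0 \<le> grid s t n l" for n l using grid_lower[OF st(2), of n l] st by auto
  have gS: "grid s t n l \<le> grid s t n (Suc l)" for n l using grid_mono[OF st(2)] by simp
  have Zg: "multiplier (grid s t n l) Z" for n l
    using multiplier_mono[OF Z st(1)] grid_lower[OF st(2)] by blast
  have cont2: "continuous_on {0..1} (\<lambda>y. \<phi>'' y / 2)" by (intro continuous_intros cont(3)) auto
  note mY = multiplier_mult[OF Zg multiplier_comp_Y[OF cont(2) g]] multiplier_mult[OF Zg multiplier_comp_Y[OF cont2 g]]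
  let ?y = "\<lambda>n k \<omega>. Y (grid s t n (Suc k)) \<omega> - Y (grid s t n k) \<omega>"
  let ?z = "\<lambda>n k \<omega>. N (grid s t n (Suc k)) \<omega> - N (grid s t n k) \<omega>"
  let ?a = "\<lambda>n k \<omega>. Z \<omega> * \<phi>' (Y (grid s t n k) \<omega>)"
  let ?c = "\<lambda>n k \<omega>. Z \<omega> * (\<phi>'' (Y (grid s t n k) \<omega>) / 2)"
  have iy: "square_integrable M (?y n k)" for n k
    using Y_increment_bound[OF g g] Y_measurable[OF g] by (intro square_integrable_bounded[where C = 1]) auto
  have iz: "square_integrable M (?z n k)" for n k
    by (intro square_integrable_diff N_square_integrable g)
  have i1: "integrable M (\<lambda>\<omega>. ?a n k \<omega> * ?y n k \<omega>)" for n k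
    using integrable_multiplier_mult[OF mY(1) g square_integrable_imp_integrable[OF iy]] .
  have i2: "integrable M (\<lambda>\<omega>. ?c n k \<omega> * (?z n k \<omega>)\<^sup>2)" for n k
    using integrable_multiplier_mult[OF mY(2) g] iz by (auto simp: square_integrable_def)
  have i2': "integrable M (\<lambda>\<omega>. ?c n k \<omega> * (?y n k \<omega>)\<^sup>2)" for n k
    using integrable_multiplier_mult[OF mY(2) g] iy by (auto simp: square_integrable_def)
  have i3: "integrable M (\<lambda>\<omega>. ?c n k \<omega> * ((?y n k \<omega>)\<^sup>2 - (?z n k \<omega>)\<^sup>2))" for n k
    using i2 i2' by (simp add: right_diff_distrib)
  have i4: "integrable M (\<lambda>\<omega>. \<bar>?y n k \<omega>\<bar> ^ 3)" for n k
  proof (rule integrable_const_bound[where B = 1])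
    show "AE \<omega> in M. norm (\<bar>?y n k \<omega>\<bar> ^ 3) \<le> 1"
      using Y_increment_bound[OF g g] by (intro AE_I2) (simp add: power_le_one)
  qed (use Y_measurable[OF g] in measurable)
  have i5: "integrable M (\<lambda>\<omega>. Z \<omega> * (\<phi> (Y t \<omega>) - \<phi> (Y s \<omega>)))"
    using integrable_multiplier[OF multiplier_comp_Y[OF cont(1)]] st
    by (intro integrable_multiplier_mult[OF Z]) auto
  \<comment> \<open>A collects the first-order terms, B the second-order terms formed with
    increments of N, D the correction from N to Y in the latter, and R bounds the Taylor
    remainders.\<close>
  define A where "A n = (\<Sum>k<Suc n. expectation (\<lambda>\<omega>. ?a n k \<omega> * ?y n k \<omega>))" for n
  define B where "B n = (\<Sum>k<Suc n. expectation (\<lambda>\<omega>. ?c n k \<omega> * (?z n k \<omega>)\<^sup>2))" for n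
  define D where "D n = expectation (\<lambda>\<omega>. \<Sum>k<Suc n. ?c n k \<omega> * ((?y n k \<omega>)\<^sup>2 - (?z n k \<omega>)\<^sup>2))" for n
  define R where "R n = expectation (\<lambda>\<omega>. \<Sum>k<Suc n. \<bar>?y n k \<omega>\<bar> ^ 3)" for n
  \<comment> \<open>The coefficient at the left endpoint is an admissible test variable for its own
    step, so each summand is exactly a space-time integral of the drift; likewise for B and the
    bracket.\<close>
  have A: "A \<longlonglongrightarrow> ?B"
    unfolding A_def drift_expectation[OF g gS mY(1)]
    by (rule grid_integral_tendsto[OF cont(2) st Z \<beta>_measurable drift_integrable[OF st]])
  have B: "B \<longlonglongrightarrow> ?G"
    unfolding B_def N_variance[OF g gS mY(2)]
    by (rule grid_integral_tendsto[OF cont2 st Z \<gamma>_measurable bracket_integrable[OF st]])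
  have D: "D \<longlonglongrightarrow> 0"
    unfolding D_def by (rule square_difference_sum_tendsto_0[OF cont2 st Z])
  have R: "R \<longlonglongrightarrow> 0"
    unfolding R_def by (rule cubic_sum_tendsto_0[OF st])
  have err: "\<bar>?E - (A n + B n + D n)\<bar> \<le> C * L * R n" for n
  proof -
    have "A n + B n + D n = expectation (\<lambda>\<omega>. (\<Sum>k<Suc n. ?a n k \<omega> * ?y n k \<omega>) + (\<Sum>k<Suc n. ?c n k \<omega> * (?z n k \<omega>)\<^sup>2)
      + (\<Sum>k<Suc n. ?c n k \<omega> * ((?y n k \<omega>)\<^sup>2 - (?z n k \<omega>)\<^sup>2)))"
      unfolding A_def B_def D_def using i1 i2 i3
      by (simp add: Bochner_Integration.integral_sum del: sum.lessThan_Suc)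
    \<comment> \<open>The squared increments of N cancel between B and D.\<close>
    also have "\<dots> = expectation (\<lambda>\<omega>. \<Sum>k<Suc n. ?a n k \<omega> * ?y n k \<omega> + ?c n k \<omega> * (?y n k \<omega>)\<^sup>2)"
      by (simp only: sum.distrib[symmetric] right_diff_distrib) (simp add: algebra_simps)
    finally have AB: "A n + B n + D n = expectation (\<lambda>\<omega>. \<Sum>k<Suc n. ?a n k \<omega> * ?y n k \<omega> + ?c n k \<omega> * (?y n k \<omega>)\<^sup>2)" .
    have iS: "integrable M (\<lambda>\<omega>. \<Sum>k<Suc n. ?a n k \<omega> * ?y n k \<omega> + ?c n k \<omega> * (?y n k \<omega>)\<^sup>2)"
      using i1 i2' by (intro Bochner_Integration.integrable_sum Bochner_Integration.integrable_add) auto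
    have "\<bar>?E - (A n + B n + D n)\<bar> = \<bar>expectation (\<lambda>\<omega>. Z \<omega> * (\<phi> (Y t \<omega>) - \<phi> (Y s \<omega>)) -
       (\<Sum>k<Suc n. ?a n k \<omega> * ?y n k \<omega> + ?c n k \<omega> * (?y n k \<omega>)\<^sup>2))\<bar>"
      unfolding AB using i5 iS by simp
    also have "\<dots> \<le> expectation (\<lambda>\<omega>. \<bar>Z \<omega> * (\<phi> (Y t \<omega>) - \<phi> (Y s \<omega>)) -
       (\<Sum>k<Suc n. ?a n k \<omega> * ?y n k \<omega> + ?c n k \<omega> * (?y n k \<omega>)\<^sup>2)\<bar>)" by (rule integral_abs_bound)
    also have "\<dots> \<le> expectation (\<lambda>\<omega>. C * L * (\<Sum>k<Suc n. \<bar>?y n k \<omega>\<bar> ^ 3))"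
    proof (rule integral_mono)
      show "integrable M (\<lambda>\<omega>. \<bar>Z \<omega> * (\<phi> (Y t \<omega>) - \<phi> (Y s \<omega>)) -
       (\<Sum>k<Suc n. ?a n k \<omega> * ?y n k \<omega> + ?c n k \<omega> * (?y n k \<omega>)\<^sup>2)\<bar>)"
        by (intro integrable_abs Bochner_Integration.integrable_diff i5 iS)
      show "integrable M (\<lambda>\<omega>. C * L * (\<Sum>k<Suc n. \<bar>?y n k \<omega>\<bar> ^ 3))"
        using i4 by (intro integrable_mult_right Bochner_Integration.integrable_sum) auto
      fix \<omega> assume w: "\<omega> \<in> space M"
      define T where "T k = \<phi> (Y (grid s t n (Suc k)) \<omega>) - \<phi> (Y (grid s t n k) \<omega>) -
        \<phi>' (Y (grid s t n k) \<omega>) * ?y n k \<omega> - \<phi>'' (Y (grid s t n k) \<omega>) / 2 * (?y n k \<omega>)\<^sup>2" for k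
      have tele: "\<phi> (Y t \<omega>) - \<phi> (Y s \<omega>) = (\<Sum>k<Suc n. \<phi> (Y (grid s t n (Suc k)) \<omega>) - \<phi> (Y (grid s t n k) \<omega>))"
        by (subst sum_lessThan_telescope) simp
      have "Z \<omega> * (\<phi> (Y t \<omega>) - \<phi> (Y s \<omega>)) - (\<Sum>k<Suc n. ?a n k \<omega> * ?y n k \<omega> + ?c n k \<omega> * (?y n k \<omega>)\<^sup>2) =
        (\<Sum>k<Suc n. Z \<omega> * T k)"
        unfolding tele sum_distrib_left sum_subtractf[symmetric] T_def
        by (intro sum.cong refl) (simp only: algebra_simps)
      also have "\<bar>\<dots>\<bar> \<le> (\<Sum>k<Suc n. \<bar>Z \<omega> * T k\<bar>)" by (rule sum_abs)
      also have "\<dots> \<le> (\<Sum>k<Suc n. C * (L * \<bar>?y n k \<omega>\<bar> ^ 3))"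
      proof (rule sum_mono)
        fix k
        have "\<bar>T k\<bar> \<le> L * \<bar>?y n k \<omega>\<bar> ^ 3"
          unfolding T_def by (rule taylor[OF Y_range[OF g w] Y_range[OF g w]])
        then show "\<bar>Z \<omega> * T k\<bar> \<le> C * (L * \<bar>?y n k \<omega>\<bar> ^ 3)"
          unfolding abs_mult using C[OF w] by (intro mult_mono') auto
      qed
      also have "\<dots> = C * L * (\<Sum>k<Suc n. \<bar>?y n k \<omega>\<bar> ^ 3)" by (simp only: sum_distrib_left mult.assoc)
      finally show "\<bar>Z \<omega> * (\<phi> (Y t \<omega>) - \<phi> (Y s \<omega>)) -
         (\<Sum>k<Suc n. ?a n k \<omega> * ?y n k \<omega> + ?c n k \<omega> * (?y n k \<omega>)\<^sup>2)\<bar> \<le> C * L * (\<Sum>k<Suc n. \<bar>?y n k \<omega>\<bar> ^ 3)" .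
    qed
    also have "\<dots> = C * L * R n" unfolding R_def by (rule integral_mult_right_zero)
    finally show ?thesis .
  qed
  have "(\<lambda>n. C * L * R n) \<longlonglongrightarrow> 0" using tendsto_mult_right_zero[OF R, of "C * L"] by simp
  then have "(\<lambda>n. ?E - (A n + B n + D n)) \<longlonglongrightarrow> 0"
    by (rule Lim_null_comparison[rotated]) (use err in auto)
  moreover have "(\<lambda>n. ?E - (A n + B n + D n)) \<longlonglongrightarrow> ?E - (?B + ?G + 0)"
    by (intro tendsto_intros A B D)
  ultimately have "?E - (?B + ?G + 0) = 0" using LIMSEQ_unique by blast
  then show ?thesis by simp
qed

end

section \<open>Ito's formula for the regularized logarithm\<close>

lemma ln_taylor_remainder:
  fixes d x y :: real
  assumes d: "0 < d" and x: "x \<in> {0..1}" and y: "y \<in> {0..1}"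
  shows "\<bar>ln (y + d) - ln (x + d) - 1 / (x + d) * (y - x) - (- 1 / (x + d)\<^sup>2) / 2 * (y - x)\<^sup>2\<bar>
    \<le> 1 / (3 * d ^ 3) * \<bar>y - x\<bar> ^ 3"
proof (cases "y = x")
  case False
  define diff where "diff k z = (if k = 0 then ln (z + d) else if k = 1 then 1 / (z + d)
    else if k = 2 then - 1 / (z + d)\<^sup>2 else 2 / (z + d) ^ 3)" for k :: nat and z
  have deriv: "DERIV (diff k) z :> diff (Suc k) z" if "k < 3" "0 \<le> z" for k z
  proof -
    have z: "0 < z + d" using that d by simp
    consider "k = 0" | "k = 1" | "k = 2" using \<open>k < 3\<close> by linarith
    then show ?thesis
    proof cases
      case 1
      have "((\<lambda>z. ln (z + d)) has_real_derivative 1 / (z + d)) (at z)"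
        using z by (auto intro!: derivative_eq_intros)
      then show ?thesis by (simp add: 1 diff_def[abs_def])
    next
      case 2
      have "((\<lambda>z. 1 / (z + d)) has_real_derivative - 1 / (z + d)\<^sup>2) (at z)"
        using z by (auto intro!: derivative_eq_intros simp: power2_eq_square)
      then show ?thesis by (simp add: 2 diff_def[abs_def])
    next
      case 3
      have "((\<lambda>z. - 1 / (z + d)\<^sup>2) has_real_derivative 2 / (z + d) ^ 3) (at z)"
      proof (rule DERIV_cong)
        show "((\<lambda>z. - 1 / (z + d)\<^sup>2) has_real_derivative
          (0 * (z + d)\<^sup>2 - (- 1) * (2 * (z + d) * 1)) / ((z + d)\<^sup>2 * (z + d)\<^sup>2)) (at z)"
          using z by (intro DERIV_divide) (auto intro!: derivative_eq_intros)
        show "(0 * (z + d)\<^sup>2 - (- 1) * (2 * (z + d) * 1)) / ((z + d)\<^sup>2 * (z + d)\<^sup>2) = 2 / (z + d) ^ 3"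
        proof -
          have "(0 * u\<^sup>2 - (- 1) * (2 * u * 1)) / (u\<^sup>2 * u\<^sup>2) = 2 / u ^ 3" if "0 < u" for u :: real
            using that by (simp add: field_simps power2_eq_square power3_eq_cube)
          from this[OF z] show ?thesis .
        qed
      qed
      then show ?thesis by (simp add: 3 diff_def[abs_def])
    qed
  qed
  obtain z where z: "if y < x then y < z \<and> z < x else x < z \<and> z < y"
    and eq: "ln (y + d) = (\<Sum>k<3. diff k x / fact k * (y - x) ^ k) + diff 3 z / fact 3 * (y - x) ^ 3"
    using Taylor[of 3 diff "\<lambda>z. ln (z + d)" 0 1 x y] deriv x y False by (auto simp: diff_def[abs_def])
  have z0: "0 \<le> z" using z x y by (auto split: if_splits)
  have "ln (y + d) - ln (x + d) - 1 / (x + d) * (y - x) - (- 1 / (x + d)\<^sup>2) / 2 * (y - x)\<^sup>2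
    = 1 / (3 * (z + d) ^ 3) * (y - x) ^ 3"
    unfolding eq by (simp add: diff_def eval_nat_numeral)
  also have "\<bar>\<dots>\<bar> = 1 / (3 * (z + d) ^ 3) * \<bar>y - x\<bar> ^ 3"
    using z0 d by (simp add: abs_mult power_abs)
  \<comment> \<open>The intermediate point z lies between x and y, hence z + d \<ge> d; the factor
    1/3 is the third derivative's 2 over 3!.\<close>
  also have "\<dots> \<le> 1 / (3 * d ^ 3) * \<bar>y - x\<bar> ^ 3"
    using z0 d by (intro mult_right_mono divide_left_mono mult_left_mono power_mono) auto
  finally show ?thesis .
qed simp

context scalar_ito
begin

text \<open>For fixed d > 0 the derivatives of ln (y + d) are bounded on [0,1]. Their bounds explode
  as d tends to 0, so later estimates must use the combination of drift and bracket terms and not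
  the two separately.\<close>

lemma
  assumes d: "0 < d" and st: "0 \<le> s" "s \<le> t" and Z: "multiplier s Z"
  shows expectation_neg_log: "expectation (\<lambda>\<omega>. Z \<omega> * (- ln (Y t \<omega> + d) - - ln (Y s \<omega> + d))) =
      (\<integral>(\<omega>, r). Z \<omega> * (indicator {s<..t} r * (- \<beta> r \<omega> / (Y r \<omega> + d) + \<gamma> r \<omega> / (2 * (Y r \<omega> + d)\<^sup>2))) \<partial>(M \<Otimes>\<^sub>M lborel))"
    and integrable_neg_log: "integrable (M \<Otimes>\<^sub>M lborel)
      (\<lambda>(\<omega>, r). Z \<omega> * (indicator {s<..t} r * (- \<beta> r \<omega> / (Y r \<omega> + d) + \<gamma> r \<omega> / (2 * (Y r \<omega> + d)\<^sup>2))))"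
proof -
  have c1: "continuous_on {0..1} (\<lambda>y. ln (y + d))"
    and c2: "continuous_on {0..1} (\<lambda>y. 1 / (y + d))"
    and c3: "continuous_on {0..1} (\<lambda>y. - 1 / (y + d)\<^sup>2)"
    and c4: "continuous_on {0..1} (\<lambda>y. - 1 / (y + d)\<^sup>2 / 2)"
    using d by (auto intro!: continuous_intros)
  note i1 = integrable_comp_Y_mult[OF c2 st Z \<beta>_measurable drift_integrable[OF st]]
  note i2 = integrable_comp_Y_mult[OF c4 st Z \<gamma>_measurable bracket_integrable[OF st]]
  have eq: "(\<lambda>(\<omega>, r). Z \<omega> * (indicator {s<..t} r * (- \<beta> r \<omega> / (Y r \<omega> + d) + \<gamma> r \<omega> / (2 * (Y r \<omega> + d)\<^sup>2)))) =
    (\<lambda>x. - ((case x of (\<omega>, r) \<Rightarrow> Z \<omega> * (indicator {s<..t} r * (1 / (Y r \<omega> + d) * \<beta> r \<omega>))) +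
       (case x of (\<omega>, r) \<Rightarrow> Z \<omega> * (indicator {s<..t} r * (- 1 / (Y r \<omega> + d)\<^sup>2 / 2 * \<gamma> r \<omega>)))))"
    by (auto simp: fun_eq_iff algebra_simps)
  show "integrable (M \<Otimes>\<^sub>M lborel)
      (\<lambda>(\<omega>, r). Z \<omega> * (indicator {s<..t} r * (- \<beta> r \<omega> / (Y r \<omega> + d) + \<gamma> r \<omega> / (2 * (Y r \<omega> + d)\<^sup>2))))"
    unfolding eq using i1 i2 by (intro integrable_minus Bochner_Integration.integrable_add)
  have "expectation (\<lambda>\<omega>. Z \<omega> * (- ln (Y t \<omega> + d) - - ln (Y s \<omega> + d))) =
    expectation (\<lambda>\<omega>. - (Z \<omega> * (ln (Y t \<omega> + d) - ln (Y s \<omega> + d))))"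
    by (intro Bochner_Integration.integral_cong refl) (simp add: algebra_simps)
  also have "\<dots> = - expectation (\<lambda>\<omega>. Z \<omega> * (ln (Y t \<omega> + d) - ln (Y s \<omega> + d)))"
    by (rule integral_minus)
  also have "expectation (\<lambda>\<omega>. Z \<omega> * (ln (Y t \<omega> + d) - ln (Y s \<omega> + d))) =
    (\<integral>(\<omega>, r). Z \<omega> * (indicator {s<..t} r * (1 / (Y r \<omega> + d) * \<beta> r \<omega>)) \<partial>(M \<Otimes>\<^sub>M lborel)) +
    (\<integral>(\<omega>, r). Z \<omega> * (indicator {s<..t} r * (- 1 / (Y r \<omega> + d)\<^sup>2 / 2 * \<gamma> r \<omega>)) \<partial>(M \<Otimes>\<^sub>M lborel))"
    by (rule ito_formula[OF st Z c1 c2 c3 ln_taylor_remainder[OF d]])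
  finally show "expectation (\<lambda>\<omega>. Z \<omega> * (- ln (Y t \<omega> + d) - - ln (Y s \<omega> + d))) =
      (\<integral>(\<omega>, r). Z \<omega> * (indicator {s<..t} r * (- \<beta> r \<omega> / (Y r \<omega> + d) + \<gamma> r \<omega> / (2 * (Y r \<omega> + d)\<^sup>2))) \<partial>(M \<Otimes>\<^sub>M lborel))"
    unfolding eq integral_minus using i1 i2 by (simp add: Bochner_Integration.integral_add)
qed

text \<open>Ito's formula for \<open>d ln (Y + d)\<close> with \<open>d \<rightarrow> 0\<close>: only the drift on \<open>{Y = 0}\<close> survives in the limit.\<close>

lemma zero_time_null:
  assumes t: "0 \<le> t"
    and \<gamma>Y: "\<And>r \<omega>. 0 \<le> r \<Longrightarrow> \<omega> \<in> space M \<Longrightarrow> \<bar>\<gamma> r \<omega>\<bar> \<le> \<kappa> * Y r \<omega>"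
    and pos: "\<And>r \<omega>. 0 \<le> r \<Longrightarrow> \<omega> \<in> space M \<Longrightarrow> Y r \<omega> = 0 \<Longrightarrow> 0 < \<beta> r \<omega>"
  shows "AE (\<omega>, r) in M \<Otimes>\<^sub>M lborel. r \<in> {0<..t} \<longrightarrow> Y r \<omega> \<noteq> 0"
proof -
  define d where "d n = 1 / real (Suc n)" for n
  have d: "0 < d n" "d n \<le> 1" for n by (auto simp: d_def)
  have dlim: "d \<longlonglongrightarrow> 0" unfolding d_def by (rule LIMSEQ_Suc) (rule lim_1_over_n)
  define h where "h n = (\<lambda>(\<omega>, r). d n * (indicator {0<..t} r *
    (- \<beta> r \<omega> / (Y r \<omega> + d n) + \<gamma> r \<omega> / (2 * (Y r \<omega> + d n)\<^sup>2))))" for n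
  define h' where "h' = (\<lambda>(\<omega>, r). indicator {0<..t} r * (if Y r \<omega> = 0 then - \<beta> r \<omega> else 0))"
  define w where "w = (\<lambda>x. \<bar>case x of (\<omega>, r) \<Rightarrow> indicator {0<..t} r * \<beta> r \<omega>\<bar> +
    (case x of (\<omega>, r) \<Rightarrow> \<bar>\<kappa>\<bar> * indicator {0<..t} r))"
  note \<beta>_measurable[measurable] \<gamma>_measurable[measurable]
  have hi: "integrable (M \<Otimes>\<^sub>M lborel) (h n)" for n
    unfolding h_def by (rule integrable_neg_log[OF d(1) order_refl t multiplier_const])
  then have hm: "h n \<in> borel_measurable (M \<Otimes>\<^sub>M lborel)" for n by auto
  have wi: "integrable (M \<Otimes>\<^sub>M lborel) w"
    unfolding w_def
    using drift_integrable[OF order_refl t] integrable_product_indicator[of "\<lambda>_. \<bar>\<kappa>\<bar>" "{0<..t}"] t by simp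
  have lim: "(\<lambda>n. h n x) \<longlonglongrightarrow> h' x" if xs: "x \<in> space (M \<Otimes>\<^sub>M lborel)" for x
  proof -
    obtain \<omega> r where x: "x = (\<omega>, r)" "\<omega> \<in> space M" using xs by (auto simp: space_pair_measure)
    show ?thesis
    proof (cases "r \<in> {0<..t}")
      case True
      then have r: "0 \<le> r" by auto
      show ?thesis
      proof (cases "Y r \<omega> = 0")
        case Y0: True
        \<comment> \<open>The bracket vanishes together with Y, so at a zero there is no
          second-order term for any d, and the drift term is exactly -\<beta> because d / (0 + d) =
          1.\<close>
        then have "\<gamma> r \<omega> = 0" using \<gamma>Y[OF r x(2)] by simp
        then have "h n x = h' x" for n using d(1)[of n] True Y0 by (simp add: h_def h'_def x)
        then show ?thesis by simp
      next
        case False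
        have "(\<lambda>n. d n * (- \<beta> r \<omega> / (Y r \<omega> + d n) + \<gamma> r \<omega> / (2 * (Y r \<omega> + d n)\<^sup>2)))
          \<longlonglongrightarrow> 0 * (- \<beta> r \<omega> / (Y r \<omega> + 0) + \<gamma> r \<omega> / (2 * (Y r \<omega> + 0)\<^sup>2))"
          by (intro tendsto_intros dlim) (use False in auto)
        then show ?thesis using True False by (simp add: h_def h'_def x)
      qed
    qed (simp add: h_def h'_def x)
  qed
  have h'm [measurable]: "h' \<in> borel_measurable (M \<Otimes>\<^sub>M lborel)"
    by (rule borel_measurable_LIMSEQ_real[OF lim hm])
  have hb: "norm (h n x) \<le> w x" if xs: "x \<in> space (M \<Otimes>\<^sub>M lborel)" for x n
  proof -
    obtain \<omega> r where x: "x = (\<omega>, r)" "\<omega> \<in> space M" using xs by (auto simp: space_pair_measure)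
    show ?thesis
    proof (cases "r \<in> {0<..t}")
      case True
      then have r: "0 \<le> r" by auto
      define y where "y = Y r \<omega>"
      have y: "0 \<le> y" using Y_range[OF r x(2)] by (simp add: y_def)
      have yd: "0 < y + d n" using y d(1)[of n] by linarith
      have "d n * \<bar>\<beta> r \<omega>\<bar> / (y + d n) \<le> \<bar>\<beta> r \<omega>\<bar>"
        using yd y d(1)[of n] by (simp add: field_simps)
      \<comment> \<open>Without the bound of \<gamma> by a multiple of Y this term would be of order
        1 / d near zeros.\<close>
      moreover have "d n * \<bar>\<gamma> r \<omega>\<bar> / (2 * (y + d n)\<^sup>2) \<le> \<bar>\<kappa>\<bar>"
      proof -
        have "d n * \<bar>\<gamma> r \<omega>\<bar> \<le> d n * (\<bar>\<kappa>\<bar> * y)"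
          using \<gamma>Y[OF r x(2)] y d(1)[of n] order_trans[OF _ mult_right_mono[OF abs_ge_self[of \<kappa>] y]]
          by (intro mult_left_mono) (auto simp: y_def)
        also have "\<dots> = \<bar>\<kappa>\<bar> * (d n * y)" by simp
        also have "\<dots> \<le> \<bar>\<kappa>\<bar> * (2 * (y + d n)\<^sup>2)"
          using y d(1)[of n] by (intro mult_left_mono) (auto simp: power2_eq_square algebra_simps)
        finally show ?thesis using yd by (simp add: divide_le_eq)
      qed
      moreover have "\<bar>h n x\<bar> \<le> d n * \<bar>\<beta> r \<omega>\<bar> / (y + d n) + d n * \<bar>\<gamma> r \<omega>\<bar> / (2 * (y + d n)\<^sup>2)"
      proof -
        have "h n x = - (d n * \<beta> r \<omega> / (y + d n)) + d n * \<gamma> r \<omega> / (2 * (y + d n)\<^sup>2)"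
          using True by (simp add: h_def x y_def algebra_simps)
        also have "\<bar>\<dots>\<bar> \<le> \<bar>d n * \<beta> r \<omega> / (y + d n)\<bar> + \<bar>d n * \<gamma> r \<omega> / (2 * (y + d n)\<^sup>2)\<bar>"
          by (metis abs_minus_cancel abs_triangle_ineq)
        finally show ?thesis using yd d(1)[of n] by (simp add: abs_mult)
      qed
      ultimately show ?thesis using True by (simp add: w_def x)
    qed (simp add: h_def w_def x)
  qed
  have h'i: "integrable (M \<Otimes>\<^sub>M lborel) h'"
    and conv: "(\<lambda>n. integral\<^sup>L (M \<Otimes>\<^sub>M lborel) (h n)) \<longlonglongrightarrow> integral\<^sup>L (M \<Otimes>\<^sub>M lborel) h'"
    using integrable_dominated_convergence[OF h'm hm wi AE_I2[OF lim] AE_I2[OF hb]]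
      integral_dominated_convergence[OF h'm hm wi AE_I2[OF lim] AE_I2[OF hb]] by auto
  have "(\<lambda>n. integral\<^sup>L (M \<Otimes>\<^sub>M lborel) (h n)) \<longlonglongrightarrow> 0"
  proof (rule Lim_null_comparison)
    \<comment> \<open>The values at the two ends contribute at most d (ln (1 + d) - ln d), where ln
      (1 + d) \<le> d and - ln d = 2 ln (1 / sqrt d) \<le> 2 / sqrt d.\<close>
    show "(\<lambda>n. d n * d n + 2 * sqrt (d n)) \<longlonglongrightarrow> 0"
      using tendsto_add[OF tendsto_mult[OF dlim dlim] tendsto_mult[OF tendsto_const[of 2] tendsto_real_sqrt[OF dlim]]] by simp
    show "eventually (\<lambda>n. norm (integral\<^sup>L (M \<Otimes>\<^sub>M lborel) (h n)) \<le> d n * d n + 2 * sqrt (d n)) sequentially"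
    proof (intro always_eventually allI)
      fix n
      have e: "integral\<^sup>L (M \<Otimes>\<^sub>M lborel) (h n) = expectation (\<lambda>\<omega>. d n * (- ln (Y t \<omega> + d n) - - ln (Y 0 \<omega> + d n)))"
        unfolding h_def by (rule expectation_neg_log[OF d(1) order_refl t multiplier_const, symmetric])
      have b: "\<bar>d n * (- ln (Y t \<omega> + d n) - - ln (Y 0 \<omega> + d n))\<bar> \<le> d n * d n + 2 * sqrt (d n)"
        if w: "\<omega> \<in> space M" for \<omega>
      proof -
        have r: "ln (d n) \<le> ln (y + d n)" "ln (y + d n) \<le> ln (1 + d n)" if "y \<in> {0..1}" for y
          using that d(1)[of n] by auto
        have 1: "\<bar>- ln (Y t \<omega> + d n) - - ln (Y 0 \<omega> + d n)\<bar> \<le> ln (1 + d n) - ln (d n)"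
          using r[OF Y_range[OF t w]] r[OF Y_range[OF order_refl w]] by linarith
        have 2: "ln (1 + d n) \<le> d n" using d(1)[of n] ln_add_one_self_le_self by simp
        have "- ln (d n) = 2 * ln (1 / sqrt (d n))" using d(1)[of n] by (simp add: ln_div ln_sqrt)
        also have "\<dots> \<le> 2 * (1 / sqrt (d n))"
          using d(1)[of n] ln_le_minus_one[of "1 / sqrt (d n)"] by simp
        finally have "\<bar>- ln (Y t \<omega> + d n) - - ln (Y 0 \<omega> + d n)\<bar> \<le> d n + 2 / sqrt (d n)"
          using 1 2 by simp
        then have "d n * \<bar>- ln (Y t \<omega> + d n) - - ln (Y 0 \<omega> + d n)\<bar> \<le> d n * (d n + 2 / sqrt (d n))"
          using d(1)[of n] by (intro mult_left_mono) auto
        also have "\<dots> = d n * d n + 2 * (d n / sqrt (d n))" by (simp add: algebra_simps)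
        also have "d n / sqrt (d n) = sqrt (d n)" using d(1)[of n] by (simp add: real_div_sqrt)
        finally show ?thesis using d(1)[of n] by (simp add: abs_mult)
      qed
      have "norm (integral\<^sup>L (M \<Otimes>\<^sub>M lborel) (h n)) \<le> expectation (\<lambda>\<omega>. \<bar>d n * (- ln (Y t \<omega> + d n) - - ln (Y 0 \<omega> + d n))\<bar>)"
        unfolding e real_norm_def by (rule integral_abs_bound)
      also have "\<dots> \<le> expectation (\<lambda>\<omega>. d n * d n + 2 * sqrt (d n))"
      proof (rule integral_mono)
        show "integrable M (\<lambda>\<omega>. \<bar>d n * (- ln (Y t \<omega> + d n) - - ln (Y 0 \<omega> + d n))\<bar>)"
          by (rule integrable_const_bound[where B = "d n * d n + 2 * sqrt (d n)"])
            (use b Y_measurable t in auto)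
      qed (use b in auto)
      also have "\<dots> = d n * d n + 2 * sqrt (d n)" by (simp add: prob_space)
      finally show "norm (integral\<^sup>L (M \<Otimes>\<^sub>M lborel) (h n)) \<le> d n * d n + 2 * sqrt (d n)" .
    qed
  qed
  with conv have "integral\<^sup>L (M \<Otimes>\<^sub>M lborel) h' = 0" using LIMSEQ_unique by blast
  \<comment> \<open>As the drift is positive at zeros, -h' is nonnegative; its integral being 0, it
    vanishes almost everywhere, and so does the set of zeros up to a null set.\<close>
  then have "integral\<^sup>L (M \<Otimes>\<^sub>M lborel) (\<lambda>x. - h' x) = 0" by simp
  moreover have "0 \<le> - h' x" if xs: "x \<in> space (M \<Otimes>\<^sub>M lborel)" for x
  proof -
    obtain \<omega> r where x: "x = (\<omega>, r)" "\<omega> \<in> space M" using xs by (auto simp: space_pair_measure)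
    show ?thesis using pos[OF _ x(2), of r] by (auto simp: h'_def x indicator_def less_imp_le)
  qed
  ultimately have "AE x in M \<Otimes>\<^sub>M lborel. - h' x = 0"
    using integral_nonneg_eq_0_iff_AE[of "M \<Otimes>\<^sub>M lborel" "\<lambda>x. - h' x"] h'i by (auto intro: AE_I2)
  then show ?thesis
    using AE_space
  proof eventually_elim
    case (elim x)
    obtain \<omega> r where x: "x = (\<omega>, r)" "\<omega> \<in> space M" using elim(2) by (auto simp: space_pair_measure)
    show ?case using elim(1) pos[OF _ x(2), of r] by (auto simp: h'_def x split: if_splits)
  qed
qed

end

section \<open>Non-attainment of zero\<close>

text \<open>Supplies good starting times arbitrarily close to 0, because time 0 itself may be a bad
  one.\<close>

lemma AE_lborel_exists_small:
  assumes "AE r in lborel. 0 < r \<longrightarrow> Q r" and "0 < (e::real)"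
  shows "\<exists>r. 0 < r \<and> r < e \<and> Q r"
proof (rule ccontr)
  assume "\<not> ?thesis"
  then have n: "\<not> Q r" if "r \<in> {0<..<e}" for r using that by auto
  obtain N where N: "N \<in> null_sets lborel" "{r \<in> space lborel. \<not> (0 < r \<longrightarrow> Q r)} \<subseteq> N"
    using assms(1) by (auto simp: eventually_ae_filter)
  have "{0<..<e} \<subseteq> N" using n N(2) by auto
  then have "emeasure lborel {0<..<e} \<le> emeasure lborel N" using N(1) by (intro emeasure_mono) auto
  also have "\<dots> = 0" using N(1) by auto
  finally show False using assms(2) by simp
qed

context filtered_prob
begin

lemma multiplier_indicator: "A \<in> sets (F s) \<Longrightarrow> multiplier s (indicator A)"
  unfolding multiplier_def by (intro conjI exI[of _ 1]) (auto simp: indicator_def)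

lemma multiplier_add: "multiplier s Y \<Longrightarrow> multiplier s Z \<Longrightarrow> multiplier s (\<lambda>\<omega>. Y \<omega> + Z \<omega>)"
proof -
  assume Y: "multiplier s Y" and Z: "multiplier s Z"
  then obtain C D where "\<And>\<omega>. \<omega> \<in> space M \<Longrightarrow> \<bar>Y \<omega>\<bar> \<le> C" "\<And>\<omega>. \<omega> \<in> space M \<Longrightarrow> \<bar>Z \<omega>\<bar> \<le> D"
    unfolding multiplier_def by blast
  then have "\<bar>Y \<omega> + Z \<omega>\<bar> \<le> C + D" if "\<omega> \<in> space M" for \<omega>
    using that by (intro order_trans[OF abs_triangle_ineq] add_mono) auto
  then show ?thesis using Y Z unfolding multiplier_def by auto
qed

text \<open>Doob's inequality for a nonnegative supermartingale at finitely many times, restricted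
  to an event A known at the start. The argument decomposes according to whether the level L has
  been reached yet: \<open>H k\<close> if so by step k, \<open>B k\<close> if not.\<close>

lemma maximal_inequality:
  fixes U :: "nat \<Rightarrow> 'w \<Rightarrow> real" and u :: "nat \<Rightarrow> real"
  assumes u: "0 \<le> u 0" "\<And>k. u k \<le> u (Suc k)"
    and U: "\<And>k. multiplier (u k) (U k)" "\<And>k \<omega>. k \<le> n \<Longrightarrow> \<omega> \<in> space M \<Longrightarrow> 0 \<le> U k \<omega>"
    and super: "\<And>k B. k < n \<Longrightarrow> B \<in> sets (F (u k)) \<Longrightarrow> expectation (\<lambda>\<omega>. indicator B \<omega> * (U (Suc k) \<omega> - U k \<omega>)) \<le> 0"
    and A: "A \<in> sets (F (u 0))" and L: "0 \<le> L"
  shows "L * prob {\<omega> \<in> A. \<exists>k\<le>n. L \<le> U k \<omega>} \<le> expectation (\<lambda>\<omega>. indicator A \<omega> * U 0 \<omega>)"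
proof -
  have u0: "0 \<le> u k" for k by (induction k) (use u in \<open>auto intro: order_trans\<close>)
  have um: "u j \<le> u k" if "j \<le> k" for j k by (rule lift_Suc_mono_le[of u]) (use u(2) that in auto)
  define B where "B k = {\<omega> \<in> A. \<forall>j\<le>k. U j \<omega> < L}" for k
  define H where "H k = {\<omega> \<in> A. \<exists>j\<le>k. L \<le> U j \<omega>}" for k
  have AM: "A \<subseteq> space M" using sets.sets_into_space[OF A] u(1) by simp
  have UF: "U j \<in> borel_measurable (F (u k))" if "j \<le> k" for j k
    by (rule adapted_mono[OF _ u0 um[OF that]]) (use U(1)[of j] in \<open>simp add: multiplier_def\<close>)
  have AF: "A \<in> sets (F (u k))" for k using A filtration_mono[OF u(1) um[of 0 k]] by auto
  have BF: "B k \<in> sets (F (u k))" for k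
  proof -
    have "B k = {\<omega> \<in> space (F (u k)). \<omega> \<in> A \<and> (\<forall>j\<in>{..k}. U j \<omega> < L)}"
      using AM u0[of k] by (auto simp: B_def)
    also have "\<dots> \<in> sets (F (u k))"
    proof (intro sets.sets_Collect_conj sets.sets_Collect_finite_All)
      show "{\<omega> \<in> space (F (u k)). \<omega> \<in> A} \<in> sets (F (u k))"
        using AF[of k] sets.sets_into_space[OF AF[of k]] by (simp add: Int_absorb1 Int_def[symmetric] Collect_conj_eq)
      show "{\<omega> \<in> space (F (u k)). U j \<omega> < L} \<in> sets (F (u k))" if "j \<in> {..k}" for j
      proof -
        have "U j \<in> borel_measurable (F (u k))" using UF that by simp
        then show ?thesis by measurable
      qed
    qed auto
    finally show ?thesis .
  qed
  have HF: "H k \<in> sets (F (u k))" for k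
  proof -
    have "H k = A - B k" by (auto simp: H_def B_def not_less)
    then show ?thesis using AF BF by auto
  qed
  have toM: "S \<in> sets M" if "S \<in> sets (F (u k))" for S k
    using that subalg[OF u0[of k]] by (auto simp: subalgebra_def)
  have [measurable]: "A \<in> sets M" "B k \<in> sets M" "H k \<in> sets M" for k
    using toM AF BF HF by blast+
  have iU: "integrable M (U k)" for k using integrable_multiplier[OF U(1) u0] .
  have iBU: "integrable M (\<lambda>\<omega>. indicator (B j) \<omega> * U k \<omega>)" for j k
    by (rule integrable_multiplier_mult[OF multiplier_indicator[OF BF] u0 iU])
  have iH: "integrable M (indicator (H k) :: 'w \<Rightarrow> real)" for k
    by (rule integrable_multiplier[OF multiplier_indicator[OF HF] u0])
  have iLH: "integrable M (\<lambda>\<omega>. L * indicator (H k) \<omega>)" for k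
    using iH[of k] by simp
  have eL: "expectation (\<lambda>\<omega>. L * indicator (H k) \<omega>) = L * prob (H k)" for k
    by simp
  \<comment> \<open>The invariant books L for the paths that have reached the level and the current
    value of U for the others.\<close>
  have main: "L * prob (H k) + expectation (\<lambda>\<omega>. indicator (B k) \<omega> * U k \<omega>) \<le> expectation (\<lambda>\<omega>. indicator A \<omega> * U 0 \<omega>)"
    if "k \<le> n" for k
    using that
  proof (induction k)
    case 0
    have "L * prob (H 0) + expectation (\<lambda>\<omega>. indicator (B 0) \<omega> * U 0 \<omega>) =
      expectation (\<lambda>\<omega>. L * indicator (H 0) \<omega> + indicator (B 0) \<omega> * U 0 \<omega>)"
      by (simp only: Bochner_Integration.integral_add[OF iLH iBU] eL)
    also have "\<dots> \<le> expectation (\<lambda>\<omega>. indicator A \<omega> * U 0 \<omega>)"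
    proof (rule integral_mono)
      show "integrable M (\<lambda>\<omega>. indicator A \<omega> * U 0 \<omega>)"
        by (rule integrable_multiplier_mult[OF multiplier_indicator[OF A] u(1) iU])
      show "integrable M (\<lambda>\<omega>. L * indicator (H 0) \<omega> + indicator (B 0) \<omega> * U 0 \<omega>)"
        by (intro Bochner_Integration.integrable_add iLH iBU)
      show "L * indicator (H 0) \<omega> + indicator (B 0) \<omega> * U 0 \<omega> \<le> indicator A \<omega> * U 0 \<omega>" for \<omega>
        by (cases "\<omega> \<in> A"; cases "L \<le> U 0 \<omega>") (simp_all add: H_def B_def)
    qed
    finally show ?case .
  next
    case (Suc k)
    have "L * prob (H (Suc k)) + expectation (\<lambda>\<omega>. indicator (B (Suc k)) \<omega> * U (Suc k) \<omega>) =
      expectation (\<lambda>\<omega>. L * indicator (H (Suc k)) \<omega> + indicator (B (Suc k)) \<omega> * U (Suc k) \<omega>)"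
      by (simp only: Bochner_Integration.integral_add[OF iLH iBU] eL)
    \<comment> \<open>A path that reaches the level exactly at step k + 1 has U at least L there, so
      booking L in place of U only lowers the sum.\<close>
    also have "\<dots> \<le> expectation (\<lambda>\<omega>. L * indicator (H k) \<omega> + indicator (B k) \<omega> * U (Suc k) \<omega>)"
    proof (rule integral_mono)
      fix \<omega> assume w: "\<omega> \<in> space M"
      have Hs: "\<omega> \<in> H (Suc k) \<longleftrightarrow> \<omega> \<in> H k \<or> (\<omega> \<in> A \<and> L \<le> U (Suc k) \<omega>)"
        unfolding H_def le_Suc_eq by blast
      have Bs: "\<omega> \<in> B j \<longleftrightarrow> \<omega> \<in> A \<and> \<omega> \<notin> H j" for j
        unfolding B_def H_def mem_Collect_eq not_le[symmetric] by blast
      have "\<omega> \<in> H k \<Longrightarrow> \<omega> \<in> A" unfolding H_def by blast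
      then show "L * indicator (H (Suc k)) \<omega> + indicator (B (Suc k)) \<omega> * U (Suc k) \<omega>
         \<le> L * indicator (H k) \<omega> + indicator (B k) \<omega> * U (Suc k) \<omega>"
        unfolding indicator_def Bs Hs
        by (cases "\<omega> \<in> A"; cases "\<omega> \<in> H k"; cases "L \<le> U (Suc k) \<omega>") simp_all
    qed (intro Bochner_Integration.integrable_add iLH iBU)+
    also have "\<dots> = L * prob (H k) + expectation (\<lambda>\<omega>. indicator (B k) \<omega> * U (Suc k) \<omega>)"
      by (simp only: Bochner_Integration.integral_add[OF iLH iBU] eL)
    \<comment> \<open>\<open>B k\<close> belongs to the past of \<open>u k\<close>, so the
      supermartingale hypothesis applies on it.\<close>
    also have "expectation (\<lambda>\<omega>. indicator (B k) \<omega> * U (Suc k) \<omega>) \<le> expectation (\<lambda>\<omega>. indicator (B k) \<omega> * U k \<omega>)"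
      using super[of k "B k"] BF Suc iBU by (simp add: right_diff_distrib)
    finally show ?case using Suc by simp
  qed
  have "0 \<le> expectation (\<lambda>\<omega>. indicator (B n) \<omega> * U n \<omega>)"
    using U(2) by (intro Bochner_Integration.integral_nonneg) (auto simp: indicator_def)
  with main[of n] show ?thesis by (simp add: H_def)
qed

text \<open>The family is treated as a whole, since only the sum of the logarithms has a bounded
  generator. The constant C must not depend on d: this is what lets the estimate survive the limit d
  \<rightarrow> 0. The hypothesis \<open>positive\<close> provides starting times, from which
  positivity is then propagated.\<close>

lemma nonhitting:
  fixes Y N \<beta> \<gamma> :: "'i \<Rightarrow> real \<Rightarrow> 'w \<Rightarrow> real"
  assumes P: "finite P"
    and ito: "\<And>a. a \<in> P \<Longrightarrow> scalar_ito M F (Y a) (N a) (\<beta> a) (\<gamma> a) (\<Gamma> a) (K a)"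
    and generator: "\<And>d. 0 < d \<Longrightarrow> d \<le> 1 \<Longrightarrow> AE (\<omega>, r) in M \<Otimes>\<^sub>M lborel. 0 < r \<longrightarrow>
      (\<Sum>a\<in>P. - \<beta> a r \<omega> / (Y a r \<omega> + d) + \<gamma> a r \<omega> / (2 * (Y a r \<omega> + d)\<^sup>2)) \<le> C"
    and C: "0 \<le> C"
    and positive: "AE r in lborel. 0 < r \<longrightarrow> (AE \<omega> in M. \<forall>a\<in>P. 0 < Y a r \<omega>)"
  shows "AE \<omega> in M. \<forall>t>0. \<forall>a\<in>P. 0 < Y a t \<omega>"
proof -
  have range: "0 \<le> Y a t \<omega>" "Y a t \<omega> \<le> 1" if "a \<in> P" "0 \<le> t" "\<omega> \<in> space M" for a t \<omega>
    using scalar_ito.Y_range[OF ito[OF that(1)] that(2,3)] by auto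
  define G where "G d t \<omega> = (\<Sum>a\<in>P. - ln (Y a t \<omega> + d))" for d t \<omega>
  have superm: "expectation (\<lambda>\<omega>. Z \<omega> * (G d t \<omega> - G d s \<omega>)) \<le> C * (t - s) * expectation Z"
    if d: "0 < d" "d \<le> 1" and st: "0 \<le> s" "s \<le> t" and Z: "multiplier s Z" "\<And>\<omega>. \<omega> \<in> space M \<Longrightarrow> 0 \<le> Z \<omega>" for d s t Z
  proof -
    let ?D = "\<lambda>a (\<omega>, r). Z \<omega> * (indicator {s<..t} r * (- \<beta> a r \<omega> / (Y a r \<omega> + d) + \<gamma> a r \<omega> / (2 * (Y a r \<omega> + d)\<^sup>2)))"
    have i: "integrable (M \<Otimes>\<^sub>M lborel) (?D a)" if "a \<in> P" for a
      using scalar_ito.integrable_neg_log[OF ito[OF that] d(1) st Z(1)] .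
    have iC: "integrable (M \<Otimes>\<^sub>M lborel) (\<lambda>(\<omega>, r). (C * Z \<omega>) * indicator {s<..t} r)"
      using integrable_multiplier[OF Z(1) st(1)] st by (intro integrable_product_indicator) auto
    have log_mult: "integrable M (\<lambda>\<omega>. Z \<omega> * (- ln (Y a t \<omega> + d) - - ln (Y a s \<omega> + d)))" if "a \<in> P" for a
    proof -
      interpret scalar_ito M F "Y a" "N a" "\<beta> a" "\<gamma> a" "\<Gamma> a" "K a" by (rule ito[OF that])
      have c: "continuous_on {0..1} (\<lambda>y. - ln (y + d))" using d by (auto intro!: continuous_intros)
      show ?thesis
        using integrable_multiplier[OF multiplier_comp_Y[OF c]] st by (intro integrable_multiplier_mult[OF Z(1)]) auto
    qed
    have "expectation (\<lambda>\<omega>. Z \<omega> * (G d t \<omega> - G d s \<omega>)) =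
      expectation (\<lambda>\<omega>. \<Sum>a\<in>P. Z \<omega> * (- ln (Y a t \<omega> + d) - - ln (Y a s \<omega> + d)))"
      unfolding G_def by (simp only: sum_subtractf[symmetric] sum_distrib_left)
    also have "\<dots> = (\<Sum>a\<in>P. expectation (\<lambda>\<omega>. Z \<omega> * (- ln (Y a t \<omega> + d) - - ln (Y a s \<omega> + d))))"
      by (rule Bochner_Integration.integral_sum) (rule log_mult)
    also have "\<dots> = (\<Sum>a\<in>P. integral\<^sup>L (M \<Otimes>\<^sub>M lborel) (?D a))"
      using scalar_ito.expectation_neg_log[OF ito d(1) st Z(1)] by (intro sum.cong refl)
    also have "\<dots> = (\<integral>x. (\<Sum>a\<in>P. ?D a x) \<partial>(M \<Otimes>\<^sub>M lborel))"
      by (rule Bochner_Integration.integral_sum[symmetric]) (rule i)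
    \<comment> \<open>Z \<ge> 0 is used here, as the generator bound is one-sided.\<close>
    also have "\<dots> \<le> (\<integral>x. (case x of (\<omega>, r) \<Rightarrow> (C * Z \<omega>) * indicator {s<..t} r) \<partial>(M \<Otimes>\<^sub>M lborel))"
    proof (rule integral_mono_AE)
      show "integrable (M \<Otimes>\<^sub>M lborel) (\<lambda>x. \<Sum>a\<in>P. ?D a x)" using i by (intro Bochner_Integration.integrable_sum)
      show "AE x in M \<Otimes>\<^sub>M lborel. (\<Sum>a\<in>P. ?D a x) \<le> (case x of (\<omega>, r) \<Rightarrow> (C * Z \<omega>) * indicator {s<..t} r)"
        using generator[OF d] AE_space
      proof eventually_elim
        case (elim x)
        obtain \<omega> r where x: "x = (\<omega>, r)" "\<omega> \<in> space M" using elim(2) by (auto simp: space_pair_measure)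
        have "(\<Sum>a\<in>P. ?D a x) = Z \<omega> * indicator {s<..t} r *
          (\<Sum>a\<in>P. - \<beta> a r \<omega> / (Y a r \<omega> + d) + \<gamma> a r \<omega> / (2 * (Y a r \<omega> + d)\<^sup>2))"
          unfolding x prod.case sum_distrib_left by (simp only: mult.assoc)
        also have "\<dots> \<le> Z \<omega> * indicator {s<..t} r * C"
        proof (cases "r \<in> {s<..t}")
          case True
          then have "0 < r" using st by auto
          then show ?thesis using elim(1) Z(2)[OF x(2)] unfolding x by (intro mult_left_mono) auto
        qed simp
        finally show ?case unfolding x by (simp add: mult_ac)
      qed
    qed (rule iC)
    also have "\<dots> = expectation (\<lambda>\<omega>. C * Z \<omega>) * measure lborel {s<..t}"
      using integrable_multiplier[OF Z(1) st(1)] st by (intro integral_product_indicator) auto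
    also have "\<dots> = C * (t - s) * expectation Z" using st by simp
    finally show ?thesis .
  qed
  \<comment> \<open>A lower bound \<eta> at the starting time keeps the initial logarithms bounded
    independently of d.\<close>
  have step: "AE \<omega> in M. (\<forall>a\<in>P. \<eta> \<le> Y a s \<omega>) \<longrightarrow> (\<forall>t\<in>{s..T}. \<forall>a\<in>P. 0 < Y a t \<omega>)"
    if s: "0 \<le> s" "s < T" and \<eta>: "0 < \<eta>" for s T \<eta>
  proof -
    define A where "A = {\<omega> \<in> space M. \<forall>a\<in>P. \<eta> \<le> Y a s \<omega>}"
    have AF: "A \<in> sets (F s)"
    proof -
      have "A = {\<omega> \<in> space (F s). \<forall>a\<in>P. \<eta> \<le> Y a s \<omega>}" using s by (simp add: A_def)
      also have "\<dots> \<in> sets (F s)"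
        using scalar_ito.Y_adapted[OF ito s(1)] by (intro sets.sets_Collect_finite_All P) measurable
      finally show ?thesis .
    qed
    have AM [measurable]: "A \<in> sets M" using AF subalg[OF s(1)] by (auto simp: subalgebra_def)
    define c where "c = real (card P)"
    \<comment> \<open>Adding \<open>c * ln 2\<close> makes the logarithms nonnegative, because Y + d
      \<le> 2; \<open>C * (T - t)\<close> compensates the growth allowed by the generator bound and
      stays nonnegative up to T.\<close>
    define U where "U d t \<omega> = G d t \<omega> + c * ln 2 + C * (T - t)" for d t \<omega>
    have U_terms: "U d t \<omega> = (\<Sum>a\<in>P. ln 2 - ln (Y a t \<omega> + d)) + C * (T - t)" for d t \<omega>
      by (simp add: U_def G_def c_def sum_subtractf sum_negf)
    have term_nonneg: "0 \<le> ln 2 - ln (Y a t \<omega> + d)" if "a \<in> P" "0 \<le> t" "\<omega> \<in> space M" "0 < d" "d \<le> 1" for a t \<omega> d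
      using range[OF that(1-3)] that(4,5) by simp
    \<comment> \<open>Bounds U at time s on the event A without reference to d.\<close>
    define K0 where "K0 = c * (ln 2 - ln \<eta>) + C * (T - s)"
    have K0: "expectation (\<lambda>\<omega>. indicator A \<omega> * U d s \<omega>) \<le> \<bar>K0\<bar>" if d: "0 < d" "d \<le> 1" for d
    proof -
      have "expectation (\<lambda>\<omega>. indicator A \<omega> * U d s \<omega>) \<le> expectation (\<lambda>\<omega>. \<bar>K0\<bar>)"
      proof (rule integral_mono')
        fix \<omega> assume w: "\<omega> \<in> space M"
        show "indicator A \<omega> * U d s \<omega> \<le> \<bar>K0\<bar>"
        proof (cases "\<omega> \<in> A")
          case True
          have "(\<Sum>a\<in>P. ln 2 - ln (Y a s \<omega> + d)) \<le> (\<Sum>a\<in>P. ln 2 - ln \<eta>)"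
          proof (rule sum_mono)
            fix a assume "a \<in> P"
            then have "\<eta> \<le> Y a s \<omega> + d" using True d by (force simp: A_def)
            then show "ln 2 - ln (Y a s \<omega> + d) \<le> ln 2 - ln \<eta>" using \<eta> by simp
          qed
          also have "\<dots> = c * (ln 2 - ln \<eta>)" by (simp add: c_def)
          finally have "U d s \<omega> \<le> K0" unfolding U_terms K0_def by simp
          then show ?thesis using True by simp
        qed simp
      qed simp_all
      then show ?thesis by (simp add: prob_space)
    qed
    \<comment> \<open>The level is ln (1 / d). At a zero of some \<open>Y a\<close> the
      corresponding term alone equals ln 2 - ln d, which is strictly larger; the surplus ln 2 leaves
      room to move to a nearby grid point.\<close>
    define B where "B d n = {\<omega> \<in> A. \<exists>k\<le>Suc n. ln (1 / d) \<le> U d (grid s T n (min k (Suc n))) \<omega>}" for d n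
    have Um: "multiplier t (U d t)" if "0 \<le> t" "0 < d" for t d
    proof -
      have c: "continuous_on {0..1} (\<lambda>y. ln 2 - ln (y + d))" using that(2) by (auto intro!: continuous_intros)
      have "multiplier t (\<lambda>\<omega>. \<Sum>a\<in>P'. ln 2 - ln (Y a t \<omega> + d))" if "P' \<subseteq> P" for P'
        using finite_subset[OF that P] that
      proof (induction P' rule: finite_induct)
        case (insert a P')
        have "multiplier t (\<lambda>\<omega>. ln 2 - ln (Y a t \<omega> + d))"
          using scalar_ito.multiplier_comp_Y[OF ito c \<open>0 \<le> t\<close>] insert by simp
        then show ?case using insert by (simp add: multiplier_add)
      qed simp
      then show ?thesis unfolding U_terms by (intro multiplier_add multiplier_const) auto
    qed
    have sT: "s \<le> T" using s by simp
    have g: "0 \<le> grid s T n k" for n k using grid_lower[OF sT, of n k] s by linarith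
    have BM [measurable]: "B d n \<in> sets M" if "0 < d" for d n
    proof -
      have "B d n = {\<omega> \<in> space M. \<omega> \<in> A \<and> (\<exists>k\<in>{..Suc n}. ln (1 / d) \<le> U d (grid s T n (min k (Suc n))) \<omega>)}"
        by (auto simp: B_def A_def)
      also have "\<dots> \<in> sets M"
      proof (intro sets.sets_Collect_conj sets.sets_Collect_finite_Ex)
        show "{\<omega> \<in> space M. \<omega> \<in> A} \<in> sets M" by measurable
        show "{\<omega> \<in> space M. ln (1 / d) \<le> U d (grid s T n (min k (Suc n))) \<omega>} \<in> sets M" for k
          using multiplier_measurable[OF Um[OF g that] g] by measurable
      qed auto
      finally show ?thesis .
    qed
    have B_le: "ln (1 / d) * prob (B d n) \<le> \<bar>K0\<bar>" if d: "0 < d" "d \<le> 1" for d n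
    proof -
      let ?u = "\<lambda>k. grid s T n (min k (Suc n))"
      have "ln (1 / d) * prob {\<omega> \<in> A. \<exists>k\<le>Suc n. ln (1 / d) \<le> U d (?u k) \<omega>} \<le> expectation (\<lambda>\<omega>. indicator A \<omega> * U d (?u 0) \<omega>)"
      proof (rule maximal_inequality)
        show "0 \<le> ?u 0" by (rule g)
        show "?u k \<le> ?u (Suc k)" for k by (rule grid_mono[OF sT]) auto
        show "multiplier (?u k) (U d (?u k))" for k by (rule Um[OF g d(1)])
        show "A \<in> sets (F (?u 0))" using AF by simp
        show "0 \<le> ln (1 / d)" using d by simp
        show "0 \<le> U d (?u k) \<omega>" if "k \<le> Suc n" "\<omega> \<in> space M" for k \<omega>
          unfolding U_terms using term_nonneg[OF _ g that(2) d] C grid_upper[OF sT, of "min k (Suc n)" n]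
          by (intro add_nonneg_nonneg sum_nonneg mult_nonneg_nonneg) auto
        fix k E assume k: "k < Suc n" and E: "E \<in> sets (F (?u k))"
        have le: "?u k \<le> ?u (Suc k)" by (rule grid_mono[OF sT]) auto
        note mE = multiplier_indicator[OF E]
        have iE: "integrable M (indicator E :: _ \<Rightarrow> real)" by (rule integrable_multiplier[OF mE g])
        have iU: "integrable M (\<lambda>\<omega>. indicator E \<omega> * (U d (?u (Suc k)) \<omega> - U d (?u k) \<omega>))"
          by (intro integrable_multiplier_mult[OF mE g] Bochner_Integration.integrable_diff
              integrable_multiplier[OF Um[OF g d(1)] g])
        have "expectation (\<lambda>\<omega>. indicator E \<omega> * (G d (?u (Suc k)) \<omega> - G d (?u k) \<omega>)) =
          expectation (\<lambda>\<omega>. indicator E \<omega> * (U d (?u (Suc k)) \<omega> - U d (?u k) \<omega>) + C * (?u (Suc k) - ?u k) * indicator E \<omega>)"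
          by (intro Bochner_Integration.integral_cong refl) (simp add: U_def algebra_simps)
        also have "\<dots> = expectation (\<lambda>\<omega>. indicator E \<omega> * (U d (?u (Suc k)) \<omega> - U d (?u k) \<omega>)) +
          C * (?u (Suc k) - ?u k) * expectation (indicator E)"
          using iU iE by (subst Bochner_Integration.integral_add) auto
        finally show "expectation (\<lambda>\<omega>. indicator E \<omega> * (U d (?u (Suc k)) \<omega> - U d (?u k) \<omega>)) \<le> 0"
          using superm[OF d g le mE] by simp
      qed
      also have "\<dots> \<le> \<bar>K0\<bar>" using K0[OF d] by simp
      finally show ?thesis by (simp add: B_def)
    qed
    \<comment> \<open>The limit inferior over the grids replaces the event that a zero occurs in
      continuous time: it is visibly measurable, inherits the bound of the \<open>B d n\<close>, and
      contains every path of A with a zero in [s, T].\<close>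
    define E where "E d = (\<Union>n. \<Inter>j\<in>{n..}. B d j)" for d
    have EM [measurable]: "E d \<in> sets M" if "0 < d" for d
    proof -
      have "(\<Inter>j\<in>{n..}. B d j) \<in> sets M" for n using BM[OF that] by (intro sets.countable_INT) auto
      then show ?thesis unfolding E_def by (intro sets.countable_UN) auto
    qed
    have E_le: "ln (1 / d) * prob (E d) \<le> \<bar>K0\<bar>" if d: "0 < d" "d \<le> 1" for d
    proof -
      \<comment> \<open>The tail intersections increase with n, so continuity from below applies,
        and each is contained in one \<open>B d n\<close>.\<close>
      have "(\<lambda>n. prob (\<Inter>j\<in>{n..}. B d j)) \<longlonglongrightarrow> prob (E d)"
        unfolding E_def
      proof (rule finite_Lim_measure_incseq)
        show "range (\<lambda>n. \<Inter>j\<in>{n..}. B d j) \<subseteq> sets M" 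
          unfolding image_subset_iff using BM[OF d(1)] by (intro ballI sets.countable_INT) auto
        show "incseq (\<lambda>n. \<Inter>j\<in>{n..}. B d j)" by (auto simp: incseq_def)
      qed
      from tendsto_mult[OF tendsto_const this] have
        l: "(\<lambda>n. ln (1 / d) * prob (\<Inter>j\<in>{n..}. B d j)) \<longlonglongrightarrow> ln (1 / d) * prob (E d)" .
      have "ln (1 / d) * prob (\<Inter>j\<in>{n..}. B d j) \<le> \<bar>K0\<bar>" for n
      proof -
        have "prob (\<Inter>j\<in>{n..}. B d j) \<le> prob (B d n)" using BM[OF d(1)] by (intro finite_measure_mono) auto
        then have "ln (1 / d) * prob (\<Inter>j\<in>{n..}. B d j) \<le> ln (1 / d) * prob (B d n)"
          using d by (intro mult_left_mono) auto
        then show ?thesis using B_le[OF d, of n] by linarith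
      qed
      then show ?thesis by (intro LIMSEQ_le_const2[OF l]) auto
    qed
    have hit: "\<omega> \<in> E d" if w: "\<omega> \<in> A" and d: "0 < d" "d \<le> 1" and t: "t \<in> {s..T}" and a: "a \<in> P" "Y a t \<omega> = 0" for \<omega> d t a
    proof -
      have w': "\<omega> \<in> space M" using w by (simp add: A_def)
      have t0: "0 \<le> t" using t s by auto
      have "s \<noteq> t" using w a \<eta> by (force simp: A_def)
      then have t': "t \<in> {s<..T}" using t by auto
      have cont: "continuous_on {s..T} (\<lambda>t. U d t \<omega>)"
        unfolding U_terms
      proof (intro continuous_intros)
        fix a assume "a \<in> P"
        then show "continuous_on {s..T} (\<lambda>t. Y a t \<omega>)"
          using scalar_ito.Y_continuous[OF ito w'] by (rule_tac continuous_on_subset) (use s in auto)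
        show "\<forall>x\<in>{s..T}. Y a x \<omega> + d \<noteq> 0"
          using range(1)[OF \<open>a \<in> P\<close> _ w'] s d by (force simp: add_nonneg_eq_0_iff)
      qed
      have "ln (1 / d) < U d t \<omega>"
      proof -
        have "ln 2 - ln (Y a t \<omega> + d) \<le> (\<Sum>a\<in>P. ln 2 - ln (Y a t \<omega> + d))"
          by (rule member_le_sum[OF a(1)]) (use term_nonneg[OF _ t0 w' d] P in auto)
        also have "\<dots> \<le> U d t \<omega>" unfolding U_terms using C t by simp
        finally have "ln 2 - ln d \<le> U d t \<omega>" using a(2) by simp
        moreover have "0 < ln (2 :: real)" by simp
        moreover have "ln (1 / d) = - ln d" using d by (simp add: ln_div)
        ultimately show ?thesis by linarith
      qed
      \<comment> \<open>At t the step function takes the value of U at the last grid point strictly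
        before t. This requires s < t, which holds because at time s all components are at least
        \<eta>.\<close>
      moreover have "(\<lambda>n. \<Sum>k<Suc n. U d (grid s T n k) \<omega> * indicator {grid s T n k<..grid s T n (Suc k)} t)
        \<longlonglongrightarrow> U d t \<omega> * indicator {s<..T} t"
        by (rule grid_step_function_tendsto[OF cont sT])
      ultimately have "eventually (\<lambda>n. ln (1 / d) <
         (\<Sum>k<Suc n. U d (grid s T n k) \<omega> * indicator {grid s T n k<..grid s T n (Suc k)} t)) sequentially"
        using t' by (intro order_tendstoD(1)) auto
      then obtain n0 where n0: "\<And>n. n0 \<le> n \<Longrightarrow> ln (1 / d) <
         (\<Sum>k<Suc n. U d (grid s T n k) \<omega> * indicator {grid s T n k<..grid s T n (Suc k)} t)"
        unfolding eventually_sequentially by blast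
      have "\<omega> \<in> B d n" if "n0 \<le> n" for n
      proof (rule ccontr)
        assume "\<omega> \<notin> B d n"
        then have lt: "U d (grid s T n k) \<omega> < ln (1 / d)" if "k < Suc n" for k
        proof -
          have "\<not> (\<exists>k\<le>Suc n. ln (1 / d) \<le> U d (grid s T n (min k (Suc n))) \<omega>)"
            using \<open>\<omega> \<notin> B d n\<close> w unfolding B_def by blast
          then have "\<not> ln (1 / d) \<le> U d (grid s T n (min k (Suc n))) \<omega>"
            using that less_imp_le by blast
          then show ?thesis using that by (simp add: min_absorb1)
        qed
        have "(\<Sum>k<Suc n. U d (grid s T n k) \<omega> * indicator {grid s T n k<..grid s T n (Suc k)} t) \<le>
          (\<Sum>k<Suc n. ln (1 / d) * indicator {grid s T n k<..grid s T n (Suc k)} t)"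
          using lt by (intro sum_mono mult_right_mono) (auto simp: less_imp_le)
        also have "\<dots> = ln (1 / d)"
          using sum_grid_indicator[OF sT, of n t] t' by (simp only: flip: sum_distrib_left) simp
        finally show False using n0[OF that] by simp
      qed
      then show ?thesis unfolding E_def by auto
    qed
    \<comment> \<open>Along this sequence the level is j + 1, so the bounds |K0| / (j + 1) force the
      intersection to be null.\<close>
    define \<Delta> where "\<Delta> j = exp (- real (Suc j))" for j
    have \<Delta>: "0 < \<Delta> j" "\<Delta> j \<le> 1" "ln (1 / \<Delta> j) = real (Suc j)" for j
      by (auto simp: \<Delta>_def ln_div)
    have NM: "(\<Inter>j. E (\<Delta> j)) \<in> sets M" using EM[OF \<Delta>(1)] by (intro sets.countable_INT) auto
    have "prob (\<Inter>j. E (\<Delta> j)) = 0"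
    proof (rule ccontr)
      assume "prob (\<Inter>j. E (\<Delta> j)) \<noteq> 0"
      then have p: "0 < prob (\<Inter>j. E (\<Delta> j))" by (simp add: zero_less_measure_iff)
      obtain j where j: "\<bar>K0\<bar> / prob (\<Inter>j. E (\<Delta> j)) < real j" using reals_Archimedean2 by blast
      have "real (Suc j) * prob (\<Inter>j. E (\<Delta> j)) \<le> real (Suc j) * prob (E (\<Delta> j))"
        using EM[OF \<Delta>(1)] by (intro mult_left_mono finite_measure_mono) auto
      also have "\<dots> \<le> \<bar>K0\<bar>" using E_le[OF \<Delta>(1,2), of j] \<Delta>(3) by simp
      also have "\<dots> < real j * prob (\<Inter>j. E (\<Delta> j))" using j p by (simp add: divide_less_eq)
      finally show False using p by (simp add: algebra_simps)
    qed
    then have "(\<Inter>j. E (\<Delta> j)) \<in> null_sets M" using NM by (auto simp: null_sets_def emeasure_eq_measure)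
    then have "AE \<omega> in M. \<omega> \<notin> (\<Inter>j. E (\<Delta> j))" by (rule AE_not_in)
    then show ?thesis
      using AE_space
    proof eventually_elim
      case (elim \<omega>)
      show ?case
      proof (intro impI ballI)
        fix t a assume h: "\<forall>a\<in>P. \<eta> \<le> Y a s \<omega>" and t: "t \<in> {s..T}" and a: "a \<in> P"
        have w: "\<omega> \<in> A" using h elim(2) by (simp add: A_def)
        have "Y a t \<omega> \<noteq> 0"
        proof
          assume "Y a t \<omega> = 0"
          then have "\<omega> \<in> (\<Inter>j. E (\<Delta> j))" using hit[OF w \<Delta>(1,2) t a] by blast
          then show False using elim(1) by simp
        qed
        then show "0 < Y a t \<omega>" using range(1)[OF a _ elim(2), of t] t s by fastforce
      qed
    qed
  qed
  have "\<forall>j::nat. \<exists>r. 0 < r \<and> r < 1 / real (Suc j) \<and> (AE \<omega> in M. \<forall>a\<in>P. 0 < Y a r \<omega>)"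
    using AE_lborel_exists_small[OF positive] by simp
  from choice[OF this] obtain \<rho> where
    "\<forall>j. 0 < \<rho> j \<and> \<rho> j < 1 / real (Suc j) \<and> (AE \<omega> in M. \<forall>a\<in>P. 0 < Y a (\<rho> j) \<omega>)" by blast
  then have \<rho>: "\<And>j. 0 < \<rho> j" "\<And>j. \<rho> j < 1 / real (Suc j)" "\<And>j. AE \<omega> in M. \<forall>a\<in>P. 0 < Y a (\<rho> j) \<omega>"
    by blast+
  have "AE \<omega> in M. \<forall>j. \<forall>a\<in>P. 0 < Y a (\<rho> j) \<omega>"
    unfolding AE_all_countable using \<rho>(3) by blast
  \<comment> \<open>Countably many starting times, lower bounds 1 / (i + 1) and durations k + 1
    exhaust all cases, so one null set suffices.\<close>
  moreover have "AE \<omega> in M. \<forall>j i k. (\<forall>a\<in>P. 1 / real (Suc i) \<le> Y a (\<rho> j) \<omega>) \<longrightarrow>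
      (\<forall>t\<in>{\<rho> j..\<rho> j + real (Suc k)}. \<forall>a\<in>P. 0 < Y a t \<omega>)"
    unfolding AE_all_countable
  proof (intro allI)
    fix j i k
    show "AE \<omega> in M. (\<forall>a\<in>P. 1 / real (Suc i) \<le> Y a (\<rho> j) \<omega>) \<longrightarrow>
      (\<forall>t\<in>{\<rho> j..\<rho> j + real (Suc k)}. \<forall>a\<in>P. 0 < Y a t \<omega>)"
      by (rule step) (use \<rho>(1)[of j] in auto)
  qed
  ultimately show ?thesis
  proof eventually_elim
    case (elim \<omega>)
    show ?case
    proof (intro allI impI ballI)
      fix t :: real and a assume t: "0 < t" and a: "a \<in> P"
      obtain j where j: "1 / real (Suc j) < t" using nat_approx_posE[OF t] by blast
      have "\<exists>i. \<forall>a\<in>P. 1 / real (Suc i) \<le> Y a (\<rho> j) \<omega>"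
      proof -
        \<comment> \<open>The inserted 1 covers the empty family.\<close>
        have "0 < Min (insert 1 ((\<lambda>a. Y a (\<rho> j) \<omega>) ` P))" using P elim(1) by (subst Min_gr_iff) auto
        from nat_approx_posE[OF this] obtain i where "1 / real (Suc i) < Min (insert 1 ((\<lambda>a. Y a (\<rho> j) \<omega>) ` P))" by blast
        then show ?thesis using P by (intro exI[of _ i]) (auto simp: less_imp_le)
      qed
      then obtain i where i: "\<forall>a\<in>P. 1 / real (Suc i) \<le> Y a (\<rho> j) \<omega>" by blast
      obtain k where k: "t \<le> real k" using real_arch_simple by blast
      have "t \<in> {\<rho> j..\<rho> j + real (Suc k)}" using j k \<rho>(1,2)[of j] by auto
      then show "0 < Y a t \<omega>" using elim(2) i a by blast
    qed
  qed
qed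

end

section \<open>Generator estimates\<close>

text \<open>Division by zero gives 0, so coinciding arguments contribute nothing and sums may
  include the diagonal. The value is antisymmetric, nonnegative for \<open>a \<ge> b\<close> in
  [0,1].\<close>

definition interaction :: "real \<Rightarrow> real \<Rightarrow> real" where
  "interaction a b = (a * (1 - b) + b * (1 - a)) / (a - b)"

lemma interaction_self [simp]: "interaction a a = 0"
  by (simp add: interaction_def)

lemma interaction_antisym: "interaction b a = - interaction a b"
  unfolding interaction_def minus_divide_right by (simp add: algebra_simps)

lemma jacobi_drift_alt:
  assumes "i \<in> {1..m}"
  shows "jacobi_drift m p q x i = p - (p + q) * x i + (\<Sum>j\<in>{1..m}. interaction (x i) (x j))"
  unfolding jacobi_drift_def interaction_def[symmetric]
  using sum.remove[of "{1..m}" i "\<lambda>j. interaction (x i) (x j)"] assms by simp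

text \<open>The reflection x to 1 - x exchanges p and q and thereby carries the estimate at the
  lower boundary to the upper one.\<close>

lemma jacobi_drift_reflect:
  assumes "i \<in> {1..m}"
  shows "jacobi_drift m q p (\<lambda>j. 1 - x j) i = - jacobi_drift m p q x i"
proof -
  have "interaction (1 - x i) (1 - x j) = - interaction (x i) (x j)" for j
    unfolding interaction_def minus_divide_right by (simp add: algebra_simps)
  then show ?thesis unfolding jacobi_drift_alt[OF assms] by (simp add: sum_negf algebra_simps)
qed

text \<open>At \<open>x m = 0\<close> each other coordinate contributes -1, or 0 when it vanishes
  too and the quotient is 0 / 0. So the drift is at least p - (m - 1).\<close>

lemma jacobi_drift_pos_at_0:
  assumes m: "1 \<le> m" and p: "real m < p" and x: "x \<in> ordered_unit_vectors m" and xm: "x m = 0"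
  shows "0 < jacobi_drift m p q x m"
proof -
  have "(\<Sum>j\<in>{1..m} - {m}. (x m * (1 - x j) + x j * (1 - x m)) / (x m - x j)) \<ge> (\<Sum>j\<in>{1..m} - {m}. - 1)"
    by (intro sum_mono) (auto simp: xm divide_simps)
  moreover have "(\<Sum>j\<in>{1..m} - {m}. - 1 :: real) = - (real m - 1)" using m by simp
  ultimately show ?thesis using p by (simp add: jacobi_drift_def xm)
qed

lemma mult_unit_interval_le:
  fixes a y :: real
  assumes "0 \<le> y" "y \<le> 1" shows "a * y \<le> \<bar>a\<bar>"
proof -
  have "a * y \<le> \<bar>a\<bar> * y" using assms by (intro mult_right_mono) auto
  also have "\<dots> \<le> \<bar>a\<bar>" using assms by (intro mult_left_le) auto
  finally show ?thesis .
qed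

text \<open>Symmetrizing in i and j removes the singularity: \<open>u j - u i\<close> is (x_i - x_j)
  u_i u_j, whose first factor cancels the denominator of the interaction, and each pair then costs
  at most u_i + u_j. The coefficients of the sum of the u_i are m - 1 from the interactions, 2 from
  the second-order term and -p \<le> -(m + 1) from the constant drift; the linear drift is bounded
  by |p + q| for each i.\<close>

lemma boundary_generator_bound:
  fixes x :: "nat \<Rightarrow> real"
  assumes x: "\<And>i. i \<in> {1..m} \<Longrightarrow> 0 \<le> x i \<and> x i \<le> 1" and inj: "inj_on x {1..m}"
    and p: "real m + 1 \<le> p" and d: "0 < d"
  shows "(\<Sum>i\<in>{1..m}. - jacobi_drift m p q x i / (x i + d) + 4 * (x i * (1 - x i)) / (2 * (x i + d)\<^sup>2))
    \<le> real m * \<bar>p + q\<bar>"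
proof -
  let ?S = "{1..m}"
  define u where "u i = 1 / (x i + d)" for i
  have xd: "0 < x i + d" if "i \<in> ?S" for i using x[OF that] d by linarith
  have u: "0 < u i" if "i \<in> ?S" for i using xd[OF that] by (simp add: u_def)
  define A where "A = (\<Sum>i\<in>?S. \<Sum>j\<in>?S. - interaction (x i) (x j) * u i)"
  have "A = (\<Sum>i\<in>?S. \<Sum>j\<in>?S. - interaction (x j) (x i) * u j)"
    unfolding A_def by (rule sum.swap)
  also have "\<dots> = (\<Sum>i\<in>?S. \<Sum>j\<in>?S. interaction (x i) (x j) * u j)"
  proof (intro sum.cong refl)
    fix i j
    show "- interaction (x j) (x i) * u j = interaction (x i) (x j) * u j"
      using interaction_antisym[of "x i" "x j"] by simp
  qed
  finally have "2 * A = (\<Sum>i\<in>?S. \<Sum>j\<in>?S. interaction (x i) (x j) * u j) + A" by simp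
  also have "\<dots> = (\<Sum>i\<in>?S. \<Sum>j\<in>?S. interaction (x i) (x j) * (u j - u i))"
    unfolding A_def sum.distrib[symmetric] by (intro sum.cong refl) (simp add: algebra_simps)
  also have "\<dots> \<le> (\<Sum>i\<in>?S. \<Sum>j\<in>?S. if i = j then 0 else u i + u j)"
  proof (intro sum_mono)
    fix i j assume ij: "i \<in> ?S" "j \<in> ?S"
    show "interaction (x i) (x j) * (u j - u i) \<le> (if i = j then 0 else u i + u j)"
    proof (cases "i = j")
      case False
      then have ne: "x i \<noteq> x j" using inj ij by (metis inj_onD)
      have "u j - u i = (x i - x j) * (u i * u j)"
        using xd[OF ij(1)] xd[OF ij(2)] by (simp add: u_def field_simps)
      then have "interaction (x i) (x j) * (u j - u i) = (x i * (1 - x j) + x j * (1 - x i)) * (u i * u j)"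
        using ne by (simp add: interaction_def)
      also have "\<dots> \<le> ((x i + d) + (x j + d)) * (u i * u j)"
      proof (rule mult_right_mono)
        have "0 \<le> x i * x j" using x ij by simp
        then show "x i * (1 - x j) + x j * (1 - x i) \<le> (x i + d) + (x j + d)" using d by (simp add: algebra_simps)
      qed (use u[OF ij(1)] u[OF ij(2)] in auto)
      also have "\<dots> = u i + u j" using xd[OF ij(1)] xd[OF ij(2)] by (simp add: u_def field_simps)
      finally show ?thesis using False by simp
    qed simp
  qed
  \<comment> \<open>The full double sum of u_i + u_j counts 2 m times the sum of the u_i; taking
    away the diagonal leaves 2 (m - 1) of them.\<close>
  also have "\<dots> = (\<Sum>i\<in>?S. \<Sum>j\<in>?S. (u i + u j) - (if i = j then 2 * u i else 0))"
    by (intro sum.cong refl) auto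
  also have "\<dots> = 2 * ((real m - 1) * (\<Sum>i\<in>?S. u i))"
  proof -
    have "(\<Sum>i\<in>?S. \<Sum>j\<in>?S. u i + u j) = 2 * real m * (\<Sum>i\<in>?S. u i)"
      by (simp add: sum.distrib sum_distrib_left mult.assoc)
    moreover have "(\<Sum>i\<in>?S. \<Sum>j\<in>?S. if i = j then 2 * u i else 0) = 2 * (\<Sum>i\<in>?S. u i)"
      by (simp add: sum_distrib_left)
    ultimately show ?thesis by (simp add: sum_subtractf algebra_simps)
  qed
  finally have A: "A \<le> (real m - 1) * (\<Sum>i\<in>?S. u i)" by simp
  have "(\<Sum>i\<in>?S. - jacobi_drift m p q x i / (x i + d) + 4 * (x i * (1 - x i)) / (2 * (x i + d)\<^sup>2))
    = A + (\<Sum>i\<in>?S. - (p - (p + q) * x i) * u i + 4 * (x i * (1 - x i)) / (2 * (x i + d)\<^sup>2))"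
    unfolding A_def sum.distrib[symmetric]
    by (intro sum.cong refl)
      (simp add: jacobi_drift_alt u_def sum_divide_distrib[symmetric] sum_negf diff_divide_distrib add_divide_distrib)
  also have "\<dots> \<le> (real m - 1) * (\<Sum>i\<in>?S. u i) + (\<Sum>i\<in>?S. - (real m + 1) * u i + \<bar>p + q\<bar> + 2 * u i)"
  proof (rule add_mono[OF A sum_mono])
    fix i assume i: "i \<in> ?S"
    have "x i * u i \<le> 1" using xd[OF i] d by (simp add: u_def field_simps)
    then have "(p + q) * (x i * u i) \<le> \<bar>p + q\<bar>"
      using x[OF i] u[OF i] by (intro mult_unit_interval_le) auto
    moreover have "(real m + 1) * u i \<le> p * u i" using p u[OF i] by (intro mult_right_mono) auto
    moreover have "4 * (x i * (1 - x i)) / (2 * (x i + d)\<^sup>2) \<le> 2 * u i"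
    proof -
      have "x i * (1 - x i) \<le> x i + d" using x[OF i] d by (simp add: algebra_simps add_increasing)
      then have "4 * (x i * (1 - x i)) / (2 * (x i + d)\<^sup>2) \<le> 4 * (x i + d) / (2 * (x i + d)\<^sup>2)"
        by (intro divide_right_mono) auto
      also have "\<dots> = 2 * u i"
      proof -
        have "4 * y / (2 * y\<^sup>2) = 2 * (1 / y)" if "0 < y" for y :: real
          using that by (simp add: power2_eq_square)
        from this[OF xd[OF i]] show ?thesis by (simp only: u_def)
      qed
      finally show ?thesis .
    qed
    ultimately show "- (p - (p + q) * x i) * u i + 4 * (x i * (1 - x i)) / (2 * (x i + d)\<^sup>2)
      \<le> - (real m + 1) * u i + \<bar>p + q\<bar> + 2 * u i" by (simp add: algebra_simps)
  qed
  also have "(\<Sum>i\<in>?S. - (real m + 1) * u i + \<bar>p + q\<bar> + 2 * u i) = (\<Sum>i\<in>?S. (1 - real m) * u i + \<bar>p + q\<bar>)"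
    by (intro sum.cong refl) (simp add: algebra_simps)
  also have "\<dots> = (1 - real m) * (\<Sum>i\<in>?S. u i) + real m * \<bar>p + q\<bar>"
    unfolding sum.distrib sum_distrib_left by simp
  also have "(real m - 1) * (\<Sum>i\<in>?S. u i) + \<dots> = real m * \<bar>p + q\<bar>"
    by (simp add: left_diff_distrib)
  finally show ?thesis .
qed

text \<open>An odd version of 1 / (u + d) with value 0 at u = 0. Being odd like
  \<open>interaction\<close>, it lets sums over pairs i < j be written as sums over all pairs, where
  indices can be permuted.\<close>

definition regularized_inverse :: "real \<Rightarrow> real \<Rightarrow> real" where
  "regularized_inverse d u = sgn u / (\<bar>u\<bar> + d)"

text \<open>The effect of each pair's repulsion on the two gaps that involve the third particle.
  Neighbours that repel each other widen the outer gap but narrow the neighbouring one, a negative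
  contribution in total; the outer pair widens both inner gaps and outweighs this, for every d and
  not only in the limit d = 0.\<close>

lemma three_body_sorted:
  fixes a b c d :: real
  assumes ab: "0 \<le> c" "c < b" "b < a" "a \<le> 1" and d: "0 < d"
  shows "0 \<le> interaction a b * regularized_inverse d (a - c) + interaction a c * regularized_inverse d (a - b)
    + interaction b a * regularized_inverse d (b - c) + interaction b c * regularized_inverse d (b - a)
    + interaction c a * regularized_inverse d (c - b) + interaction c b * regularized_inverse d (c - a)"
proof -
  define u v where "u = a - b" and "v = b - c"
  have uv: "0 < u" "0 < v" using ab by (auto simp: u_def v_def)
  have abc: "a - b = u" "b - c = v" "a - c = u + v" "b - a = - u" "c - b = - v" "c - a = - (u + v)"
    by (auto simp: u_def v_def)
  define w where "w s t = s * (1 - t) + t * (1 - s)" for s t :: real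
  have wpos: "0 \<le> w s t" if "s \<in> {0..1}" "t \<in> {0..1}" for s t using that by (simp add: w_def)
  \<comment> \<open>Terms are grouped by the interacting pair, with all gaps expressed by u and
    v.\<close>
  have eq: "interaction a b * regularized_inverse d (a - c) + interaction a c * regularized_inverse d (a - b)
    + interaction b a * regularized_inverse d (b - c) + interaction b c * regularized_inverse d (b - a)
    + interaction c a * regularized_inverse d (c - b) + interaction c b * regularized_inverse d (c - a)
    = w a b / u * (1 / (u + v + d) - 1 / (v + d)) + w b c / v * (1 / (u + v + d) - 1 / (u + d))
      + w a c / (u + v) * (1 / (u + d) + 1 / (v + d))"
  proof -
    define A B C where "A = w a b / u" and "B = w b c / v" and "C = w a c / (u + v)"
    have i: "interaction a b = A" "interaction b c = B" "interaction a c = C"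
      by (simp_all add: interaction_def abc w_def A_def B_def C_def)
    then have i': "interaction b a = - A" "interaction c b = - B" "interaction c a = - C"
      using interaction_antisym[of a b] interaction_antisym[of b c] interaction_antisym[of a c] by simp_all
    have r: "regularized_inverse d y = 1 / (y + d)" "regularized_inverse d (- y) = - (1 / (y + d))" if "0 < y" for y
      using that by (simp_all add: regularized_inverse_def)
    have "0 < u + v" using uv by simp
    then show ?thesis
      unfolding i i' abc r(1)[OF uv(1)] r(2)[OF uv(1)] r(1)[OF uv(2)] r(2)[OF uv(2)] r(1)[OF \<open>0 < u + v\<close>]
        r(2)[OF \<open>0 < u + v\<close>] A_def[symmetric] B_def[symmetric] C_def[symmetric]
      by (simp add: algebra_simps)
  qed
  have e1: "w a b / u * (1 / (u + v + d) - 1 / (v + d)) = - w a b * (u + d) / ((u + d) * (v + d) * (u + v + d))"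
  proof -
    have "1 / (u + v + d) - 1 / (v + d) = - u / ((v + d) * (u + v + d))"
      using uv d by (simp add: field_simps)
    moreover have "w a b / u * (- u / (y * z)) = - w a b * t / (t * y * z)" if "0 < t" for t y z
      using that uv by simp
    ultimately show ?thesis using uv d by simp
  qed
  have e2: "w b c / v * (1 / (u + v + d) - 1 / (u + d)) = - w b c * (v + d) / ((u + d) * (v + d) * (u + v + d))"
  proof -
    have "1 / (u + v + d) - 1 / (u + d) = - v / ((u + d) * (u + v + d))"
      using uv d by (simp add: field_simps)
    moreover have "w b c / v * (- v / (t * z)) = - w b c * y / (t * y * z)" if "0 < y" for t y z
      using that uv by simp
    ultimately show ?thesis using uv d by simp
  qed
  \<comment> \<open>Only an inequality: (r + 2 d) (r + d) / r = r + 3 d + 2 d^2 / r, and dropping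
    the last term gives the denominator of the other two groups and a numerator affine in d.\<close>
  have e3: "w a c / (u + v) * (1 / (u + d) + 1 / (v + d)) \<ge> w a c * (u + v + 3 * d) / ((u + d) * (v + d) * (u + v + d))"
  proof -
    define r where "r = u + v"
    have r: "0 < r" using uv by (simp add: r_def)
    have "1 / (u + d) + 1 / (v + d) = (r + 2 * d) / ((u + d) * (v + d))"
      using uv d by (simp add: r_def field_simps)
    then have "w a c / (u + v) * (1 / (u + d) + 1 / (v + d)) = w a c * ((r + 2 * d) * (r + d) / r) / ((u + d) * (v + d) * (u + v + d))"
    proof -
      have "w a c / r * ((r + 2 * d) / y) = w a c * ((r + 2 * d) * (r + d) / r) / (y * (r + d))" if "0 < y" for y
        using that r d by (simp add: divide_simps)
      from this[of "(u + d) * (v + d)"] show ?thesis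
        using uv d \<open>1 / (u + d) + 1 / (v + d) = _\<close> unfolding r_def by simp
    qed
    moreover have "r + 3 * d \<le> (r + 2 * d) * (r + d) / r"
      using r d by (simp add: field_simps)
    moreover have "0 \<le> w a c" using ab by (intro wpos) auto
    ultimately have "w a c * (r + 3 * d) / ((u + d) * (v + d) * (u + v + d)) \<le>
        w a c / (u + v) * (1 / (u + d) + 1 / (v + d))"
      using uv d by (simp only:) (intro divide_right_mono mult_left_mono, auto)
    then show ?thesis by (simp add: r_def)
  qed
  \<comment> \<open>The numerator is affine in d. Its constant part is 2 u v (u + v). Its slope 3 w
    a c - w a b - w b c is affine in b and, on [c, a], smallest at b = a if a + c \<le> 1 and at b =
    c otherwise; the two identities expand it around these points.\<close>
  have main: "0 \<le> - w a b * (u + d) - w b c * (v + d) + w a c * (u + v + 3 * d)"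
  proof -
    have "- w a b * u - w b c * v + w a c * (u + v) = 2 * u * v * (u + v)"
      unfolding w_def u_def v_def by (simp add: algebra_simps)
    moreover have "0 \<le> 2 * u * v * (u + v)" using uv by simp
    moreover have "0 \<le> 3 * w a c - w a b - w b c"
    proof (cases "a + c \<le> 1")
      case True
      have "3 * w a c - w a b - w b c = 2 * (a - c)\<^sup>2 + 2 * (c * (1 - c)) + 2 * ((a - b) * (1 - (a + c)))"
        unfolding w_def by (simp add: power2_eq_square algebra_simps)
      then show ?thesis using True ab by simp
    next
      case False
      have "3 * w a c - w a b - w b c = 2 * (a - c)\<^sup>2 + 2 * (a * (1 - a)) + 2 * ((b - c) * ((a + c) - 1))"
        unfolding w_def by (simp add: power2_eq_square algebra_simps)
      then show ?thesis using False ab by simp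
    qed
    then have "0 \<le> d * (3 * w a c - w a b - w b c)" using d by simp
    ultimately show ?thesis by (simp add: algebra_simps)
  qed
  have "0 \<le> (- w a b * (u + d) - w b c * (v + d) + w a c * (u + v + 3 * d)) / ((u + d) * (v + d) * (u + v + d))"
    using main uv d by simp
  then show ?thesis unfolding eq e1 e2 using e3 by (simp add: diff_divide_distrib add_divide_distrib)
qed

text \<open>The sum is symmetric in the three points, so every ordering reduces to the sorted
  case.\<close>

lemma three_body_nonneg:
  fixes a b c d :: real
  assumes "a \<in> {0..1}" "b \<in> {0..1}" "c \<in> {0..1}" and "a \<noteq> b" "b \<noteq> c" "a \<noteq> c" and d: "0 < d"
  shows "0 \<le> interaction a b * regularized_inverse d (a - c) + interaction a c * regularized_inverse d (a - b)
    + interaction b a * regularized_inverse d (b - c) + interaction b c * regularized_inverse d (b - a)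
    + interaction c a * regularized_inverse d (c - b) + interaction c b * regularized_inverse d (c - a)"
proof -
  consider "c < b" "b < a" | "b < c" "c < a" | "c < a" "a < b" | "a < c" "c < b" | "b < a" "a < c" | "a < b" "b < c"
    using assms by linarith
  then show ?thesis
  proof cases
    case 1 then show ?thesis using three_body_sorted[of c b a d] assms by simp
  next
    case 2 then show ?thesis using three_body_sorted[of b c a d] assms by simp
  next
    case 3 then show ?thesis using three_body_sorted[of c a b d] assms by simp
  next
    case 4 then show ?thesis using three_body_sorted[of a c b d] assms by simp
  next
    case 5 then show ?thesis using three_body_sorted[of b a c d] assms by simp
  next
    case 6 then show ?thesis using three_body_sorted[of a b c d] assms by simp
  qed
qed

text \<open>A single summand has no sign, but the triple sum is invariant under the six permutations
  of its indices and may be replaced by their average.\<close>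

lemma sum_symmetrize6:
  fixes f :: "'i \<Rightarrow> 'i \<Rightarrow> 'i \<Rightarrow> real"
  assumes "\<And>i j k. i \<in> S \<Longrightarrow> j \<in> S \<Longrightarrow> k \<in> S \<Longrightarrow>
    0 \<le> f i j k + f i k j + f j i k + f j k i + f k i j + f k j i"
  shows "0 \<le> (\<Sum>i\<in>S. \<Sum>j\<in>S. \<Sum>k\<in>S. f i j k)"
proof -
  define T where "T g = (\<Sum>i\<in>S. \<Sum>j\<in>S. \<Sum>k\<in>S. g i j k)" for g :: "'i \<Rightarrow> 'i \<Rightarrow> 'i \<Rightarrow> real"
  have s1: "T (\<lambda>i j k. g i k j) = T g" for g
    unfolding T_def by (rule sum.cong[OF refl], rule sum.swap)
  have s2: "T (\<lambda>i j k. g j i k) = T g" for g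
    unfolding T_def by (rule sum.swap)
  have p: "T (\<lambda>i j k. f i k j) = T f" "T (\<lambda>i j k. f j i k) = T f" "T (\<lambda>i j k. f j k i) = T f"
    "T (\<lambda>i j k. f k i j) = T f" "T (\<lambda>i j k. f k j i) = T f"
    using s1[of f] s2[of f] s1[of "\<lambda>i j k. f j i k"] s2[of "\<lambda>i j k. f i k j"] s1[of "\<lambda>i j k. f j k i"]
      s2[of "\<lambda>i j k. f k i j"] by auto
  have "0 \<le> T (\<lambda>i j k. f i j k + f i k j + f j i k + f j k i + f k i j + f k j i)"
    unfolding T_def by (intro sum_nonneg assms)
  also have "\<dots> = T f + T (\<lambda>i j k. f i k j) + T (\<lambda>i j k. f j i k) + T (\<lambda>i j k. f j k i)
      + T (\<lambda>i j k. f k i j) + T (\<lambda>i j k. f k j i)"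
    unfolding T_def by (simp add: sum.distrib)
  also have "\<dots> = 6 * T f" unfolding p by simp
  finally show ?thesis by (simp add: T_def)
qed

lemma sum_ordered_pairs:
  fixes f :: "nat \<Rightarrow> nat \<Rightarrow> real"
  assumes "\<And>i. f i i = 0"
  shows "(\<Sum>i\<in>{1..m}. \<Sum>j\<in>{1..m}. f i j) = (\<Sum>(i, j)\<in>{(i, j). i \<in> {1..m} \<and> j \<in> {1..m} \<and> i < j}. f i j + f j i)"
proof -
  let ?P = "{(i, j). i \<in> {1..m} \<and> j \<in> {1..m} \<and> i < j}"
  let ?Q = "{(i, j). i \<in> {1..m} \<and> j \<in> {1..m} \<and> j < i}"
  have fin: "finite ?P" "finite ?Q" by (auto intro: finite_subset[of _ "{1..m} \<times> {1..m}"])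
  have "(\<Sum>i\<in>{1..m}. \<Sum>j\<in>{1..m}. f i j) = (\<Sum>(i, j)\<in>{1..m} \<times> {1..m}. f i j)"
    by (simp add: sum.cartesian_product)
  also have "\<dots> = (\<Sum>(i, j)\<in>?P \<union> ?Q. f i j)"
  proof (rule sum.mono_neutral_right)
    show "\<forall>z\<in>{1..m} \<times> {1..m} - (?P \<union> ?Q). (case z of (i, j) \<Rightarrow> f i j) = 0"
    proof
      fix z assume z: "z \<in> {1..m} \<times> {1..m} - (?P \<union> ?Q)"
      obtain i j where ij: "z = (i, j)" by (cases z)
      have "i \<in> {1..m}" "j \<in> {1..m}" "(i, j) \<notin> ?P" "(i, j) \<notin> ?Q" using z unfolding ij by blast+
      then have "\<not> i < j" "\<not> j < i" by blast+
      then have "i = j" by simp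
      then show "(case z of (i, j) \<Rightarrow> f i j) = 0" using assms ij by simp
    qed
  qed auto
  also have "\<dots> = (\<Sum>(i, j)\<in>?P. f i j) + (\<Sum>(i, j)\<in>?Q. f i j)"
    by (rule sum.union_disjoint[OF fin]) auto
  also have "(\<Sum>(i, j)\<in>?Q. f i j) = (\<Sum>(i, j)\<in>?P. f j i)"
    by (rule sum.reindex_bij_witness[of _ prod.swap prod.swap]) auto
  finally show ?thesis by (simp add: sum.distrib split_beta')
qed

text \<open>The drift of a gap consists of a linear part, the repulsion of the pair itself and the
  action of third particles. The last has a sign after summation over all pairs. With w the
  numerator of the interaction and u the gap, the pair's own repulsion 2 w / (u (u + d)) dominates
  the second-order term, which is at most 2 w / (u + d)^2. The linear part costs |p + q| per
  pair.\<close>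

lemma collision_generator_bound:
  fixes x :: "nat \<Rightarrow> real"
  assumes x: "\<And>i. i \<in> {1..m} \<Longrightarrow> 0 \<le> x i \<and> x i \<le> 1"
    and dec: "\<And>i j. i \<in> {1..m} \<Longrightarrow> j \<in> {1..m} \<Longrightarrow> i < j \<Longrightarrow> x j < x i" and d: "0 < d"
  shows "(\<Sum>(i, j)\<in>{(i, j). i \<in> {1..m} \<and> j \<in> {1..m} \<and> i < j}.
      - (jacobi_drift m p q x i - jacobi_drift m p q x j) / (x i - x j + d) +
      (4 * (x i * (1 - x i)) + 4 * (x j * (1 - x j))) / (2 * (x i - x j + d)\<^sup>2))
    \<le> real (m * m) * \<bar>p + q\<bar>"
proof -
  let ?S = "{1..m}" and ?P = "{(i, j). i \<in> {1..m} \<and> j \<in> {1..m} \<and> i < j}"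
  let ?b = "jacobi_drift m p q x"
  define \<psi> where "\<psi> i k = regularized_inverse d (x i - x k)" for i k
  have \<psi>0: "\<psi> i i = 0" for i by (simp add: \<psi>_def regularized_inverse_def)
  have \<psi>anti: "\<psi> k i = - \<psi> i k" for i k
    by (simp add: \<psi>_def regularized_inverse_def abs_minus_commute sgn_if)
  have \<psi>P: "\<psi> i j = 1 / (x i - x j + d)" if "(i, j) \<in> ?P" for i j
    using that dec[of i j] by (simp add: \<psi>_def regularized_inverse_def)
  have ne: "x i \<noteq> x j" if "i \<in> ?S" "j \<in> ?S" "i \<noteq> j" for i j
    using dec[of i j] dec[of j i] that by (cases "i < j") auto
  define W where "W i j = interaction (x i) (x j)" for i j
  have W0: "W i i = 0" for i by (simp add: W_def)
  have Wanti: "W k i = - W i k" for i k unfolding W_def by (rule interaction_antisym)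
  have b: "?b i = p - (p + q) * x i + (\<Sum>j\<in>?S. W i j)" if "i \<in> ?S" for i
    using jacobi_drift_alt[OF that] by (simp add: W_def)
  \<comment> \<open>The summand j = k is the pair's own repulsion and is treated separately. When
    two of the indices coincide, all six terms vanish; otherwise the three-particle estimate
    applies.\<close>
  have three: "0 \<le> (\<Sum>i\<in>?S. \<Sum>j\<in>?S. \<Sum>k\<in>?S. if j = k then 0 else W i j * \<psi> i k)"
  proof (rule sum_symmetrize6)
    fix i j k assume ijk: "i \<in> ?S" "j \<in> ?S" "k \<in> ?S"
    show "0 \<le> (if j = k then 0 else W i j * \<psi> i k) + (if k = j then 0 else W i k * \<psi> i j)
      + (if i = k then 0 else W j i * \<psi> j k) + (if k = i then 0 else W j k * \<psi> j i)
      + (if i = j then 0 else W k i * \<psi> k j) + (if j = i then 0 else W k j * \<psi> k i)"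
    proof (cases "i = j \<or> j = k \<or> i = k")
      case True
      then show ?thesis using W0 \<psi>0 by auto
    next
      case False
      then show ?thesis
        using three_body_nonneg[of "x i" "x j" "x k" d] x ijk ne d by (auto simp: W_def \<psi>_def)
    qed
  qed
  have "(\<Sum>(i, j)\<in>?P. (?b i - ?b j) * \<psi> i j) = (\<Sum>i\<in>?S. \<Sum>k\<in>?S. ?b i * \<psi> i k)"
  proof (subst sum_ordered_pairs)
    show "(\<Sum>(i, j)\<in>?P. (?b i - ?b j) * \<psi> i j) = (\<Sum>(i, j)\<in>?P. ?b i * \<psi> i j + ?b j * \<psi> j i)"
    proof (intro sum.cong refl, clarify)
      fix i j
      show "(?b i - ?b j) * \<psi> i j = ?b i * \<psi> i j + ?b j * \<psi> j i"
      proof -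
        have "\<psi> j i = - \<psi> i j" by (rule \<psi>anti)
        then show ?thesis by (simp add: left_diff_distrib)
      qed
    qed
  qed (simp add: \<psi>0)
  \<comment> \<open>The summand of the interaction in which j equals the partner k is split off from
    the third particles.\<close>
  also have "\<dots> = (\<Sum>i\<in>?S. \<Sum>k\<in>?S. (p - (p + q) * x i) * \<psi> i k + (W i k * \<psi> i k + (\<Sum>j\<in>?S. if j = k then 0 else W i j * \<psi> i k)))"
  proof (intro sum.cong refl)
    fix i k assume ik: "i \<in> ?S" "k \<in> ?S"
    have "(\<Sum>j\<in>?S. W i j * \<psi> i k) = W i k * \<psi> i k + (\<Sum>j\<in>?S. if j = k then 0 else W i j * \<psi> i k)"
      using ik sum.remove[of ?S k "\<lambda>j. W i j * \<psi> i k"] sum.remove[of ?S k "\<lambda>j. if j = k then 0 else W i j * \<psi> i k"]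
      by simp
    then show "?b i * \<psi> i k = (p - (p + q) * x i) * \<psi> i k + (W i k * \<psi> i k + (\<Sum>j\<in>?S. if j = k then 0 else W i j * \<psi> i k))"
      unfolding b[OF ik(1)] by (simp add: algebra_simps sum_distrib_left)
  qed
  also have "\<dots> = (\<Sum>i\<in>?S. \<Sum>k\<in>?S. (p - (p + q) * x i) * \<psi> i k + W i k * \<psi> i k) +
    (\<Sum>i\<in>?S. \<Sum>k\<in>?S. \<Sum>j\<in>?S. if j = k then 0 else W i j * \<psi> i k)"
    by (simp add: sum.distrib add.assoc)
  also have "(\<Sum>i\<in>?S. \<Sum>k\<in>?S. \<Sum>j\<in>?S. if j = k then 0 else W i j * \<psi> i k) =
      (\<Sum>i\<in>?S. \<Sum>j\<in>?S. \<Sum>k\<in>?S. if j = k then 0 else W i j * \<psi> i k)"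
    by (rule sum.cong[OF refl], rule sum.swap)
  also have "(\<Sum>i\<in>?S. \<Sum>k\<in>?S. (p - (p + q) * x i) * \<psi> i k + W i k * \<psi> i k) =
    (\<Sum>(i, j)\<in>?P. - (p + q) * ((x i - x j) * \<psi> i j) + 2 * (W i j * \<psi> i j))"
  proof (subst sum_ordered_pairs)
    show "(\<Sum>(i, j)\<in>?P. (p - (p + q) * x i) * \<psi> i j + W i j * \<psi> i j + ((p - (p + q) * x j) * \<psi> j i + W j i * \<psi> j i))
      = (\<Sum>(i, j)\<in>?P. - (p + q) * ((x i - x j) * \<psi> i j) + 2 * (W i j * \<psi> i j))"
    proof (intro sum.cong refl, clarify)
      fix i j
      show "(p - (p + q) * x i) * \<psi> i j + W i j * \<psi> i j + ((p - (p + q) * x j) * \<psi> j i + W j i * \<psi> j i)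
        = - (p + q) * ((x i - x j) * \<psi> i j) + 2 * (W i j * \<psi> i j)"
      proof -
        have "\<psi> j i = - \<psi> i j" "W j i = - W i j" by (rule \<psi>anti, rule Wanti)
        then show ?thesis by (simp add: algebra_simps)
      qed
    qed
  qed (simp add: \<psi>0)
  finally have drift: "(\<Sum>(i, j)\<in>?P. - (p + q) * ((x i - x j) * \<psi> i j) + 2 * (W i j * \<psi> i j))
    \<le> (\<Sum>(i, j)\<in>?P. (?b i - ?b j) * \<psi> i j)" using three by linarith
  have fin: "finite ?P" by (rule finite_subset[of _ "{1..m} \<times> {1..m}"]) auto
  have card: "card ?P \<le> m * m"
  proof -
    have "card ?P \<le> card ({1..m} \<times> {1..m})" by (intro card_mono) auto
    then show ?thesis by simp
  qed
  have "(\<Sum>(i, j)\<in>?P. - (?b i - ?b j) / (x i - x j + d) + (4 * (x i * (1 - x i)) + 4 * (x j * (1 - x j))) / (2 * (x i - x j + d)\<^sup>2))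
    = (\<Sum>(i, j)\<in>?P. (4 * (x i * (1 - x i)) + 4 * (x j * (1 - x j))) / (2 * (x i - x j + d)\<^sup>2)) - (\<Sum>(i, j)\<in>?P. (?b i - ?b j) * \<psi> i j)"
    unfolding sum_subtractf[symmetric]
  proof (intro sum.cong refl, clarify)
    fix i j assume "i \<in> ?S" "j \<in> ?S" "i < j"
    then have "\<psi> i j = 1 / (x i - x j + d)" by (intro \<psi>P) simp
    then show "- (?b i - ?b j) / (x i - x j + d) + (4 * (x i * (1 - x i)) + 4 * (x j * (1 - x j))) / (2 * (x i - x j + d)\<^sup>2)
      = (4 * (x i * (1 - x i)) + 4 * (x j * (1 - x j))) / (2 * (x i - x j + d)\<^sup>2) - (?b i - ?b j) * \<psi> i j"
      by (simp add: minus_divide_left)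
  qed
  also have "\<dots> \<le> (\<Sum>(i, j)\<in>?P. (4 * (x i * (1 - x i)) + 4 * (x j * (1 - x j))) / (2 * (x i - x j + d)\<^sup>2)) -
     (\<Sum>(i, j)\<in>?P. - (p + q) * ((x i - x j) * \<psi> i j) + 2 * (W i j * \<psi> i j))" using drift by simp
  also have "\<dots> = (\<Sum>(i, j)\<in>?P. (4 * (x i * (1 - x i)) + 4 * (x j * (1 - x j))) / (2 * (x i - x j + d)\<^sup>2)
      + (p + q) * ((x i - x j) * \<psi> i j) - 2 * (W i j * \<psi> i j))"
    unfolding sum_subtractf[symmetric] by (intro sum.cong refl) (simp add: split_beta' algebra_simps)
  also have "\<dots> \<le> (\<Sum>(i, j)\<in>?P. \<bar>p + q\<bar>)"
  proof (intro sum_mono, clarify)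
    fix i j assume ij: "i \<in> ?S" "j \<in> ?S" "i < j"
    define u where "u = x i - x j"
    have u: "0 < u" using dec[OF ij] by (simp add: u_def)
    have \<psi>u: "\<psi> i j = 1 / (u + d)" using \<psi>P[of i j] ij by (simp add: u_def)
    define w where "w = x i * (1 - x j) + x j * (1 - x i)"
    have w0: "0 \<le> w" using x ij by (simp add: w_def)
    \<comment> \<open>Up to the factor 4, the bracket of the gap falls short of the interaction
      numerator by exactly the square of the gap.\<close>
    have "w - u\<^sup>2 = x i * (1 - x i) + x j * (1 - x j)"
      unfolding w_def u_def by (simp add: power2_eq_square algebra_simps)
    then have wle: "x i * (1 - x i) + x j * (1 - x j) \<le> w" using zero_le_power2[of u] by linarith
    have "(4 * (x i * (1 - x i)) + 4 * (x j * (1 - x j))) / (2 * (u + d)\<^sup>2) \<le> (4 * w) / (2 * (u + d)\<^sup>2)"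
      using wle by (intro divide_right_mono) auto
    also have "\<dots> = 2 * w / ((u + d) * (u + d))" by (simp add: power2_eq_square)
    \<comment> \<open>One factor u + d is lowered to u. This is the place where the regularization
      works in the right direction.\<close>
    also have "\<dots> \<le> 2 * w / (u * (u + d))"
      using w0 u d by (intro divide_left_mono mult_right_mono) auto
    also have "\<dots> = 2 * (W i j * \<psi> i j)" by (simp add: W_def interaction_def \<psi>u w_def u_def)
    finally have 1: "(4 * (x i * (1 - x i)) + 4 * (x j * (1 - x j))) / (2 * (u + d)\<^sup>2) \<le> 2 * (W i j * \<psi> i j)" .
    have "0 \<le> u * \<psi> i j" "u * \<psi> i j \<le> 1" using u d by (auto simp: \<psi>u)
    then have "(p + q) * (u * \<psi> i j) \<le> \<bar>p + q\<bar>"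
      by (intro mult_unit_interval_le)
    with 1 show "(4 * (x i * (1 - x i)) + 4 * (x j * (1 - x j))) / (2 * (x i - x j + d)\<^sup>2)
      + (p + q) * ((x i - x j) * \<psi> i j) - 2 * (W i j * \<psi> i j) \<le> \<bar>p + q\<bar>"
      unfolding u_def by linarith
  qed
  also have "\<dots> = real (card ?P) * \<bar>p + q\<bar>" by (simp add: split_beta')
  also have "\<dots> \<le> real (m * m) * \<bar>p + q\<bar>" using card by (intro mult_right_mono) (auto simp del: of_nat_mult)
  finally show ?thesis .
qed

section \<open>The Jacobi eigenvalue process\<close>

text \<open>Time is rounded down to multiples of 1 / (n + 1), so that each approximation glues
  countably many functions of the path alone. Continuity on the whole line makes the rounding
  harmless at every time.\<close>

lemma joint_measurable_continuous:
  fixes f :: "real \<Rightarrow> 'w \<Rightarrow> real"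
  assumes f: "\<And>r. f r \<in> borel_measurable M" and c: "\<And>\<omega>. \<omega> \<in> space M \<Longrightarrow> continuous_on UNIV (\<lambda>r. f r \<omega>)"
  shows "(\<lambda>(\<omega>, r). f r \<omega>) \<in> borel_measurable (M \<Otimes>\<^sub>M lborel)"
proof (rule borel_measurable_LIMSEQ_real)
  define h where "h n x = f (real_of_int \<lfloor>real (Suc n) * snd x\<rfloor> / real (Suc n)) (fst x)" for n and x :: "'w \<times> real"
  show "h n \<in> borel_measurable (M \<Otimes>\<^sub>M lborel)" for n
    unfolding h_def
  proof (rule measurable_compose_countable[where f = "\<lambda>i x. f (real_of_int i / real (Suc n)) (fst x)"
        and g = "\<lambda>x. \<lfloor>real (Suc n) * snd x\<rfloor>"])
    show "(\<lambda>x. \<lfloor>real (Suc n) * snd x\<rfloor>) \<in> measurable (M \<Otimes>\<^sub>M lborel) (count_space UNIV)" by measurable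
    show "(\<lambda>x. f (real_of_int i / real (Suc n)) (fst x)) \<in> borel_measurable (M \<Otimes>\<^sub>M lborel)" for i
      by (rule measurable_compose[OF measurable_fst f])
  qed
  fix x assume "x \<in> space (M \<Otimes>\<^sub>M (lborel :: real measure))"
  then obtain \<omega> r where x: "x = (\<omega>, r)" "\<omega> \<in> space M" by (auto simp: space_pair_measure)
  have "(\<lambda>n. real_of_int \<lfloor>real (Suc n) * r\<rfloor> / real (Suc n)) \<longlonglongrightarrow> r"
  proof (rule LIMSEQ_I)
    fix e :: real assume "0 < e"
    then obtain n0 where n0: "1 / real (Suc n0) < e" using nat_approx_posE by blast
    have "norm (real_of_int \<lfloor>real (Suc n) * r\<rfloor> / real (Suc n) - r) < e" if n: "n0 \<le> n" for n
    proof -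
      have "\<bar>real_of_int \<lfloor>real (Suc n) * r\<rfloor> - real (Suc n) * r\<bar> \<le> 1" by linarith
      then have "\<bar>real_of_int \<lfloor>real (Suc n) * r\<rfloor> - real (Suc n) * r\<bar> / real (Suc n) \<le> 1 / real (Suc n)"
        by (intro divide_right_mono) auto
      moreover have "real_of_int \<lfloor>real (Suc n) * r\<rfloor> / real (Suc n) - r =
          (real_of_int \<lfloor>real (Suc n) * r\<rfloor> - real (Suc n) * r) / real (Suc n)"
        by (simp add: diff_divide_distrib)
      moreover have "1 / real (Suc n) \<le> 1 / real (Suc n0)" using n by (intro divide_left_mono) auto
      ultimately show ?thesis using n0 by (simp add: abs_divide)
    qed
    then show "\<exists>no. \<forall>n\<ge>no. norm (real_of_int \<lfloor>real (Suc n) * r\<rfloor> / real (Suc n) - r) < e" by blast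
  qed
  moreover have "isCont (\<lambda>r. f r \<omega>) r" using c[OF x(2)] by (simp add: continuous_on_eq_continuous_at)
  ultimately show "(\<lambda>n. h n x) \<longlonglongrightarrow> (case x of (\<omega>, r) \<Rightarrow> f r \<omega>)"
    unfolding x h_def by (auto intro: isCont_tendsto_compose)
qed

lemma square_integrable_bound_AE:
  assumes g: "square_integrable N g" and f: "f \<in> borel_measurable N" and le: "AE x in N. \<bar>f x\<bar> \<le> g x"
  shows "square_integrable N f"
proof -
  have "integrable N (\<lambda>x. (f x)\<^sup>2)"
  proof (rule Bochner_Integration.integrable_bound)
    show "integrable N (\<lambda>x. (g x)\<^sup>2)" using g by (simp add: square_integrable_def)
    show "AE x in N. norm ((f x)\<^sup>2) \<le> norm ((g x)\<^sup>2)"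
      using le
    proof eventually_elim
      case (elim x)
      then have "(f x)\<^sup>2 \<le> (g x)\<^sup>2" by (metis abs_ge_zero power2_abs power_mono)
      then show ?case by simp
    qed
  qed (use f in measurable)
  then show ?thesis using f by (simp add: square_integrable_def)
qed

text \<open>By antisymmetry the weights -i turn the interactions into half the sum of (j - i) W_ij.
  For ordered vectors every such term is at least |W_ij|, because distinct indices differ by at
  least 1 and W_ij has the sign of j - i. The linear drift costs at most m (|p| + |p + q|) per
  coordinate.\<close>

lemma interaction_sum_bound:
  fixes x :: "nat \<Rightarrow> real"
  assumes x: "x \<in> ordered_unit_vectors m"
  shows "(\<Sum>i\<in>{1..m}. \<Sum>j\<in>{1..m}. \<bar>interaction (x i) (x j)\<bar>) \<le>
    2 * (\<Sum>i\<in>{1..m}. - real i * jacobi_drift m p q x i) + 2 * (real (m * m) * (\<bar>p\<bar> + \<bar>p + q\<bar>))"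
proof -
  let ?S = "{1..m}"
  have x01: "0 \<le> x i" "x i \<le> 1" if "i \<in> ?S" for i using x that by (auto simp: ordered_unit_vectors_def)
  have xle: "x j \<le> x i" if "i \<in> ?S" "j \<in> ?S" "i \<le> j" for i j using x that by (auto simp: ordered_unit_vectors_def)
  define W where "W i j = interaction (x i) (x j)" for i j
  have Wpos: "0 \<le> W i j" if "i \<in> ?S" "j \<in> ?S" "i \<le> j" for i j
    using x01[OF that(1)] x01[OF that(2)] xle[OF that] by (simp add: W_def interaction_def)
  have Wanti: "W j i = - W i j" for i j unfolding W_def by (rule interaction_antisym)
  have "(\<Sum>i\<in>?S. \<Sum>j\<in>?S. \<bar>W i j\<bar>) \<le> (\<Sum>i\<in>?S. \<Sum>j\<in>?S. (real j - real i) * W i j)"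
  proof (intro sum_mono)
    fix i j assume ij: "i \<in> ?S" "j \<in> ?S"
    consider "i = j" | "i < j" | "j < i" by linarith
    then show "\<bar>W i j\<bar> \<le> (real j - real i) * W i j"
    proof cases
      case 1
      then show ?thesis by (simp add: W_def)
    next
      case 2
      then have "1 * W i j \<le> (real j - real i) * W i j" using Wpos[of i j] ij by (intro mult_right_mono) auto
      then show ?thesis using 2 Wpos[of i j] ij by simp
    next
      case 3
      then have "1 * W j i \<le> (real i - real j) * W j i" using Wpos[of j i] ij by (intro mult_right_mono) auto
      moreover have "\<bar>W i j\<bar> = W j i" using 3 Wpos[of j i] ij Wanti[of i j] by simp
      moreover have "(real i - real j) * W j i = (real j - real i) * W i j"
        using Wanti[of i j] by (simp add: algebra_simps)
      ultimately show ?thesis by simp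
    qed
  qed
  also have "\<dots> = (\<Sum>i\<in>?S. \<Sum>j\<in>?S. real j * W i j) + (\<Sum>i\<in>?S. \<Sum>j\<in>?S. - real i * W i j)"
    by (simp add: sum.distrib[symmetric] algebra_simps)
  also have "(\<Sum>i\<in>?S. \<Sum>j\<in>?S. real j * W i j) = (\<Sum>i\<in>?S. \<Sum>j\<in>?S. real i * W j i)"
    by (rule sum.swap)
  also have "\<dots> = (\<Sum>i\<in>?S. \<Sum>j\<in>?S. - real i * W i j)"
  proof (intro sum.cong refl)
    fix i j show "real i * W j i = - real i * W i j" using Wanti[of i j] by simp
  qed
  finally have A: "(\<Sum>i\<in>?S. \<Sum>j\<in>?S. \<bar>W i j\<bar>) \<le> 2 * (\<Sum>i\<in>?S. \<Sum>j\<in>?S. - real i * W i j)" by simp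
  have "(\<Sum>i\<in>?S. - real i * jacobi_drift m p q x i) =
      (\<Sum>i\<in>?S. - real i * (p - (p + q) * x i)) + (\<Sum>i\<in>?S. \<Sum>j\<in>?S. - real i * W i j)"
    unfolding sum.distrib[symmetric]
  proof (rule sum.cong[OF refl])
    fix i assume i: "i \<in> ?S"
    show "- real i * jacobi_drift m p q x i = - real i * (p - (p + q) * x i) + (\<Sum>j\<in>?S. - real i * W i j)"
      unfolding jacobi_drift_alt[OF i] W_def[symmetric] sum_distrib_left[symmetric] by (simp only: distrib_left)
  qed
  moreover have "(\<Sum>i\<in>?S. - (real m * (\<bar>p\<bar> + \<bar>p + q\<bar>))) \<le> (\<Sum>i\<in>?S. - real i * (p - (p + q) * x i))"
  proof (rule sum_mono)
    fix i assume i: "i \<in> ?S"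
    have "\<bar>p - (p + q) * x i\<bar> \<le> \<bar>p\<bar> + \<bar>p + q\<bar> * \<bar>x i\<bar>" by (simp add: abs_mult[symmetric])
    also have "\<bar>p + q\<bar> * \<bar>x i\<bar> \<le> \<bar>p + q\<bar>" using x01[OF i] by (intro mult_left_le) auto
    finally have "\<bar>real i * (p - (p + q) * x i)\<bar> \<le> real m * (\<bar>p\<bar> + \<bar>p + q\<bar>)"
      unfolding abs_mult using i by (intro mult_mono') auto
    then show "- (real m * (\<bar>p\<bar> + \<bar>p + q\<bar>)) \<le> - real i * (p - (p + q) * x i)" by linarith
  qed
  ultimately show ?thesis using A by (simp add: W_def)
qed

section \<open>Martingale parts and singular drift of the coordinates\<close>

locale jacobi_process =
  fixes M :: "'w measure" and F :: "real \<Rightarrow> 'w measure"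
    and m :: nat and p q :: real
    and \<nu> :: "nat \<Rightarrow> real \<Rightarrow> 'w \<Rightarrow> real"
    and X :: "real \<Rightarrow> 'w \<Rightarrow> nat \<Rightarrow> real"
  assumes m_pos: "1 \<le> m" and jacobi: "jacobi_eigenvalue_process M F m p q \<nu> X"

sublocale jacobi_process \<subseteq> brownian_filtered M F m \<nu>
proof -
  have "filtered_prob_space M F" "independent_brownian_motions M F m \<nu>"
    using jacobi by (auto simp: jacobi_eigenvalue_process_def)
  then show "brownian_filtered M F m \<nu>"
    by (auto simp: filtered_prob_space_def brownian_filtered_def filtered_prob_def filtered_prob_axioms_def
        brownian_filtered_axioms_def)
qed

context jacobi_process
begin

text \<open>\<open>P\<close> is \<open>X\<close> frozen at negative times: unlike \<open>X\<close> it is jointly measurable on the whole time axis.\<close>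

definition P :: "real \<Rightarrow> 'w \<Rightarrow> nat \<Rightarrow> real" where
  "P r \<omega> = X (max 0 r) \<omega>"

lemma P_eq: "0 \<le> r \<Longrightarrow> P r = X r"
  by (simp add: P_def fun_eq_iff)

lemma P_ordered: "\<omega> \<in> space M \<Longrightarrow> P r \<omega> \<in> ordered_unit_vectors m"
  using jacobi by (simp add: jacobi_eigenvalue_process_def P_def)

lemma P_unit: "\<omega> \<in> space M \<Longrightarrow> i \<in> {1..m} \<Longrightarrow> 0 \<le> P r \<omega> i" "\<omega> \<in> space M \<Longrightarrow> i \<in> {1..m} \<Longrightarrow> P r \<omega> i \<le> 1"
  using P_ordered by (auto simp: ordered_unit_vectors_def)

lemma P_antimono: "\<omega> \<in> space M \<Longrightarrow> i \<in> {1..m} \<Longrightarrow> j \<in> {1..m} \<Longrightarrow> i \<le> j \<Longrightarrow> P r \<omega> j \<le> P r \<omega> i"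
  using P_ordered by (auto simp: ordered_unit_vectors_def)

lemma P_adapted: "0 \<le> r \<Longrightarrow> i \<in> {1..m} \<Longrightarrow> (\<lambda>\<omega>. P r \<omega> i) \<in> borel_measurable (F r)"
  using jacobi by (simp add: jacobi_eigenvalue_process_def P_eq)

lemma P_continuous: "\<omega> \<in> space M \<Longrightarrow> i \<in> {1..m} \<Longrightarrow> continuous_on UNIV (\<lambda>r. P r \<omega> i)"
proof -
  assume "\<omega> \<in> space M" "i \<in> {1..m}"
  then have "continuous_on {0..} (\<lambda>t. X t \<omega> i)" using jacobi by (simp add: jacobi_eigenvalue_process_def)
  then show ?thesis unfolding P_def
    by (rule continuous_on_compose2[where f = "max 0"]) (auto intro!: continuous_intros)
qed

lemma P_measurable: "i \<in> {1..m} \<Longrightarrow> (\<lambda>\<omega>. P r \<omega> i) \<in> borel_measurable M"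
  using adapted_measurable[OF P_adapted[of "max 0 r" i]] by (simp add: P_def)

lemma P_joint_measurable: "i \<in> {1..m} \<Longrightarrow> (\<lambda>(\<omega>, r). P r \<omega> i) \<in> borel_measurable (M \<Otimes>\<^sub>M lborel)"
  using joint_measurable_continuous[of "\<lambda>r \<omega>. P r \<omega> i"] P_measurable P_continuous by simp

text \<open>The equation only asserts that some integral process exists for each coordinate; one is
  fixed here, so that combinations of coordinates can refer to it.\<close>

definition noise :: "nat \<Rightarrow> real \<Rightarrow> 'w \<Rightarrow> real" where
  "noise i = (SOME I. is_ito_integral M F (\<nu> i) (\<lambda>s \<omega>. 2 * sqrt (X s \<omega> i * (1 - X s \<omega> i))) I \<and>
        (AE \<omega> in M. \<forall>t\<ge>0. X t \<omega> i = X 0 \<omega> i + I t \<omega> + (LINT s:{0..t}|lborel. jacobi_drift m p q (X s \<omega>) i)))"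

lemma noise:
  assumes "i \<in> {1..m}"
  shows "is_ito_integral M F (\<nu> i) (\<lambda>s \<omega>. 2 * sqrt (X s \<omega> i * (1 - X s \<omega> i))) (noise i)"
    and "AE \<omega> in M. \<forall>t\<ge>0. X t \<omega> i = X 0 \<omega> i + noise i t \<omega> + (LINT s:{0..t}|lborel. jacobi_drift m p q (X s \<omega>) i)"
proof -
  have "\<exists>I. is_ito_integral M F (\<nu> i) (\<lambda>s \<omega>. 2 * sqrt (X s \<omega> i * (1 - X s \<omega> i))) I \<and>
        (AE \<omega> in M. \<forall>t\<ge>0. X t \<omega> i = X 0 \<omega> i + I t \<omega> + (LINT s:{0..t}|lborel. jacobi_drift m p q (X s \<omega>) i))"
    using jacobi assms unfolding jacobi_eigenvalue_process_def by blast
  from someI_ex[OF this]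
  show "is_ito_integral M F (\<nu> i) (\<lambda>s \<omega>. 2 * sqrt (X s \<omega> i * (1 - X s \<omega> i))) (noise i)"
    and "AE \<omega> in M. \<forall>t\<ge>0. X t \<omega> i = X 0 \<omega> i + noise i t \<omega> + (LINT s:{0..t}|lborel. jacobi_drift m p q (X s \<omega>) i)"
    unfolding noise_def[symmetric] by auto
qed

lemma noise_ito_integral:
  assumes i: "i \<in> {1..m}"
  shows "ito_integral M F m \<nu> i (\<lambda>s \<omega>. 2 * sqrt (X s \<omega> i * (1 - X s \<omega> i))) (noise i) 2"
proof (intro ito_integral.intro brownian_filtered_axioms ito_integral_axioms.intro i noise(1))
  fix r :: real and \<omega> assume r: "0 \<le> r" and w: "\<omega> \<in> space M"
  have "X r \<omega> i * (1 - X r \<omega> i) \<le> 1"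
    using P_unit[OF w i, of r] P_eq[OF r] by (intro mult_le_one) auto
  moreover have "0 \<le> X r \<omega> i * (1 - X r \<omega> i)"
    using P_unit[OF w i, of r] P_eq[OF r] by simp
  ultimately show "\<bar>2 * sqrt (X r \<omega> i * (1 - X r \<omega> i))\<bar> \<le> 2" by simp
next
  note P_joint_measurable[OF i, measurable]
  have "(\<lambda>(\<omega>, r). indicator {0..} r * (2 * sqrt (P r \<omega> i * (1 - P r \<omega> i)))) \<in> borel_measurable (M \<Otimes>\<^sub>M lborel)"
    by measurable
  moreover have "(\<lambda>(\<omega>, r). indicator {0..} r * (2 * sqrt (P r \<omega> i * (1 - P r \<omega> i)))) =
    (\<lambda>(\<omega>, r). indicator {0..} r * (2 * sqrt (X r \<omega> i * (1 - X r \<omega> i))))"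
    by (auto simp: fun_eq_iff indicator_def P_eq)
  ultimately show "(\<lambda>(\<omega>, r). indicator {0..} r * (2 * sqrt (X r \<omega> i * (1 - X r \<omega> i)))) \<in> borel_measurable (M \<Otimes>\<^sub>M lborel)"
    by simp
qed

lemma noise_square_integrable: "i \<in> {1..m} \<Longrightarrow> 0 \<le> t \<Longrightarrow> square_integrable M (noise i t)"
  using ito_integral.square_integrable_ito[OF noise_ito_integral] .

lemma noise_martingale:
  "i \<in> {1..m} \<Longrightarrow> multiplier s Z \<Longrightarrow> 0 \<le> s \<Longrightarrow> s \<le> t \<Longrightarrow> expectation (\<lambda>\<omega>. Z \<omega> * (noise i t \<omega> - noise i s \<omega>)) = 0"
  using ito_integral.ito_martingale[OF noise_ito_integral] .

lemma noise_covariation: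
  assumes ij: "i \<in> {1..m}" "j \<in> {1..m}" and Z: "multiplier s Z" and st: "0 \<le> s" "s \<le> t"
  shows "expectation (\<lambda>\<omega>. Z \<omega> * ((noise i t \<omega> - noise i s \<omega>) * (noise j t \<omega> - noise j s \<omega>))) =
    (if i = j then (\<integral>(\<omega>, r). Z \<omega> * (indicator {s<..t} r * (4 * (P r \<omega> i * (1 - P r \<omega> i)))) \<partial>(M \<Otimes>\<^sub>M lborel)) else 0)"
proof -
  have "(\<integral>(\<omega>, r). Z \<omega> * (indicator {s<..t} r * ((2 * sqrt (X r \<omega> i * (1 - X r \<omega> i))) * (2 * sqrt (X r \<omega> i * (1 - X r \<omega> i))))) \<partial>(M \<Otimes>\<^sub>M lborel))
    = (\<integral>(\<omega>, r). Z \<omega> * (indicator {s<..t} r * (4 * (P r \<omega> i * (1 - P r \<omega> i)))) \<partial>(M \<Otimes>\<^sub>M lborel))"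
  proof (rule Bochner_Integration.integral_cong[OF refl])
    fix x :: "'w \<times> real" assume "x \<in> space (M \<Otimes>\<^sub>M lborel)"
    then obtain \<omega> r where x: "x = (\<omega>, r)" "\<omega> \<in> space M" by (auto simp: space_pair_measure)
    show "(case x of (\<omega>, r) \<Rightarrow> Z \<omega> * (indicator {s<..t} r * ((2 * sqrt (X r \<omega> i * (1 - X r \<omega> i))) * (2 * sqrt (X r \<omega> i * (1 - X r \<omega> i)))))) =
      (case x of (\<omega>, r) \<Rightarrow> Z \<omega> * (indicator {s<..t} r * (4 * (P r \<omega> i * (1 - P r \<omega> i)))))"
    proof (cases "r \<in> {s<..t}")
      case True
      then have r: "0 \<le> r" using st by auto
      have "0 \<le> P r \<omega> i * (1 - P r \<omega> i)" using P_unit[OF x(2) ij(1), of r] by simp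
      then have "(2 * sqrt (P r \<omega> i * (1 - P r \<omega> i))) * (2 * sqrt (P r \<omega> i * (1 - P r \<omega> i))) = 4 * (P r \<omega> i * (1 - P r \<omega> i))"
        by simp
      then show ?thesis unfolding x prod.case P_eq[OF r] by simp
    qed (simp add: x)
  qed
  then show ?thesis
    using ito_covariation[OF noise_ito_integral[OF ij(1)] noise_ito_integral[OF ij(2)] Z st] by auto
qed

definition drift :: "nat \<Rightarrow> real \<Rightarrow> 'w \<Rightarrow> real" where
  "drift i r \<omega> = jacobi_drift m p q (P r \<omega>) i"

definition singular :: "nat \<Rightarrow> real \<Rightarrow> 'w \<Rightarrow> real" where
  "singular i r \<omega> = (\<Sum>j\<in>{1..m}. \<bar>interaction (P r \<omega> i) (P r \<omega> j)\<bar>)"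

definition total_singular :: "real \<Rightarrow> 'w \<Rightarrow> real" where
  "total_singular r \<omega> = (\<Sum>i\<in>{1..m}. singular i r \<omega>)"

lemma drift_joint_measurable:
  assumes "i \<in> {1..m}" shows "(\<lambda>(\<omega>, r). drift i r \<omega>) \<in> borel_measurable (M \<Otimes>\<^sub>M lborel)"
proof -
  note P_joint_measurable[unfolded split_beta', measurable]
  show ?thesis
    unfolding drift_def jacobi_drift_alt[OF assms] interaction_def split_beta' using assms by measurable
qed

lemma singular_joint_measurable:
  assumes "i \<in> {1..m}" shows "(\<lambda>(\<omega>, r). singular i r \<omega>) \<in> borel_measurable (M \<Otimes>\<^sub>M lborel)"
proof -
  note P_joint_measurable[unfolded split_beta', measurable]
  show ?thesis unfolding singular_def interaction_def split_beta' using assms by measurable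
qed

lemma total_singular_joint_measurable: "(\<lambda>(\<omega>, r). total_singular r \<omega>) \<in> borel_measurable (M \<Otimes>\<^sub>M lborel)"
proof -
  note singular_joint_measurable[unfolded split_beta', measurable]
  show ?thesis unfolding total_singular_def split_beta' by measurable
qed

lemma singular_nonneg: "0 \<le> singular i r \<omega>"
  unfolding singular_def by (intro sum_nonneg) auto

lemma singular_le_total: "i \<in> {1..m} \<Longrightarrow> singular i r \<omega> \<le> total_singular r \<omega>"
  unfolding total_singular_def by (rule member_le_sum) (auto intro: singular_nonneg)

lemma total_singular_nonneg: "0 \<le> total_singular r \<omega>"
  unfolding total_singular_def by (intro sum_nonneg singular_nonneg)

lemma drift_bound:
  assumes w: "\<omega> \<in> space M" and i: "i \<in> {1..m}"
  shows "\<bar>drift i r \<omega>\<bar> \<le> \<bar>p\<bar> + \<bar>p + q\<bar> + total_singular r \<omega>"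
proof -
  have "\<bar>\<Sum>j\<in>{1..m}. interaction (P r \<omega> i) (P r \<omega> j)\<bar> \<le> singular i r \<omega>"
    unfolding singular_def by (rule sum_abs)
  moreover have "\<bar>(p + q) * P r \<omega> i\<bar> \<le> \<bar>p + q\<bar>"
    unfolding abs_mult using P_unit[OF w i, of r] by (intro mult_left_le) auto
  ultimately show ?thesis
    using singular_le_total[OF i, of r \<omega>] unfolding drift_def jacobi_drift_alt[OF i] by linarith
qed

text \<open>The two sides agree as long as no other coordinate coincides with coordinate i. A
  coincidence contributes 0 to the real sum and possibly infinity to the extended one.\<close>

lemma singular_le_ennreal:
  assumes w: "\<omega> \<in> space M" and i: "i \<in> {1..m}" and r: "0 \<le> r"
  shows "ennreal (singular i r \<omega>) \<le> jacobi_singular_drift m (X r \<omega>) i"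
proof -
  have "singular i r \<omega> = (\<Sum>j\<in>{1..m} - {i}. \<bar>interaction (P r \<omega> i) (P r \<omega> j)\<bar>)"
    unfolding singular_def using sum.remove[of "{1..m}" i "\<lambda>j. \<bar>interaction (P r \<omega> i) (P r \<omega> j)\<bar>"] i by simp
  then have "ennreal (singular i r \<omega>) = (\<Sum>j\<in>{1..m} - {i}. ennreal \<bar>interaction (P r \<omega> i) (P r \<omega> j)\<bar>)"
    by (simp add: sum_ennreal)
  also have "\<dots> \<le> (\<Sum>j\<in>{1..m} - {i}. ennreal (X r \<omega> i * (1 - X r \<omega> j) + X r \<omega> j * (1 - X r \<omega> i)) / ennreal \<bar>X r \<omega> i - X r \<omega> j\<bar>)"
  proof (rule sum_mono)
    fix j assume j: "j \<in> {1..m} - {i}"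
    have n: "0 \<le> X r \<omega> i * (1 - X r \<omega> j) + X r \<omega> j * (1 - X r \<omega> i)"
      using P_unit[OF w i, of r] P_unit[OF w, of j r] j unfolding P_eq[OF r] by simp
    show "ennreal \<bar>interaction (P r \<omega> i) (P r \<omega> j)\<bar> \<le>
      ennreal (X r \<omega> i * (1 - X r \<omega> j) + X r \<omega> j * (1 - X r \<omega> i)) / ennreal \<bar>X r \<omega> i - X r \<omega> j\<bar>"
    proof (cases "X r \<omega> i = X r \<omega> j")
      case False
      then show ?thesis using n unfolding P_eq[OF r] interaction_def
        by (simp add: divide_ennreal abs_divide)
    qed (simp add: P_eq[OF r])
  qed
  finally show ?thesis unfolding jacobi_singular_drift_def .
qed

lemma total_singular_integrable:
  "AE \<omega> in M. \<forall>t\<ge>0. set_integrable lborel {0..t} (\<lambda>r. total_singular r \<omega>)"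
proof -
  have "AE \<omega> in M. \<forall>t\<ge>0. \<forall>i\<in>{1..m}. (\<integral>\<^sup>+s\<in>{0..t}. jacobi_singular_drift m (X s \<omega>) i \<partial>lborel) < \<infinity>"
    using jacobi by (simp add: jacobi_eigenvalue_process_def)
  then show ?thesis
    using AE_space
  proof eventually_elim
    case (elim \<omega>)
    show ?case
    proof (intro allI impI)
      fix t :: real assume t: "0 \<le> t"
      have "set_integrable lborel {0..t} (\<lambda>r. singular i r \<omega>)" if i: "i \<in> {1..m}" for i
        unfolding set_integrable_def
      proof (rule integrableI_bounded)
        have "(\<lambda>r. singular i r \<omega>) \<in> borel_measurable lborel"
          using measurable_compose[OF measurable_Pair1'[OF elim(2)] singular_joint_measurable[OF i]] by simp
        then show "(\<lambda>r. indicator {0..t} r *\<^sub>R singular i r \<omega>) \<in> borel_measurable lborel" by measurable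
        have "(\<integral>\<^sup>+r. ennreal (norm (indicator {0..t} r *\<^sub>R singular i r \<omega>)) \<partial>lborel) \<le>
          (\<integral>\<^sup>+s\<in>{0..t}. jacobi_singular_drift m (X s \<omega>) i \<partial>lborel)"
          using singular_le_ennreal[OF elim(2) i] singular_nonneg
          by (intro nn_integral_mono) (auto simp: indicator_def)
        also have "\<dots> < \<infinity>" using elim(1) t i by blast
        finally show "(\<integral>\<^sup>+r. ennreal (norm (indicator {0..t} r *\<^sub>R singular i r \<omega>)) \<partial>lborel) < \<infinity>" .
      qed
      then show "set_integrable lborel {0..t} (\<lambda>r. total_singular r \<omega>)"
        unfolding total_singular_def set_integrable_def scaleR_sum_right
        by (intro Bochner_Integration.integrable_sum)
    qed
  qed
qed

lemma drift_set_integrable: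
  "AE \<omega> in M. \<forall>t\<ge>0. \<forall>i\<in>{1..m}. set_integrable lborel {0..t} (\<lambda>r. drift i r \<omega>)"
  using total_singular_integrable AE_space
proof eventually_elim
  case (elim \<omega>)
  show ?case
  proof (intro allI impI ballI)
    fix t :: real and i assume t: "0 \<le> t" and i: "i \<in> {1..m}"
    have "set_integrable lborel {0..t} (\<lambda>r. \<bar>p\<bar> + \<bar>p + q\<bar> + total_singular r \<omega>)"
      using elim(1) t by (intro set_integral_add set_integrable_const) auto
    then show "set_integrable lborel {0..t} (\<lambda>r. drift i r \<omega>)"
    proof (rule set_integrable_bound)
      have "(\<lambda>r. drift i r \<omega>) \<in> borel_measurable lborel"
        using measurable_compose[OF measurable_Pair1'[OF elim(2)] drift_joint_measurable[OF i]] by simp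
      then show "set_borel_measurable lborel {0..t} (\<lambda>r. drift i r \<omega>)"
        unfolding set_borel_measurable_def by measurable
      show "AE r in lborel. r \<in> {0..t} \<longrightarrow> norm (drift i r \<omega>) \<le> norm (\<bar>p\<bar> + \<bar>p + q\<bar> + total_singular r \<omega>)"
        using drift_bound[OF elim(2) i] by (intro AE_I2) (force intro: order_trans)
    qed
  qed
qed

section \<open>Affine combinations of the coordinates as scalar processes\<close>

definition combination :: "real \<Rightarrow> (nat \<Rightarrow> real) \<Rightarrow> real \<Rightarrow> 'w \<Rightarrow> real" where
  "combination c0 c r \<omega> = c0 + (\<Sum>i\<in>{1..m}. c i * P r \<omega> i)"

definition combined_noise :: "(nat \<Rightarrow> real) \<Rightarrow> real \<Rightarrow> 'w \<Rightarrow> real" where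
  "combined_noise c t \<omega> = (\<Sum>i\<in>{1..m}. c i * noise i t \<omega>)"

definition combined_drift :: "(nat \<Rightarrow> real) \<Rightarrow> real \<Rightarrow> 'w \<Rightarrow> real" where
  "combined_drift c r \<omega> = (\<Sum>i\<in>{1..m}. c i * drift i r \<omega>)"

text \<open>Only squares of the weights occur: the driving Brownian motions are independent, so the
  mixed brackets vanish.\<close>

definition combined_bracket :: "(nat \<Rightarrow> real) \<Rightarrow> real \<Rightarrow> 'w \<Rightarrow> real" where
  "combined_bracket c r \<omega> = (\<Sum>i\<in>{1..m}. (c i)\<^sup>2 * (4 * (P r \<omega> i * (1 - P r \<omega> i))))"

lemma combined_noise_square_integrable: "0 \<le> t \<Longrightarrow> square_integrable M (combined_noise c t)"
  unfolding combined_noise_def[abs_def]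
  by (intro square_integrable_sum square_integrable_cmult noise_square_integrable) auto

lemma combined_noise_martingale:
  assumes st: "0 \<le> s" "s \<le> t" and Z: "multiplier s Z"
  shows "expectation (\<lambda>\<omega>. Z \<omega> * (combined_noise c t \<omega> - combined_noise c s \<omega>)) = 0"
proof -
  have int: "integrable M (\<lambda>\<omega>. Z \<omega> * (noise i t \<omega> - noise i s \<omega>))" if "i \<in> {1..m}" for i
    using square_integrable_imp_integrable[OF square_integrable_diff[OF noise_square_integrable noise_square_integrable]]
      st that by (intro integrable_multiplier_mult[OF Z]) auto
  have "expectation (\<lambda>\<omega>. Z \<omega> * (combined_noise c t \<omega> - combined_noise c s \<omega>)) =
    expectation (\<lambda>\<omega>. \<Sum>i\<in>{1..m}. c i * (Z \<omega> * (noise i t \<omega> - noise i s \<omega>)))"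
    unfolding combined_noise_def sum_subtractf[symmetric] sum_distrib_left
    by (intro Bochner_Integration.integral_cong refl sum.cong) (simp add: algebra_simps)
  also have "\<dots> = (\<Sum>i\<in>{1..m}. expectation (\<lambda>\<omega>. c i * (Z \<omega> * (noise i t \<omega> - noise i s \<omega>))))"
    using int by (intro Bochner_Integration.integral_sum) auto
  also have "\<dots> = 0"
    using noise_martingale[OF _ Z st] by (intro sum.neutral) simp
  finally show ?thesis .
qed

lemma combined_noise_variance:
  assumes st: "0 \<le> s" "s \<le> t" and Z: "multiplier s Z"
  shows "expectation (\<lambda>\<omega>. Z \<omega> * (combined_noise c t \<omega> - combined_noise c s \<omega>)\<^sup>2) =
    (\<integral>(\<omega>, r). Z \<omega> * (indicator {s<..t} r * combined_bracket c r \<omega>) \<partial>(M \<Otimes>\<^sub>M lborel))"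
proof -
  let ?d = "\<lambda>i \<omega>. noise i t \<omega> - noise i s \<omega>"
  have sq: "square_integrable M (?d i)" if "i \<in> {1..m}" for i
    using that st by (intro square_integrable_diff noise_square_integrable) auto
  have int: "integrable M (\<lambda>\<omega>. Z \<omega> * (?d i \<omega> * ?d j \<omega>))" if "i \<in> {1..m}" "j \<in> {1..m}" for i j
    by (rule integrable_multiplier_mult[OF Z st(1) square_integrable_mult[OF sq sq]]) (use that in auto)
  let ?H = "\<lambda>i x. case x of (\<omega>, r) \<Rightarrow> Z \<omega> * (indicator {s<..t} r * (4 * (P r \<omega> i * (1 - P r \<omega> i))))"
  have intH: "integrable (M \<Otimes>\<^sub>M lborel) (?H i)" if i: "i \<in> {1..m}" for i
  proof (rule Bochner_Integration.integrable_bound)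
    show "integrable (M \<Otimes>\<^sub>M lborel) (\<lambda>(\<omega>, r). (4 * Z \<omega>) * indicator {s<..t} r)"
      using integrable_multiplier[OF Z st(1)] st by (intro integrable_product_indicator) auto
    have [measurable]: "Z \<in> borel_measurable M" using multiplier_measurable[OF Z st(1)] .
    note P_joint_measurable[OF i, measurable]
    show "?H i \<in> borel_measurable (M \<Otimes>\<^sub>M lborel)" by measurable
    show "AE x in M \<Otimes>\<^sub>M lborel. norm (?H i x) \<le> norm (case x of (\<omega>, r) \<Rightarrow> (4 * Z \<omega>) * indicator {s<..t} r)"
    proof (rule AE_I2)
      fix x :: "'w \<times> real" assume "x \<in> space (M \<Otimes>\<^sub>M lborel)"
      then obtain \<omega> r where x: "x = (\<omega>, r)" "\<omega> \<in> space M" by (auto simp: space_pair_measure)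
      have "\<bar>P r \<omega> i * (1 - P r \<omega> i)\<bar> \<le> 1"
        unfolding abs_mult using P_unit[OF x(2) i, of r] by (intro mult_le_one) auto
      then have "\<bar>Z \<omega>\<bar> * (indicator {s<..t} r * (4 * \<bar>P r \<omega> i * (1 - P r \<omega> i)\<bar>)) \<le> \<bar>Z \<omega>\<bar> * (indicator {s<..t} r * 4)"
        by (intro mult_left_mono) auto
      then show "norm (?H i x) \<le> norm (case x of (\<omega>, r) \<Rightarrow> (4 * Z \<omega>) * indicator {s<..t} r)"
        unfolding x by (simp add: abs_mult mult_ac)
    qed
  qed
  have "expectation (\<lambda>\<omega>. Z \<omega> * (combined_noise c t \<omega> - combined_noise c s \<omega>)\<^sup>2) =
    expectation (\<lambda>\<omega>. \<Sum>i\<in>{1..m}. \<Sum>j\<in>{1..m}. (c i * c j) * (Z \<omega> * (?d i \<omega> * ?d j \<omega>)))"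
  proof (rule Bochner_Integration.integral_cong[OF refl])
    fix \<omega>
    have d: "combined_noise c t \<omega> - combined_noise c s \<omega> = (\<Sum>i\<in>{1..m}. c i * ?d i \<omega>)"
      unfolding combined_noise_def sum_subtractf[symmetric] by (simp only: right_diff_distrib)
    show "Z \<omega> * (combined_noise c t \<omega> - combined_noise c s \<omega>)\<^sup>2 =
      (\<Sum>i\<in>{1..m}. \<Sum>j\<in>{1..m}. (c i * c j) * (Z \<omega> * (?d i \<omega> * ?d j \<omega>)))"
      unfolding d power2_eq_square unfolding sum_product unfolding sum_distrib_left
      by (intro sum.cong refl) (simp only: mult_ac)
  qed
  also have "\<dots> = (\<Sum>i\<in>{1..m}. \<Sum>j\<in>{1..m}. expectation (\<lambda>\<omega>. (c i * c j) * (Z \<omega> * (?d i \<omega> * ?d j \<omega>))))"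
    using int by (subst Bochner_Integration.integral_sum) (auto intro!: sum.cong Bochner_Integration.integral_sum)
  also have "\<dots> = (\<Sum>i\<in>{1..m}. \<Sum>j\<in>{1..m}. if j = i then (c i)\<^sup>2 * integral\<^sup>L (M \<Otimes>\<^sub>M lborel) (?H i) else 0)"
    using noise_covariation[OF _ _ Z st] by (intro sum.cong refl) (auto simp: power2_eq_square)
  also have "\<dots> = (\<Sum>i\<in>{1..m}. (c i)\<^sup>2 * integral\<^sup>L (M \<Otimes>\<^sub>M lborel) (?H i))"
    by (intro sum.cong refl) simp
  also have "\<dots> = (\<integral>x. (\<Sum>i\<in>{1..m}. (c i)\<^sup>2 * ?H i x) \<partial>(M \<Otimes>\<^sub>M lborel))"
    using intH by (subst Bochner_Integration.integral_sum) auto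
  also have "\<dots> = (\<integral>(\<omega>, r). Z \<omega> * (indicator {s<..t} r * combined_bracket c r \<omega>) \<partial>(M \<Otimes>\<^sub>M lborel))"
    by (intro Bochner_Integration.integral_cong refl)
      (simp add: combined_bracket_def sum_distrib_left split_beta' mult_ac)
  finally show ?thesis .
qed

lemma combined_decomposition:
  "AE \<omega> in M. \<forall>t\<ge>0. set_integrable lborel {0..t} (\<lambda>r. combined_drift c r \<omega>) \<and>
     combination c0 c t \<omega> = combination c0 c 0 \<omega> + combined_noise c t \<omega> + (LINT r:{0..t}|lborel. combined_drift c r \<omega>)"
proof -
  have "AE \<omega> in M. \<forall>i\<in>{1..m}. \<forall>t\<ge>0. X t \<omega> i = X 0 \<omega> i + noise i t \<omega> + (LINT s:{0..t}|lborel. jacobi_drift m p q (X s \<omega>) i)"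
    using noise(2) by (simp add: AE_finite_all)
  then show ?thesis
    using drift_set_integrable
  proof eventually_elim
    case (elim \<omega>)
    show ?case
    proof (intro allI impI)
      fix t :: real assume t: "0 \<le> t"
      have i: "set_integrable lborel {0..t} (\<lambda>r. drift i r \<omega>)" if "i \<in> {1..m}" for i
        using elim(2) t that by blast
      have eq: "P t \<omega> i = P 0 \<omega> i + noise i t \<omega> + (LINT r:{0..t}|lborel. drift i r \<omega>)" if "i \<in> {1..m}" for i
      proof -
        have "(LINT s:{0..t}|lborel. jacobi_drift m p q (X s \<omega>) i) = (LINT r:{0..t}|lborel. drift i r \<omega>)"
          by (rule set_lebesgue_integral_cong) (auto simp: drift_def P_eq)
        moreover have "X t \<omega> i = X 0 \<omega> i + noise i t \<omega> + (LINT s:{0..t}|lborel. jacobi_drift m p q (X s \<omega>) i)"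
          using elim(1) that t by blast
        ultimately show ?thesis using t by (simp add: P_eq)
      qed
      have "(LINT r:{0..t}|lborel. combined_drift c r \<omega>) = (\<integral>r. (\<Sum>i\<in>{1..m}. c i * (indicator {0..t} r *\<^sub>R drift i r \<omega>)) \<partial>lborel)"
        unfolding set_lebesgue_integral_def combined_drift_def scaleR_sum_right
        by (intro Bochner_Integration.integral_cong refl sum.cong) (simp add: mult_ac)
      also have "\<dots> = (\<Sum>i\<in>{1..m}. c i * (LINT r:{0..t}|lborel. drift i r \<omega>))"
        unfolding set_lebesgue_integral_def using i
        by (subst Bochner_Integration.integral_sum) (auto simp: set_integrable_def)
      finally have l: "(LINT r:{0..t}|lborel. combined_drift c r \<omega>) = (\<Sum>i\<in>{1..m}. c i * (LINT r:{0..t}|lborel. drift i r \<omega>))" .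
      have "integrable lborel (\<lambda>r. \<Sum>i\<in>{1..m}. c i * (indicator {0..t} r *\<^sub>R drift i r \<omega>))"
        using i by (intro Bochner_Integration.integrable_sum integrable_mult_right) (auto simp: set_integrable_def)
      moreover have "(\<lambda>r. \<Sum>i\<in>{1..m}. c i * (indicator {0..t} r *\<^sub>R drift i r \<omega>)) = (\<lambda>r. indicator {0..t} r *\<^sub>R combined_drift c r \<omega>)"
        by (simp add: combined_drift_def sum_distrib_left mult_ac)
      ultimately have "set_integrable lborel {0..t} (\<lambda>r. combined_drift c r \<omega>)"
        unfolding set_integrable_def by simp
      moreover have "combination c0 c t \<omega> = combination c0 c 0 \<omega> + combined_noise c t \<omega> + (LINT r:{0..t}|lborel. combined_drift c r \<omega>)"
      proof -
        have "(\<Sum>i\<in>{1..m}. c i * P t \<omega> i) = (\<Sum>i\<in>{1..m}. c i * P 0 \<omega> i + c i * noise i t \<omega> + c i * (LINT r:{0..t}|lborel. drift i r \<omega>))"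
          by (rule sum.cong[OF refl]) (simp only: eq distrib_left)
        then show ?thesis unfolding l combination_def combined_noise_def by (simp add: sum.distrib)
      qed
      ultimately show "set_integrable lborel {0..t} (\<lambda>r. combined_drift c r \<omega>) \<and>
        combination c0 c t \<omega> = combination c0 c 0 \<omega> + combined_noise c t \<omega> + (LINT r:{0..t}|lborel. combined_drift c r \<omega>)" by blast
    qed
  qed
qed

definition singular_integral :: "real \<Rightarrow> 'w \<Rightarrow> real" where
  "singular_integral t \<omega> = (LINT r:{0..t}|lborel. total_singular r \<omega>)"

text \<open>With weights decreasing in the index all singular pair terms enter the drift with the same sign, so
  the total singular drift is controlled by the increments of a bounded process and a martingale.\<close>

definition weight :: "nat \<Rightarrow> real" where
  "weight i = - real i"

definition drift_const :: real where
  "drift_const = real (m * m) * (\<bar>p\<bar> + \<bar>p + q\<bar>)"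

lemma drift_const_nonneg: "0 \<le> drift_const"
  by (simp add: drift_const_def)

lemma total_singular_le:
  assumes "\<omega> \<in> space M"
  shows "total_singular r \<omega> \<le> 2 * combined_drift weight r \<omega> + 2 * drift_const"
  using interaction_sum_bound[OF P_ordered[OF assms], where p = p and q = q]
  unfolding total_singular_def singular_def combined_drift_def weight_def drift_def drift_const_def by simp

lemma singular_integral_increment:
  "AE \<omega> in M. \<forall>s t. 0 \<le> s \<longrightarrow> s \<le> t \<longrightarrow> 0 \<le> singular_integral t \<omega> - singular_integral s \<omega> \<and>
    singular_integral t \<omega> - singular_integral s \<omega> \<le>
      2 * real (m * m) - 2 * (combined_noise weight t \<omega> - combined_noise weight s \<omega>) + 2 * drift_const * (t - s)"
  using total_singular_integrable combined_decomposition[of weight 0] AE_space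
proof eventually_elim
  case (elim \<omega>)
  show ?case
  proof (intro allI impI)
    fix s t :: real assume st: "0 \<le> s" "s \<le> t"
    then have t: "0 \<le> t" by simp
    have iR: "set_integrable lborel {0..t} (\<lambda>r. total_singular r \<omega>)" using elim(1) t by blast
    have iD: "set_integrable lborel {0..t} (\<lambda>r. combined_drift weight r \<omega>)" using elim(2) t by blast
    note R = set_integral_Ioc[OF st iR] and D = set_integral_Ioc[OF st iD]
    have "0 \<le> (LINT r:{s<..t}|lborel. total_singular r \<omega>)"
      unfolding set_lebesgue_integral_def using total_singular_nonneg by (intro Bochner_Integration.integral_nonneg) auto
    moreover have "(LINT r:{s<..t}|lborel. total_singular r \<omega>) \<le>
      (LINT r:{s<..t}|lborel. 2 * combined_drift weight r \<omega> + 2 * drift_const)"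
    proof (rule set_integral_mono[OF R(1)])
      have "set_integrable lborel {s<..t} (\<lambda>r. 2 * drift_const)"
        by (rule set_integral_Ioc[OF st set_integrable_const])
      then show "set_integrable lborel {s<..t} (\<lambda>r. 2 * combined_drift weight r \<omega> + 2 * drift_const)"
        using D(1) by (intro set_integral_add) auto
    qed (rule total_singular_le[OF elim(3)])
    moreover have "(LINT r:{s<..t}|lborel. 2 * combined_drift weight r \<omega> + 2 * drift_const) =
      2 * (LINT r:{s<..t}|lborel. combined_drift weight r \<omega>) + 2 * drift_const * (t - s)"
    proof -
      have "set_integrable lborel {s<..t} (\<lambda>r. 2 * drift_const)"
        by (rule set_integral_Ioc[OF st set_integrable_const])
      then have "(LINT r:{s<..t}|lborel. 2 * combined_drift weight r \<omega> + 2 * drift_const) =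
         (LINT r:{s<..t}|lborel. 2 * combined_drift weight r \<omega>) + (LINT r:{s<..t}|lborel. 2 * drift_const)"
        using D(1) by (intro set_integral_add(2)) auto
      moreover have "(LINT r:{s<..t}|lborel. 2 * drift_const) = 2 * drift_const * (t - s)"
        using st by (simp add: set_lebesgue_integral_def)
      ultimately show ?thesis by simp
    qed
    \<comment> \<open>The equation of the weighted combination is solved for its drift integral,
      which is the increment of a bounded process minus that of a martingale.\<close>
    moreover have "(LINT r:{s<..t}|lborel. combined_drift weight r \<omega>) =
      combination 0 weight t \<omega> - combination 0 weight s \<omega> - (combined_noise weight t \<omega> - combined_noise weight s \<omega>)"
    proof -
      have "combination 0 weight t \<omega> = combination 0 weight 0 \<omega> + combined_noise weight t \<omega> + (LINT r:{0..t}|lborel. combined_drift weight r \<omega>)"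
        "combination 0 weight s \<omega> = combination 0 weight 0 \<omega> + combined_noise weight s \<omega> + (LINT r:{0..s}|lborel. combined_drift weight r \<omega>)"
        using elim(2) t st(1) by blast+
      then show ?thesis using D(2) by linarith
    qed
    moreover have "combination 0 weight t \<omega> - combination 0 weight s \<omega> \<le> real (m * m)"
    proof -
      have "combination 0 weight t \<omega> - combination 0 weight s \<omega> = (\<Sum>i\<in>{1..m}. real i * (P s \<omega> i - P t \<omega> i))"
        by (simp add: combination_def weight_def sum_negf sum_subtractf right_diff_distrib)
      also have "\<dots> \<le> (\<Sum>i\<in>{1..m}. real m)"
      proof (rule sum_mono)
        fix i assume i: "i \<in> {1..m}"
        have "P s \<omega> i - P t \<omega> i \<le> 1" using P_unit[OF elim(3) i, of s] P_unit[OF elim(3) i, of t] by linarith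
        then have "real i * (P s \<omega> i - P t \<omega> i) \<le> real i * 1" by (intro mult_left_mono) auto
        moreover have "real i \<le> real m" using i by simp
        ultimately show "real i * (P s \<omega> i - P t \<omega> i) \<le> real m" by linarith
      qed
      finally show ?thesis by simp
    qed
    ultimately show "0 \<le> singular_integral t \<omega> - singular_integral s \<omega> \<and>
      singular_integral t \<omega> - singular_integral s \<omega> \<le>
        2 * real (m * m) - 2 * (combined_noise weight t \<omega> - combined_noise weight s \<omega>) + 2 * drift_const * (t - s)"
      unfolding singular_integral_def R(2) by argo
  qed
qed

lemma singular_integral_measurable: "singular_integral t \<in> borel_measurable M"
proof -
  note total_singular_joint_measurable[measurable]
  show ?thesis unfolding singular_integral_def[abs_def] set_lebesgue_integral_def by measurable
qed

lemma singular_integral_0: "singular_integral 0 \<omega> = 0"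
  by (simp add: singular_integral_def set_integral_singleton)

text \<open>The bound on increments, taken from time 0, compares it with a stochastic integral,
  which is in mean square by construction.\<close>

lemma singular_integral_square_integrable:
  assumes t: "0 \<le> t"
  shows "square_integrable M (singular_integral t)"
proof (rule square_integrable_bound_AE[OF _ singular_integral_measurable])
  let ?n = "\<lambda>\<omega>. combined_noise weight t \<omega> - combined_noise weight 0 \<omega>"
  have n: "square_integrable M ?n"
    by (intro square_integrable_diff combined_noise_square_integrable t order_refl)
  then have "square_integrable M (\<lambda>\<omega>. \<bar>?n \<omega>\<bar>)" by (auto simp: square_integrable_def)
  then show "square_integrable M (\<lambda>\<omega>. (2 * real (m * m) + 2 * drift_const * t) + 2 * \<bar>?n \<omega>\<bar>)"
    by (intro square_integrable_add square_integrable_cmult) (auto simp: square_integrable_def)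
  show "AE \<omega> in M. \<bar>singular_integral t \<omega>\<bar> \<le> (2 * real (m * m) + 2 * drift_const * t) + 2 * \<bar>?n \<omega>\<bar>"
    using singular_integral_increment
  proof eventually_elim
    case (elim \<omega>)
    then have "0 \<le> singular_integral t \<omega> - singular_integral 0 \<omega> \<and>
      singular_integral t \<omega> - singular_integral 0 \<omega> \<le> 2 * real (m * m) - 2 * ?n \<omega> + 2 * drift_const * (t - 0)"
      using t by blast
    then have h: "0 \<le> singular_integral t \<omega>"
      "singular_integral t \<omega> \<le> 2 * real (m * m) - 2 * ?n \<omega> + 2 * drift_const * t"
      unfolding singular_integral_0 by simp_all
    have gen: "a - 2 * n + b \<le> (a + b) + 2 * \<bar>n\<bar>" for a b n :: real by linarith
    show ?case unfolding abs_of_nonneg[OF h(1)] by (rule order_trans[OF h(2) gen])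
  qed
qed

lemma combined_drift_measurable: "(\<lambda>(\<omega>, r). combined_drift c r \<omega>) \<in> borel_measurable (M \<Otimes>\<^sub>M lborel)"
proof -
  note drift_joint_measurable[unfolded split_beta', measurable]
  show ?thesis unfolding combined_drift_def split_beta' by measurable
qed

lemma combined_bracket_measurable: "(\<lambda>(\<omega>, r). combined_bracket c r \<omega>) \<in> borel_measurable (M \<Otimes>\<^sub>M lborel)"
proof -
  note P_joint_measurable[unfolded split_beta', measurable]
  show ?thesis unfolding combined_bracket_def split_beta' by measurable
qed

text \<open>The drift of each coordinate exceeds the total singular drift by at most |p| + |p + q|;
  integrating this reduces the variation of every combination to the one increasing process
  \<open>singular_integral\<close>.\<close>

lemma combined_variation_increment:
  "AE \<omega> in M. \<forall>s t. 0 \<le> s \<longrightarrow> s \<le> t \<longrightarrow>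
    \<bar>(LINT r:{0..t}|lborel. \<bar>combined_drift c r \<omega>\<bar>) - (LINT r:{0..s}|lborel. \<bar>combined_drift c r \<omega>\<bar>)\<bar> \<le>
     (\<Sum>i\<in>{1..m}. \<bar>c i\<bar>) * ((\<bar>p\<bar> + \<bar>p + q\<bar>) * (t - s) + (singular_integral t \<omega> - singular_integral s \<omega>))"
  using total_singular_integrable combined_decomposition[of c 0] AE_space
proof eventually_elim
  case (elim \<omega>)
  show ?case
  proof (intro allI impI)
    fix s t :: real assume st: "0 \<le> s" "s \<le> t"
    then have t: "0 \<le> t" by simp
    define \<kappa> where "\<kappa> = \<bar>p\<bar> + \<bar>p + q\<bar>"
    define a where "a = (\<Sum>i\<in>{1..m}. \<bar>c i\<bar>)"
    have iR: "set_integrable lborel {0..t} (\<lambda>r. total_singular r \<omega>)" using elim(1) t by blast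
    have "set_integrable lborel {0..t} (\<lambda>r. combined_drift c r \<omega>)" using elim(2) t by blast
    then have iD: "set_integrable lborel {0..t} (\<lambda>r. \<bar>combined_drift c r \<omega>\<bar>)" by (rule set_integrable_abs)
    note R = set_integral_Ioc[OF st iR] and D = set_integral_Ioc[OF st iD]
    have ic: "set_integrable lborel {s<..t} (\<lambda>r. \<kappa>)" by (rule set_integral_Ioc[OF st set_integrable_const])
    have "(LINT r:{s<..t}|lborel. \<bar>combined_drift c r \<omega>\<bar>) \<le> (LINT r:{s<..t}|lborel. a * (\<kappa> + total_singular r \<omega>))"
    proof (rule set_integral_mono[OF D(1)])
      show "set_integrable lborel {s<..t} (\<lambda>r. a * (\<kappa> + total_singular r \<omega>))"
        using R(1) ic by (intro set_integrable_mult_right set_integral_add) auto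
      fix r
      have "\<bar>combined_drift c r \<omega>\<bar> \<le> (\<Sum>i\<in>{1..m}. \<bar>c i * drift i r \<omega>\<bar>)"
        unfolding combined_drift_def by (rule sum_abs)
      also have "\<dots> \<le> (\<Sum>i\<in>{1..m}. \<bar>c i\<bar> * (\<kappa> + total_singular r \<omega>))"
        using drift_bound[OF elim(3)] unfolding abs_mult \<kappa>_def by (intro sum_mono mult_left_mono) auto
      finally show "\<bar>combined_drift c r \<omega>\<bar> \<le> a * (\<kappa> + total_singular r \<omega>)"
        by (simp only: a_def sum_distrib_right)
    qed
    also have "\<dots> = a * ((LINT r:{s<..t}|lborel. \<kappa>) + (LINT r:{s<..t}|lborel. total_singular r \<omega>))"
      using R(1) ic by (simp add: set_integral_add(2))
    also have "(LINT r:{s<..t}|lborel. \<kappa>) = \<kappa> * (t - s)"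
      using st by (simp add: set_lebesgue_integral_def)
    finally have "(LINT r:{s<..t}|lborel. \<bar>combined_drift c r \<omega>\<bar>) \<le> a * (\<kappa> * (t - s) + (singular_integral t \<omega> - singular_integral s \<omega>))"
      unfolding singular_integral_def R(2) .
    moreover have "0 \<le> (LINT r:{s<..t}|lborel. \<bar>combined_drift c r \<omega>\<bar>)"
      unfolding set_lebesgue_integral_def by (intro Bochner_Integration.integral_nonneg) auto
    ultimately show "\<bar>(LINT r:{0..t}|lborel. \<bar>combined_drift c r \<omega>\<bar>) - (LINT r:{0..s}|lborel. \<bar>combined_drift c r \<omega>\<bar>)\<bar> \<le>
     (\<Sum>i\<in>{1..m}. \<bar>c i\<bar>) * ((\<bar>p\<bar> + \<bar>p + q\<bar>) * (t - s) + (singular_integral t \<omega> - singular_integral s \<omega>))"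
      unfolding D(2) a_def \<kappa>_def by simp
  qed
qed

text \<open>Coordinates, reflected coordinates and gaps are all of this form, so the hypotheses on
  scalar processes are checked once. The function K comes from
  \<open>singular_integral_increment\<close> tested against Z: the martingale increment has mean
  zero, and a term linear in time together with 2 m^2 remains, scaled by the sum of the |c
  i|.\<close>

lemma scalar_ito_combination:
  assumes range: "\<And>r \<omega>. \<omega> \<in> space M \<Longrightarrow> combination c0 c r \<omega> \<in> {0..1}"
  shows "scalar_ito M F (combination c0 c) (combined_noise c) (combined_drift c) (combined_bracket c)
    (4 * (\<Sum>i\<in>{1..m}. (c i)\<^sup>2))
    (\<lambda>t. (\<Sum>i\<in>{1..m}. \<bar>c i\<bar>) * ((\<bar>p\<bar> + \<bar>p + q\<bar> + 2 * drift_const) * t + 2 * real (m * m)))"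
proof -
  define a where "a = (\<Sum>i\<in>{1..m}. \<bar>c i\<bar>)"
  define \<kappa> where "\<kappa> = \<bar>p\<bar> + \<bar>p + q\<bar>"
  have a0: "0 \<le> a" unfolding a_def by (intro sum_nonneg) auto
  have \<kappa>0: "0 \<le> \<kappa>" by (simp add: \<kappa>_def)
  define V where "V t \<omega> = (LINT r:{0..t}|lborel. \<bar>combined_drift c r \<omega>\<bar>)" for t \<omega>
  note combined_drift_measurable[measurable]
  have Vm: "V t \<in> borel_measurable M" for t
    unfolding V_def[abs_def] set_lebesgue_integral_def by measurable
  have V0: "V 0 \<omega> = 0" for \<omega> by (simp add: V_def set_integral_singleton)
  have V_inc: "AE \<omega> in M. \<forall>s t. 0 \<le> s \<longrightarrow> s \<le> t \<longrightarrow>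
      \<bar>V t \<omega> - V s \<omega>\<bar> \<le> a * (\<kappa> * (t - s) + (singular_integral t \<omega> - singular_integral s \<omega>))"
    using combined_variation_increment[of c] unfolding V_def a_def \<kappa>_def .
  have Vsq: "square_integrable M (V t)" if t: "0 \<le> t" for t
  proof (rule square_integrable_bound_AE[OF _ Vm])
    show "square_integrable M (\<lambda>\<omega>. a * (\<kappa> * t + singular_integral t \<omega>))"
      by (intro square_integrable_cmult square_integrable_add singular_integral_square_integrable[OF t])
        (auto simp: square_integrable_def)
    show "AE \<omega> in M. \<bar>V t \<omega>\<bar> \<le> a * (\<kappa> * t + singular_integral t \<omega>)"
      using V_inc
    proof eventually_elim
      case (elim \<omega>)
      then have "\<bar>V t \<omega> - V 0 \<omega>\<bar> \<le> a * (\<kappa> * (t - 0) + (singular_integral t \<omega> - singular_integral 0 \<omega>))"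
        using t by blast
      then show ?case by (simp add: V0 singular_integral_0)
    qed
  qed
  have Vcond: "expectation (\<lambda>\<omega>. Z \<omega> * (V t \<omega> - V s \<omega>)) \<le> (a * ((\<kappa> + 2 * drift_const) * t + 2 * real (m * m))) * expectation Z"
    if st: "0 \<le> s" "s \<le> t" and Z: "multiplier s Z" "\<And>\<omega>. \<omega> \<in> space M \<Longrightarrow> 0 \<le> Z \<omega>" for s t Z
  proof -
    let ?n = "\<lambda>\<omega>. combined_noise weight t \<omega> - combined_noise weight s \<omega>"
    define k where "k = (\<kappa> + 2 * drift_const) * (t - s) + 2 * real (m * m)"
    have iV: "integrable M (\<lambda>\<omega>. Z \<omega> * (V t \<omega> - V s \<omega>))"
      using square_integrable_imp_integrable[OF square_integrable_diff[OF Vsq Vsq]] st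
      by (intro integrable_multiplier_mult[OF Z(1)]) auto
    have in': "integrable M (\<lambda>\<omega>. Z \<omega> * ?n \<omega>)"
      using square_integrable_imp_integrable[OF square_integrable_diff[OF combined_noise_square_integrable combined_noise_square_integrable]] st
      by (intro integrable_multiplier_mult[OF Z(1)]) auto
    have iZ: "integrable M Z" using integrable_multiplier[OF Z(1) st(1)] .
    have "expectation (\<lambda>\<omega>. Z \<omega> * (V t \<omega> - V s \<omega>)) \<le> expectation (\<lambda>\<omega>. (a * k) * Z \<omega> - (2 * a) * (Z \<omega> * ?n \<omega>))"
    proof (rule integral_mono_AE[OF iV])
      show "integrable M (\<lambda>\<omega>. (a * k) * Z \<omega> - (2 * a) * (Z \<omega> * ?n \<omega>))" using iZ in' by simp
      show "AE \<omega> in M. Z \<omega> * (V t \<omega> - V s \<omega>) \<le> (a * k) * Z \<omega> - (2 * a) * (Z \<omega> * ?n \<omega>)"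
        using V_inc singular_integral_increment AE_space
      proof eventually_elim
        case (elim \<omega>)
        have "V t \<omega> - V s \<omega> \<le> a * (\<kappa> * (t - s) + (singular_integral t \<omega> - singular_integral s \<omega>))"
          using elim(1) st abs_ge_self order_trans by blast
        also have "\<dots> \<le> a * (\<kappa> * (t - s) + (2 * real (m * m) - 2 * ?n \<omega> + 2 * drift_const * (t - s)))"
          using elim(2) st a0 by (intro mult_left_mono add_left_mono) blast+
        also have "\<dots> = a * k - 2 * a * ?n \<omega>" by (simp add: k_def algebra_simps)
        finally have "Z \<omega> * (V t \<omega> - V s \<omega>) \<le> Z \<omega> * (a * k - 2 * a * ?n \<omega>)"
          using Z(2)[OF elim(3)] by (rule mult_left_mono)
        then show ?case by (simp add: algebra_simps)
      qed
    qed
    also have "\<dots> = (a * k) * expectation Z"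
      using iZ in' combined_noise_martingale[OF st Z(1), of weight] by simp
    \<comment> \<open>Enlarging t - s to t frees the bound from the starting time.\<close>
    also have "\<dots> \<le> (a * ((\<kappa> + 2 * drift_const) * t + 2 * real (m * m))) * expectation Z"
    proof (intro mult_right_mono mult_left_mono a0)
      show "k \<le> (\<kappa> + 2 * drift_const) * t + 2 * real (m * m)"
        unfolding k_def using st \<kappa>0 drift_const_nonneg by (intro add_right_mono mult_left_mono) auto
      show "0 \<le> expectation Z" using Z(2) by (intro Bochner_Integration.integral_nonneg) auto
    qed
    finally show ?thesis .
  qed
  show ?thesis
  proof (intro scalar_ito.intro filtered_prob_axioms scalar_ito_axioms.intro)
    fix t :: real assume t: "0 \<le> t"
    show "combination c0 c t \<in> borel_measurable (F t)"
      unfolding combination_def[abs_def]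
      by (intro borel_measurable_add borel_measurable_const borel_measurable_sum borel_measurable_times P_adapted[OF t])
    show "square_integrable M (combined_noise c t)" by (rule combined_noise_square_integrable[OF t])
    show "square_integrable M (\<lambda>\<omega>. LINT r:{0..t}|lborel. \<bar>combined_drift c r \<omega>\<bar>)"
      using Vsq[OF t] unfolding V_def .
    fix \<omega> assume w: "\<omega> \<in> space M"
    show "combination c0 c t \<omega> \<in> {0..1}" by (rule range[OF w])
    show "\<bar>combined_bracket c t \<omega>\<bar> \<le> 4 * (\<Sum>i\<in>{1..m}. (c i)\<^sup>2)"
    proof -
      have "\<bar>combined_bracket c t \<omega>\<bar> \<le> (\<Sum>i\<in>{1..m}. \<bar>(c i)\<^sup>2 * (4 * (P t \<omega> i * (1 - P t \<omega> i)))\<bar>)"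
        unfolding combined_bracket_def by (rule sum_abs)
      also have "\<dots> \<le> (\<Sum>i\<in>{1..m}. 4 * (c i)\<^sup>2)"
      proof (rule sum_mono)
        fix i assume i: "i \<in> {1..m}"
        have "\<bar>P t \<omega> i * (1 - P t \<omega> i)\<bar> \<le> 1"
          unfolding abs_mult using P_unit[OF w i, of t] by (intro mult_le_one) auto
        then have "(c i)\<^sup>2 * (4 * \<bar>P t \<omega> i * (1 - P t \<omega> i)\<bar>) \<le> (c i)\<^sup>2 * 4" by (intro mult_left_mono) auto
        then show "\<bar>(c i)\<^sup>2 * (4 * (P t \<omega> i * (1 - P t \<omega> i)))\<bar> \<le> 4 * (c i)\<^sup>2" by (simp add: abs_mult)
      qed
      finally show ?thesis by (simp only: sum_distrib_left)
    qed
  next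
    fix \<omega> assume w: "\<omega> \<in> space M"
    show "continuous_on {0..} (\<lambda>t. combination c0 c t \<omega>)"
      unfolding combination_def
      by (intro continuous_intros continuous_on_subset[OF P_continuous[OF w]]) auto
  next
    have "AE \<omega> in M. \<forall>i\<in>{1..m}. continuous_on {0..} (\<lambda>t. noise i t \<omega>)"
      using noise(1) by (simp add: AE_finite_all is_ito_integral_def)
    then show "AE \<omega> in M. continuous_on {0..} (\<lambda>t. combined_noise c t \<omega>)"
    proof eventually_elim
      case (elim \<omega>)
      then show ?case unfolding combined_noise_def by (intro continuous_intros) auto
    qed
    show "(\<lambda>(\<omega>, r). combined_drift c r \<omega>) \<in> borel_measurable (M \<Otimes>\<^sub>M lborel)" by (rule combined_drift_measurable)
    show "(\<lambda>(\<omega>, r). combined_bracket c r \<omega>) \<in> borel_measurable (M \<Otimes>\<^sub>M lborel)" by (rule combined_bracket_measurable)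
    show "AE \<omega> in M. \<forall>t\<ge>0. set_integrable lborel {0..t} (\<lambda>r. combined_drift c r \<omega>)"
      using combined_decomposition[of c c0] by eventually_elim blast
    show "AE \<omega> in M. \<forall>t\<ge>0. combination c0 c t \<omega> = combination c0 c 0 \<omega> + combined_noise c t \<omega> + (LINT r:{0..t}|lborel. combined_drift c r \<omega>)"
      using combined_decomposition[of c c0] by eventually_elim blast
  next
    fix s t :: real and Z assume st: "0 \<le> s" "s \<le> t" and Z: "multiplier s Z"
    show "expectation (\<lambda>\<omega>. Z \<omega> * (combined_noise c t \<omega> - combined_noise c s \<omega>)) = 0"
      by (rule combined_noise_martingale[OF st Z])
    show "expectation (\<lambda>\<omega>. Z \<omega> * (combined_noise c t \<omega> - combined_noise c s \<omega>)\<^sup>2) =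
        (\<integral>(\<omega>, r). Z \<omega> * (indicator {s<..t} r * combined_bracket c r \<omega>) \<partial>(M \<Otimes>\<^sub>M lborel))"
      by (rule combined_noise_variance[OF st Z])
    assume "\<And>\<omega>. \<omega> \<in> space M \<Longrightarrow> 0 \<le> Z \<omega>"
    from Vcond[OF st Z this] show "expectation (\<lambda>\<omega>. Z \<omega> * ((LINT r:{0..t}|lborel. \<bar>combined_drift c r \<omega>\<bar>) - (LINT r:{0..s}|lborel. \<bar>combined_drift c r \<omega>\<bar>)))
          \<le> (\<Sum>i\<in>{1..m}. \<bar>c i\<bar>) * ((\<bar>p\<bar> + \<bar>p + q\<bar> + 2 * drift_const) * t + 2 * real (m * m)) * expectation Z"
      unfolding V_def a_def \<kappa>_def by simp
  qed
qed

end

text \<open>At \<open>x 1 = 1\<close> each other coordinate contributes exactly 1, or 0 if it equals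
  1 as well, while the remaining drift is -q.\<close>

lemma jacobi_drift_neg_at_1:
  assumes m: "1 \<le> m" and q: "real m < q" and x: "x \<in> ordered_unit_vectors m" and x1: "x 1 = 1"
  shows "jacobi_drift m p q x 1 < 0"
proof -
  have "(\<Sum>j\<in>{1..m} - {1}. (x 1 * (1 - x j) + x j * (1 - x 1)) / (x 1 - x j)) \<le> (\<Sum>j\<in>{1..m} - {1}. 1)"
  proof (rule sum_mono)
    fix j
    show "(x 1 * (1 - x j) + x j * (1 - x 1)) / (x 1 - x j) \<le> 1" unfolding x1 by simp
  qed
  moreover have "(\<Sum>j\<in>{1..m} - {1}. 1 :: real) = real m - 1" using m by simp
  moreover have "p - (p + q) * x 1 = - q" unfolding x1 by simp
  ultimately show ?thesis using q unfolding jacobi_drift_def by linarith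
qed

section \<open>Exceptional times, collisions and the boundary\<close>

definition coord :: "nat \<Rightarrow> nat \<Rightarrow> real" where
  "coord k l = (if l = k then 1 else 0)"

lemma coord_sum: "k \<in> {1..m} \<Longrightarrow> (\<Sum>l\<in>{1..m}. coord k l * f l) = f k"
  by (simp add: coord_def if_distrib[of "\<lambda>x. x * _"] cong: if_cong)

context jacobi_process
begin

lemma combination_coord:
  assumes "k \<in> {1..m}"
  shows "combination 0 (coord k) r \<omega> = P r \<omega> k" "combined_drift (coord k) r \<omega> = drift k r \<omega>"
    "combined_bracket (coord k) r \<omega> = 4 * (P r \<omega> k * (1 - P r \<omega> k))"
proof -
  have "(coord k l)\<^sup>2 = coord k l" for l by (simp add: coord_def)
  then show "combination 0 (coord k) r \<omega> = P r \<omega> k" "combined_drift (coord k) r \<omega> = drift k r \<omega>"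
    "combined_bracket (coord k) r \<omega> = 4 * (P r \<omega> k * (1 - P r \<omega> k))"
    unfolding combination_def combined_drift_def combined_bracket_def by (simp_all only: coord_sum[OF assms])
qed

lemma combination_reflected:
  assumes "k \<in> {1..m}"
  shows "combination 1 (\<lambda>l. - coord k l) r \<omega> = 1 - P r \<omega> k" "combined_drift (\<lambda>l. - coord k l) r \<omega> = - drift k r \<omega>"
    "combined_bracket (\<lambda>l. - coord k l) r \<omega> = 4 * (P r \<omega> k * (1 - P r \<omega> k))"
proof -
  have "(- coord k l)\<^sup>2 = coord k l" for l by (simp add: coord_def)
  then show "combination 1 (\<lambda>l. - coord k l) r \<omega> = 1 - P r \<omega> k" "combined_drift (\<lambda>l. - coord k l) r \<omega> = - drift k r \<omega>"
    "combined_bracket (\<lambda>l. - coord k l) r \<omega> = 4 * (P r \<omega> k * (1 - P r \<omega> k))"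
    unfolding combination_def combined_drift_def combined_bracket_def
    by (simp_all only: mult_minus_left sum_negf coord_sum[OF assms])
qed

lemma combination_difference:
  assumes ij: "i \<in> {1..m}" "j \<in> {1..m}" "i \<noteq> j"
  shows "combination 0 (\<lambda>l. coord i l - coord j l) r \<omega> = P r \<omega> i - P r \<omega> j"
    "combined_drift (\<lambda>l. coord i l - coord j l) r \<omega> = drift i r \<omega> - drift j r \<omega>"
    "combined_bracket (\<lambda>l. coord i l - coord j l) r \<omega> =
      4 * (P r \<omega> i * (1 - P r \<omega> i)) + 4 * (P r \<omega> j * (1 - P r \<omega> j))"
proof -
  have sq: "(coord i l - coord j l)\<^sup>2 = coord i l + coord j l" for l using ij(3) by (simp add: coord_def)
  show "combination 0 (\<lambda>l. coord i l - coord j l) r \<omega> = P r \<omega> i - P r \<omega> j"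
    "combined_drift (\<lambda>l. coord i l - coord j l) r \<omega> = drift i r \<omega> - drift j r \<omega>"
    "combined_bracket (\<lambda>l. coord i l - coord j l) r \<omega> =
      4 * (P r \<omega> i * (1 - P r \<omega> i)) + 4 * (P r \<omega> j * (1 - P r \<omega> j))"
    unfolding combination_def combined_drift_def combined_bracket_def sq
    by (simp_all only: left_diff_distrib distrib_right sum_subtractf sum.distrib coord_sum[OF ij(1)] coord_sum[OF ij(2)])
qed

text \<open>By the ordering it is enough to watch the smallest and the largest coordinate. At the
  boundary their drift points inwards, and the bracket 4 x (1 - x) is at most 4 times the distance
  to it; these are the two hypotheses of \<open>zero_time_null\<close>.\<close>

lemma boundary_times_null:
  assumes pq: "real m < p" "real m < q"
  shows "AE (\<omega>, r) in M \<Otimes>\<^sub>M lborel. 0 < r \<longrightarrow> P r \<omega> m \<noteq> 0 \<and> P r \<omega> 1 \<noteq> 1"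
proof -
  have m1: "m \<in> {1..m}" "1 \<in> {1..m}" using m_pos by auto
  interpret L: scalar_ito M F "combination 0 (coord m)" "combined_noise (coord m)" "combined_drift (coord m)"
    "combined_bracket (coord m)" "4 * (\<Sum>i\<in>{1..m}. (coord m i)\<^sup>2)"
    "\<lambda>t. (\<Sum>i\<in>{1..m}. \<bar>coord m i\<bar>) * ((\<bar>p\<bar> + \<bar>p + q\<bar> + 2 * drift_const) * t + 2 * real (m * m))"
    by (rule scalar_ito_combination) (use P_unit m1 in \<open>simp add: combination_coord[OF m1(1)]\<close>)
  interpret U: scalar_ito M F "combination 1 (\<lambda>l. - coord 1 l)" "combined_noise (\<lambda>l. - coord 1 l)" "combined_drift (\<lambda>l. - coord 1 l)"
    "combined_bracket (\<lambda>l. - coord 1 l)" "4 * (\<Sum>i\<in>{1..m}. (- coord 1 i)\<^sup>2)"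
    "\<lambda>t. (\<Sum>i\<in>{1..m}. \<bar>- coord 1 i\<bar>) * ((\<bar>p\<bar> + \<bar>p + q\<bar> + 2 * drift_const) * t + 2 * real (m * m))"
    by (rule scalar_ito_combination, unfold combination_reflected[OF m1(2)]) (use P_unit[OF _ m1(2)] in auto)
  have "AE (\<omega>, r) in M \<Otimes>\<^sub>M lborel. r \<in> {0<..real n} \<longrightarrow> combination 0 (coord m) r \<omega> \<noteq> 0" for n :: nat
  proof (rule L.zero_time_null[where \<kappa> = 4])
    fix r \<omega> assume w: "\<omega> \<in> space M"
    have "\<bar>P r \<omega> m * (1 - P r \<omega> m)\<bar> \<le> P r \<omega> m"
      unfolding abs_mult using P_unit[OF w m1(1), of r] by (simp add: mult_left_le)
    then show "\<bar>combined_bracket (coord m) r \<omega>\<bar> \<le> 4 * combination 0 (coord m) r \<omega>"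
      unfolding combination_coord[OF m1(1)] by (simp add: abs_mult)
    show "0 < combined_drift (coord m) r \<omega>" if "combination 0 (coord m) r \<omega> = 0"
      using that jacobi_drift_pos_at_0[OF m_pos pq(1) P_ordered[OF w]]
      unfolding combination_coord[OF m1(1)] drift_def by blast
  qed simp
  moreover have "AE (\<omega>, r) in M \<Otimes>\<^sub>M lborel. r \<in> {0<..real n} \<longrightarrow> combination 1 (\<lambda>l. - coord 1 l) r \<omega> \<noteq> 0" for n :: nat
  proof (rule U.zero_time_null[where \<kappa> = 4])
    fix r \<omega> assume w: "\<omega> \<in> space M"
    have "\<bar>P r \<omega> 1 * (1 - P r \<omega> 1)\<bar> \<le> 1 - P r \<omega> 1"
      unfolding abs_mult using P_unit[OF w m1(2), of r] by (simp add: mult_left_le_one_le)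
    then show "\<bar>combined_bracket (\<lambda>l. - coord 1 l) r \<omega>\<bar> \<le> 4 * combination 1 (\<lambda>l. - coord 1 l) r \<omega>"
      unfolding combination_reflected[OF m1(2)] by (simp add: abs_mult)
    show "0 < combined_drift (\<lambda>l. - coord 1 l) r \<omega>" if "combination 1 (\<lambda>l. - coord 1 l) r \<omega> = 0"
      using that jacobi_drift_neg_at_1[OF m_pos pq(2) P_ordered[OF w], of r p]
      unfolding combination_reflected[OF m1(2)] drift_def by simp
  qed simp
  \<comment> \<open>Countably many horizons n exhaust all positive times.\<close>
  ultimately have "AE x in M \<Otimes>\<^sub>M lborel. \<forall>n::nat. (case x of (\<omega>, r) \<Rightarrow> r \<in> {0<..real n} \<longrightarrow> combination 0 (coord m) r \<omega> \<noteq> 0)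
    \<and> (case x of (\<omega>, r) \<Rightarrow> r \<in> {0<..real n} \<longrightarrow> combination 1 (\<lambda>l. - coord 1 l) r \<omega> \<noteq> 0)"
    unfolding AE_all_countable by (intro allI AE_conjI)
  then show ?thesis
  proof eventually_elim
    case (elim x)
    obtain \<omega> r where x: "x = (\<omega>, r)" by (cases x)
    obtain n :: nat where "r \<le> real n" using real_arch_simple by blast
    then show ?case using spec[OF elim, of n]
      unfolding x prod.case combination_coord[OF m1(1)] combination_reflected[OF m1(2)] by auto
  qed
qed

text \<open>Nothing is asked at times r \<le> 0: negative times are artificial, and the starting
  point may be degenerate.\<close>

definition regular :: "'w \<times> real \<Rightarrow> bool" where
  "regular = (\<lambda>(\<omega>, r). 0 < r \<longrightarrow>
     (\<forall>i\<in>{1..m}. \<forall>j\<in>{1..m}. i \<noteq> j \<longrightarrow> P r \<omega> i \<noteq> P r \<omega> j) \<and> P r \<omega> m \<noteq> 0 \<and> P r \<omega> 1 \<noteq> 1)"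

lemma regular_measurable: "{x \<in> space (M \<Otimes>\<^sub>M lborel). regular x} \<in> sets (M \<Otimes>\<^sub>M lborel)"
proof -
  have m1: "m \<in> {1..m}" "1 \<in> {1..m}" using m_pos by auto
  note P_joint_measurable[unfolded split_beta', measurable]
  show ?thesis unfolding regular_def split_beta' using m1 by measurable
qed

text \<open>At an interior collision the extended singular drift is infinite, so the finiteness of
  its time integral leaves only a null set of such times. At a collision on the boundary the term is
  0 / 0 and counts as 0, hence the exception in the conclusion.\<close>

lemma collision_times_null:
  assumes w: "\<omega> \<in> space M"
    and fin: "\<forall>t\<ge>0. \<forall>i\<in>{1..m}. (\<integral>\<^sup>+s\<in>{0..t}. jacobi_singular_drift m (X s \<omega>) i \<partial>lborel) < \<infinity>"
    and ij: "i \<in> {1..m}" "j \<in> {1..m}" "i \<noteq> j"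
  shows "AE r in lborel. 0 < r \<longrightarrow> P r \<omega> i = P r \<omega> j \<longrightarrow> P r \<omega> i = 0 \<or> P r \<omega> i = 1"
proof -
  have m [measurable]: "(\<lambda>r. P r \<omega> k) \<in> borel_measurable lborel" if "k \<in> {1..m}" for k
    using measurable_compose[OF measurable_Pair1'[OF w] P_joint_measurable[OF that]] by simp
  define B where "B n = {r \<in> space lborel. 0 < r \<and> r \<le> real n \<and> P r \<omega> i = P r \<omega> j \<and> P r \<omega> i \<noteq> 0 \<and> P r \<omega> i \<noteq> 1}" for n :: nat
  have Bm: "B n \<in> sets lborel" for n unfolding B_def using ij by measurable
  have "emeasure lborel (B n) = 0" for n
  proof -
    \<comment> \<open>Infinity times the measure is finite only if the measure is 0.\<close>
    have "\<infinity> * emeasure lborel (B n) = (\<integral>\<^sup>+r. \<infinity> * indicator (B n) r \<partial>lborel)"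
      using Bm by (simp add: nn_integral_cmult_indicator)
    also have "\<dots> \<le> (\<integral>\<^sup>+s\<in>{0..real n}. jacobi_singular_drift m (X s \<omega>) i \<partial>lborel)"
    proof (intro nn_integral_mono)
      fix r
      show "\<infinity> * indicator (B n) r \<le> jacobi_singular_drift m (X r \<omega>) i * indicator {0..real n} r"
      proof (cases "r \<in> B n")
        case True
        then have r: "0 \<le> r" "r \<le> real n" by (auto simp: B_def)
        have X: "X r \<omega> i = X r \<omega> j" "X r \<omega> i \<noteq> 0" "X r \<omega> i \<noteq> 1" using True P_eq[OF r(1)] by (auto simp: B_def)
        have "0 < X r \<omega> i" "X r \<omega> i < 1" using X P_unit[OF w ij(1), of r] unfolding P_eq[OF r(1)] by auto
        then have "0 < X r \<omega> i * (1 - X r \<omega> i)" by simp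
        then have "ennreal (X r \<omega> i * (1 - X r \<omega> j) + X r \<omega> j * (1 - X r \<omega> i)) / ennreal \<bar>X r \<omega> i - X r \<omega> j\<bar> = \<infinity>"
          using X by (simp add: ennreal_divide_eq_top_iff)
        then have "\<infinity> \<le> jacobi_singular_drift m (X r \<omega>) i"
          unfolding jacobi_singular_drift_def
          using member_le_sum[of j "{1..m} - {i}" "\<lambda>j. ennreal (X r \<omega> i * (1 - X r \<omega> j) + X r \<omega> j * (1 - X r \<omega> i)) / ennreal \<bar>X r \<omega> i - X r \<omega> j\<bar>"] ij
          by auto
        then show ?thesis using True r by simp
      qed simp
    qed
    also have "\<dots> < \<infinity>" using fin ij by auto
    finally show ?thesis by (simp add: ennreal_top_mult split: if_splits)
  qed
  then have "AE r in lborel. \<forall>n. r \<notin> B n"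
    unfolding AE_all_countable using Bm by (auto intro!: AE_not_in simp: null_sets_def)
  then show ?thesis
  proof eventually_elim
    case (elim r)
    obtain n :: nat where "r \<le> real n" using real_arch_simple by blast
    then show ?case using spec[OF elim, of n] by (auto simp: B_def)
  qed
qed

lemma regular_AE:
  assumes pq: "real m < p" "real m < q"
  shows "AE x in M \<Otimes>\<^sub>M lborel. regular x"
proof (rule space_time.AE_pair_measure[OF regular_measurable])
  have "AE \<omega> in M. \<forall>t\<ge>0. \<forall>i\<in>{1..m}. (\<integral>\<^sup>+s\<in>{0..t}. jacobi_singular_drift m (X s \<omega>) i \<partial>lborel) < \<infinity>"
    using jacobi by (simp add: jacobi_eigenvalue_process_def)
  then show "AE \<omega> in M. AE r in lborel. regular (\<omega>, r)"
    using space_time.AE_pair[OF boundary_times_null[OF pq]] AE_space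
  proof eventually_elim
    case (elim \<omega>)
    have m1: "m \<in> {1..m}" "1 \<in> {1..m}" using m_pos by auto
    have "AE r in lborel. \<forall>i\<in>{1..m}. \<forall>j\<in>{1..m}. i \<noteq> j \<longrightarrow> 0 < r \<longrightarrow> P r \<omega> i = P r \<omega> j \<longrightarrow> P r \<omega> i = 0 \<or> P r \<omega> i = 1"
      using collision_times_null[OF elim(3,1)] by (simp add: AE_finite_all)
    then show ?case
      using elim(2)
    proof eventually_elim
      case (elim r)
      show ?case unfolding regular_def prod.case
      proof (intro impI conjI ballI)
        assume r: "0 < r"
        then show b: "P r \<omega> m \<noteq> 0" "P r \<omega> 1 \<noteq> 1" using elim(2) by auto
        fix i j assume ij: "i \<in> {1..m}" "j \<in> {1..m}" "i \<noteq> j"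
        \<comment> \<open>All coordinates lie between the two extreme ones and are therefore off the
          boundary, which excludes the exceptional case.\<close>
        have "P r \<omega> m \<le> P r \<omega> i" "0 \<le> P r \<omega> m" "P r \<omega> i \<le> P r \<omega> 1" "P r \<omega> 1 \<le> 1"
          using P_antimono[OF \<open>\<omega> \<in> space M\<close>] P_unit[OF \<open>\<omega> \<in> space M\<close>] ij m1 by auto
        then have "P r \<omega> i \<noteq> 0" "P r \<omega> i \<noteq> 1" using b by linarith+
        then show "P r \<omega> i \<noteq> P r \<omega> j" using elim(1) ij r by blast
      qed
    qed
  qed
qed

text \<open>Fubini exchanges the quantifiers: a starting time must be fixed first, and be good for
  almost every path.\<close>

lemma regular_AE_time:
  assumes pq: "real m < p" "real m < q"
  shows "AE r in lborel. AE \<omega> in M. regular (\<omega>, r)"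
proof -
  have "AE \<omega> in M. AE r in lborel. regular (\<omega>, r)" by (rule space_time.AE_pair[OF regular_AE[OF pq]])
  then show ?thesis
    using space_time.AE_commute[of "\<lambda>\<omega> r. regular (\<omega>, r)"] regular_measurable by simp
qed

lemma regular_strict:
  assumes w: "\<omega> \<in> space M" and r: "0 < r" and reg: "regular (\<omega>, r)" and ij: "i \<in> {1..m}" "j \<in> {1..m}" "i < j"
  shows "P r \<omega> j < P r \<omega> i"
proof -
  have "P r \<omega> i \<noteq> P r \<omega> j"
    using reg r ij less_imp_neq[OF ij(3)] unfolding regular_def prod.case by blast
  moreover have "P r \<omega> j \<le> P r \<omega> i" using P_antimono[OF w ij(1,2)] ij(3) by simp
  ultimately show ?thesis by simp
qed

text \<open>All gaps enter together, because the action of third particles has a sign only after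
  summation over all pairs. The bounds on p and q enter through \<open>regular_AE\<close>, that is,
  through the null set of boundary times.\<close>

lemma no_collision:
  assumes pq: "real m < p" "real m < q"
  shows "AE \<omega> in M. \<forall>t>0. \<forall>i\<in>{1..m}. \<forall>j\<in>{1..m}. i < j \<longrightarrow> P t \<omega> j < P t \<omega> i"
proof -
  let ?A = "{(i, j). i \<in> {1..m} \<and> j \<in> {1..m} \<and> i < j}"
  define c where "c = (\<lambda>(i, j) l. coord i l - coord j l)"
  have cc: "combination 0 (c a) r \<omega> = P r \<omega> (fst a) - P r \<omega> (snd a)"
    "combined_drift (c a) r \<omega> = drift (fst a) r \<omega> - drift (snd a) r \<omega>"
    "combined_bracket (c a) r \<omega> = 4 * (P r \<omega> (fst a) * (1 - P r \<omega> (fst a))) + 4 * (P r \<omega> (snd a) * (1 - P r \<omega> (snd a)))"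
    if "a \<in> ?A" for a r \<omega>
    using combination_difference[of "fst a" "snd a"] that by (auto simp: c_def split_beta')
  have "AE \<omega> in M. \<forall>t>0. \<forall>a\<in>?A. 0 < combination 0 (c a) t \<omega>"
  proof (rule nonhitting)
    show "finite ?A" by (rule finite_subset[of _ "{1..m} \<times> {1..m}"]) auto
    show "scalar_ito M F (combination 0 (c a)) (combined_noise (c a)) (combined_drift (c a)) (combined_bracket (c a))
      (4 * (\<Sum>i\<in>{1..m}. (c a i)\<^sup>2))
      (\<lambda>t. (\<Sum>i\<in>{1..m}. \<bar>c a i\<bar>) * ((\<bar>p\<bar> + \<bar>p + q\<bar> + 2 * drift_const) * t + 2 * real (m * m)))" if a: "a \<in> ?A" for a
    proof (rule scalar_ito_combination)
      fix r \<omega> assume w: "\<omega> \<in> space M"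
      have "fst a \<in> {1..m}" "snd a \<in> {1..m}" "fst a \<le> snd a" using a by auto
      then show "combination 0 (c a) r \<omega> \<in> {0..1}"
        using P_unit[OF w, of _ r] P_antimono[OF w, of "fst a" "snd a" r] unfolding cc[OF a] by fastforce
    qed
    show "AE (\<omega>, r) in M \<Otimes>\<^sub>M lborel. 0 < r \<longrightarrow>
      (\<Sum>a\<in>?A. - combined_drift (c a) r \<omega> / (combination 0 (c a) r \<omega> + d) +
        combined_bracket (c a) r \<omega> / (2 * (combination 0 (c a) r \<omega> + d)\<^sup>2)) \<le> real (m * m) * \<bar>p + q\<bar>"
      if d: "0 < d" "d \<le> 1" for d
      using regular_AE[OF pq] AE_space
    proof eventually_elim
      case (elim x)
      obtain \<omega> r where x: "x = (\<omega>, r)" "\<omega> \<in> space M" using elim(2) by (auto simp: space_pair_measure)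
      show ?case unfolding x prod.case
      proof
        assume r: "0 < r"
        have "(\<Sum>a\<in>?A. - combined_drift (c a) r \<omega> / (combination 0 (c a) r \<omega> + d) +
            combined_bracket (c a) r \<omega> / (2 * (combination 0 (c a) r \<omega> + d)\<^sup>2)) =
          (\<Sum>(i, j)\<in>?A. - (jacobi_drift m p q (P r \<omega>) i - jacobi_drift m p q (P r \<omega>) j) / (P r \<omega> i - P r \<omega> j + d) +
            (4 * (P r \<omega> i * (1 - P r \<omega> i)) + 4 * (P r \<omega> j * (1 - P r \<omega> j))) / (2 * (P r \<omega> i - P r \<omega> j + d)\<^sup>2))"
          by (intro sum.cong refl) (simp only: cc drift_def split_beta')
        also have "\<dots> \<le> real (m * m) * \<bar>p + q\<bar>"
          using P_unit[OF x(2)] regular_strict[OF x(2) r] elim(1) d(1) unfolding x(1)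
          by (intro collision_generator_bound) blast+
        finally show "(\<Sum>a\<in>?A. - combined_drift (c a) r \<omega> / (combination 0 (c a) r \<omega> + d) +
            combined_bracket (c a) r \<omega> / (2 * (combination 0 (c a) r \<omega> + d)\<^sup>2)) \<le> real (m * m) * \<bar>p + q\<bar>" .
      qed
    qed
    show "0 \<le> real (m * m) * \<bar>p + q\<bar>" by simp
    show "AE r in lborel. 0 < r \<longrightarrow> (AE \<omega> in M. \<forall>a\<in>?A. 0 < combination 0 (c a) r \<omega>)"
      using regular_AE_time[OF pq]
    proof eventually_elim
      case (elim r)
      show ?case
      proof
        assume r: "0 < r"
        show "AE \<omega> in M. \<forall>a\<in>?A. 0 < combination 0 (c a) r \<omega>"
          using elim AE_space
        proof eventually_elim
          case (elim \<omega>)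
          show ?case
          proof
            fix a assume a: "a \<in> ?A"
            then show "0 < combination 0 (c a) r \<omega>"
              using regular_strict[OF elim(2) r elim(1), of "fst a" "snd a"] unfolding cc[OF a] by auto
          qed
        qed
      qed
    qed
  qed
  then show ?thesis
  proof eventually_elim
    case (elim \<omega>)
    show ?case
    proof (intro allI impI ballI)
      fix t :: real and i j assume t: "0 < t" and ij: "i \<in> {1..m}" "j \<in> {1..m}" "i < j"
      then have a: "(i, j) \<in> ?A" by simp
      have "0 < combination 0 (c (i, j)) t \<omega>" using elim t a by blast
      then show "P t \<omega> j < P t \<omega> i" unfolding cc[OF a] by simp
    qed
  qed
qed

text \<open>All coordinates enter and not only the smallest one, since the interactions become
  harmless through symmetrization over all of them. The bound on q keeps the upper boundary null in
  time, as \<open>regular_AE\<close> asks.\<close>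

lemma no_hitting_0:
  assumes pq: "real m + 1 \<le> p" "real m < q"
  shows "AE \<omega> in M. \<forall>t>0. \<forall>i\<in>{1..m}. 0 < P t \<omega> i"
proof -
  have mp: "real m < p" using pq by simp
  have "AE \<omega> in M. \<forall>t>0. \<forall>a\<in>{1..m}. 0 < combination 0 (coord a) t \<omega>"
  proof (rule nonhitting)
    show "scalar_ito M F (combination 0 (coord a)) (combined_noise (coord a)) (combined_drift (coord a)) (combined_bracket (coord a))
      (4 * (\<Sum>i\<in>{1..m}. (coord a i)\<^sup>2))
      (\<lambda>t. (\<Sum>i\<in>{1..m}. \<bar>coord a i\<bar>) * ((\<bar>p\<bar> + \<bar>p + q\<bar> + 2 * drift_const) * t + 2 * real (m * m)))" if a: "a \<in> {1..m}" for a
      by (rule scalar_ito_combination) (use P_unit[OF _ a] in \<open>simp add: combination_coord[OF a]\<close>)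
    show "AE (\<omega>, r) in M \<Otimes>\<^sub>M lborel. 0 < r \<longrightarrow>
      (\<Sum>a\<in>{1..m}. - combined_drift (coord a) r \<omega> / (combination 0 (coord a) r \<omega> + d) +
        combined_bracket (coord a) r \<omega> / (2 * (combination 0 (coord a) r \<omega> + d)\<^sup>2)) \<le> real m * \<bar>p + q\<bar>"
      if d: "0 < d" "d \<le> 1" for d
      using regular_AE[OF mp pq(2)] AE_space
    proof eventually_elim
      case (elim x)
      obtain \<omega> r where x: "x = (\<omega>, r)" "\<omega> \<in> space M" using elim(2) by (auto simp: space_pair_measure)
      show ?case unfolding x prod.case
      proof
        assume r: "0 < r"
        have "inj_on (P r \<omega>) {1..m}"
          using elim(1) r unfolding x regular_def inj_on_def prod.case by blast
        then have "(\<Sum>a\<in>{1..m}. - jacobi_drift m p q (P r \<omega>) a / (P r \<omega> a + d) +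
          4 * (P r \<omega> a * (1 - P r \<omega> a)) / (2 * (P r \<omega> a + d)\<^sup>2)) \<le> real m * \<bar>p + q\<bar>"
          using P_unit[OF x(2)] pq(1) d(1) by (intro boundary_generator_bound) blast+
        then show "(\<Sum>a\<in>{1..m}. - combined_drift (coord a) r \<omega> / (combination 0 (coord a) r \<omega> + d) +
          combined_bracket (coord a) r \<omega> / (2 * (combination 0 (coord a) r \<omega> + d)\<^sup>2)) \<le> real m * \<bar>p + q\<bar>"
          by (simp only: combination_coord drift_def cong: sum.cong)
      qed
    qed
    show "AE r in lborel. 0 < r \<longrightarrow> (AE \<omega> in M. \<forall>a\<in>{1..m}. 0 < combination 0 (coord a) r \<omega>)"
      using regular_AE_time[OF mp pq(2)]
    proof eventually_elim
      case (elim r)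
      show ?case
      proof
        assume r: "0 < r"
        show "AE \<omega> in M. \<forall>a\<in>{1..m}. 0 < combination 0 (coord a) r \<omega>"
          using elim AE_space
        proof eventually_elim
          case (elim \<omega>)
          show ?case
          proof
            fix a assume a: "a \<in> {1..m}"
            have m1: "m \<in> {1..m}" using m_pos by auto
            have "P r \<omega> m \<noteq> 0" using elim(1) r by (simp add: regular_def)
            then have "0 < P r \<omega> m" using P_unit(1)[OF elim(2) m1, of r] by simp
            also have "\<dots> \<le> P r \<omega> a" using P_antimono[OF elim(2) a m1, of r] a by simp
            finally show "0 < combination 0 (coord a) r \<omega>" unfolding combination_coord[OF a] .
          qed
        qed
      qed
    qed
  qed simp_all
  then show ?thesis
  proof eventually_elim
    case (elim \<omega>)
    then show ?case using combination_coord(1) by auto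
  qed
qed

lemma no_hitting_1:
  assumes pq: "real m < p" "real m + 1 \<le> q"
  shows "AE \<omega> in M. \<forall>t>0. \<forall>i\<in>{1..m}. P t \<omega> i < 1"
proof -
  have mq: "real m < q" using pq by simp
  let ?c = "\<lambda>a l. - coord a l"
  have "AE \<omega> in M. \<forall>t>0. \<forall>a\<in>{1..m}. 0 < combination 1 (?c a) t \<omega>"
  proof (rule nonhitting)
    show "scalar_ito M F (combination 1 (?c a)) (combined_noise (?c a)) (combined_drift (?c a)) (combined_bracket (?c a))
      (4 * (\<Sum>i\<in>{1..m}. (?c a i)\<^sup>2))
      (\<lambda>t. (\<Sum>i\<in>{1..m}. \<bar>?c a i\<bar>) * ((\<bar>p\<bar> + \<bar>p + q\<bar> + 2 * drift_const) * t + 2 * real (m * m)))" if a: "a \<in> {1..m}" for a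
      by (rule scalar_ito_combination) (use P_unit[OF _ a] in \<open>simp add: combination_reflected[OF a]\<close>)
    show "AE (\<omega>, r) in M \<Otimes>\<^sub>M lborel. 0 < r \<longrightarrow>
      (\<Sum>a\<in>{1..m}. - combined_drift (?c a) r \<omega> / (combination 1 (?c a) r \<omega> + d) +
        combined_bracket (?c a) r \<omega> / (2 * (combination 1 (?c a) r \<omega> + d)\<^sup>2)) \<le> real m * \<bar>q + p\<bar>"
      if d: "0 < d" "d \<le> 1" for d
      using regular_AE[OF pq(1) mq] AE_space
    proof eventually_elim
      case (elim x)
      obtain \<omega> r where x: "x = (\<omega>, r)" "\<omega> \<in> space M" using elim(2) by (auto simp: space_pair_measure)
      show ?case unfolding x prod.case
      proof
        assume r: "0 < r"
        \<comment> \<open>The reflected vector satisfies the estimate at the lower boundary with p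
          and q exchanged, hence the constant \<open>q + p\<close>.\<close>
        define y where "y a = 1 - P r \<omega> a" for a
        have "inj_on y {1..m}"
          using elim(1) r unfolding x regular_def inj_on_def prod.case y_def by auto
        moreover have "0 \<le> y a \<and> y a \<le> 1" if "a \<in> {1..m}" for a
          using P_unit[OF x(2) that, of r] by (simp add: y_def)
        ultimately have "(\<Sum>a\<in>{1..m}. - jacobi_drift m q p y a / (y a + d) +
          4 * (y a * (1 - y a)) / (2 * (y a + d)\<^sup>2)) \<le> real m * \<bar>q + p\<bar>"
          using pq(2) d(1) by (intro boundary_generator_bound)
        moreover have "- combined_drift (?c a) r \<omega> / (combination 1 (?c a) r \<omega> + d) +
          combined_bracket (?c a) r \<omega> / (2 * (combination 1 (?c a) r \<omega> + d)\<^sup>2) =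
          - jacobi_drift m q p y a / (y a + d) + 4 * (y a * (1 - y a)) / (2 * (y a + d)\<^sup>2)" if a: "a \<in> {1..m}" for a
          unfolding combination_reflected[OF a] drift_def y_def jacobi_drift_reflect[OF a] by (simp add: mult.commute)
        ultimately show "(\<Sum>a\<in>{1..m}. - combined_drift (?c a) r \<omega> / (combination 1 (?c a) r \<omega> + d) +
          combined_bracket (?c a) r \<omega> / (2 * (combination 1 (?c a) r \<omega> + d)\<^sup>2)) \<le> real m * \<bar>q + p\<bar>"
          by (simp only: cong: sum.cong)
      qed
    qed
    show "AE r in lborel. 0 < r \<longrightarrow> (AE \<omega> in M. \<forall>a\<in>{1..m}. 0 < combination 1 (?c a) r \<omega>)"
      using regular_AE_time[OF pq(1) mq]
    proof eventually_elim
      case (elim r)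
      show ?case
      proof
        assume r: "0 < r"
        show "AE \<omega> in M. \<forall>a\<in>{1..m}. 0 < combination 1 (?c a) r \<omega>"
          using elim AE_space
        proof eventually_elim
          case (elim \<omega>)
          show ?case
          proof
            fix a assume a: "a \<in> {1..m}"
            have m1: "1 \<in> {1..m}" using m_pos by auto
            have "P r \<omega> 1 \<noteq> 1" using elim(1) r by (simp add: regular_def)
            then have "P r \<omega> 1 < 1" using P_unit(2)[OF elim(2) m1, of r] by simp
            moreover have "P r \<omega> a \<le> P r \<omega> 1" using P_antimono[OF elim(2) m1 a, of r] a by simp
            ultimately show "0 < combination 1 (?c a) r \<omega>" unfolding combination_reflected[OF a] by simp
          qed
        qed
      qed
    qed
  qed simp_all
  then show ?thesis
  proof eventually_elim
    case (elim \<omega>)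
    then show ?case using combination_reflected(1) by auto
  qed
qed

text \<open>A probability equal to 1 requires an event, although uncountably many times occur in the
  condition. On [1 / (n + 1), n + 1] a path without collision keeps the two coordinates apart by
  some 1 / (k + 1), by compactness, and by continuity rational times suffice to test this.\<close>

lemma collision_free_event:
  assumes ij: "i \<in> {1..m}" "j \<in> {1..m}"
  shows "{\<omega> \<in> space M. \<forall>t>0. P t \<omega> i \<noteq> P t \<omega> j} \<in> sets M"
proof -
  let ?f = "\<lambda>\<omega> t. \<bar>P t \<omega> i - P t \<omega> j\<bar>"
  have eq: "(\<forall>t>0. P t \<omega> i \<noteq> P t \<omega> j) \<longleftrightarrow> (\<forall>n::nat. \<exists>k::nat. \<forall>s::rat.
      1 / real (Suc n) \<le> real_of_rat s \<and> real_of_rat s \<le> real (Suc n) \<longrightarrow> 1 / real (Suc k) \<le> ?f \<omega> (real_of_rat s))"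
    (is "?L \<longleftrightarrow> ?R") if w: "\<omega> \<in> space M" for \<omega>
  proof
    have c: "continuous_on UNIV (?f \<omega>)" by (intro continuous_intros P_continuous[OF w] ij)
    {
      assume L: ?L
      show ?R
      proof
        fix n :: nat
        have "\<exists>z\<in>{1 / real (Suc n)..real (Suc n)}. \<forall>y\<in>{1 / real (Suc n)..real (Suc n)}. ?f \<omega> z \<le> ?f \<omega> y"
        proof (rule continuous_attains_inf)
          have "1 / real (Suc n) \<le> 1" by simp
          also have "1 \<le> real (Suc n)" by simp
          finally show "{1 / real (Suc n)..real (Suc n)} \<noteq> {}" by simp
        qed (use continuous_on_subset[OF c] in auto)
        then obtain z where z: "z \<in> {1 / real (Suc n)..real (Suc n)}"
          "\<And>y. y \<in> {1 / real (Suc n)..real (Suc n)} \<Longrightarrow> ?f \<omega> z \<le> ?f \<omega> y" by blast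
        have "0 < 1 / real (Suc n)" by simp
        then have "0 < z" using z(1) by (meson atLeastAtMost_iff less_le_trans)
        then have "0 < ?f \<omega> z" using L by simp
        then obtain k where k: "1 / real (Suc k) < ?f \<omega> z" using nat_approx_posE by blast
        show "\<exists>k::nat. \<forall>s::rat. 1 / real (Suc n) \<le> real_of_rat s \<and> real_of_rat s \<le> real (Suc n) \<longrightarrow>
            1 / real (Suc k) \<le> ?f \<omega> (real_of_rat s)"
        proof (intro exI[of _ k] allI impI)
          fix s :: rat assume "1 / real (Suc n) \<le> real_of_rat s \<and> real_of_rat s \<le> real (Suc n)"
          then have "?f \<omega> z \<le> ?f \<omega> (real_of_rat s)" by (intro z(2)) simp
          with k show "1 / real (Suc k) \<le> ?f \<omega> (real_of_rat s)" by linarith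
        qed
      qed
    next
      assume R: ?R
      show ?L
      proof (intro allI impI notI)
        fix t :: real assume t: "0 < t" and e: "P t \<omega> i = P t \<omega> j"
        obtain n1 where n1: "1 / real (Suc n1) < t" using nat_approx_posE[OF t] by blast
        obtain n2 :: nat where n2: "t < real n2" using reals_Archimedean2 by blast
        define n where "n = max n1 n2"
        have "1 / real (Suc n) \<le> 1 / real (Suc n1)" by (intro divide_left_mono) (auto simp: n_def)
        then have n: "1 / real (Suc n) < t" "t < real (Suc n)" using n1 n2 by (auto simp: n_def)
        from R obtain k :: nat where k: "\<And>s::rat. 1 / real (Suc n) \<le> real_of_rat s \<Longrightarrow> real_of_rat s \<le> real (Suc n) \<Longrightarrow>
            1 / real (Suc k) \<le> ?f \<omega> (real_of_rat s)" by blast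
        have "isCont (?f \<omega>) t" using c by (simp add: continuous_on_eq_continuous_at)
        then have "(?f \<omega> \<longlongrightarrow> ?f \<omega> t) (nhds t)"
          using tendsto_at_iff_tendsto_nhds[of "?f \<omega>" t] unfolding isCont_def by blast
        moreover have "?f \<omega> t < 1 / real (Suc k)" using e by simp
        ultimately have "eventually (\<lambda>s. ?f \<omega> s < 1 / real (Suc k)) (nhds t)" by (rule order_tendstoD(2))
        then obtain \<delta> where \<delta>: "0 < \<delta>" "\<And>s. dist s t < \<delta> \<Longrightarrow> ?f \<omega> s < 1 / real (Suc k)"
          unfolding eventually_nhds_metric by blast
        \<comment> \<open>As t lies strictly inside the window, there is a rational time just to its
          right that is still in the window and at which the distance is still too small.\<close>
        have "t < min (t + \<delta>) (real (Suc n))" using \<delta>(1) n by simp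
        then obtain s :: rat where s: "t < real_of_rat s" "real_of_rat s < min (t + \<delta>) (real (Suc n))"
          using of_rat_dense by blast
        then have "?f \<omega> (real_of_rat s) < 1 / real (Suc k)" by (intro \<delta>(2)) (auto simp: dist_real_def)
        moreover have "1 / real (Suc k) \<le> ?f \<omega> (real_of_rat s)" using s n by (intro k) auto
        ultimately show False by linarith
      qed
    }
  qed
  have [measurable]: "(\<lambda>\<omega>. P t \<omega> i) \<in> borel_measurable M" "(\<lambda>\<omega>. P t \<omega> j) \<in> borel_measurable M" for t
    using P_measurable ij by auto
  have "{\<omega> \<in> space M. \<forall>n::nat. \<exists>k::nat. \<forall>s::rat.
      1 / real (Suc n) \<le> real_of_rat s \<and> real_of_rat s \<le> real (Suc n) \<longrightarrow> 1 / real (Suc k) \<le> ?f \<omega> (real_of_rat s)} \<in> sets M"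
    by measurable
  also have "{\<omega> \<in> space M. \<forall>n::nat. \<exists>k::nat. \<forall>s::rat.
      1 / real (Suc n) \<le> real_of_rat s \<and> real_of_rat s \<le> real (Suc n) \<longrightarrow> 1 / real (Suc k) \<le> ?f \<omega> (real_of_rat s)} =
    {\<omega> \<in> space M. \<forall>t>0. P t \<omega> i \<noteq> P t \<omega> j}"
    using eq by blast
  finally show ?thesis .
qed

end

theorem mainTheorem10:
  fixes M :: "'w measure" and F :: "real \<Rightarrow> 'w measure"
    and m :: nat and p q :: real
    and \<nu> :: "nat \<Rightarrow> real \<Rightarrow> 'w \<Rightarrow> real"
    and X :: "real \<Rightarrow> 'w \<Rightarrow> nat \<Rightarrow> real"
    and x :: "nat \<Rightarrow> real"
  assumes "1 \<le> m"
    and "jacobi_eigenvalue_process M F m p q \<nu> X"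
    and "x \<in> ordered_unit_vectors m"
    and "AE \<omega> in M. \<forall>i\<in>{1..m}. X 0 \<omega> i = x i"
  shows "(min p q > real m \<longrightarrow>
           \<P>(\<omega> in M. \<forall>t>0. \<forall>i\<in>{1..m}. \<forall>j\<in>{1..m}. i \<noteq> j \<longrightarrow> X t \<omega> i \<noteq> X t \<omega> j) = 1) \<and>
         (min p q \<ge> real m + 1 \<longrightarrow>
           (AE \<omega> in M. \<forall>t>0. 0 < X t \<omega> m \<and> X t \<omega> 1 < 1))"
proof (intro conjI impI)
  interpret jacobi_process M F m p q \<nu> X
    using assms(1,2) by unfold_locales
  {
    assume "real m < min p q"
    then have pq: "real m < p" "real m < q" by auto
    let ?E = "{\<omega> \<in> space M. \<forall>t>0. \<forall>i\<in>{1..m}. \<forall>j\<in>{1..m}. i \<noteq> j \<longrightarrow> X t \<omega> i \<noteq> X t \<omega> j}"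
    \<comment> \<open>The finite quantifiers over indices are moved outside the one over time, so
      that the events of single pairs can be intersected.\<close>
    have "?E = {\<omega> \<in> space M. \<forall>i\<in>{1..m}. \<forall>j\<in>{1..m}. i \<noteq> j \<longrightarrow> (\<forall>t>0. P t \<omega> i \<noteq> P t \<omega> j)}"
      using P_eq by force
    also have "\<dots> \<in> sets M"
      by (intro sets.sets_Collect_finite_All sets.sets_Collect_imp sets.sets_Collect_const collision_free_event) auto
    finally have E: "?E \<in> sets M" .
    have "AE \<omega> in M. \<omega> \<in> ?E"
      using no_collision[OF pq] AE_space
    proof eventually_elim
      case (elim \<omega>)
      have "X t \<omega> i \<noteq> X t \<omega> j" if "0 < t" "i \<in> {1..m}" "j \<in> {1..m}" "i \<noteq> j" for t i j
      proof -
        have "P t \<omega> j < P t \<omega> i \<or> P t \<omega> i < P t \<omega> j" using elim(1) that by (meson linorder_neqE_nat)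
        then show ?thesis using P_eq[of t] that(1) by auto
      qed
      then show ?case using elim(2) by blast
    qed
    then show "\<P>(\<omega> in M. \<forall>t>0. \<forall>i\<in>{1..m}. \<forall>j\<in>{1..m}. i \<noteq> j \<longrightarrow> X t \<omega> i \<noteq> X t \<omega> j) = 1"
      using E by (simp only: AE_in_set_eq_1)
  next
    assume "real m + 1 \<le> min p q"
    then have pq: "real m + 1 \<le> p" "real m + 1 \<le> q" "real m < p" "real m < q" by auto
    show "AE \<omega> in M. \<forall>t>0. 0 < X t \<omega> m \<and> X t \<omega> 1 < 1"
      using no_hitting_0[OF pq(1,4)] no_hitting_1[OF pq(3,2)]
    proof eventually_elim
      case (elim \<omega>)
      show ?case
      proof (intro allI impI)
        fix t :: real assume t: "0 < t"
        then have "0 < P t \<omega> m \<and> P t \<omega> 1 < 1" using elim m_pos by simp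
        then show "0 < X t \<omega> m \<and> X t \<omega> 1 < 1" using P_eq[of t] t by simp
      qed
    qed
  }
qed

end
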